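(* Assume $d(\beta,c,\gamma)$ is twice differentiable on the domain $\{(\beta,c,\gamma):\beta>0,\gamma>0,c<3(\beta^2\gamma/4)^{1/3}\}$. (i) If $1<p<3$, then for each fixed $\beta>0$ and $c<0$ there exists a sequence $\gamma_k\to0^+$ with $d_{cc}(\beta,c,\gamma_k)>0$ for all $k$. (ii) If $p>3$, then for each fixed $\beta>0$ and $c<0$ there exists a sequence $\gamma_k\to0^+$ with $d_{cc}(\beta,c,\gamma_k)<0$ for all $k$.
   Context: Fix $p>1$ and a $C^2$ function $f:\mathbb R\to\mathbb R$ homogeneous of degree $p$, i.e. $f(\lambda s)=\lambda^p f(s)$ for all $\lambda>0$ and $s\in\mathbb R$. Let $F$ be the antiderivative of $f$ with $F(0)=0$. Assume $F(s_0)<0$ for some $s_0\in\mathbb R$. The operators are defined as follows. $\mathcal H$ is the Hilbert transform (Fourier symbol $-i\,\mathrm{sgn}\,\xi$). $D_x^{1/2}$ is the Fourier multiplier with symbol $|\xi|^{1/2}$. $\partial_x^{-1}$ is the Fourier multiplier with symbol $(i\xi)^{-1}$, and $\partial_x^{-2}=(\partial_x^{-1})^2$. Let $\mathcal X=\{u\in H^{1/2}(\mathbb R):\partial_x^{-1}u\in L^2(\mathbb R)\}$. A solitary wave is a function $\varphi\in\mathcal X$ satisfying $\beta\mathcal H\varphi_x-c\varphi+f(\varphi)=\gamma\partial_x^{-2}\varphi$. Functionals on $\mathcal X$: - $E(u)=\int_{\mathbb R}\big(\frac\beta2(D_x^{1/2}u)^2+\frac\gamma2(\partial_x^{-1}u)^2+F(u)\big)dx$;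 - $Q(u)=\frac12\int_{\mathbb R}u^2dx$; - $S(u)=E(u)-cQ(u)$. The set of ground states $\mathcal G(\beta,c,\gamma)$ is the set of nonzero solitary waves $\varphi$ such that $S(\varphi)\le S(\psi)$ for every nonzero solitary wave $\psi$ with the same $\beta,c,\gamma$; it is nonempty for $\beta,\gamma>0$, $c<c_*$. Define $d(\beta,c,\gamma)=E(\varphi)-cQ(\varphi)$ for any $\varphi\in\mathcal G(\beta,c,\gamma)$; this value is independent of the choice of $\varphi$. $d_{cc}$ denotes the second partial derivative in $c$. *)

theory Defs
  imports "HOL-Analysis.Analysis"
begin

definition L2fun :: "(real \<Rightarrow> real) \<Rightarrow> bool" where
  "L2fun u \<longleftrightarrow> u \<in> borel_measurable lborel \<and> integrable lborel (\<lambda>x. (u x)^2)"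

text \<open>Plancherel (L2) Fourier transform: v is the L2-limit of the truncated integrals
  of u(x) e^(-i x xi) over [-R,R], with convention hat u(xi) = int u(x) e^(-i x xi) dx.\<close>
definition is_fourier :: "(real \<Rightarrow> real) \<Rightarrow> (real \<Rightarrow> complex) \<Rightarrow> bool" where
  "is_fourier u v \<longleftrightarrow> v \<in> borel_measurable lborel \<and>
     ((\<lambda>R. \<integral>\<^sup>+ \<xi>. ennreal ((cmod (v \<xi> - (LINT x:{-R..R}|lborel. complex_of_real (u x) * cis (- (x * \<xi>)))))^2) \<partial>lborel)
        \<longlongrightarrow> 0) at_top"

definition fourier :: "(real \<Rightarrow> real) \<Rightarrow> real \<Rightarrow> complex" where
  "fourier u = (SOME v. is_fourier u v)"

text \<open>The space X = { u in H^(1/2) : d_x^(-1) u in L2 }, described on the Fourier side.\<close>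
definition in_X :: "(real \<Rightarrow> real) \<Rightarrow> bool" where
  "in_X u \<longleftrightarrow> L2fun u \<and>
     (\<integral>\<^sup>+ \<xi>. ennreal ((1 + \<bar>\<xi>\<bar>) * (cmod (fourier u \<xi>))^2) \<partial>lborel) < \<infinity> \<and>
     (\<integral>\<^sup>+ \<xi>. ennreal ((cmod (fourier u \<xi>))^2 / \<xi>^2) \<partial>lborel) < \<infinity>"

text \<open>Bilinear forms: half_form u w = int (D^(1/2) u)(D^(1/2) w) dx,
  inv_form u w = int (d_x^(-1) u)(d_x^(-1) w) dx (via Plancherel).\<close>
definition half_form :: "(real \<Rightarrow> real) \<Rightarrow> (real \<Rightarrow> real) \<Rightarrow> real" where
  "half_form u w = (1 / (2 * pi)) *
     (\<integral>\<xi>. \<bar>\<xi>\<bar> * Re (fourier u \<xi> * cnj (fourier w \<xi>)) \<partial>lborel)"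

definition inv_form :: "(real \<Rightarrow> real) \<Rightarrow> (real \<Rightarrow> real) \<Rightarrow> real" where
  "inv_form u w = (1 / (2 * pi)) *
     (\<integral>\<xi>. Re (fourier u \<xi> * cnj (fourier w \<xi>)) / \<xi>^2 \<partial>lborel)"

definition energyE :: "(real \<Rightarrow> real) \<Rightarrow> real \<Rightarrow> real \<Rightarrow> (real \<Rightarrow> real) \<Rightarrow> real" where
  "energyE F \<beta> \<gamma> u = \<beta> / 2 * half_form u u + \<gamma> / 2 * inv_form u u + (\<integral>x. F (u x) \<partial>lborel)"

definition massQ :: "(real \<Rightarrow> real) \<Rightarrow> real" where
  "massQ u = 1 / 2 * (\<integral>x. (u x)^2 \<partial>lborel)"

definition actionS :: "(real \<Rightarrow> real) \<Rightarrow> real \<Rightarrow> real \<Rightarrow> real \<Rightarrow> (real \<Rightarrow> real) \<Rightarrow> real" where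
  "actionS F \<beta> c \<gamma> u = energyE F \<beta> \<gamma> u - c * massQ u"

text \<open>Solitary wave: phi in X solving beta H phi_x - c phi + f(phi) = gamma d_x^(-2) phi
  in the weak sense (tested against every psi in X, i.e. as an identity in the dual of X).\<close>
definition solitary_wave ::
  "(real \<Rightarrow> real) \<Rightarrow> real \<Rightarrow> real \<Rightarrow> real \<Rightarrow> (real \<Rightarrow> real) \<Rightarrow> bool" where
  "solitary_wave f \<beta> c \<gamma> \<phi> \<longleftrightarrow> in_X \<phi> \<and>
     (\<forall>\<psi>. in_X \<psi> \<longrightarrow>
        integrable lborel (\<lambda>x. f (\<phi> x) * \<psi> x) \<and>
        \<beta> * half_form \<phi> \<psi> - c * (\<integral>x. \<phi> x * \<psi> x \<partial>lborel)
          + (\<integral>x. f (\<phi> x) * \<psi> x \<partial>lborel) + \<gamma> * inv_form \<phi> \<psi> = 0)"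

definition nonzero_fun :: "(real \<Rightarrow> real) \<Rightarrow> bool" where
  "nonzero_fun u \<longleftrightarrow> \<not> (AE x in lborel. u x = 0)"

definition ground_states ::
  "(real \<Rightarrow> real) \<Rightarrow> (real \<Rightarrow> real) \<Rightarrow> real \<Rightarrow> real \<Rightarrow> real \<Rightarrow> (real \<Rightarrow> real) set" where
  "ground_states f F \<beta> c \<gamma> =
     {\<phi>. solitary_wave f \<beta> c \<gamma> \<phi> \<and> nonzero_fun \<phi> \<and>
          (\<forall>\<psi>. solitary_wave f \<beta> c \<gamma> \<psi> \<and> nonzero_fun \<psi> \<longrightarrow>
                actionS F \<beta> c \<gamma> \<phi> \<le> actionS F \<beta> c \<gamma> \<psi>)}"

definition dfun :: "(real \<Rightarrow> real) \<Rightarrow> (real \<Rightarrow> real) \<Rightarrow> real \<Rightarrow> real \<Rightarrow> real \<Rightarrow> real" where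
  "dfun f F \<beta> c \<gamma> = actionS F \<beta> c \<gamma> (SOME \<phi>. \<phi> \<in> ground_states f F \<beta> c \<gamma>)"

definition d_cc :: "(real \<Rightarrow> real) \<Rightarrow> (real \<Rightarrow> real) \<Rightarrow> real \<Rightarrow> real \<Rightarrow> real \<Rightarrow> real" where
  "d_cc f F \<beta> c \<gamma> = deriv (\<lambda>c'. deriv (\<lambda>c''. dfun f F \<beta> c'' \<gamma>) c') c"

definition dom3 :: "(real \<times> real \<times> real) set" where
  "dom3 = {(\<beta>, c, \<gamma>). \<beta> > 0 \<and> \<gamma> > 0 \<and> c < 3 * (\<beta>^2 * \<gamma> / 4) powr (1/3)}"

definition twice_differentiable_on ::
  "(real \<times> real \<times> real \<Rightarrow> real) \<Rightarrow> (real \<times> real \<times> real) set \<Rightarrow> bool" where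
  "twice_differentiable_on g S \<longleftrightarrow>
     (\<exists>D :: real \<times> real \<times> real \<Rightarrow> (real \<times> real \<times> real) \<Rightarrow>\<^sub>L real.
        \<forall>x\<in>S. (g has_derivative blinfun_apply (D x)) (at x) \<and> D differentiable (at x))"

definition C2_fun :: "(real \<Rightarrow> real) \<Rightarrow> bool" where
  "C2_fun f \<longleftrightarrow> (\<exists>f1 f2. \<forall>s. (f has_real_derivative f1 s) (at s) \<and>
      (f1 has_real_derivative f2 s) (at s) \<and> isCont f2 s)"

end

theory Submission
  imports Defs "HOL-Probability.Probability" "HOL-Complex_Analysis.Great_Picard"
    "HOL-Real_Asymp.Real_Asymp"
begin

text \<open>
  A ground state is a minimizer of the quadratic form
  \<open>I(u) = \<beta>|D\<^sup>1\<^sup>/\<^sup>2u|\<^sup>2 + s|u|\<^sup>2 + \<gamma>|\<partial>\<^sup>-\<^sup>1u|\<^sup>2\<close>, \<open>s = -c\<close>, on \<open>K(u) = -(p+1) \<integral>F(u) = 1\<close>, up to a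
  scalar factor, so \<open>d = (1/2 - 1/(p+1)) m\<^sup>q\<close> with \<open>m\<close> the minimal value and \<open>q = (p+1)/(p-1)\<close>. The minimizer
  exists by concentration compactness: a minimizing sequence does not vanish, so after translation it
  has a nonzero local limit \<open>v\<close>; both \<open>I\<close> and \<open>K\<close> split along \<open>v\<close> and the remainder, and strict
  subadditivity of \<open>k\<^sup>2\<^sup>/\<^sup>(\<^sup>p\<^sup>+\<^sup>1\<^sup>)\<close> forces \<open>K(v) \<ge> 1\<close>.

  Dilations give \<open>d(\<beta>, -s, \<gamma>) = s\<^sup>a G(\<gamma>/s\<^sup>3)\<close> with \<open>a = 2/(p-1)\<close> and \<open>G\<close> nondecreasing and bounded below by a
  positive constant. Hence \<open>h(s) = d(\<beta>, -s, 1)\<close> is comparable to \<open>s\<^sup>a\<close> for large \<open>s\<close>, and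
  \<open>d\<^sub>c\<^sub>c(\<beta>, c, \<gamma>)\<close> is a positive multiple of \<open>h''(-c \<gamma>\<^sup>-\<^sup>1\<^sup>/\<^sup>3)\<close>. If \<open>p < 3\<close> then \<open>a > 1\<close> and \<open>h\<close> cannot be concave near
  infinity; if \<open>p > 3\<close> then \<open>a < 1\<close> and \<open>h\<close>, being sublinear and unbounded, cannot be convex there.
\<close>

section \<open>Square integrable functions\<close>

text \<open>Restricting to c < 0 makes every coefficient of the quadratic form positive, so its
  values control the H^(1/2) norm directly. The obstacle is that H^(1/2) of the line does not embed
  into L^infinity; averages over dyadic intervals take the place of pointwise bounds and also yield
  local compactness. \<open>fourier\<close> is a choice of an L^2 limit, determined only almost
  everywhere, so Plancherel's identity and the rules for sums, translations and dilations are
  derived from that limit first. Smoothness enters through p: a nonzero homogeneous C^2 function has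
  p >= 2, which puts the exponent p + 1 >= 3 in the range where vanishing can be excluded. The lower
  bound for G comes from an embedding constant that does not see gamma, since the gamma-term of the
  form is nonnegative and is dropped; the upper bound for large s comes from monotonicity, gamma /
  s^3 being at most 1. The sign of h'' is read off from growth rates alone: no formula for
  derivatives of d and no smooth dependence of ground states enters, and the assumed
  differentiability serves to make h' and h'' exist.\<close>

definition sqint :: "'a measure \<Rightarrow> ('a \<Rightarrow> 'b::{banach,second_countable_topology}) \<Rightarrow> bool" where
  "sqint M f \<longleftrightarrow> f \<in> borel_measurable M \<and> integrable M (\<lambda>x. (norm (f x))\<^sup>2)"

text \<open>The square of the L^2 norm, so that pointwise inequalities integrate without roots; the
  price is the factor 2 in \<open>sqint_add\<close>. The sharp triangle inequality is
  \<open>nsq_triangle\<close>.\<close>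

definition nsq :: "'a measure \<Rightarrow> ('a \<Rightarrow> 'b::{banach,second_countable_topology}) \<Rightarrow> real" where
  "nsq M f = (\<integral>x. (norm (f x))\<^sup>2 \<partial>M)"

lemma sqint_measurable[measurable_dest]: "sqint M f \<Longrightarrow> f \<in> borel_measurable M"
  by (simp add: sqint_def)

lemma sqint_integrable: "sqint M f \<Longrightarrow> integrable M (\<lambda>x. (norm (f x))\<^sup>2)"
  by (simp add: sqint_def)

lemma nsq_nonneg[simp]: "0 \<le> nsq M f"
  by (simp add: nsq_def)

lemma sqint_nn_integral:
  "sqint M f \<Longrightarrow> (\<integral>\<^sup>+x. ennreal ((norm (f x))\<^sup>2) \<partial>M) = ennreal (nsq M f)"
  unfolding nsq_def by (rule nn_integral_eq_integral) (auto simp: sqint_def)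

lemma sqint_nnI:
  assumes "f \<in> borel_measurable M" "(\<integral>\<^sup>+x. ennreal ((norm (f x))\<^sup>2) \<partial>M) \<le> ennreal C" "0 \<le> C"
  shows "sqint M f" "nsq M f \<le> C"
proof -
  have "integrable M (\<lambda>x. (norm (f x))\<^sup>2)"
    using assms(1,2) by (intro integrableI_bounded) (auto simp: order_le_less_trans ennreal_less_top)
  then show *: "sqint M f" using assms(1) by (simp add: sqint_def)
  show "nsq M f \<le> C"
    using assms(2,3) sqint_nn_integral[OF *] by simp
qed

lemma sqint_bound:
  assumes "sqint M g" "f \<in> borel_measurable M" "AE x in M. norm (f x) \<le> norm (g x)"
  shows "sqint M f" "nsq M f \<le> nsq M g"
proof -
  have *: "integrable M (\<lambda>x. (norm (f x))\<^sup>2)"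
    by (rule Bochner_Integration.integrable_bound[OF sqint_integrable[OF assms(1)]])
      (use assms in \<open>auto intro!: power_mono\<close>)
  then show "sqint M f" using assms(2) by (simp add: sqint_def)
  show "nsq M f \<le> nsq M g" unfolding nsq_def
    using * assms by (intro integral_mono_AE) (auto simp: sqint_def power_mono)
qed

lemma norm_add_sq_le: "(norm (a + b))\<^sup>2 \<le> 2 * (norm a)\<^sup>2 + 2 * (norm (b::'a::real_normed_vector))\<^sup>2"
proof -
  have "(norm (a + b))\<^sup>2 \<le> (norm a + norm b)\<^sup>2"
    by (intro power_mono norm_triangle_ineq) auto
  also have "\<dots> \<le> 2 * (norm a)\<^sup>2 + 2 * (norm b)\<^sup>2"
    using sum_squares_bound[of "norm a" "norm b"] by (simp add: power2_sum)
  finally show ?thesis .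
qed

lemma sqint_add:
  assumes "sqint M f" "sqint M g"
  shows "sqint M (\<lambda>x. f x + g x)" "nsq M (\<lambda>x. f x + g x) \<le> 2 * nsq M f + 2 * nsq M g"
proof -
  have i: "integrable M (\<lambda>x. 2 * (norm (f x))\<^sup>2 + 2 * (norm (g x))\<^sup>2)"
    using assms by (auto simp: sqint_def)
  have *: "integrable M (\<lambda>x. (norm (f x + g x))\<^sup>2)"
    by (rule Bochner_Integration.integrable_bound[OF i])
      (use assms norm_add_sq_le in \<open>auto simp: sqint_def\<close>)
  then show "sqint M (\<lambda>x. f x + g x)" using assms by (auto simp: sqint_def)
  have "nsq M (\<lambda>x. f x + g x) \<le> (\<integral>x. 2 * (norm (f x))\<^sup>2 + 2 * (norm (g x))\<^sup>2 \<partial>M)"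
    unfolding nsq_def by (intro integral_mono * i norm_add_sq_le)
  also have "\<dots> = 2 * nsq M f + 2 * nsq M g"
    using assms by (simp add: nsq_def sqint_def)
  finally show "nsq M (\<lambda>x. f x + g x) \<le> 2 * nsq M f + 2 * nsq M g" .
qed

lemma sqint_uminus: "sqint M (\<lambda>x. - f x) \<longleftrightarrow> sqint M f" "nsq M (\<lambda>x. - f x) = nsq M f"
  by (auto simp: sqint_def nsq_def borel_measurable_uminus_eq)

lemma sqint_diff:
  assumes "sqint M f" "sqint M g"
  shows "sqint M (\<lambda>x. f x - g x)" "nsq M (\<lambda>x. f x - g x) \<le> 2 * nsq M f + 2 * nsq M g"
  using sqint_add[of M f "\<lambda>x. - g x"] assms sqint_uminus[of M g] by auto

lemma sqint_scaleR:
  assumes "sqint M f"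
  shows "sqint M (\<lambda>x. c *\<^sub>R f x)" "nsq M (\<lambda>x. c *\<^sub>R f x) = c\<^sup>2 * nsq M f"
  using assms by (auto simp: sqint_def nsq_def power_mult_distrib)

lemma sqint_mult_left:
  fixes f :: "_ \<Rightarrow> 'b::{real_normed_div_algebra,banach,second_countable_topology}"
  assumes "sqint M f"
  shows "sqint M (\<lambda>x. c * f x)" "nsq M (\<lambda>x. c * f x) = (norm c)\<^sup>2 * nsq M f"
  using assms by (auto simp: sqint_def nsq_def power_mult_distrib norm_mult)

lemma sqint_zero[simp]: "sqint M (\<lambda>x. 0)"
  by (simp add: sqint_def)

lemma nsq_swap: "nsq M (\<lambda>x. f x - g x) = nsq M (\<lambda>x. g x - f x)"
  by (simp add: nsq_def norm_minus_commute)

lemma sqint_times_norm_integrable: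
  assumes "sqint M f" "sqint M g"
  shows "integrable M (\<lambda>x. norm (f x) * norm (g x))"
proof (rule Bochner_Integration.integrable_bound)
  show "integrable M (\<lambda>x. (norm (f x))\<^sup>2 + (norm (g x))\<^sup>2)"
    using assms by (auto simp: sqint_def)
  have "norm (f x) * norm (g x) \<le> (norm (f x))\<^sup>2 + (norm (g x))\<^sup>2" for x
    using sum_squares_bound[of "norm (f x)" "norm (g x)"] mult_nonneg_nonneg[OF norm_ge_zero norm_ge_zero, of "f x" "g x"]
    by linarith
  then show "AE x in M. norm (norm (f x) * norm (g x)) \<le> norm ((norm (f x))\<^sup>2 + (norm (g x))\<^sup>2)"
    by (auto simp: abs_mult)
qed (use assms in measurable)

lemma sqint_times_integrable:
  fixes f g :: "_ \<Rightarrow> 'b::{real_normed_algebra,banach,second_countable_topology}"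
  assumes "sqint M f" "sqint M g"
  shows "integrable M (\<lambda>x. f x * g x)"
  by (rule Bochner_Integration.integrable_bound[OF sqint_times_norm_integrable[OF assms]])
    (use assms in \<open>auto simp: norm_mult_ineq\<close>)

text \<open>Discriminant argument: the integral of (|f| - t |g|)^2 is a nonnegative quadratic
  polynomial in t.\<close>

lemma cauchy_schwarz:
  assumes "sqint M f" "sqint M g"
  shows "(\<integral>x. norm (f x) * norm (g x) \<partial>M) \<le> sqrt (nsq M f) * sqrt (nsq M g)"
proof -
  let ?I = "\<integral>x. norm (f x) * norm (g x) \<partial>M"
  have i: "integrable M (\<lambda>x. norm (f x) * norm (g x))"
    by (rule sqint_times_norm_integrable[OF assms])
  have I0: "?I \<ge> 0" by simp
  have q: "2 * t * ?I \<le> nsq M f + t\<^sup>2 * nsq M g" for t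
  proof -
    have "2 * t * ?I = (\<integral>x. 2 * t * (norm (f x) * norm (g x)) \<partial>M)" by simp
    also have "\<dots> \<le> (\<integral>x. (norm (f x))\<^sup>2 + t\<^sup>2 * (norm (g x))\<^sup>2 \<partial>M)"
    proof (rule integral_mono)
      show "2 * t * (norm (f x) * norm (g x)) \<le> (norm (f x))\<^sup>2 + t\<^sup>2 * (norm (g x))\<^sup>2" for x
        using sum_squares_bound[of "norm (f x)" "t * norm (g x)"]
        by (simp add: power_mult_distrib algebra_simps)
    qed (use assms i in \<open>auto simp: sqint_def\<close>)
    also have "\<dots> = nsq M f + t\<^sup>2 * nsq M g"
      using assms by (simp add: nsq_def sqint_def)
    finally show ?thesis .
  qed
  have "?I\<^sup>2 \<le> nsq M f * nsq M g"
  proof (cases "nsq M g = 0")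
    case True
    \<comment> \<open>Here the polynomial is affine in t. The t used below makes its linear part 2
      (\<open>nsq M f\<close> + 1), which exceeds \<open>nsq M f\<close>.\<close>
    have "?I = 0"
    proof (rule ccontr)
      assume "?I \<noteq> 0"
      then have "2 * ((nsq M f + 1) / ?I) * ?I = 2 * (nsq M f + 1)" by simp
      then show False
        using q[of "(nsq M f + 1) / ?I"] nsq_nonneg[of M f] True by simp
    qed
    then show ?thesis using True by simp
  next
    case False
    then have g: "nsq M g > 0" using nsq_nonneg[of M g] by linarith
    show ?thesis
      using q[of "?I / nsq M g"] g by (auto simp: field_simps power2_eq_square)
  qed
  then have "sqrt (?I\<^sup>2) \<le> sqrt (nsq M f * nsq M g)" by (rule real_sqrt_le_mono)
  then show ?thesis using I0 by (simp add: real_sqrt_mult)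
qed

lemma cauchy_schwarz_prod:
  fixes f g :: "_ \<Rightarrow> 'b::{real_normed_algebra,banach,second_countable_topology}"
  assumes "sqint M f" "sqint M g"
  shows "norm (\<integral>x. f x * g x \<partial>M) \<le> sqrt (nsq M f) * sqrt (nsq M g)"
proof -
  have "norm (\<integral>x. f x * g x \<partial>M) \<le> (\<integral>x. norm (f x * g x) \<partial>M)" by (rule integral_norm_bound)
  also have "\<dots> \<le> (\<integral>x. norm (f x) * norm (g x) \<partial>M)"
    by (rule integral_mono) (auto intro!: integrable_norm sqint_times_integrable sqint_times_norm_integrable assms norm_mult_ineq)
  also have "\<dots> \<le> sqrt (nsq M f) * sqrt (nsq M g)" by (rule cauchy_schwarz[OF assms])
  finally show ?thesis .
qed

lemma nsq_triangle:
  assumes "sqint M f" "sqint M g"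
  shows "sqrt (nsq M (\<lambda>x. f x + g x)) \<le> sqrt (nsq M f) + sqrt (nsq M g)"
proof -
  have i: "integrable M (\<lambda>x. norm (f x) * norm (g x))"
    by (rule sqint_times_norm_integrable[OF assms])
  have "nsq M (\<lambda>x. f x + g x) \<le> (\<integral>x. (norm (f x))\<^sup>2 + (norm (g x))\<^sup>2 + 2 * (norm (f x) * norm (g x)) \<partial>M)"
    unfolding nsq_def
  proof (rule integral_mono)
    show "(norm (f x + g x))\<^sup>2 \<le> (norm (f x))\<^sup>2 + (norm (g x))\<^sup>2 + 2 * (norm (f x) * norm (g x))" for x
      using power_mono[OF norm_triangle_ineq[of "f x" "g x"], of 2] by (simp add: power2_sum)
  qed (use assms i sqint_add(1)[OF assms] in \<open>auto simp: sqint_def\<close>)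
  also have "\<dots> = nsq M f + nsq M g + 2 * (\<integral>x. norm (f x) * norm (g x) \<partial>M)"
    using assms i by (simp add: nsq_def sqint_def)
  also have "\<dots> \<le> nsq M f + nsq M g + 2 * (sqrt (nsq M f) * sqrt (nsq M g))"
    using cauchy_schwarz[OF assms] by simp
  also have "\<dots> = (sqrt (nsq M f) + sqrt (nsq M g))\<^sup>2" by (simp add: power2_sum)
  finally have "sqrt (nsq M (\<lambda>x. f x + g x)) \<le> sqrt ((sqrt (nsq M f) + sqrt (nsq M g))\<^sup>2)"
    by (rule real_sqrt_le_mono)
  then show ?thesis by simp
qed

lemma nsq_AE_zero:
  assumes "sqint M f" "nsq M f = 0"
  shows "AE x in M. f x = 0"
proof -
  have "AE x in M. (norm (f x))\<^sup>2 = 0"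
    using assms by (subst integral_nonneg_eq_0_iff_AE[symmetric]) (auto simp: sqint_def nsq_def)
  then show ?thesis by simp
qed

lemma sqint_cong_AE:
  assumes "sqint M f" "g \<in> borel_measurable M" "AE x in M. f x = g x"
  shows "sqint M g" "nsq M g = nsq M f"
proof -
  show g: "sqint M g" by (rule sqint_bound[OF assms(1,2)]) (use assms(3) in auto)
  show "nsq M g = nsq M f" unfolding nsq_def
    by (rule integral_cong_AE) (use assms in auto)
qed

text \<open>Fatou's lemma gives square integrability of the pointwise limit together with the bound,
  with no dominating function. An eventual bound suffices, as the Cauchy estimate in
  \<open>L2_complete\<close> provides only that.\<close>

lemma nsq_fatou:
  fixes f :: "nat \<Rightarrow> _ \<Rightarrow> _"
  assumes "\<And>k. sqint M (f k)" "g \<in> borel_measurable M" "AE x in M. (\<lambda>k. f k x) \<longlonglongrightarrow> g x"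
    "\<forall>\<^sub>F k in sequentially. nsq M (f k) \<le> C"
  shows "sqint M g" "nsq M g \<le> C"
proof -
  obtain k0 where "\<forall>k\<ge>k0. nsq M (f k) \<le> C" using assms(4) by (auto simp: eventually_sequentially)
  then have C0: "C \<ge> 0" using order_trans[OF nsq_nonneg[of M "f k0"], of C] by simp
  have "(\<integral>\<^sup>+x. ennreal ((norm (g x))\<^sup>2) \<partial>M) = (\<integral>\<^sup>+x. liminf (\<lambda>k. ennreal ((norm (f k x))\<^sup>2)) \<partial>M)"
  proof (rule nn_integral_cong_AE)
    show "AE x in M. ennreal ((norm (g x))\<^sup>2) = liminf (\<lambda>k. ennreal ((norm (f k x))\<^sup>2))"
      using assms(3)
    proof eventually_elim
      case (elim x)
      then have "(\<lambda>k. ennreal ((norm (f k x))\<^sup>2)) \<longlonglongrightarrow> ennreal ((norm (g x))\<^sup>2)"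
        by (intro tendsto_intros)
      then show ?case using lim_imp_Liminf[OF sequentially_bot] by metis
    qed
  qed
  also have "\<dots> \<le> liminf (\<lambda>k. \<integral>\<^sup>+x. ennreal ((norm (f k x))\<^sup>2) \<partial>M)"
    by (rule nn_integral_liminf) (use assms(1) in measurable)
  also have "\<dots> = liminf (\<lambda>k. ennreal (nsq M (f k)))"
    using sqint_nn_integral[OF assms(1)] by simp
  also have "\<dots> \<le> liminf (\<lambda>k. ennreal C)"
    by (rule Liminf_mono) (use assms(4) in eventually_elim, auto intro: ennreal_leI)
  also have "\<dots> = ennreal C" by (simp add: Liminf_const)
  finally have le: "(\<integral>\<^sup>+x. ennreal ((norm (g x))\<^sup>2) \<partial>M) \<le> ennreal C" .
  show "sqint M g" "nsq M g \<le> C" using sqint_nnI[OF assms(2) le C0] by auto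
qed

text \<open>Riesz-Fischer for concrete functions. The almost everywhere convergent subsequence is
  part of the conclusion because \<open>local_compactness\<close> bounds the limit through
  it.\<close>

theorem L2_complete:
  fixes f :: "nat \<Rightarrow> 'a \<Rightarrow> 'b::{banach,second_countable_topology}"
  assumes f: "\<And>n. sqint M (f n)"
    and cau: "\<And>e. e > 0 \<Longrightarrow> \<exists>N. \<forall>m\<ge>N. \<forall>n\<ge>N. nsq M (\<lambda>x. f m x - f n x) < e"
  obtains g r where "sqint M g" "(\<lambda>n. nsq M (\<lambda>x. f n x - g x)) \<longlonglongrightarrow> 0"
    "strict_mono (r :: nat \<Rightarrow> nat)" "AE x in M. (\<lambda>k. f (r k) x) \<longlonglongrightarrow> g x"
proof -
  have [measurable]: "f n \<in> borel_measurable M" for n using f by (rule sqint_measurable)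
  have "\<exists>N. \<forall>m\<ge>N. \<forall>n\<ge>N. nsq M (\<lambda>x. f m x - f n x) < (1/4)^k" for k :: nat
    by (rule cau) simp
  then obtain N where N: "\<And>k m n. m \<ge> N k \<Longrightarrow> n \<ge> N k \<Longrightarrow> nsq M (\<lambda>x. f m x - f n x) < (1/4)^k"
    by metis
  define r where "r = rec_nat (N 0) (\<lambda>k x. max (N (Suc k)) (Suc x))"
  have r0: "r (Suc k) = max (N (Suc k)) (Suc (r k))" for k by (simp add: r_def)
  have rN: "r k \<ge> N k" for k by (cases k) (auto simp: r0, simp add: r_def)
  have rmono: "strict_mono r" by (rule strict_monoI_Suc) (simp add: r0)
  define d where "d k x = f (r (Suc k)) x - f (r k) x" for k x
  have d: "sqint M (d k)" "nsq M (d k) < (1/4)^k" for k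
  proof -
    show "sqint M (d k)" unfolding d_def by (intro sqint_diff f)
    have "r (Suc k) \<ge> N k" using rN[of k] r0[of k] by simp
    then show "nsq M (d k) < (1/4)^k" unfolding d_def using N rN by auto
  qed
  have [measurable]: "d k \<in> borel_measurable M" for k using d(1) by (rule sqint_measurable)
  \<comment> \<open>The increments have squared norm below 4^(-k), so the weight 2^k still leaves a
    summable series of integrals; finiteness of the weighted sum at a point then forces geometric
    decay of the increments there.\<close>
  have "(\<integral>\<^sup>+x. (\<Sum>k. ennreal (2^k * (norm (d k x))\<^sup>2)) \<partial>M) = (\<Sum>k. \<integral>\<^sup>+x. ennreal (2^k * (norm (d k x))\<^sup>2) \<partial>M)"
    by (rule nn_integral_suminf) measurable
  also have "\<dots> = (\<Sum>k. ennreal (2^k * nsq M (d k)))"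
    by (simp add: ennreal_mult nn_integral_cmult sqint_nn_integral d(1))
  also have "\<dots> \<le> (\<Sum>k. ennreal ((1/2)^k))"
  proof (intro suminf_le allI ennreal_leI)
    show "2^k * nsq M (d k) \<le> (1/2)^k" for k
    proof -
      have "2^k * nsq M (d k) \<le> 2^k * (1/4)^k" using d(2)[of k] by (intro mult_left_mono) auto
      also have "\<dots> = (1/2)^k" by (simp flip: power_mult_distrib)
      finally show ?thesis .
    qed
  qed auto
  also have "\<dots> = ennreal (\<Sum>k. (1/2)^k)" by (intro suminf_ennreal2) auto
  also have "\<dots> < \<infinity>" by simp
  finally have "(\<integral>\<^sup>+x. (\<Sum>k. ennreal (2^k * (norm (d k x))\<^sup>2)) \<partial>M) \<noteq> \<infinity>" by simp
  then have "AE x in M. (\<Sum>k. ennreal (2^k * (norm (d k x))\<^sup>2)) \<noteq> \<infinity>"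
    by (intro nn_integral_noteq_infinite) measurable
  then have conv: "AE x in M. convergent (\<lambda>k. f (r k) x)"
  proof eventually_elim
    case (elim x)
    define T where "T = (\<Sum>k. ennreal (2^k * (norm (d k x))\<^sup>2))"
    obtain S where S: "T = ennreal S" "S \<ge> 0"
      using elim unfolding T_def[symmetric] by (cases T) auto
    have b: "norm (d k x) \<le> sqrt S * (sqrt (1/2))^k" for k
    proof -
      have "(\<Sum>i\<in>{k}. ennreal (2^i * (norm (d i x))\<^sup>2)) \<le> T"
        unfolding T_def by (rule sum_le_suminf) (auto intro: summableI)
      then have "ennreal (2^k * (norm (d k x))\<^sup>2) \<le> ennreal S" unfolding S(1) by simp
      then have "2^k * (norm (d k x))\<^sup>2 \<le> S" using S(2) by (subst (asm) ennreal_le_iff)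
      then have "(norm (d k x))\<^sup>2 \<le> S * (1/2)^k" by (simp add: field_simps)
      then have "sqrt ((norm (d k x))\<^sup>2) \<le> sqrt (S * (1/2)^k)" by (rule real_sqrt_le_mono)
      then show ?thesis by (simp add: real_sqrt_mult real_sqrt_power del: real_sqrt_divide)
    qed
    have "summable (\<lambda>k. sqrt S * (sqrt (1/2))^k)"
      by (intro summable_mult summable_geometric) (simp add: real_sqrt_lt_1_iff)
    then have "summable (\<lambda>k. d k x)" by (rule summable_comparison_test') (use b in auto)
    then have "convergent (\<lambda>n. \<Sum>k<n. d k x)" by (simp add: summable_iff_convergent)
    moreover have "(\<Sum>k<n. d k x) = f (r n) x - f (r 0) x" for n
      unfolding d_def by (rule sum_lessThan_telescope)
    ultimately have "convergent (\<lambda>n. f (r n) x - f (r 0) x)" by simp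
    then have "convergent (\<lambda>n. (f (r n) x - f (r 0) x) + f (r 0) x)"
      by (intro convergent_add convergent_const)
    then show ?case by simp
  qed
  define g where "g x = lim (\<lambda>k. f (r k) x)" for x
  have [measurable]: "g \<in> borel_measurable M" unfolding g_def by measurable
  have lim: "AE x in M. (\<lambda>k. f (r k) x) \<longlonglongrightarrow> g x"
    using conv by eventually_elim (simp add: g_def convergent_LIMSEQ_iff)
  \<comment> \<open>Fatou along the subsequence with n held fixed: the Cauchy bound for f n - f (r
    j) passes to f n - g.\<close>
  have key: "sqint M (\<lambda>x. f n x - g x) \<and> nsq M (\<lambda>x. f n x - g x) \<le> (1/4)^k" if "n \<ge> N k" for n k
  proof -
    have ev: "\<forall>\<^sub>F j in sequentially. nsq M (\<lambda>x. f n x - f (r j) x) \<le> (1/4)^k"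
      unfolding eventually_sequentially
    proof (intro exI[of _ k] allI impI)
      fix j assume "k \<le> j"
      then have "r j \<ge> N k" using rN[of k] rmono by (meson le_trans strict_mono_less_eq)
      then show "nsq M (\<lambda>x. f n x - f (r j) x) \<le> (1/4)^k" using N that by (simp add: less_imp_le)
    qed
    have l: "AE x in M. (\<lambda>j. f n x - f (r j) x) \<longlonglongrightarrow> f n x - g x"
      using lim by eventually_elim (intro tendsto_intros)
    show ?thesis
      using nsq_fatou[OF sqint_diff(1)[OF f f] _ l ev] by auto
  qed
  show thesis
  proof
    show "sqint M g"
      using sqint_diff(1)[OF f conjunct1[OF key[of 0 "N 0"]], of "N 0"] by simp
    show "(\<lambda>n. nsq M (\<lambda>x. f n x - g x)) \<longlonglongrightarrow> 0"
    proof (rule LIMSEQ_I)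
      fix e :: real assume "0 < e"
      then obtain k where k: "(1/4)^k < e" using real_arch_pow_inv[of e "1/4"] by auto
      have "norm (nsq M (\<lambda>x. f n x - g x) - 0) < e" if "n \<ge> N k" for n
        using key[OF that] k nsq_nonneg[of M "\<lambda>x. f n x - g x"] by simp
      then show "\<exists>no. \<forall>n\<ge>no. norm (nsq M (\<lambda>x. f n x - g x) - 0) < e" by blast
    qed
    show "strict_mono r" by (fact rmono)
    show "AE x in M. (\<lambda>k. f (r k) x) \<longlonglongrightarrow> g x" by (fact lim)
  qed
qed

section \<open>The Plancherel theorem\<close>

lemma sqint_shift:
  fixes k :: "real \<Rightarrow> 'b::{banach,second_countable_topology}"
  assumes "sqint lborel k"
  shows "sqint lborel (\<lambda>x. k (x + h))" "nsq lborel (\<lambda>x. k (x + h)) = nsq lborel k"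
  using lborel_integrable_real_affine[of "\<lambda>x. (norm (k x))\<^sup>2" 1 h]
    lborel_integral_real_affine[of 1 "\<lambda>x. (norm (k x))\<^sup>2" h] assms
  by (auto simp: sqint_def nsq_def add.commute)

lemma nsq_tendsto_dominated:
  fixes f :: "nat \<Rightarrow> 'a \<Rightarrow> 'b::{banach,second_countable_topology}"
  assumes "\<And>n. f n \<in> borel_measurable M" "integrable M w"
    "AE x in M. (\<lambda>n. f n x) \<longlonglongrightarrow> 0" "\<And>n. AE x in M. (norm (f n x))\<^sup>2 \<le> w x"
  shows "(\<lambda>n. nsq M (f n)) \<longlonglongrightarrow> 0"
proof -
  have "(\<lambda>n. nsq M (f n)) \<longlonglongrightarrow> (\<integral>x. 0 \<partial>M)"
    unfolding nsq_def
  proof (rule integral_dominated_convergence[OF _ _ assms(2)])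
    show "AE x in M. (\<lambda>n. (norm (f n x))\<^sup>2) \<longlonglongrightarrow> 0"
      using assms(3) by eventually_elim (auto intro!: tendsto_eq_intros)
  qed (use assms in auto)
  then show ?thesis by simp
qed

text \<open>\<open>measurable_on\<close> speaks of negligible sets, which are null for the completed
  measure; almost everywhere statements do not distinguish it from \<open>lborel\<close>.\<close>

lemma AE_lborel_negligible:
  assumes "negligible N" "\<And>x. x \<notin> N \<Longrightarrow> P (x::real)"
  shows "AE x in lborel. P x"
proof -
  have "N \<in> null_sets lebesgue" using assms(1) negligible_iff_null_sets by blast
  then have "AE x in lebesgue. P x"
    by (rule AE_I') (use assms(2) in auto)
  then show ?thesis by (simp add: AE_completion_iff)
qed

lemma continuous_compact_support_sqint:
  fixes g :: "real \<Rightarrow> 'b::euclidean_space"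
  assumes g: "continuous_on UNIV g" and supp: "\<And>x. \<bar>x\<bar> > r \<Longrightarrow> g x = 0"
  obtains B where "B > 0" "\<And>x. norm (g x) \<le> B" "sqint lborel g"
proof -
  have "compact (g ` {-r..r})"
    by (intro compact_continuous_image continuous_on_subset[OF g]) auto
  then obtain B where B: "B > 0" "\<And>x. x \<in> {-r..r} \<Longrightarrow> norm (g x) \<le> B"
    by (auto dest!: compact_imp_bounded simp: bounded_pos)
  have b: "norm (g x) \<le> B" for x
    using B(1) B(2)[of x] supp[of x] by (cases "\<bar>x\<bar> > r") (auto simp: abs_if split: if_splits)
  have [measurable]: "g \<in> borel_measurable borel" using g by (rule borel_measurable_continuous_onI)
  have "integrable lborel (\<lambda>x. (norm (g x))\<^sup>2)"
  proof (rule Bochner_Integration.integrable_bound)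
    show "integrable lborel (\<lambda>x. B\<^sup>2 * indicat_real {-r..r} x)"
      by (intro integrable_mult_right integrable_real_indicator) (auto simp: emeasure_lborel_Icc_eq)
    show "AE x in lborel. norm ((norm (g x))\<^sup>2) \<le> norm (B\<^sup>2 * indicat_real {-r..r} x)"
      using b supp by (intro AE_I2) (auto simp: indicator_def abs_mult power_mono not_le)
  qed measurable
  then have "sqint lborel g" by (simp add: sqint_def)
  then show thesis using that B(1) b by blast
qed

lemma sqint_truncate_tendsto:
  fixes k :: "real \<Rightarrow> 'b::{banach,second_countable_topology}"
  assumes k: "sqint lborel k"
  shows "(\<lambda>n. nsq lborel (\<lambda>x. k x - (if \<bar>x\<bar> \<le> real n \<and> norm (k x) \<le> real n then k x else 0))) \<longlonglongrightarrow> 0"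
proof (rule nsq_tendsto_dominated[OF _ sqint_integrable[OF k]])
  have [measurable]: "k \<in> borel_measurable lborel" using k by (rule sqint_measurable)
  then show "(\<lambda>x. k x - (if \<bar>x\<bar> \<le> real n \<and> norm (k x) \<le> real n then k x else 0)) \<in> borel_measurable lborel" for n
    by measurable
  show "AE x in lborel. (\<lambda>n. k x - (if \<bar>x\<bar> \<le> real n \<and> norm (k x) \<le> real n then k x else 0)) \<longlonglongrightarrow> 0"
  proof (intro AE_I2 tendsto_eventually)
    fix x
    obtain N where N: "real N \<ge> max \<bar>x\<bar> (norm (k x))" using real_arch_simple by blast
    show "\<forall>\<^sub>F n in sequentially. k x - (if \<bar>x\<bar> \<le> real n \<and> norm (k x) \<le> real n then k x else 0) = 0"
      unfolding eventually_sequentially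
    proof (intro exI[of _ N] allI impI)
      fix n assume "N \<le> n"
      then have "real N \<le> real n" by simp
      then show "k x - (if \<bar>x\<bar> \<le> real n \<and> norm (k x) \<le> real n then k x else 0) = 0"
        using N by simp
    qed
  qed
  show "AE x in lborel. (norm (k x - (if \<bar>x\<bar> \<le> real n \<and> norm (k x) \<le> real n then k x else 0)))\<^sup>2 \<le> (norm (k x))\<^sup>2" for n
    by (intro AE_I2) auto
qed

text \<open>Measurability supplies continuous functions converging almost everywhere. They need not
  be bounded or compactly supported, so both properties are imposed by continuous cutoffs that fix
  the limit; dominated convergence then applies.\<close>

lemma sqint_dense_continuous_bounded:
  fixes k :: "real \<Rightarrow> 'b::euclidean_space"
  assumes [measurable]: "k \<in> borel_measurable lborel"
    and n: "n > (0::real)" "\<And>x. norm (k x) \<le> n" "\<And>x. \<bar>x\<bar> > n \<Longrightarrow> k x = 0" and e: "e > 0"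
  obtains g where "continuous_on UNIV g" "\<And>x. \<bar>x\<bar> > n + 1 \<Longrightarrow> g x = 0" "nsq lborel (\<lambda>x. k x - g x) < e"
proof -
  have "k \<in> borel_measurable lebesgue" using assms(1) by (rule measurable_completion)
  then have "k measurable_on UNIV"
    by (subst measurable_on_iff_borel_measurable) (auto simp: lebesgue_on_UNIV_eq)
  then obtain N g where N: "negligible N" and g: "\<And>j. continuous_on UNIV (g (j::nat))"
    and lim: "\<And>x. x \<notin> N \<Longrightarrow> (\<lambda>j. g j x) \<longlonglongrightarrow> k x"
    by (auto simp: measurable_on_def)
  \<comment> \<open>The first factor is a trapezoid, 1 on [-n, n] and 0 outside [-n - 1, n + 1]; the
    second retracts onto the ball of radius n. Neither changes a value of k.\<close>
  define G where "G j x = (max 0 (min 1 (n + 1 - \<bar>x\<bar>)) * (n / max n (norm (g j x)))) *\<^sub>R g j x" for j x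
  have m0: "max n t \<noteq> 0" for t using n(1) by (auto simp: max_def)
  have Gc: "continuous_on UNIV (G j)" for j
    unfolding G_def by (intro continuous_intros g ballI m0)
  have [measurable]: "G j \<in> borel_measurable lborel" for j
    using borel_measurable_continuous_onI[OF Gc[of j]] by simp
  have Gs: "G j x = 0" if "\<bar>x\<bar> > n + 1" for j x using that by (simp add: G_def)
  have Gb: "norm (G j x) \<le> n" for j x
  proof -
    have "norm (G j x) = max 0 (min 1 (n + 1 - \<bar>x\<bar>)) * ((n / max n (norm (g j x))) * norm (g j x))"
      using n(1) by (simp add: G_def abs_mult)
    also have "\<dots> \<le> 1 * ((n / max n (norm (g j x))) * norm (g j x))"
      using n(1) by (intro mult_right_mono) (auto simp: max_def)
    also have "\<dots> \<le> n" using n(1) by (auto simp: max_def field_simps mult_right_mono)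
    finally show ?thesis .
  qed
  have ae: "AE x in lborel. (\<lambda>j. k x - G j x) \<longlonglongrightarrow> 0"
  proof (rule AE_lborel_negligible[OF N])
    fix x assume "x \<notin> N"
    from lim[OF this] have l: "(\<lambda>j. g j x) \<longlonglongrightarrow> k x" .
    have "(\<lambda>j. G j x) \<longlonglongrightarrow> (max 0 (min 1 (n + 1 - \<bar>x\<bar>)) * (n / max n (norm (k x)))) *\<^sub>R k x"
      unfolding G_def by (intro tendsto_intros l m0)
    also have "(max 0 (min 1 (n + 1 - \<bar>x\<bar>)) * (n / max n (norm (k x)))) *\<^sub>R k x = k x"
      using n(2)[of x] n(3)[of x] n(1) by (cases "\<bar>x\<bar> > n") (auto simp: max_def)
    finally show "(\<lambda>j. k x - G j x) \<longlonglongrightarrow> 0" using tendsto_diff[OF tendsto_const, of _ _ _ "k x"] by force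
  qed
  have "(\<lambda>j. nsq lborel (\<lambda>x. k x - G j x)) \<longlonglongrightarrow> 0"
  proof (rule nsq_tendsto_dominated[OF _ _ ae])
    show "integrable lborel (\<lambda>x. (2 * n)\<^sup>2 * indicat_real {-(n+1)..n+1} x)"
      by (intro integrable_mult_right integrable_real_indicator) (auto simp: emeasure_lborel_Icc_eq)
    show "AE x in lborel. (norm (k x - G j x))\<^sup>2 \<le> (2 * n)\<^sup>2 * indicat_real {-(n+1)..n+1} x" for j
    proof (rule AE_I2)
      fix x
      have "norm (k x - G j x) \<le> 2 * n"
        using norm_triangle_ineq4[of "k x" "G j x"] Gb[of j x] n(2)[of x] by simp
      then have "(norm (k x - G j x))\<^sup>2 \<le> (2 * n)\<^sup>2" by (rule power_mono) simp
      moreover have "k x - G j x = 0" if "\<bar>x\<bar> > n + 1" using that Gs n(3) by simp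
      ultimately show "(norm (k x - G j x))\<^sup>2 \<le> (2 * n)\<^sup>2 * indicat_real {-(n+1)..n+1} x"
        by (cases "\<bar>x\<bar> > n + 1") (auto simp: indicator_def)
    qed
  qed measurable
  then have "\<forall>\<^sub>F j in sequentially. nsq lborel (\<lambda>x. k x - G j x) < e"
    using e by (rule order_tendstoD)
  then obtain j where "nsq lborel (\<lambda>x. k x - G j x) < e" by (auto simp: eventually_sequentially)
  then show thesis using that[of "G j"] Gc Gs by blast
qed

lemma sqint_dense_continuous:
  fixes k :: "real \<Rightarrow> 'b::euclidean_space"
  assumes k: "sqint lborel k" and e: "e > 0"
  obtains g r where "continuous_on UNIV g" "\<And>x. \<bar>x\<bar> > r \<Longrightarrow> g x = 0" "nsq lborel (\<lambda>x. k x - g x) < e"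
proof -
  have [measurable]: "k \<in> borel_measurable lborel" using k by (rule sqint_measurable)
  define kn where "kn n x = (if \<bar>x\<bar> \<le> real n \<and> norm (k x) \<le> real n then k x else 0)" for n x
  have "\<forall>\<^sub>F n in sequentially. nsq lborel (\<lambda>x. k x - kn n x) < e / 4"
    unfolding kn_def using e by (intro order_tendstoD(2)[OF sqint_truncate_tendsto[OF k]]) simp
  then obtain N where N: "\<And>n. n \<ge> N \<Longrightarrow> nsq lborel (\<lambda>x. k x - kn n x) < e / 4"
    by (auto simp: eventually_sequentially)
  \<comment> \<open>The successor makes n positive, as the bounded case requires.\<close>
  define n where "n = Suc N"
  have n: "nsq lborel (\<lambda>x. k x - kn n x) < e / 4" using N[of n] by (simp add: n_def)
  have knm[measurable]: "kn n \<in> borel_measurable lborel" unfolding kn_def by measurable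
  have kn: "sqint lborel (kn n)" by (rule sqint_bound[OF k]) (auto simp: kn_def)
  obtain g where g: "continuous_on UNIV g" "\<And>x. \<bar>x\<bar> > real n + 1 \<Longrightarrow> g x = 0"
    "nsq lborel (\<lambda>x. kn n x - g x) < e / 4"
    by (rule sqint_dense_continuous_bounded[OF knm, of "real n" "e/4"])
      (use e in \<open>auto simp: kn_def n_def split: if_splits\<close>)
  obtain B where B: "sqint lborel g" using continuous_compact_support_sqint[OF g(1,2)] by metis
  have "nsq lborel (\<lambda>x. (k x - kn n x) + (kn n x - g x)) < e"
    using sqint_add(2)[OF sqint_diff(1)[OF k kn] sqint_diff(1)[OF kn B]] n g(3) by linarith
  then have "nsq lborel (\<lambda>x. k x - g x) < e" by simp
  then show thesis using that g(1,2) by blast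
qed

text \<open>Translations are isometries, so replacing k by a continuous compactly supported
  approximation costs an error uniform in the translation.\<close>

lemma L2_translation_continuous:
  fixes k :: "real \<Rightarrow> 'b::euclidean_space"
  assumes k: "sqint lborel k" and h: "h \<longlonglongrightarrow> 0"
  shows "(\<lambda>n. nsq lborel (\<lambda>x. k (x + h n) - k x)) \<longlonglongrightarrow> 0"
proof (rule LIMSEQ_I)
  fix e :: real assume e: "e > 0"
  obtain g r where g: "continuous_on UNIV g" "\<And>x. \<bar>x\<bar> > r \<Longrightarrow> g x = 0"
    "nsq lborel (\<lambda>x. k x - g x) < e / 16"
    using sqint_dense_continuous[OF k, of "e/16"] e by auto
  obtain B where B: "\<And>x. norm (g x) \<le> B" "sqint lborel g"
    using continuous_compact_support_sqint[OF g(1,2)] by metis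
  have gm[measurable]: "g \<in> borel_measurable borel" using g(1) by (rule borel_measurable_continuous_onI)
  \<comment> \<open>A common bound on the shifts keeps all supports inside one interval, which gives
    the dominating function.\<close>
  have "Bseq h" using h convergentI convergent_imp_Bseq by blast
  then obtain H where H: "\<And>n. \<bar>h n\<bar> \<le> H" by (auto simp: Bseq_def)
  have "(\<lambda>n. nsq lborel (\<lambda>x. g (x + h n) - g x)) \<longlonglongrightarrow> 0"
  proof (rule nsq_tendsto_dominated)
    show "integrable lborel (\<lambda>x. (2 * B)\<^sup>2 * indicat_real {-(r+H)..r+H} x)"
      by (intro integrable_mult_right integrable_real_indicator) (auto simp: emeasure_lborel_Icc_eq)
    have "isCont g x" for x using g(1) continuous_on_eq_continuous_at[of UNIV g] by auto
    have "(\<lambda>n. g (x + h n)) \<longlonglongrightarrow> g (x + 0)" for x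
      by (rule isCont_tendsto_compose[OF \<open>\<And>x. isCont g x\<close>]) (intro tendsto_intros h)
    then have "(\<lambda>n. g (x + h n) - g x) \<longlonglongrightarrow> g (x + 0) - g x" for x by (intro tendsto_intros)
    then show "AE x in lborel. (\<lambda>n. g (x + h n) - g x) \<longlonglongrightarrow> 0" by simp
    show "AE x in lborel. (norm (g (x + h n) - g x))\<^sup>2 \<le> (2 * B)\<^sup>2 * indicat_real {-(r+H)..r+H} x" for n
    proof (rule AE_I2)
      fix x
      have "norm (g (x + h n) - g x) \<le> 2 * B"
        using norm_triangle_ineq4[of "g (x + h n)" "g x"] B(1)[of x] B(1)[of "x + h n"] by simp
      then have "(norm (g (x + h n) - g x))\<^sup>2 \<le> (2 * B)\<^sup>2" by (rule power_mono) simp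
      moreover have "g (x + h n) - g x = 0" if "\<bar>x\<bar> > r + H"
        using that g(2)[of x] g(2)[of "x + h n"] H[of n] by (auto simp: abs_if split: if_splits)
      ultimately show "(norm (g (x + h n) - g x))\<^sup>2 \<le> (2 * B)\<^sup>2 * indicat_real {-(r+H)..r+H} x"
        by (cases "\<bar>x\<bar> > r + H") (auto simp: indicator_def)
    qed
  qed measurable
  then have "\<forall>\<^sub>F n in sequentially. nsq lborel (\<lambda>x. g (x + h n) - g x) < e / 4"
    by (rule order_tendstoD) (use e in auto)
  then obtain N where N: "\<And>n. n \<ge> N \<Longrightarrow> nsq lborel (\<lambda>x. g (x + h n) - g x) < e / 4"
    by (auto simp: eventually_sequentially)
  have "nsq lborel (\<lambda>x. k (x + h n) - k x) < e" if "n \<ge> N" for n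
  proof -
    let ?d = "\<lambda>x. k x - g x"
    have d: "sqint lborel ?d" by (rule sqint_diff[OF k B(2)])
    have dd: "sqint lborel (\<lambda>x. ?d (x + h n) - ?d x)" "nsq lborel (\<lambda>x. ?d (x + h n) - ?d x) < e / 4"
      using sqint_diff[OF sqint_shift(1)[OF d] d, of "h n"] sqint_shift(2)[OF d, of "h n"] g(3) by auto
    have gg: "sqint lborel (\<lambda>x. g (x + h n) - g x)"
      by (rule sqint_diff[OF sqint_shift(1)[OF B(2)] B(2)])
    have "nsq lborel (\<lambda>x. (?d (x + h n) - ?d x) + (g (x + h n) - g x)) < e"
      using sqint_add(2)[OF dd(1) gg] dd(2) N[OF that] by linarith
    then show ?thesis by (simp add: algebra_simps)
  qed
  then show "\<exists>N. \<forall>n\<ge>N. norm (nsq lborel (\<lambda>x. k (x + h n) - k x) - 0) < e"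
    by (intro exI[of _ N]) auto
qed

section \<open>The Fourier integral and Plancherel's identity by Gaussian summation\<close>

definition ft :: "(real \<Rightarrow> complex) \<Rightarrow> real \<Rightarrow> complex" where
  "ft k \<xi> = (\<integral>x. k x * cis (- (x * \<xi>)) \<partial>lborel)"

lemma borel_measurable_cis[measurable (raw)]:
  assumes "f \<in> borel_measurable M"
  shows "(\<lambda>x. cis (f x)) \<in> borel_measurable M"
proof -
  have "continuous_on UNIV cis" unfolding cis_conv_exp by (intro continuous_intros)
  then show ?thesis using assms by (rule borel_measurable_continuous_on)
qed

lemma borel_measurable_cnj[measurable (raw)]:
  "f \<in> borel_measurable M \<Longrightarrow> (\<lambda>x. cnj (f x)) \<in> borel_measurable M"
  by (rule borel_measurable_continuous_on[of cnj]) (intro continuous_intros)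

lemma integrable_times_cis:
  assumes "integrable M k" "f \<in> borel_measurable M"
  shows "integrable M (\<lambda>x. k x * cis (f x))"
proof (rule Bochner_Integration.integrable_bound[OF assms(1)])
  have [measurable]: "k \<in> borel_measurable M" using assms(1) by simp
  note assms(2)[measurable]
  show "(\<lambda>x. k x * cis (f x)) \<in> borel_measurable M" by measurable
qed (simp add: norm_mult)

lemma borel_measurable_ft[measurable]:
  assumes [measurable]: "k \<in> borel_measurable borel"
  shows "ft k \<in> borel_measurable borel"
  unfolding ft_def by measurable

lemma ft_diff:
  assumes "integrable lborel k" "integrable lborel l"
  shows "ft (\<lambda>x. k x - l x) \<xi> = ft k \<xi> - ft l \<xi>"
proof -
  have "ft (\<lambda>x. k x - l x) \<xi> = (\<integral>x. k x * cis (- (x * \<xi>)) - l x * cis (- (x * \<xi>)) \<partial>lborel)"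
    by (simp add: ft_def left_diff_distrib)
  also have "\<dots> = ft k \<xi> - ft l \<xi>"
    unfolding ft_def by (intro Bochner_Integration.integral_diff integrable_times_cis assms) measurable
  finally show ?thesis .
qed

lemma ft_shift: "ft (\<lambda>x. k (x + h)) \<xi> = cis (h * \<xi>) * ft k \<xi>"
proof -
  have "ft k \<xi> = (\<integral>x. k (x + h) * cis (- ((x + h) * \<xi>)) \<partial>lborel)"
    unfolding ft_def using lborel_integral_real_affine[of 1 "\<lambda>x. k x * cis (- (x * \<xi>))" h]
    by (simp add: add.commute)
  then have "cis (h * \<xi>) * ft k \<xi> = (\<integral>x. cis (h * \<xi>) * (k (x + h) * cis (- ((x + h) * \<xi>))) \<partial>lborel)"
    by simp
  also have "\<dots> = (\<integral>x. k (x + h) * cis (- (x * \<xi>)) \<partial>lborel)"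
  proof (rule Bochner_Integration.integral_cong)
    fix x
    have "cis (h * \<xi>) * cis (- ((x + h) * \<xi>)) = cis (- (x * \<xi>))"
      by (simp add: cis_mult algebra_simps)
    then show "cis (h * \<xi>) * (k (x + h) * cis (- ((x + h) * \<xi>))) = k (x + h) * cis (- (x * \<xi>))"
      by (metis mult.left_commute)
  qed simp
  finally show ?thesis by (simp add: ft_def)
qed

lemma norm_ft_le: "norm (ft k \<xi>) \<le> (\<integral>x. norm (k x) \<partial>lborel)"
proof -
  have "norm (ft k \<xi>) \<le> (\<integral>x. norm (k x * cis (- (x * \<xi>))) \<partial>lborel)"
    unfolding ft_def by (rule integral_norm_bound)
  then show ?thesis by (simp add: norm_mult)
qed

lemma integrable_ft_times:
  assumes k: "integrable lborel k" and g: "integrable lborel g"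
  shows "integrable lborel (\<lambda>\<xi>. ft k \<xi> * g \<xi>)"
proof (rule Bochner_Integration.integrable_bound)
  have [measurable]: "k \<in> borel_measurable borel" "g \<in> borel_measurable borel"
    using k g by (auto dest: borel_measurable_integrable)
  show "integrable lborel (\<lambda>\<xi>. (\<integral>x. norm (k x) \<partial>lborel) * norm (g \<xi>))" using g by simp
  show "(\<lambda>\<xi>. ft k \<xi> * g \<xi>) \<in> borel_measurable lborel" by measurable
  show "AE \<xi> in lborel. norm (ft k \<xi> * g \<xi>) \<le> norm ((\<integral>x. norm (k x) \<partial>lborel) * norm (g \<xi>))"
    by (intro AE_I2) (simp add: norm_mult mult_right_mono norm_ft_le)
qed

text \<open>Fubini. This identity stands in for an inversion formula: it moves a Gaussian from the
  frequency side, where it regularizes, to the other side, where it concentrates at 0.\<close>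

lemma ft_multiplication_formula:
  assumes k: "integrable lborel k" and g: "integrable lborel g"
  shows "(\<integral>\<xi>. ft k \<xi> * g \<xi> \<partial>lborel) = (\<integral>x. k x * ft g x \<partial>lborel)"
proof -
  have [measurable]: "k \<in> borel_measurable borel" "g \<in> borel_measurable borel"
    using k g by (auto dest: borel_measurable_integrable)
  define f where "f x \<xi> = k x * (g \<xi> * cis (- (\<xi> * x)))" for x \<xi>
  have "integrable (lborel \<Otimes>\<^sub>M lborel) (case_prod f)"
  proof (rule lborel_pair.Fubini_integrable)
    show "case_prod f \<in> borel_measurable (lborel \<Otimes>\<^sub>M lborel)" unfolding f_def by measurable
    have "(\<integral>\<xi>. norm (case (x, \<xi>) of (x, y) \<Rightarrow> f x y) \<partial>lborel) = norm (k x) * (\<integral>\<xi>. norm (g \<xi>) \<partial>lborel)" for x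
      by (simp add: f_def norm_mult)
    then show "integrable lborel (\<lambda>x. \<integral>\<xi>. norm (case (x, \<xi>) of (x, y) \<Rightarrow> f x y) \<partial>lborel)"
      using k by simp
    show "AE x in lborel. integrable lborel (\<lambda>y. case (x, y) of (x, y) \<Rightarrow> f x y)"
      unfolding f_def using g by (intro AE_I2) (auto intro!: integrable_times_cis)
  qed
  from lborel_pair.Fubini_integral[OF this]
  have "(\<integral>\<xi>. (\<integral>x. f x \<xi> \<partial>lborel) \<partial>lborel) = (\<integral>x. (\<integral>\<xi>. f x \<xi> \<partial>lborel) \<partial>lborel)" .
  moreover have "(\<integral>x. f x \<xi> \<partial>lborel) = ft k \<xi> * g \<xi>" for \<xi>
  proof -
    have "(\<integral>x. f x \<xi> \<partial>lborel) = (\<integral>x. (k x * cis (- (x * \<xi>))) * g \<xi> \<partial>lborel)"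
      by (simp add: f_def algebra_simps)
    then show ?thesis by (simp add: ft_def)
  qed
  moreover have "(\<integral>\<xi>. f x \<xi> \<partial>lborel) = k x * ft g x" for x
    by (simp add: f_def ft_def)
  ultimately show ?thesis by simp
qed

text \<open>Normalized by its value 1 at the origin and not by its integral: the dilates
  \<open>gauss (\<xi> / c)\<close> must tend to 1 as c grows.\<close>

definition gauss :: "real \<Rightarrow> real" where "gauss z = exp (- z\<^sup>2 / 2)"

lemma gauss_eq: "gauss z = sqrt (2 * pi) * std_normal_density z"
  by (simp add: gauss_def std_normal_density_def)

lemma borel_measurable_gauss[measurable]: "gauss \<in> borel_measurable borel"
  unfolding gauss_def[abs_def] by measurable

lemma gauss_integrable: "integrable lborel gauss" "(\<integral>z. gauss z \<partial>lborel) = sqrt (2 * pi)"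
proof -
  have "integrable lborel (\<lambda>z. sqrt (2 * pi) * std_normal_density z)"
    by (intro integrable_mult_right integrable_normal_density) simp
  then show "integrable lborel gauss" by (simp add: gauss_eq[abs_def])
  show "(\<integral>z. gauss z \<partial>lborel) = sqrt (2 * pi)" by (simp add: gauss_eq integral_normal_density)
qed

lemma gauss_scaled_integrable: "c > 0 \<Longrightarrow> integrable lborel (\<lambda>\<xi>. complex_of_real (gauss (\<xi> / c)))"
  using lborel_integrable_real_affine[OF gauss_integrable(1), of "1/c" 0] by simp

text \<open>After rescaling, the integral is the characteristic function of the standard normal
  distribution.\<close>

lemma ft_gauss_scaled:
  assumes c: "c > 0"
  shows "ft (\<lambda>\<xi>. complex_of_real (gauss (\<xi> / c))) h = complex_of_real (c * sqrt (2 * pi) * gauss (c * h))"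
proof -
  have "ft (\<lambda>\<xi>. complex_of_real (gauss (\<xi> / c))) h
      = c *\<^sub>R (\<integral>z. complex_of_real (gauss z) * cis (- (c * z * h)) \<partial>lborel)"
    unfolding ft_def using c lborel_integral_real_affine[of c "\<lambda>\<xi>. complex_of_real (gauss (\<xi> / c)) * cis (- (\<xi> * h))" 0]
    by simp
  also have "(\<integral>z. complex_of_real (gauss z) * cis (- (c * z * h)) \<partial>lborel)
      = complex_of_real (sqrt (2 * pi)) * (\<integral>z. std_normal_density z *\<^sub>R iexp (- (c * h) * z) \<partial>lborel)"
    unfolding integral_mult_right_zero[symmetric]
    by (intro Bochner_Integration.integral_cong) (simp_all add: gauss_eq cis_conv_exp scaleR_conv_of_real algebra_simps)
  also have "(\<integral>z. std_normal_density z *\<^sub>R iexp (- (c * h) * z) \<partial>lborel) = char std_normal_distribution (- (c * h))"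
    unfolding char_def by (subst integral_density) (auto simp: normal_density_nonneg)
  also have "\<dots> = complex_of_real (gauss (c * h))"
    by (simp add: char_std_normal_distribution gauss_def)
  finally show ?thesis by (simp add: scaleR_conv_of_real mult.assoc)
qed

text \<open>The squared modulus of the transform becomes the transform of an integrable function
  whose value at 0 is the squared norm of k. Plancherel's identity thereby turns into a statement
  about one point.\<close>

lemma autocorrelation:
  assumes k: "integrable lborel k"
  defines "R \<equiv> \<lambda>h. \<integral>y. k (y + h) * cnj (k y) \<partial>lborel"
  shows "integrable lborel R" "ft R \<xi> = complex_of_real ((norm (ft k \<xi>))\<^sup>2)"
proof -
  have [measurable]: "k \<in> borel_measurable borel" using k by (auto dest: borel_measurable_integrable)
  have sh: "integrable lborel (\<lambda>h. k (y + h))" "(\<integral>h. norm (k (y + h)) \<partial>lborel) = (\<integral>h. norm (k h) \<partial>lborel)" for y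
    using lborel_integrable_real_affine[OF k, of 1 y] lborel_integral_real_affine[of 1 "\<lambda>h. norm (k h)" y] by auto
  define f where "f y h \<xi> = cnj (k y) * (k (y + h) * cis (- (h * \<xi>)))" for y h \<xi>
  have int: "integrable (lborel \<Otimes>\<^sub>M lborel) (\<lambda>(y, h). f y h \<xi>)" for \<xi>
  proof (rule lborel_pair.Fubini_integrable)
    show "(\<lambda>(y, h). f y h \<xi>) \<in> borel_measurable (lborel \<Otimes>\<^sub>M lborel)" unfolding f_def by measurable
    have "(\<integral>h. norm (case (y, h) of (y, h) \<Rightarrow> f y h \<xi>) \<partial>lborel) = norm (k y) * (\<integral>h. norm (k h) \<partial>lborel)" for y
      by (simp add: f_def norm_mult sh(2))
    then show "integrable lborel (\<lambda>y. \<integral>h. norm (case (y, h) of (y, h) \<Rightarrow> f y h \<xi>) \<partial>lborel)"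
      using k by simp
    show "AE y in lborel. integrable lborel (\<lambda>h. case (y, h) of (y, h) \<Rightarrow> f y h \<xi>)"
      unfolding f_def using sh(1) by (intro AE_I2) (auto intro!: integrable_times_cis)
  qed
  have "(\<integral>y. f y h \<xi> \<partial>lborel) = R h * cis (- (h * \<xi>))" for h \<xi>
  proof -
    have "(\<integral>y. f y h \<xi> \<partial>lborel) = (\<integral>y. (k (y + h) * cnj (k y)) * cis (- (h * \<xi>)) \<partial>lborel)"
      by (simp add: f_def algebra_simps)
    then show ?thesis by (simp add: R_def)
  qed
  note R = this
  show "integrable lborel R"
    using lborel_pair.integrable_snd[OF int[of 0]] by (simp add: R)
  have "ft R \<xi> = (\<integral>h. (\<integral>y. f y h \<xi> \<partial>lborel) \<partial>lborel)" by (simp add: R ft_def)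
  also have "\<dots> = (\<integral>y. (\<integral>h. f y h \<xi> \<partial>lborel) \<partial>lborel)"
    by (rule lborel_pair.Fubini_integral[OF int])
  also have "\<dots> = (\<integral>y. cnj (k y) * (cis (y * \<xi>) * ft k \<xi>) \<partial>lborel)"
  proof (rule Bochner_Integration.integral_cong)
    fix y
    have "(\<integral>h. f y h \<xi> \<partial>lborel) = cnj (k y) * ft (\<lambda>x. k (x + y)) \<xi>"
      by (simp add: f_def ft_def add.commute)
    then show "(\<integral>h. f y h \<xi> \<partial>lborel) = cnj (k y) * (cis (y * \<xi>) * ft k \<xi>)" by (simp add: ft_shift)
  qed simp
  also have "\<dots> = (\<integral>y. cnj (k y * cis (- (y * \<xi>))) * ft k \<xi> \<partial>lborel)"
    by (simp add: cis_cnj mult.assoc)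
  also have "\<dots> = cnj (ft k \<xi>) * ft k \<xi>"
  proof -
    have "(\<integral>y. cnj (k y * cis (- (y * \<xi>))) \<partial>lborel) = cnj (ft k \<xi>)"
      unfolding ft_def by (rule Bochner_Integration.integral_cnj)
    then show ?thesis by simp
  qed
  finally show "ft R \<xi> = complex_of_real ((norm (ft k \<xi>))\<^sup>2)"
    by (simp only: complex_norm_square mult.commute)
qed

text \<open>Integrating the squared transform against \<open>gauss (\<xi> / c)\<close> equals an
  average of the autocorrelation near 0 at scale 1 / c. Continuity of translations makes the
  autocorrelation continuous at 0, so these averages converge to 2 pi times its value there.\<close>

theorem plancherel_L1_L2:
  assumes k: "integrable lborel k" and k2: "sqint lborel k"
  shows "sqint lborel (ft k)" "nsq lborel (ft k) = 2 * pi * nsq lborel k"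
proof -
  have [measurable]: "k \<in> borel_measurable borel" using k by (auto dest: borel_measurable_integrable)
  define R where "R h = (\<integral>y. k (y + h) * cnj (k y) \<partial>lborel)" for h
  have Ri: "integrable lborel R" and Rft: "ft R \<xi> = complex_of_real ((norm (ft k \<xi>))\<^sup>2)" for \<xi>
    using autocorrelation[OF k] by (auto simp: R_def[abs_def])
  have [measurable]: "R \<in> borel_measurable borel" using Ri by (auto dest: borel_measurable_integrable)
  have kc: "sqint lborel (\<lambda>y. cnj (k y))" "nsq lborel (\<lambda>y. cnj (k y)) = nsq lborel k"
    using k2 by (auto simp: sqint_def nsq_def)
  have R0: "R 0 = complex_of_real (nsq lborel k)"
    by (simp add: R_def nsq_def complex_norm_square[symmetric] flip: of_real_power)
  have Rb: "norm (R h) \<le> nsq lborel k" for h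
    using cauchy_schwarz_prod[OF sqint_shift(1)[OF k2, of h] kc(1)] sqint_shift(2)[OF k2, of h] kc(2)
    by (simp add: R_def)
  have Rlim: "(\<lambda>n. R (h n)) \<longlonglongrightarrow> R 0" if h: "h \<longlonglongrightarrow> 0" for h
  proof (rule LIM_zero_cancel, rule Lim_null_comparison)
    have "R t - R 0 = (\<integral>y. (k (y + t) - k y) * cnj (k y) \<partial>lborel)" for t
      unfolding R_def
      by (subst Bochner_Integration.integral_diff[symmetric])
        (auto intro!: sqint_times_integrable sqint_shift(1)[OF k2] k2 kc simp: left_diff_distrib)
    then have "norm (R t - R 0) \<le> sqrt (nsq lborel (\<lambda>y. k (y + t) - k y)) * sqrt (nsq lborel k)" for t
      using cauchy_schwarz_prod[OF sqint_diff(1)[OF sqint_shift(1)[OF k2] k2] kc(1), of t] kc(2) by simp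
    then show "\<forall>\<^sub>F n in sequentially. norm (R (h n) - R 0) \<le> sqrt (nsq lborel (\<lambda>y. k (y + h n) - k y)) * sqrt (nsq lborel k)"
      by simp
    show "(\<lambda>n. sqrt (nsq lborel (\<lambda>y. k (y + h n) - k y)) * sqrt (nsq lborel k)) \<longlonglongrightarrow> 0"
      using L2_translation_continuous[OF k2 h] by (auto intro!: tendsto_eq_intros)
  qed
  define c where "c n = real (Suc n)" for n
  have c: "c n > 0" for n by (simp add: c_def)
  have c_inv: "(\<lambda>n. z / c n) \<longlonglongrightarrow> 0" for z
  proof -
    have "(\<lambda>n. z * inverse (real (Suc n))) \<longlonglongrightarrow> z * 0" by (intro tendsto_intros LIMSEQ_inverse_real_of_nat)
    then show ?thesis by (simp add: c_def divide_inverse)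
  qed
  define J where "J n = (\<integral>z. R (z / c n) * complex_of_real (sqrt (2 * pi) * gauss z) \<partial>lborel)" for n
  have J: "J n = (\<integral>\<xi>. complex_of_real ((norm (ft k \<xi>))\<^sup>2 * gauss (\<xi> / c n)) \<partial>lborel)" for n
  proof -
    have "(\<integral>\<xi>. complex_of_real ((norm (ft k \<xi>))\<^sup>2 * gauss (\<xi> / c n)) \<partial>lborel)
        = (\<integral>\<xi>. ft R \<xi> * complex_of_real (gauss (\<xi> / c n)) \<partial>lborel)" by (simp add: Rft)
    also have "\<dots> = (\<integral>h. R h * ft (\<lambda>\<xi>. complex_of_real (gauss (\<xi> / c n))) h \<partial>lborel)"
      by (rule ft_multiplication_formula[OF Ri gauss_scaled_integrable[OF c]])
    also have "\<dots> = (\<integral>h. R h * complex_of_real (c n * sqrt (2 * pi) * gauss (c n * h)) \<partial>lborel)"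
      by (simp add: ft_gauss_scaled[OF c])
    also have "\<dots> = \<bar>1 / c n\<bar> *\<^sub>R (\<integral>z. R (0 + (1 / c n) * z) * complex_of_real (c n * sqrt (2 * pi) * gauss (c n * (0 + (1 / c n) * z))) \<partial>lborel)"
      by (rule lborel_integral_real_affine) (use c[of n] in simp)
    also have "\<dots> = J n"
      unfolding J_def integral_scaleR_right[symmetric]
      using c[of n] by (intro Bochner_Integration.integral_cong) (auto simp: scaleR_conv_of_real field_simps)
    finally show ?thesis by simp
  qed
  have "J \<longlonglongrightarrow> (\<integral>z. R 0 * complex_of_real (sqrt (2 * pi) * gauss z) \<partial>lborel)"
    unfolding J_def
  proof (rule integral_dominated_convergence[where w="\<lambda>z. nsq lborel k * (sqrt (2 * pi) * gauss z)"])
    show "integrable lborel (\<lambda>z. nsq lborel k * (sqrt (2 * pi) * gauss z))"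
      using gauss_integrable(1) by simp
    show "AE z in lborel. (\<lambda>n. R (z / c n) * complex_of_real (sqrt (2 * pi) * gauss z)) \<longlonglongrightarrow> R 0 * complex_of_real (sqrt (2 * pi) * gauss z)"
      by (intro AE_I2 tendsto_intros Rlim c_inv)
    show "AE z in lborel. norm (R (z / c n) * complex_of_real (sqrt (2 * pi) * gauss z)) \<le> nsq lborel k * (sqrt (2 * pi) * gauss z)" for n
      using Rb by (intro AE_I2) (auto simp: norm_mult gauss_def intro!: mult_right_mono)
  qed auto
  also have "(\<integral>z. R 0 * complex_of_real (sqrt (2 * pi) * gauss z) \<partial>lborel) = complex_of_real (2 * pi * nsq lborel k)"
    using gauss_integrable(2) by (simp add: R0 flip: of_real_mult)
  finally have Jlim: "J \<longlonglongrightarrow> complex_of_real (2 * pi * nsq lborel k)" .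
  define I where "I n = (\<integral>\<xi>. (norm (ft k \<xi>))\<^sup>2 * gauss (\<xi> / c n) \<partial>lborel)" for n
  have gi: "integrable lborel (\<lambda>\<xi>. (norm (ft k \<xi>))\<^sup>2 * gauss (\<xi> / c n))" for n
    using integrable_Re[OF integrable_ft_times[OF Ri gauss_scaled_integrable[OF c[of n]]]]
    by (simp only: Rft of_real_mult[symmetric] Re_complex_of_real)
  have "J n = complex_of_real (I n)" for n unfolding J I_def by (rule integral_of_real[OF gi])
  then have Ilim: "I \<longlonglongrightarrow> 2 * pi * nsq lborel k"
    using Jlim tendsto_of_real_iff by (metis (no_types, lifting) ext)
  \<comment> \<open>The exponent 1/4 is half of that in \<open>gauss\<close>, so the square of this
    factor is the Gaussian weight. Fatou first yields square integrability of the transform; only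
    then can it dominate in the exact limit.\<close>
  define f where "f n \<xi> = exp (- (\<xi> / c n)\<^sup>2 / 4) *\<^sub>R ft k \<xi>" for n \<xi>
  have fn: "(norm (f n \<xi>))\<^sup>2 = (norm (ft k \<xi>))\<^sup>2 * gauss (\<xi> / c n)" for n \<xi>
    by (simp add: f_def gauss_def power_mult_distrib exp_double[symmetric] mult.commute)
  have fm[measurable]: "f n \<in> borel_measurable lborel" for n unfolding f_def by measurable
  have f2: "sqint lborel (f n)" "nsq lborel (f n) = I n" for n
    unfolding sqint_def nsq_def fn I_def using gi[of n] fm[of n] by (auto simp only:)
  have flim: "AE \<xi> in lborel. (\<lambda>n. f n \<xi>) \<longlonglongrightarrow> ft k \<xi>"
  proof (rule AE_I2)
    fix \<xi>
    have "(\<lambda>n. f n \<xi>) \<longlonglongrightarrow> exp (- 0\<^sup>2 / 4) *\<^sub>R ft k \<xi>"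
      unfolding f_def by (intro tendsto_intros c_inv) auto
    then show "(\<lambda>n. f n \<xi>) \<longlonglongrightarrow> ft k \<xi>" by simp
  qed
  have "\<forall>\<^sub>F n in sequentially. I n < 2 * pi * nsq lborel k + 1"
    by (rule order_tendstoD[OF Ilim]) simp
  then have "\<forall>\<^sub>F n in sequentially. nsq lborel (f n) \<le> 2 * pi * nsq lborel k + 1"
    by eventually_elim (simp add: f2)
  from nsq_fatou(1)[OF f2(1) _ flim this] show 1: "sqint lborel (ft k)" by simp
  have "I \<longlonglongrightarrow> nsq lborel (ft k)"
    unfolding f2(2)[symmetric] nsq_def
  proof (rule integral_dominated_convergence[OF _ _ sqint_integrable[OF 1]])
    show "AE \<xi> in lborel. (\<lambda>n. (norm (f n \<xi>))\<^sup>2) \<longlonglongrightarrow> (norm (ft k \<xi>))\<^sup>2"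
      using flim by eventually_elim (intro tendsto_intros)
    show "AE \<xi> in lborel. norm ((norm (f n \<xi>))\<^sup>2) \<le> (norm (ft k \<xi>))\<^sup>2" for n
      unfolding fn by (intro AE_I2) (auto simp: gauss_def abs_mult intro!: mult_left_le)
  qed measurable
  then show "nsq lborel (ft k) = 2 * pi * nsq lborel k"
    using Ilim LIMSEQ_unique by blast
qed

section \<open>The Fourier transform of square integrable functions\<close>

text \<open>A truncated L^2 function is both integrable and square integrable, so \<open>ft\<close>
  and its Plancherel identity apply; \<open>ft_trunc\<close> identifies its transform with the
  integrals in \<open>is_fourier\<close>.\<close>

definition trunc :: "real \<Rightarrow> (real \<Rightarrow> real) \<Rightarrow> real \<Rightarrow> complex" where
  "trunc R u x = complex_of_real (indicator {-R..R} x * u x)"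

lemma L2fun_sqint: "L2fun u \<longleftrightarrow> sqint lborel u"
  by (simp add: L2fun_def sqint_def)

lemma sqint_of_real:
  fixes u :: "'a \<Rightarrow> real"
  assumes "sqint M u"
  shows "sqint M (\<lambda>x. complex_of_real (u x))" "nsq M (\<lambda>x. complex_of_real (u x)) = nsq M u"
  using assms by (auto simp: sqint_def nsq_def)

lemma sqint_indicator:
  assumes "sqint M f" "A \<in> sets M"
  shows "sqint M (\<lambda>x. indicator A x *\<^sub>R f x)" "nsq M (\<lambda>x. indicator A x *\<^sub>R f x) \<le> nsq M f"
  using assms(2) sqint_measurable[OF assms(1)]
  by (auto intro!: sqint_bound[OF assms(1)] simp: indicator_def)

lemma trunc_props:
  assumes u: "sqint lborel u"
  shows "sqint lborel (trunc R u)" "integrable lborel (trunc R u)"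
proof -
  have [measurable]: "u \<in> borel_measurable lborel" using u by (rule sqint_measurable)
  have 1: "sqint lborel (\<lambda>x. indicator {-R..R} x *\<^sub>R u x)" by (rule sqint_indicator(1)[OF u]) simp
  show "sqint lborel (trunc R u)"
    using sqint_of_real(1)[OF 1] by (simp add: trunc_def[abs_def])
  have 2: "sqint lborel (indicat_real {-R..R})"
    by (auto simp: sqint_def power2_eq_square emeasure_lborel_Icc_eq simp flip: indicator_inter_arith)
  have "integrable lborel (\<lambda>x. indicat_real {-R..R} x * u x)"
    by (rule sqint_times_integrable[OF 2 u])
  then show "integrable lborel (trunc R u)" unfolding trunc_def[abs_def] by (rule integrable_of_real)
qed

lemma ft_trunc: "(LINT x:{-R..R}|lborel. complex_of_real (u x) * cis (- (x * \<xi>))) = ft (trunc R u) \<xi>"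
  unfolding set_lebesgue_integral_def ft_def trunc_def
  by (intro Bochner_Integration.integral_cong) (auto simp: indicator_def)

lemma trunc_tendsto:
  assumes u: "sqint lborel u"
  shows "((\<lambda>R. nsq lborel (\<lambda>x. trunc R u x - complex_of_real (u x))) \<longlongrightarrow> 0) at_top"
proof -
  have [measurable]: "u \<in> borel_measurable lborel" using u by (rule sqint_measurable)
  have [measurable]: "trunc R u \<in> borel_measurable lborel" for R
    using trunc_props(1)[OF u] by (rule sqint_measurable)
  show ?thesis
  proof (rule tendsto_at_topI_sequentially)
    fix X :: "nat \<Rightarrow> real" assume X: "filterlim X at_top sequentially"
    show "(\<lambda>n. nsq lborel (\<lambda>x. trunc (X n) u x - complex_of_real (u x))) \<longlonglongrightarrow> 0"
    proof (rule nsq_tendsto_dominated[OF _ sqint_integrable[OF u]])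
      show "AE x in lborel. (norm (trunc (X n) u x - complex_of_real (u x)))\<^sup>2 \<le> (norm (u x))\<^sup>2" for n
        by (intro AE_I2) (auto simp: trunc_def indicator_def)
      show "AE x in lborel. (\<lambda>n. trunc (X n) u x - complex_of_real (u x)) \<longlonglongrightarrow> 0"
      proof (intro AE_I2 tendsto_eventually)
        fix x :: real
        have "\<forall>\<^sub>F n in sequentially. \<bar>x\<bar> \<le> X n" using X by (auto simp: filterlim_at_top)
        then show "\<forall>\<^sub>F n in sequentially. trunc (X n) u x - complex_of_real (u x) = 0"
          by eventually_elim (auto simp: trunc_def indicator_def)
      qed
    qed measurable
  qed
qed

lemma nsq_ft_trunc_diff:
  assumes u: "sqint lborel u"
  shows "sqint lborel (\<lambda>\<xi>. ft (trunc R u) \<xi> - ft (trunc R' u) \<xi>)"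
    "nsq lborel (\<lambda>\<xi>. ft (trunc R u) \<xi> - ft (trunc R' u) \<xi>)
      = 2 * pi * nsq lborel (\<lambda>x. trunc R u x - trunc R' u x)"
proof -
  have "(\<lambda>\<xi>. ft (trunc R u) \<xi> - ft (trunc R' u) \<xi>) = ft (\<lambda>x. trunc R u x - trunc R' u x)"
    by (intro ext ft_diff[symmetric] trunc_props(2) u)
  then show "sqint lborel (\<lambda>\<xi>. ft (trunc R u) \<xi> - ft (trunc R' u) \<xi>)"
    "nsq lborel (\<lambda>\<xi>. ft (trunc R u) \<xi> - ft (trunc R' u) \<xi>)
      = 2 * pi * nsq lborel (\<lambda>x. trunc R u x - trunc R' u x)"
    using plancherel_L1_L2[OF Bochner_Integration.integrable_diff[OF trunc_props(2)[OF u] trunc_props(2)[OF u]]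
      sqint_diff(1)[OF trunc_props(1)[OF u] trunc_props(1)[OF u]], of R R']
    by simp_all
qed

text \<open>The transforms of truncations are Cauchy by Plancherel. Completeness is applied to
  integer radii, while \<open>is_fourier\<close> asks for the limit along all real radii.\<close>

lemma L2_fourier_exists:
  assumes u: "sqint lborel u"
  obtains v where "sqint lborel v" "((\<lambda>R. nsq lborel (\<lambda>\<xi>. v \<xi> - ft (trunc R u) \<xi>)) \<longlongrightarrow> 0) at_top"
proof -
  define e where "e R = nsq lborel (\<lambda>x. trunc R u x - complex_of_real (u x))" for R
  have e_lim: "(e \<longlongrightarrow> 0) at_top" unfolding e_def by (rule trunc_tendsto[OF u])
  have e0: "e R \<ge> 0" for R by (simp add: e_def)
  note t = trunc_props[OF u] and cu = sqint_of_real(1)[OF u]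
  have dif: "nsq lborel (\<lambda>\<xi>. ft (trunc R u) \<xi> - ft (trunc R' u) \<xi>) \<le> 4 * pi * (e R + e R')" for R R'
  proof -
    have "nsq lborel (\<lambda>x. (trunc R u x - complex_of_real (u x)) - (trunc R' u x - complex_of_real (u x))) \<le> 2 * e R + 2 * e R'"
      unfolding e_def by (intro sqint_diff(2) sqint_diff(1) t cu)
    then show ?thesis by (simp add: nsq_ft_trunc_diff[OF u])
  qed
  have ft2: "sqint lborel (ft (trunc R u))" for R by (rule plancherel_L1_L2[OF t(2) t(1)])
  have en: "(\<lambda>n. e (real n)) \<longlonglongrightarrow> 0"
    by (rule filterlim_compose[OF e_lim filterlim_real_sequentially])
  obtain v r where v: "sqint lborel v" "(\<lambda>n. nsq lborel (\<lambda>x. ft (trunc (real n) u) x - v x)) \<longlonglongrightarrow> 0"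
  proof (rule L2_complete[of lborel "\<lambda>n. ft (trunc (real n) u)", OF ft2])
    fix d :: real assume d: "d > 0"
    then have "\<forall>\<^sub>F n in sequentially. e (real n) < d / (8 * pi)"
      by (intro order_tendstoD(2)[OF en]) simp
    then obtain N where N: "\<And>n. n \<ge> N \<Longrightarrow> e (real n) < d / (8 * pi)" by (auto simp: eventually_sequentially)
    show "\<exists>N. \<forall>m\<ge>N. \<forall>n\<ge>N. nsq lborel (\<lambda>x. ft (trunc (real m) u) x - ft (trunc (real n) u) x) < d"
    proof (intro exI[of _ N] allI impI)
      fix m n assume mn: "N \<le> m" "N \<le> n"
      have "4 * pi * (e m + e n) < 4 * pi * (d / (8 * pi) + d / (8 * pi))"
        by (intro mult_strict_left_mono add_strict_mono N mn) auto
      also have "\<dots> = d" by simp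
      finally show "nsq lborel (\<lambda>x. ft (trunc (real m) u) x - ft (trunc (real n) u) x) < d"
        using dif[of m n] by linarith
    qed
  qed auto
  \<comment> \<open>The triangle inequality passes through an integer radius n, and n tends to
    infinity; what remains depends on R alone.\<close>
  have bound: "nsq lborel (\<lambda>\<xi>. v \<xi> - ft (trunc R u) \<xi>) \<le> 8 * pi * e R" for R
  proof (rule tendsto_lowerbound)
    show "(\<lambda>n. 2 * nsq lborel (\<lambda>x. ft (trunc (real n) u) x - v x) + 2 * (4 * pi * (e R + e (real n)))) \<longlonglongrightarrow> 8 * pi * e R"
      by (auto intro!: tendsto_eq_intros v en)
    have "nsq lborel (\<lambda>\<xi>. (v \<xi> - ft (trunc n u) \<xi>) + (ft (trunc n u) \<xi> - ft (trunc R u) \<xi>))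
      \<le> 2 * nsq lborel (\<lambda>x. v x - ft (trunc n u) x) + 2 * nsq lborel (\<lambda>\<xi>. ft (trunc n u) \<xi> - ft (trunc R u) \<xi>)" for n
      by (intro sqint_add(2) sqint_diff(1) v(1) ft2)
    then have b: "nsq lborel (\<lambda>\<xi>. v \<xi> - ft (trunc R u) \<xi>)
      \<le> 2 * nsq lborel (\<lambda>x. ft (trunc n u) x - v x) + 2 * nsq lborel (\<lambda>\<xi>. ft (trunc n u) \<xi> - ft (trunc R u) \<xi>)" for n
      by (simp only: nsq_swap[of _ v] add_diff_eq diff_add_cancel)
    have "nsq lborel (\<lambda>\<xi>. v \<xi> - ft (trunc R u) \<xi>)
      \<le> 2 * nsq lborel (\<lambda>x. ft (trunc n u) x - v x) + 2 * (4 * pi * (e R + e n))" for n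
      using dif[of n R] b[of n] by (simp only: add.commute[of "e n"])
    then show "\<forall>\<^sub>F n in sequentially. nsq lborel (\<lambda>\<xi>. v \<xi> - ft (trunc R u) \<xi>)
      \<le> 2 * nsq lborel (\<lambda>x. ft (trunc (real n) u) x - v x) + 2 * (4 * pi * (e R + e (real n)))" by simp
  qed simp
  have "((\<lambda>R. nsq lborel (\<lambda>\<xi>. v \<xi> - ft (trunc R u) \<xi>)) \<longlongrightarrow> 0) at_top"
  proof (rule Lim_null_comparison)
    show "\<forall>\<^sub>F R in at_top. norm (nsq lborel (\<lambda>\<xi>. v \<xi> - ft (trunc R u) \<xi>)) \<le> 8 * pi * e R"
      using bound by simp
    show "((\<lambda>R. 8 * pi * e R) \<longlongrightarrow> 0) at_top" by (auto intro!: tendsto_eq_intros e_lim)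
  qed
  then show thesis using that v(1) by blast
qed

text \<open>Existence of a limit makes the choice in \<open>fourier\<close> meaningful.
  \<open>is_fourier\<close> gives only measurability and convergence of extended integrals;
  finiteness of one of them transfers square integrability from a truncated transform.\<close>

lemma fourier_L2:
  assumes u: "sqint lborel u"
  shows "sqint lborel (fourier u)" "((\<lambda>R. nsq lborel (\<lambda>\<xi>. fourier u \<xi> - ft (trunc R u) \<xi>)) \<longlongrightarrow> 0) at_top"
proof -
  have ft2: "sqint lborel (ft (trunc R u))" for R
    by (rule plancherel_L1_L2[OF trunc_props(2)[OF u] trunc_props(1)[OF u]])
  define nn where "nn v R = (\<integral>\<^sup>+\<xi>. ennreal ((cmod (v \<xi> - ft (trunc R u) \<xi>))\<^sup>2) \<partial>lborel)" for v R
  have isf: "is_fourier u v \<longleftrightarrow> v \<in> borel_measurable lborel \<and> (nn v \<longlongrightarrow> 0) at_top" for v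
    unfolding is_fourier_def ft_trunc nn_def ..
  obtain v0 where v0: "sqint lborel v0" "((\<lambda>R. nsq lborel (\<lambda>\<xi>. v0 \<xi> - ft (trunc R u) \<xi>)) \<longlongrightarrow> 0) at_top"
    using L2_fourier_exists[OF u] by blast
  have "nn v0 = (\<lambda>R. ennreal (nsq lborel (\<lambda>\<xi>. v0 \<xi> - ft (trunc R u) \<xi>)))"
    unfolding nn_def by (intro ext sqint_nn_integral sqint_diff v0 ft2)
  then have "(nn v0 \<longlongrightarrow> ennreal 0) at_top" by (simp only: tendsto_ennrealI[OF v0(2)])
  then have "is_fourier u v0"
    unfolding isf using sqint_measurable[OF v0(1)] by simp
  then have "is_fourier u (fourier u)" unfolding fourier_def by (rule someI[of "is_fourier u" v0])
  then have m[measurable]: "fourier u \<in> borel_measurable lborel" and lim: "(nn (fourier u) \<longlongrightarrow> 0) at_top"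
    by (auto simp: isf)
  have [measurable]: "ft (trunc R u) \<in> borel_measurable lborel" for R using ft2 by (rule sqint_measurable)
  have d: "sqint lborel (\<lambda>\<xi>. fourier u \<xi> - ft (trunc R u) \<xi>)" if "nn (fourier u) R < 1" for R
    by (rule sqint_nnI(1)[where C=1]) (use that in \<open>auto simp: nn_def\<close>)
  have ev: "\<forall>\<^sub>F R in at_top. nn (fourier u) R < 1" by (rule order_tendstoD[OF lim]) simp
  then obtain R0 where "nn (fourier u) R0 < 1" by (auto simp: eventually_at_top_linorder)
  then show f: "sqint lborel (fourier u)" using sqint_add(1)[OF d[of R0] ft2[of R0]] by simp
  have "nn (fourier u) = (\<lambda>R. ennreal (nsq lborel (\<lambda>\<xi>. fourier u \<xi> - ft (trunc R u) \<xi>)))"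
    unfolding nn_def by (intro ext sqint_nn_integral sqint_diff f ft2)
  with lim have "((\<lambda>R. ennreal (nsq lborel (\<lambda>\<xi>. fourier u \<xi> - ft (trunc R u) \<xi>))) \<longlongrightarrow> ennreal 0) at_top"
    by simp
  then show "((\<lambda>R. nsq lborel (\<lambda>\<xi>. fourier u \<xi> - ft (trunc R u) \<xi>)) \<longlongrightarrow> 0) at_top"
    by (subst (asm) tendsto_ennreal_iff) auto
qed

lemma sqrt_nsq_diff_le:
  assumes "sqint M f" "sqint M g"
  shows "\<bar>sqrt (nsq M f) - sqrt (nsq M g)\<bar> \<le> sqrt (nsq M (\<lambda>x. f x - g x))"
  using nsq_triangle[OF sqint_diff(1)[OF assms] assms(2)]
    nsq_triangle[OF sqint_diff(1)[OF assms(2,1)] assms(1)] nsq_swap[of M f g]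
  by simp

theorem plancherel:
  assumes u: "sqint lborel u"
  shows "nsq lborel (fourier u) = 2 * pi * nsq lborel u"
proof -
  note t = trunc_props[OF u] and cu = sqint_of_real[OF u]
  have ft2: "sqint lborel (ft (trunc R u))" for R by (rule plancherel_L1_L2[OF t(2) t(1)])
  have "((\<lambda>R. sqrt (nsq lborel (ft (trunc R u)))) \<longlongrightarrow> sqrt (nsq lborel (fourier u))) at_top"
  proof (rule LIM_zero_cancel, rule Lim_null_comparison)
    show "\<forall>\<^sub>F R in at_top. norm (sqrt (nsq lborel (ft (trunc R u))) - sqrt (nsq lborel (fourier u)))
        \<le> sqrt (nsq lborel (\<lambda>\<xi>. fourier u \<xi> - ft (trunc R u) \<xi>))"
      using sqrt_nsq_diff_le[OF ft2 fourier_L2(1)[OF u]] by (simp add: nsq_swap[of _ "fourier u"])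
    show "((\<lambda>R. sqrt (nsq lborel (\<lambda>\<xi>. fourier u \<xi> - ft (trunc R u) \<xi>))) \<longlongrightarrow> 0) at_top"
      using tendsto_real_sqrt[OF fourier_L2(2)[OF u]] by simp
  qed
  moreover have "((\<lambda>R. sqrt (nsq lborel (ft (trunc R u)))) \<longlongrightarrow> sqrt (2 * pi) * sqrt (nsq lborel u)) at_top"
  proof -
    have "((\<lambda>R. sqrt (nsq lborel (trunc R u))) \<longlongrightarrow> sqrt (nsq lborel u)) at_top"
    proof (rule LIM_zero_cancel, rule Lim_null_comparison)
      show "\<forall>\<^sub>F R in at_top. norm (sqrt (nsq lborel (trunc R u)) - sqrt (nsq lborel u))
          \<le> sqrt (nsq lborel (\<lambda>\<xi>. trunc R u \<xi> - complex_of_real (u \<xi>)))"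
        using sqrt_nsq_diff_le[OF t(1) cu(1)] by (simp add: cu(2))
      show "((\<lambda>R. sqrt (nsq lborel (\<lambda>\<xi>. trunc R u \<xi> - complex_of_real (u \<xi>)))) \<longlongrightarrow> 0) at_top"
        using tendsto_real_sqrt[OF trunc_tendsto[OF u]] by simp
    qed
    then have "((\<lambda>R. sqrt (2 * pi) * sqrt (nsq lborel (trunc R u))) \<longlongrightarrow> sqrt (2 * pi) * sqrt (nsq lborel u)) at_top"
      by (rule tendsto_mult_left)
    moreover have "sqrt (nsq lborel (ft (trunc R u))) = sqrt (2 * pi) * sqrt (nsq lborel (trunc R u))" for R
      by (simp only: plancherel_L1_L2(2)[OF t(2) t(1)] real_sqrt_mult)
    ultimately show ?thesis by presburger
  qed
  ultimately have "sqrt (nsq lborel (fourier u)) = sqrt (2 * pi) * sqrt (nsq lborel u)"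
    by (rule tendsto_unique[OF trivial_limit_at_top_linorder])
  then show ?thesis by (simp flip: real_sqrt_mult)
qed

text \<open>Both pairings are continuous in the L^2 norm, so the formula for truncations survives
  the limit. Test functions lie in L^1 and L^2 at once so that \<open>ft g\<close> is a concrete
  square integrable function.\<close>

lemma fourier_dual:
  assumes u: "sqint lborel u" and g: "integrable lborel g" "sqint lborel g"
  shows "(\<integral>\<xi>. fourier u \<xi> * g \<xi> \<partial>lborel) = (\<integral>x. complex_of_real (u x) * ft g x \<partial>lborel)"
proof -
  note t = trunc_props[OF u] and cu = sqint_of_real[OF u]
  have ft2: "sqint lborel (ft (trunc R u))" for R by (rule plancherel_L1_L2[OF t(2) t(1)])
  have g2: "sqint lborel (ft g)" by (rule plancherel_L1_L2[OF g])
  have "((\<lambda>R. \<integral>\<xi>. ft (trunc R u) \<xi> * g \<xi> \<partial>lborel) \<longlongrightarrow> (\<integral>\<xi>. fourier u \<xi> * g \<xi> \<partial>lborel)) at_top"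
  proof (rule LIM_zero_cancel, rule Lim_null_comparison)
    have "norm ((\<integral>\<xi>. ft (trunc R u) \<xi> * g \<xi> \<partial>lborel) - (\<integral>\<xi>. fourier u \<xi> * g \<xi> \<partial>lborel))
      = norm (\<integral>\<xi>. (ft (trunc R u) \<xi> - fourier u \<xi>) * g \<xi> \<partial>lborel)" for R
      by (subst Bochner_Integration.integral_diff[symmetric])
        (auto intro!: sqint_times_integrable ft2 g fourier_L2(1)[OF u] simp: left_diff_distrib)
    then have "norm ((\<integral>\<xi>. ft (trunc R u) \<xi> * g \<xi> \<partial>lborel) - (\<integral>\<xi>. fourier u \<xi> * g \<xi> \<partial>lborel))
      \<le> sqrt (nsq lborel (\<lambda>\<xi>. fourier u \<xi> - ft (trunc R u) \<xi>)) * sqrt (nsq lborel g)" for R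
      using cauchy_schwarz_prod[OF sqint_diff(1)[OF ft2 fourier_L2(1)[OF u]] g(2), of R]
      by (simp add: nsq_swap[of _ "fourier u"])
    then show "\<forall>\<^sub>F R in at_top. norm ((\<integral>\<xi>. ft (trunc R u) \<xi> * g \<xi> \<partial>lborel) - (\<integral>\<xi>. fourier u \<xi> * g \<xi> \<partial>lborel))
      \<le> sqrt (nsq lborel (\<lambda>\<xi>. fourier u \<xi> - ft (trunc R u) \<xi>)) * sqrt (nsq lborel g)" by simp
    show "((\<lambda>R. sqrt (nsq lborel (\<lambda>\<xi>. fourier u \<xi> - ft (trunc R u) \<xi>)) * sqrt (nsq lborel g)) \<longlongrightarrow> 0) at_top"
      using tendsto_mult_left_zero[OF tendsto_real_sqrt[OF fourier_L2(2)[OF u], simplified]] .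
  qed
  moreover have "((\<lambda>R. \<integral>\<xi>. ft (trunc R u) \<xi> * g \<xi> \<partial>lborel) \<longlongrightarrow> (\<integral>x. complex_of_real (u x) * ft g x \<partial>lborel)) at_top"
    unfolding ft_multiplication_formula[OF t(2) g(1)]
  proof (rule LIM_zero_cancel, rule Lim_null_comparison)
    have "norm ((\<integral>x. trunc R u x * ft g x \<partial>lborel) - (\<integral>x. complex_of_real (u x) * ft g x \<partial>lborel))
      = norm (\<integral>x. (trunc R u x - complex_of_real (u x)) * ft g x \<partial>lborel)" for R
      by (subst Bochner_Integration.integral_diff[symmetric])
        (auto intro!: sqint_times_integrable t g2 cu simp: left_diff_distrib)
    then have "norm ((\<integral>x. trunc R u x * ft g x \<partial>lborel) - (\<integral>x. complex_of_real (u x) * ft g x \<partial>lborel))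
      \<le> sqrt (nsq lborel (\<lambda>x. trunc R u x - complex_of_real (u x))) * sqrt (nsq lborel (ft g))" for R
      using cauchy_schwarz_prod[OF sqint_diff(1)[OF t(1) cu(1)] g2, of R] by simp
    then show "\<forall>\<^sub>F R in at_top. norm ((\<integral>x. trunc R u x * ft g x \<partial>lborel) - (\<integral>x. complex_of_real (u x) * ft g x \<partial>lborel))
      \<le> sqrt (nsq lborel (\<lambda>x. trunc R u x - complex_of_real (u x))) * sqrt (nsq lborel (ft g))" by simp
    show "((\<lambda>R. sqrt (nsq lborel (\<lambda>x. trunc R u x - complex_of_real (u x))) * sqrt (nsq lborel (ft g))) \<longlongrightarrow> 0) at_top"
      using tendsto_mult_left_zero[OF tendsto_real_sqrt[OF trunc_tendsto[OF u], simplified]] .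
  qed
  ultimately show ?thesis by (rule tendsto_unique[OF trivial_limit_at_top_linorder])
qed

lemma indicator_Icc_sqint: "sqint lborel (indicat_real {a..b})" "nsq lborel (indicat_real {a..b}) = max 0 (b - a)"
proof -
  have "(norm (indicat_real {a..b} x))\<^sup>2 = indicat_real {a..b} x" for x by (auto simp: indicator_def)
  then show "sqint lborel (indicat_real {a..b})" "nsq lborel (indicat_real {a..b}) = max 0 (b - a)"
    by (auto simp: sqint_def nsq_def emeasure_lborel_Icc_eq max_def)
qed

text \<open>Since the Fourier transform is only defined up to null sets, its functional equations
  are derived from its transpose, which determines it.\<close>

lemma fourier_unique:
  assumes u: "sqint lborel u" and v: "sqint lborel v"
    and dual: "\<And>g. integrable lborel g \<Longrightarrow> sqint lborel g \<Longrightarrow>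
      (\<integral>\<xi>. v \<xi> * g \<xi> \<partial>lborel) = (\<integral>x. complex_of_real (u x) * ft g x \<partial>lborel)"
  shows "AE \<xi> in lborel. fourier u \<xi> = v \<xi>"
proof -
  define w where "w \<xi> = fourier u \<xi> - v \<xi>" for \<xi>
  have w: "sqint lborel w" unfolding w_def by (intro sqint_diff fourier_L2 u v)
  have "AE \<xi> in lborel. indicat_real {-real n..real n} \<xi> *\<^sub>R w \<xi> = 0" for n
  proof -
    \<comment> \<open>The conjugate of w cut off to a bounded interval is an allowed test function,
      and pairing w with it gives the squared norm of w on that interval.\<close>
    define g where "g \<xi> = indicat_real {-real n..real n} \<xi> *\<^sub>R cnj (w \<xi>)" for \<xi>
    have wc: "sqint lborel (\<lambda>\<xi>. cnj (w \<xi>))" using w by (auto simp: sqint_def)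
    have g2: "sqint lborel g" unfolding g_def by (rule sqint_indicator(1)[OF wc]) simp
    have g1: "integrable lborel g"
      unfolding g_def scaleR_conv_of_real
      by (rule sqint_times_integrable[OF sqint_of_real(1)[OF indicator_Icc_sqint(1)] wc])
    have "(\<integral>\<xi>. w \<xi> * g \<xi> \<partial>lborel) = 0"
      unfolding w_def left_diff_distrib
      by (subst Bochner_Integration.integral_diff)
        (auto intro!: sqint_times_integrable fourier_L2 u v g2 simp: dual[OF g1 g2] fourier_dual[OF u g1 g2])
    moreover have "w \<xi> * g \<xi> = complex_of_real ((norm (indicat_real {-real n..real n} \<xi> *\<^sub>R w \<xi>))\<^sup>2)" for \<xi>
      by (auto simp: g_def indicator_def complex_norm_square simp del: of_real_power)
    ultimately have "nsq lborel (\<lambda>\<xi>. indicat_real {-real n..real n} \<xi> *\<^sub>R w \<xi>) = 0"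
      by (simp add: nsq_def del: of_real_power)
    then show ?thesis by (rule nsq_AE_zero[OF sqint_indicator(1)[OF w], rotated]) simp
  qed
  then have "AE \<xi> in lborel. \<forall>n. indicat_real {-real n..real n} \<xi> *\<^sub>R w \<xi> = 0"
    unfolding AE_all_countable by blast
  then show ?thesis
  proof eventually_elim
    case (elim \<xi>)
    obtain n where "\<bar>\<xi>\<bar> \<le> real n" using real_arch_simple by blast
    then show ?case using elim[rule_format, of n] by (auto simp: w_def indicator_def split: if_splits)
  qed
qed

lemma ft_cis_shift: "ft (\<lambda>\<xi>. cis (h * \<xi>) * g \<xi>) x = ft g (x - h)"
  unfolding ft_def
proof (rule Bochner_Integration.integral_cong)
  fix \<xi>
  have "cis (h * \<xi>) * g \<xi> * cis (- (\<xi> * x)) = g \<xi> * (cis (h * \<xi>) * cis (- (\<xi> * x)))"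
    by (simp only: mult_ac)
  also have "cis (h * \<xi>) * cis (- (\<xi> * x)) = cis (- (\<xi> * (x - h)))"
    unfolding cis_mult by (simp add: algebra_simps)
  finally show "cis (h * \<xi>) * g \<xi> * cis (- (\<xi> * x)) = g \<xi> * cis (- (\<xi> * (x - h)))" .
qed simp

text \<open>The values of \<open>fourier\<close> are chosen separately for each function, so even
  linearity is available only almost everywhere.\<close>

lemma fourier_lincomb:
  assumes u: "sqint lborel u" and w: "sqint lborel w"
  shows "AE \<xi> in lborel. fourier (\<lambda>x. a * u x + b * w x) \<xi> = of_real a * fourier u \<xi> + of_real b * fourier w \<xi>"
proof (rule fourier_unique)
  fix g :: "real \<Rightarrow> complex" assume g: "integrable lborel g" "sqint lborel g"
  have g2: "sqint lborel (ft g)" by (rule plancherel_L1_L2[OF g])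
  have "(\<integral>\<xi>. (of_real a * fourier u \<xi> + of_real b * fourier w \<xi>) * g \<xi> \<partial>lborel)
    = of_real a * (\<integral>\<xi>. fourier u \<xi> * g \<xi> \<partial>lborel) + of_real b * (\<integral>\<xi>. fourier w \<xi> * g \<xi> \<partial>lborel)"
    by (simp add: distrib_right mult.assoc sqint_times_integrable fourier_L2 u w g)
  also have "\<dots> = of_real a * (\<integral>x. complex_of_real (u x) * ft g x \<partial>lborel) + of_real b * (\<integral>x. complex_of_real (w x) * ft g x \<partial>lborel)"
    by (simp add: fourier_dual u w g)
  also have "\<dots> = (\<integral>x. complex_of_real (a * u x + b * w x) * ft g x \<partial>lborel)"
    by (simp add: distrib_right mult.assoc sqint_times_integrable sqint_of_real u w g2)
  finally show "(\<integral>\<xi>. (of_real a * fourier u \<xi> + of_real b * fourier w \<xi>) * g \<xi> \<partial>lborel)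
    = (\<integral>x. complex_of_real (a * u x + b * w x) * ft g x \<partial>lborel)" .
qed (intro sqint_add sqint_mult_left fourier_L2 u w)+

lemma fourier_shift:
  assumes u: "sqint lborel u"
  shows "AE \<xi> in lborel. fourier (\<lambda>x. u (x + h)) \<xi> = cis (h * \<xi>) * fourier u \<xi>"
proof (rule fourier_unique)
  show "sqint lborel (\<lambda>x. u (x + h))" by (rule sqint_shift(1)[OF u])
  have [measurable]: "fourier u \<in> borel_measurable lborel" by (rule sqint_measurable[OF fourier_L2(1)[OF u]])
  show "sqint lborel (\<lambda>\<xi>. cis (h * \<xi>) * fourier u \<xi>)"
    by (rule sqint_bound(1)[OF fourier_L2(1)[OF u]]) (auto simp: norm_mult)
  fix g :: "real \<Rightarrow> complex" assume g: "integrable lborel g" "sqint lborel g"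
  have [measurable]: "g \<in> borel_measurable lborel" by (rule sqint_measurable[OF g(2)])
  have cg: "integrable lborel (\<lambda>\<xi>. cis (h * \<xi>) * g \<xi>)"
    by (subst mult.commute) (intro integrable_times_cis g(1), simp)
  have cg2: "sqint lborel (\<lambda>\<xi>. cis (h * \<xi>) * g \<xi>)" by (rule sqint_bound(1)[OF g(2)]) (auto simp: norm_mult)
  have "(\<integral>\<xi>. cis (h * \<xi>) * fourier u \<xi> * g \<xi> \<partial>lborel) = (\<integral>\<xi>. fourier u \<xi> * (cis (h * \<xi>) * g \<xi>) \<partial>lborel)"
    by (simp add: algebra_simps)
  also have "\<dots> = (\<integral>x. complex_of_real (u x) * ft g (x - h) \<partial>lborel)"
    by (simp add: fourier_dual[OF u cg cg2] ft_cis_shift)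
  also have "\<dots> = (\<integral>x. complex_of_real (u (x + h)) * ft g x \<partial>lborel)"
    using lborel_integral_real_affine[of 1 "\<lambda>x. complex_of_real (u x) * ft g (x - h)" h] by (simp add: add.commute)
  finally show "(\<integral>\<xi>. cis (h * \<xi>) * fourier u \<xi> * g \<xi> \<partial>lborel) = (\<integral>x. complex_of_real (u (x + h)) * ft g x \<partial>lborel)" .
qed

lemma sqint_dilate:
  fixes k :: "real \<Rightarrow> 'b::{banach,second_countable_topology}"
  assumes k: "sqint lborel k" and c: "c > 0"
  shows "sqint lborel (\<lambda>x. k (c * x))" "nsq lborel (\<lambda>x. k (c * x)) = nsq lborel k / c"
  using lborel_integrable_real_affine[of "\<lambda>x. (norm (k x))\<^sup>2" c 0]
    lborel_integral_real_affine[of c "\<lambda>x. (norm (k x))\<^sup>2" 0] assms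
  by (auto simp: sqint_def nsq_def)

lemma fourier_dilate:
  assumes u: "sqint lborel u" and c: "c > 0"
  shows "AE \<xi> in lborel. fourier (\<lambda>x. u (c * x)) \<xi> = of_real (1 / c) * fourier u (\<xi> / c)"
proof (rule fourier_unique)
  show "sqint lborel (\<lambda>x. u (c * x))" by (rule sqint_dilate(1)[OF u c])
  show "sqint lborel (\<lambda>\<xi>. of_real (1 / c) * fourier u (\<xi> / c))"
    using sqint_dilate(1)[OF fourier_L2(1)[OF u], of "1/c"] c by (intro sqint_mult_left) simp
  fix g :: "real \<Rightarrow> complex" assume g: "integrable lborel g" "sqint lborel g"
  have cg: "integrable lborel (\<lambda>\<xi>. g (c * \<xi>))" "sqint lborel (\<lambda>\<xi>. g (c * \<xi>))"
    using lborel_integrable_real_affine[OF g(1), of c 0] sqint_dilate(1)[OF g(2) c] c by auto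
  have ftg: "ft (\<lambda>\<xi>. g (c * \<xi>)) x = of_real (1 / c) * ft g (x / c)" for x
    unfolding ft_def
    using lborel_integral_real_affine[of c "\<lambda>\<xi>. g \<xi> * cis (- (\<xi> * (x / c)))" 0] c
    by (simp add: scaleR_conv_of_real mult.commute mult.left_commute)
  have "(\<integral>\<xi>. of_real (1 / c) * fourier u (\<xi> / c) * g \<xi> \<partial>lborel) = (\<integral>\<xi>. fourier u \<xi> * g (c * \<xi>) \<partial>lborel)"
    using lborel_integral_real_affine[of c "\<lambda>\<xi>. of_real (1 / c) * fourier u (\<xi> / c) * g \<xi>" 0] c
    by (simp add: scaleR_conv_of_real)
  also have "\<dots> = (\<integral>x. complex_of_real (u x) * (of_real (1 / c) * ft g (x / c)) \<partial>lborel)"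
    by (simp add: fourier_dual[OF u cg] ftg)
  also have "\<dots> = (\<integral>x. complex_of_real (u (c * x)) * ft g x \<partial>lborel)"
    using lborel_integral_real_affine[of c "\<lambda>x. complex_of_real (u x) * (of_real (1 / c) * ft g (x / c))" 0] c
    by (simp add: scaleR_conv_of_real)
  finally show "(\<integral>\<xi>. of_real (1 / c) * fourier u (\<xi> / c) * g \<xi> \<partial>lborel) = (\<integral>x. complex_of_real (u (c * x)) * ft g x \<partial>lborel)" .
qed

section \<open>Quadratic forms given by Fourier multipliers\<close>

text \<open>The bilinear form of the Fourier multiplier with symbol m; the prefactor makes m = 1
  give the L^2 inner product, see \<open>mform_one\<close>.\<close>

definition mform :: "(real \<Rightarrow> real) \<Rightarrow> (real \<Rightarrow> real) \<Rightarrow> (real \<Rightarrow> real) \<Rightarrow> real" where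
  "mform m u w = (1 / (2 * pi)) * (\<integral>\<xi>. m \<xi> * Re (fourier u \<xi> * cnj (fourier w \<xi>)) \<partial>lborel)"

definition mfin :: "(real \<Rightarrow> real) \<Rightarrow> (real \<Rightarrow> real) \<Rightarrow> bool" where
  "mfin m u \<longleftrightarrow> sqint lborel u \<and> integrable lborel (\<lambda>\<xi>. m \<xi> * (cmod (fourier u \<xi>))\<^sup>2)"

definition mult_ok :: "(real \<Rightarrow> real) \<Rightarrow> bool" where
  "mult_ok m \<longleftrightarrow> m \<in> borel_measurable borel \<and> (\<forall>\<xi>. 0 \<le> m \<xi>)"

lemma half_form_mform: "half_form u w = mform (\<lambda>\<xi>. \<bar>\<xi>\<bar>) u w"
  by (simp add: half_form_def mform_def)

lemma inv_form_mform: "inv_form u w = mform (\<lambda>\<xi>. 1 / \<xi>\<^sup>2) u w"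
  by (simp add: inv_form_def mform_def)

lemma fourier_measurable:
  assumes "sqint lborel u"
  shows "fourier u \<in> borel_measurable borel"
  using sqint_measurable[OF fourier_L2(1)[OF assms]] by simp

lemma abs_Re_mult_cnj_le: "\<bar>Re (a * cnj b)\<bar> \<le> (cmod a)\<^sup>2 + (cmod b)\<^sup>2"
proof -
  have "\<bar>Re (a * cnj b)\<bar> \<le> cmod a * cmod b" using abs_Re_le_cmod[of "a * cnj b"] by (simp add: norm_mult)
  then show ?thesis
    using sum_squares_bound[of "cmod a" "cmod b"] mult_nonneg_nonneg[OF norm_ge_zero norm_ge_zero, of a b] by linarith
qed

lemma mform_integrable:
  assumes m: "mult_ok m" and u: "mfin m u" and w: "mfin m w"
  shows "integrable lborel (\<lambda>\<xi>. m \<xi> * Re (fourier u \<xi> * cnj (fourier w \<xi>)))"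
proof (rule Bochner_Integration.integrable_bound)
  have [measurable]: "m \<in> borel_measurable borel" "fourier u \<in> borel_measurable borel" "fourier w \<in> borel_measurable borel"
    using m u w by (auto simp: mult_ok_def mfin_def intro: fourier_measurable)
  show "integrable lborel (\<lambda>\<xi>. m \<xi> * (cmod (fourier u \<xi>))\<^sup>2 + m \<xi> * (cmod (fourier w \<xi>))\<^sup>2)"
    using u w by (auto simp: mfin_def)
  show "(\<lambda>\<xi>. m \<xi> * Re (fourier u \<xi> * cnj (fourier w \<xi>))) \<in> borel_measurable lborel"
    by measurable
  have "\<bar>m \<xi> * Re (fourier u \<xi> * cnj (fourier w \<xi>))\<bar> \<le> m \<xi> * (cmod (fourier u \<xi>))\<^sup>2 + m \<xi> * (cmod (fourier w \<xi>))\<^sup>2" for \<xi>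
  proof -
    have m0: "m \<xi> \<ge> 0" using m by (simp add: mult_ok_def)
    have "\<bar>m \<xi> * Re (fourier u \<xi> * cnj (fourier w \<xi>))\<bar> = m \<xi> * \<bar>Re (fourier u \<xi> * cnj (fourier w \<xi>))\<bar>"
      by (simp only: abs_mult abs_of_nonneg[OF m0])
    then show ?thesis
      using mult_left_mono[OF abs_Re_mult_cnj_le[of "fourier u \<xi>" "fourier w \<xi>"] m0] by (simp only: distrib_left)
  qed
  then show "AE \<xi> in lborel. norm (m \<xi> * Re (fourier u \<xi> * cnj (fourier w \<xi>)))
      \<le> norm (m \<xi> * (cmod (fourier u \<xi>))\<^sup>2 + m \<xi> * (cmod (fourier w \<xi>))\<^sup>2)"
    unfolding real_norm_def by (intro AE_I2 order_trans[OF _ abs_ge_self])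
qed

lemma mform_sym: "mform m u w = mform m w u"
proof -
  have "Re (a * cnj b) = Re (b * cnj a)" for a b by (simp add: mult.commute)
  then have "(\<lambda>\<xi>. m \<xi> * Re (fourier u \<xi> * cnj (fourier w \<xi>))) = (\<lambda>\<xi>. m \<xi> * Re (fourier w \<xi> * cnj (fourier u \<xi>)))"
    by (intro ext arg_cong2[where f="(*)"] refl)
  then show ?thesis unfolding mform_def by (simp only:)
qed

lemma mform_diag: "mform m u u = (1 / (2 * pi)) * (\<integral>\<xi>. m \<xi> * (cmod (fourier u \<xi>))\<^sup>2 \<partial>lborel)"
proof -
  have "Re (a * cnj a) = (cmod a)\<^sup>2" for a
    unfolding complex_norm_square[symmetric] by (rule Re_complex_of_real)
  then show ?thesis unfolding mform_def by (simp only:)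
qed

lemma mform_nonneg: "mult_ok m \<Longrightarrow> 0 \<le> mform m u u"
  unfolding mform_diag by (auto simp: mult_ok_def)

lemma mfin_lincomb:
  assumes m: "mult_ok m" and u: "mfin m u" and w: "mfin m w"
  shows "mfin m (\<lambda>x. a * u x + b * w x)"
proof -
  have u2: "sqint lborel u" and w2: "sqint lborel w" using u w by (auto simp: mfin_def)
  have l2: "sqint lborel (\<lambda>x. a * u x + b * w x)" by (intro sqint_add sqint_mult_left u2 w2)
  have [measurable]: "m \<in> borel_measurable borel" "fourier (\<lambda>x. a * u x + b * w x) \<in> borel_measurable borel"
    using m l2 by (auto simp: mult_ok_def intro: fourier_measurable)
  have "integrable lborel (\<lambda>\<xi>. m \<xi> * (cmod (fourier (\<lambda>x. a * u x + b * w x) \<xi>))\<^sup>2)"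
  proof (rule Bochner_Integration.integrable_bound)
    show "integrable lborel (\<lambda>\<xi>. 2 * a\<^sup>2 * (m \<xi> * (cmod (fourier u \<xi>))\<^sup>2) + 2 * b\<^sup>2 * (m \<xi> * (cmod (fourier w \<xi>))\<^sup>2))"
      using u w by (auto simp: mfin_def)
    show "AE \<xi> in lborel. norm (m \<xi> * (cmod (fourier (\<lambda>x. a * u x + b * w x) \<xi>))\<^sup>2)
      \<le> norm (2 * a\<^sup>2 * (m \<xi> * (cmod (fourier u \<xi>))\<^sup>2) + 2 * b\<^sup>2 * (m \<xi> * (cmod (fourier w \<xi>))\<^sup>2))"
      using fourier_lincomb[OF u2 w2, of a b]
    proof eventually_elim
      case (elim \<xi>)
      have m0: "m \<xi> \<ge> 0" using m by (simp add: mult_ok_def)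
      have "(cmod (fourier (\<lambda>x. a * u x + b * w x) \<xi>))\<^sup>2 \<le> 2 * a\<^sup>2 * (cmod (fourier u \<xi>))\<^sup>2 + 2 * b\<^sup>2 * (cmod (fourier w \<xi>))\<^sup>2"
        using norm_add_sq_le[of "of_real a * fourier u \<xi>" "of_real b * fourier w \<xi>"]
        by (simp add: elim norm_mult power_mult_distrib)
      from mult_left_mono[OF this m0] m0 show ?case by (simp add: distrib_left mult_ac)
    qed
  qed measurable
  then show ?thesis using l2 by (simp add: mfin_def)
qed

lemma mform_lincomb_left:
  assumes m: "mult_ok m" and u: "mfin m u" and v: "mfin m v" and w: "mfin m w"
  shows "mform m (\<lambda>x. a * u x + b * v x) w = a * mform m u w + b * mform m v w"
proof -
  have u2: "sqint lborel u" and v2: "sqint lborel v" and w2: "sqint lborel w" using u v w by (auto simp: mfin_def)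
  have l2: "sqint lborel (\<lambda>x. a * u x + b * v x)" by (intro sqint_add sqint_mult_left u2 v2)
  have [measurable]: "m \<in> borel_measurable borel" "fourier (\<lambda>x. a * u x + b * v x) \<in> borel_measurable borel"
    "fourier u \<in> borel_measurable borel" "fourier v \<in> borel_measurable borel" "fourier w \<in> borel_measurable borel"
    using m u2 v2 w2 l2 by (auto simp: mult_ok_def intro: fourier_measurable)
  have "(\<integral>\<xi>. m \<xi> * Re (fourier (\<lambda>x. a * u x + b * v x) \<xi> * cnj (fourier w \<xi>)) \<partial>lborel)
    = (\<integral>\<xi>. a * (m \<xi> * Re (fourier u \<xi> * cnj (fourier w \<xi>))) + b * (m \<xi> * Re (fourier v \<xi> * cnj (fourier w \<xi>))) \<partial>lborel)"
  proof (rule integral_cong_AE)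
    show "AE \<xi> in lborel. m \<xi> * Re (fourier (\<lambda>x. a * u x + b * v x) \<xi> * cnj (fourier w \<xi>))
       = a * (m \<xi> * Re (fourier u \<xi> * cnj (fourier w \<xi>))) + b * (m \<xi> * Re (fourier v \<xi> * cnj (fourier w \<xi>)))"
      using fourier_lincomb[OF u2 v2, of a b] by eventually_elim (simp add: algebra_simps)
  qed measurable
  also have "\<dots> = a * (\<integral>\<xi>. m \<xi> * Re (fourier u \<xi> * cnj (fourier w \<xi>)) \<partial>lborel)
      + b * (\<integral>\<xi>. m \<xi> * Re (fourier v \<xi> * cnj (fourier w \<xi>)) \<partial>lborel)"
    using mform_integrable[OF m u w] mform_integrable[OF m v w]
    by (subst Bochner_Integration.integral_add) (auto simp del: times_complex.sel)
  finally show ?thesis by (simp add: mform_def distrib_left mult.left_commute del: times_complex.sel)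
qed

lemma mform_lincomb_diag:
  assumes m: "mult_ok m" and u: "mfin m u" and v: "mfin m v"
  shows "mform m (\<lambda>x. a * u x + b * v x) (\<lambda>x. a * u x + b * v x)
    = a\<^sup>2 * mform m u u + 2 * a * b * mform m u v + b\<^sup>2 * mform m v v"
  using mform_lincomb_left[OF m u v mfin_lincomb[OF m u v], of a b a b]
    mform_lincomb_left[OF m u v u, of a b] mform_lincomb_left[OF m u v v, of a b]
    mform_sym[of m u "\<lambda>x. a * u x + b * v x"] mform_sym[of m v "\<lambda>x. a * u x + b * v x"] mform_sym[of m v u]
  by (simp add: algebra_simps power2_eq_square)

lemma mfin_shift:
  assumes m: "mult_ok m" and u: "mfin m u"
  shows "mfin m (\<lambda>x. u (x + h))" "mform m (\<lambda>x. u (x + h)) (\<lambda>x. u (x + h)) = mform m u u"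
proof -
  have u2: "sqint lborel u" using u by (simp add: mfin_def)
  have s2: "sqint lborel (\<lambda>x. u (x + h))" by (rule sqint_shift(1)[OF u2])
  have [measurable]: "m \<in> borel_measurable borel" "fourier u \<in> borel_measurable borel" "fourier (\<lambda>x. u (x + h)) \<in> borel_measurable borel"
    using m u2 s2 by (auto simp: mult_ok_def intro: fourier_measurable)
  have ae: "AE \<xi> in lborel. m \<xi> * (cmod (fourier (\<lambda>x. u (x + h)) \<xi>))\<^sup>2 = m \<xi> * (cmod (fourier u \<xi>))\<^sup>2"
    using fourier_shift[OF u2, of h] by eventually_elim (simp add: norm_mult)
  have "integrable lborel (\<lambda>\<xi>. m \<xi> * (cmod (fourier (\<lambda>x. u (x + h)) \<xi>))\<^sup>2)"
    using u by (subst integrable_cong_AE[OF _ _ ae]) (auto simp: mfin_def)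
  then show "mfin m (\<lambda>x. u (x + h))" using s2 by (simp add: mfin_def)
  show "mform m (\<lambda>x. u (x + h)) (\<lambda>x. u (x + h)) = mform m u u"
    unfolding mform_diag by (subst integral_cong_AE[OF _ _ ae]) auto
qed

lemma mfin_dilate:
  assumes m: "mult_ok m" and c: "c > 0" and u: "sqint lborel u"
  shows "mfin m (\<lambda>x. u (c * x)) \<longleftrightarrow> mfin (\<lambda>\<xi>. m (c * \<xi>)) u"
    "mform m (\<lambda>x. u (c * x)) (\<lambda>x. u (c * x)) = mform (\<lambda>\<xi>. m (c * \<xi>)) u u / c"
proof -
  have s2: "sqint lborel (\<lambda>x. u (c * x))" by (rule sqint_dilate(1)[OF u c])
  have [measurable]: "m \<in> borel_measurable borel" "fourier u \<in> borel_measurable borel" "fourier (\<lambda>x. u (c * x)) \<in> borel_measurable borel"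
    using m u s2 by (auto simp: mult_ok_def intro: fourier_measurable)
  let ?F = "\<lambda>\<xi>. m \<xi> * (cmod (of_real (1 / c) * fourier u (\<xi> / c)))\<^sup>2"
  have ae: "AE \<xi> in lborel. m \<xi> * (cmod (fourier (\<lambda>x. u (c * x)) \<xi>))\<^sup>2 = ?F \<xi>"
    using fourier_dilate[OF u c] by eventually_elim simp
  have F: "?F (0 + c * \<xi>) = (1 / c\<^sup>2) * (m (c * \<xi>) * (cmod (fourier u \<xi>))\<^sup>2)" for \<xi>
    using c by (simp add: norm_mult norm_divide power_divide)
  have "integrable lborel (\<lambda>\<xi>. m \<xi> * (cmod (fourier (\<lambda>x. u (c * x)) \<xi>))\<^sup>2) \<longleftrightarrow> integrable lborel ?F"
    by (intro integrable_cong_AE ae) measurable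
  also have "\<dots> \<longleftrightarrow> integrable lborel (\<lambda>\<xi>. ?F (0 + c * \<xi>))"
    using c by (intro lborel_integrable_real_affine_iff[symmetric]) simp
  also have "\<dots> \<longleftrightarrow> integrable lborel (\<lambda>\<xi>. m (c * \<xi>) * (cmod (fourier u \<xi>))\<^sup>2)"
    unfolding F
  proof
    assume "integrable lborel (\<lambda>\<xi>. 1 / c\<^sup>2 * (m (c * \<xi>) * (cmod (fourier u \<xi>))\<^sup>2))"
    then have "integrable lborel (\<lambda>\<xi>. c\<^sup>2 * (1 / c\<^sup>2 * (m (c * \<xi>) * (cmod (fourier u \<xi>))\<^sup>2)))" by (rule integrable_mult_right)
    moreover have "(\<lambda>\<xi>. c\<^sup>2 * (1 / c\<^sup>2 * (m (c * \<xi>) * (cmod (fourier u \<xi>))\<^sup>2))) = (\<lambda>\<xi>. m (c * \<xi>) * (cmod (fourier u \<xi>))\<^sup>2)"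
      using c by (intro ext) simp
    ultimately show "integrable lborel (\<lambda>\<xi>. m (c * \<xi>) * (cmod (fourier u \<xi>))\<^sup>2)" by (simp only:)
  qed (rule integrable_mult_right)
  finally show "mfin m (\<lambda>x. u (c * x)) \<longleftrightarrow> mfin (\<lambda>\<xi>. m (c * \<xi>)) u"
    using s2 u by (simp add: mfin_def)
  have "(\<integral>\<xi>. m \<xi> * (cmod (fourier (\<lambda>x. u (c * x)) \<xi>))\<^sup>2 \<partial>lborel) = (\<integral>\<xi>. ?F \<xi> \<partial>lborel)"
    by (intro integral_cong_AE ae) measurable
  also have "\<dots> = \<bar>c\<bar> *\<^sub>R (\<integral>\<xi>. ?F (0 + c * \<xi>) \<partial>lborel)"
    using c by (intro lborel_integral_real_affine) simp
  also have "\<dots> = (\<integral>\<xi>. m (c * \<xi>) * (cmod (fourier u \<xi>))\<^sup>2 \<partial>lborel) / c"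
    unfolding F using c by (simp add: power2_eq_square)
  finally show "mform m (\<lambda>x. u (c * x)) (\<lambda>x. u (c * x)) = mform (\<lambda>\<xi>. m (c * \<xi>)) u u / c"
    unfolding mform_diag by simp
qed

lemma mfin_one: "mfin (\<lambda>\<xi>. 1) u \<longleftrightarrow> sqint lborel u"
  using sqint_integrable[OF fourier_L2(1)[of u]] by (auto simp: mfin_def)

lemma mform_one_diag:
  assumes "sqint lborel u"
  shows "mform (\<lambda>\<xi>. 1) u u = (\<integral>x. (u x)\<^sup>2 \<partial>lborel)"
  using plancherel[OF assms] unfolding mform_diag by (simp add: nsq_def)

text \<open>Polarization of Plancherel's identity, applied to the sum of u and w.\<close>

lemma mform_one:
  assumes u: "sqint lborel u" and w: "sqint lborel w"
  shows "mform (\<lambda>\<xi>. 1) u w = (\<integral>x. u x * w x \<partial>lborel)"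
proof -
  have m: "mult_ok (\<lambda>\<xi>. 1)" by (simp add: mult_ok_def)
  have s: "sqint lborel (\<lambda>x. 1 * u x + 1 * w x)" by (intro sqint_add sqint_mult_left u w)
  have "(\<integral>x. (1 * u x + 1 * w x)\<^sup>2 \<partial>lborel) = (\<integral>x. (u x)\<^sup>2 + 2 * (u x * w x) + (w x)\<^sup>2 \<partial>lborel)"
    by (intro Bochner_Integration.integral_cong) (auto simp: power2_sum)
  also have "\<dots> = (\<integral>x. (u x)\<^sup>2 \<partial>lborel) + 2 * (\<integral>x. u x * w x \<partial>lborel) + (\<integral>x. (w x)\<^sup>2 \<partial>lborel)"
    using sqint_integrable[OF u] sqint_integrable[OF w] sqint_times_integrable[OF u w] by simp
  finally show ?thesis
    using mform_lincomb_diag[OF m, of u w 1 1] u w mform_one_diag[OF s]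
    by (simp add: mfin_one mform_one_diag)
qed

lemma mform_add_mult:
  assumes m: "mult_ok m" "mult_ok n" and u: "mfin m u" "mfin n u" and w: "mfin m w" "mfin n w" and ab: "a \<ge> 0" "b \<ge> 0"
  shows "mult_ok (\<lambda>\<xi>. a * m \<xi> + b * n \<xi>)" "mfin (\<lambda>\<xi>. a * m \<xi> + b * n \<xi>) u"
    "mform (\<lambda>\<xi>. a * m \<xi> + b * n \<xi>) u w = a * mform m u w + b * mform n u w"
proof -
  show "mult_ok (\<lambda>\<xi>. a * m \<xi> + b * n \<xi>)" using m ab by (auto simp: mult_ok_def)
  show "mfin (\<lambda>\<xi>. a * m \<xi> + b * n \<xi>) u"
    using u by (auto simp: mfin_def distrib_right mult.assoc)
  have "(\<integral>\<xi>. (a * m \<xi> + b * n \<xi>) * Re (fourier u \<xi> * cnj (fourier w \<xi>)) \<partial>lborel)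
     = a * (\<integral>\<xi>. m \<xi> * Re (fourier u \<xi> * cnj (fourier w \<xi>)) \<partial>lborel) + b * (\<integral>\<xi>. n \<xi> * Re (fourier u \<xi> * cnj (fourier w \<xi>)) \<partial>lborel)"
    using mform_integrable[OF m(1) u(1) w(1)] mform_integrable[OF m(2) u(2) w(2)]
    by (simp add: distrib_right mult.assoc del: times_complex.sel)
  then show "mform (\<lambda>\<xi>. a * m \<xi> + b * n \<xi>) u w = a * mform m u w + b * mform n u w"
    by (simp add: mform_def distrib_left mult.left_commute del: times_complex.sel)
qed

text \<open>At the origin \<open>1 / \<xi>\<^sup>2\<close> is 0 by the convention for division; a
  single point affects no integral.\<close>

lemma mult_ok_basic: "mult_ok (\<lambda>\<xi>. \<bar>\<xi>\<bar>)" "mult_ok (\<lambda>\<xi>. 1 / \<xi>\<^sup>2)" "mult_ok (\<lambda>\<xi>. 1)"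
  by (auto simp: mult_ok_def)

lemma nn_integrable_iff:
  assumes "g \<in> borel_measurable M" "\<And>x. 0 \<le> g x"
  shows "(\<integral>\<^sup>+x. ennreal (g x) \<partial>M) < \<infinity> \<longleftrightarrow> integrable M (g :: _ \<Rightarrow> real)"
  using assms by (auto simp: integrable_iff_bounded)

text \<open>Plancherel takes care of the summand 1 in the weight 1 + |xi|, so membership splits into
  two conditions of the same kind, to which the lemmas on multipliers apply.\<close>

lemma in_X_iff: "in_X u \<longleftrightarrow> mfin (\<lambda>\<xi>. \<bar>\<xi>\<bar>) u \<and> mfin (\<lambda>\<xi>. 1 / \<xi>\<^sup>2) u"
proof (cases "sqint lborel u")
  case True
  have [measurable]: "fourier u \<in> borel_measurable borel" by (rule fourier_measurable[OF True])
  have "integrable lborel (\<lambda>\<xi>. (1 + \<bar>\<xi>\<bar>) * (cmod (fourier u \<xi>))\<^sup>2) \<longleftrightarrow> integrable lborel (\<lambda>\<xi>. \<bar>\<xi>\<bar> * (cmod (fourier u \<xi>))\<^sup>2)"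
  proof
    assume "integrable lborel (\<lambda>\<xi>. (1 + \<bar>\<xi>\<bar>) * (cmod (fourier u \<xi>))\<^sup>2)"
    then have "integrable lborel (\<lambda>\<xi>. (1 + \<bar>\<xi>\<bar>) * (cmod (fourier u \<xi>))\<^sup>2 - (cmod (fourier u \<xi>))\<^sup>2)"
      using sqint_integrable[OF fourier_L2(1)[OF True]] by (intro Bochner_Integration.integrable_diff) auto
    then show "integrable lborel (\<lambda>\<xi>. \<bar>\<xi>\<bar> * (cmod (fourier u \<xi>))\<^sup>2)" by (simp add: distrib_right)
  next
    assume "integrable lborel (\<lambda>\<xi>. \<bar>\<xi>\<bar> * (cmod (fourier u \<xi>))\<^sup>2)"
    then show "integrable lborel (\<lambda>\<xi>. (1 + \<bar>\<xi>\<bar>) * (cmod (fourier u \<xi>))\<^sup>2)"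
      using sqint_integrable[OF fourier_L2(1)[OF True]] by (simp add: distrib_right)
  qed
  then show ?thesis
    using True unfolding in_X_def mfin_def L2fun_sqint by (subst (1 2) nn_integrable_iff) (auto simp: mult_nonneg_nonneg)
qed (auto simp: in_X_def mfin_def L2fun_sqint)

lemma in_X_sqint: "in_X u \<Longrightarrow> sqint lborel u"
  by (simp add: in_X_iff mfin_def)

lemma in_X_lincomb: "in_X u \<Longrightarrow> in_X w \<Longrightarrow> in_X (\<lambda>x. a * u x + b * w x)"
  by (auto simp: in_X_iff mfin_lincomb mult_ok_basic)

lemma in_X_scale: "in_X u \<Longrightarrow> in_X (\<lambda>x. a * u x)"
  using in_X_lincomb[of u u a 0] by simp

lemma in_X_add: "in_X u \<Longrightarrow> in_X w \<Longrightarrow> in_X (\<lambda>x. u x + w x)"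
  using in_X_lincomb[of u w 1 1] by simp

lemma in_X_diff: "in_X u \<Longrightarrow> in_X w \<Longrightarrow> in_X (\<lambda>x. u x - w x)"
  using in_X_lincomb[of u w 1 "-1"] by simp

lemma in_X_shift: "in_X u \<Longrightarrow> in_X (\<lambda>x. u (x + h))"
  by (auto simp: in_X_iff mfin_shift mult_ok_basic)

text \<open>The total symbol; \<open>s\<close> stands for \<open>-c > 0\<close>.\<close>

definition wt :: "real \<Rightarrow> real \<Rightarrow> real \<Rightarrow> real \<Rightarrow> real" where
  "wt \<beta> s \<gamma> \<xi> = 1 * (\<beta> * \<bar>\<xi>\<bar> + s * 1) + \<gamma> * (1 / \<xi>\<^sup>2)"

abbreviation Bform :: "real \<Rightarrow> real \<Rightarrow> real \<Rightarrow> (real \<Rightarrow> real) \<Rightarrow> (real \<Rightarrow> real) \<Rightarrow> real" where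
  "Bform \<beta> s \<gamma> \<equiv> mform (wt \<beta> s \<gamma>)"

lemma mult_ok_wt: "\<beta> > 0 \<Longrightarrow> s > 0 \<Longrightarrow> \<gamma> > 0 \<Longrightarrow> mult_ok (wt \<beta> s \<gamma>)"
  unfolding mult_ok_def wt_def[abs_def] by auto

lemma Bform_eq:
  assumes "\<beta> > 0" "s > 0" "\<gamma> > 0" and u: "in_X u" and w: "in_X w"
  shows "Bform \<beta> s \<gamma> u w = \<beta> * half_form u w + s * (\<integral>x. u x * w x \<partial>lborel) + \<gamma> * inv_form u w"
proof -
  have uw: "mfin (\<lambda>\<xi>. \<bar>\<xi>\<bar>) u" "mfin (\<lambda>\<xi>. 1) u" "mfin (\<lambda>\<xi>. 1 / \<xi>\<^sup>2) u"
    "mfin (\<lambda>\<xi>. \<bar>\<xi>\<bar>) w" "mfin (\<lambda>\<xi>. 1) w" "mfin (\<lambda>\<xi>. 1 / \<xi>\<^sup>2) w"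
    using u w in_X_sqint[OF u] in_X_sqint[OF w] by (auto simp: in_X_iff mfin_one)
  note 1 = mform_add_mult[OF mult_ok_basic(1,3) uw(1,2,4,5), of \<beta> s]
    mform_add_mult[OF mult_ok_basic(1,3) uw(4,5,1,2), of \<beta> s]
  show ?thesis
    \<comment> \<open>The explicit factors 1 in \<open>wt\<close> make it a literal instance of the
      linear combination in \<open>mform_add_mult\<close>, used twice.\<close>
    unfolding wt_def[abs_def]
    using 1 mform_add_mult(3)[OF _ mult_ok_basic(2) _ uw(3) _ uw(6), of "\<lambda>\<xi>. \<beta> * \<bar>\<xi>\<bar> + s * 1" 1 \<gamma>] assms(1-3)
    by (simp add: half_form_mform inv_form_mform mform_one in_X_sqint u w)
qed

text \<open>The symbol dominates multiples of both |xi| and 1 / xi^2. Thus one form decides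
  membership in X for every choice of positive parameters, which is what changing s and gamma by
  dilation needs.\<close>

lemma in_X_wt:
  assumes "\<beta> > 0" "s > 0" "\<gamma> > 0"
  shows "in_X u \<longleftrightarrow> mfin (wt \<beta> s \<gamma>) u"
proof (cases "sqint lborel u")
  case True
  have [measurable]: "fourier u \<in> borel_measurable borel" by (rule fourier_measurable[OF True])
  show ?thesis
  proof
    assume u: "in_X u"
    have "integrable lborel (\<lambda>\<xi>. \<beta> * (\<bar>\<xi>\<bar> * (cmod (fourier u \<xi>))\<^sup>2) + s * (cmod (fourier u \<xi>))\<^sup>2 + \<gamma> * (1 / \<xi>\<^sup>2 * (cmod (fourier u \<xi>))\<^sup>2))"
      using u sqint_integrable[OF fourier_L2(1)[OF True]]
      by (intro Bochner_Integration.integrable_add integrable_mult_right) (auto simp: in_X_iff mfin_def)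
    also have "(\<lambda>\<xi>. \<beta> * (\<bar>\<xi>\<bar> * (cmod (fourier u \<xi>))\<^sup>2) + s * (cmod (fourier u \<xi>))\<^sup>2 + \<gamma> * (1 / \<xi>\<^sup>2 * (cmod (fourier u \<xi>))\<^sup>2))
      = (\<lambda>\<xi>. wt \<beta> s \<gamma> \<xi> * (cmod (fourier u \<xi>))\<^sup>2)" by (simp add: wt_def algebra_simps)
    finally show "mfin (wt \<beta> s \<gamma>) u" using True by (simp add: mfin_def)
  next
    assume w: "mfin (wt \<beta> s \<gamma>) u"
    have "mfin m u" if m: "m \<in> borel_measurable borel" "\<And>\<xi>. 0 \<le> m \<xi>" "\<And>\<xi>. m \<xi> \<le> C * wt \<beta> s \<gamma> \<xi>" for m C
      unfolding mfin_def
    proof (rule conjI, rule True, rule Bochner_Integration.integrable_bound)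
      show "integrable lborel (\<lambda>\<xi>. C * (wt \<beta> s \<gamma> \<xi> * (cmod (fourier u \<xi>))\<^sup>2))" using w by (simp add: mfin_def)
      show "(\<lambda>\<xi>. m \<xi> * (cmod (fourier u \<xi>))\<^sup>2) \<in> borel_measurable lborel" using m(1) by measurable
      have "m \<xi> * (cmod (fourier u \<xi>))\<^sup>2 \<le> C * wt \<beta> s \<gamma> \<xi> * (cmod (fourier u \<xi>))\<^sup>2" for \<xi>
        by (intro mult_right_mono m) auto
      then have "norm (m \<xi> * (cmod (fourier u \<xi>))\<^sup>2) \<le> norm (C * (wt \<beta> s \<gamma> \<xi> * (cmod (fourier u \<xi>))\<^sup>2))" for \<xi>
        unfolding real_norm_def abs_of_nonneg[OF mult_nonneg_nonneg[OF m(2) zero_le_power2]]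
        by (intro order_trans[OF _ abs_ge_self]) (simp only: mult.assoc)
      then show "AE \<xi> in lborel. norm (m \<xi> * (cmod (fourier u \<xi>))\<^sup>2) \<le> norm (C * (wt \<beta> s \<gamma> \<xi> * (cmod (fourier u \<xi>))\<^sup>2))"
        by (rule AE_I2)
    qed
    note dom = this
    have 1: "\<bar>\<xi>\<bar> \<le> (1 / \<beta>) * wt \<beta> s \<gamma> \<xi>" for \<xi>
    proof -
      have "\<bar>\<xi>\<bar> = (1 / \<beta>) * (\<beta> * \<bar>\<xi>\<bar>)" using assms by simp
      also have "\<dots> \<le> (1 / \<beta>) * wt \<beta> s \<gamma> \<xi>"
        using assms by (intro mult_left_mono) (simp_all add: wt_def)
      finally show ?thesis .
    qed
    have 2: "1 / \<xi>\<^sup>2 \<le> (1 / \<gamma>) * wt \<beta> s \<gamma> \<xi>" for \<xi>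
    proof -
      have "1 / \<xi>\<^sup>2 = (1 / \<gamma>) * (\<gamma> * (1 / \<xi>\<^sup>2))" using assms by simp
      also have "\<dots> \<le> (1 / \<gamma>) * wt \<beta> s \<gamma> \<xi>"
        using assms by (intro mult_left_mono) (simp_all add: wt_def)
      finally show ?thesis .
    qed
    show "in_X u" unfolding in_X_iff
    proof
      show "mfin (\<lambda>\<xi>. \<bar>\<xi>\<bar>) u" by (rule dom[OF _ _ 1]) auto
      show "mfin (\<lambda>\<xi>. 1 / \<xi>\<^sup>2) u" by (rule dom[OF _ _ 2]) auto
    qed
  qed
qed (auto simp: in_X_def mfin_def L2fun_sqint)

section \<open>The Sobolev embedding by dyadic averages\<close>

text \<open>\<open>Hhalf\<close> is the only information on \<open>H\<^sup>1\<^sup>/\<^sup>2\<close> that the embedding and the compactness argument use. It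
  does not mention the Fourier transform: the averages over \<open>[x, x + 2\<^sup>-\<^sup>k]\<close> grow only linearly in \<open>k\<close>, while their
  \<open>L\<^sup>2\<close> distance to the function decays geometrically.\<close>

definition Hhalf :: "real \<Rightarrow> (real \<Rightarrow> real) \<Rightarrow> bool" where
  "Hhalf N u \<longleftrightarrow> sqint lborel u \<and> nsq lborel u \<le> N\<^sup>2 \<and> (\<forall>h. nsq lborel (\<lambda>x. u (x + h) - u x) \<le> \<bar>h\<bar> * N\<^sup>2)"

lemma cmod_cis_diff_one_sq: "(cmod (cis t - 1))\<^sup>2 = 4 * (sin (t / 2))\<^sup>2"
proof -
  have "(cmod (cis t - 1))\<^sup>2 = 2 - 2 * cos t"
    using sin_cos_squared_add[of t] by (simp add: cmod_power2 power2_diff)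
  then show ?thesis using cos_double_sin[of "t / 2"] by simp
qed

text \<open>Linear in |t| because only half a derivative is available: the right side is the
  geometric mean of the trivial bound 4 and the quadratic bound t^2.\<close>

lemma cmod_cis_diff_one_sq_le: "(cmod (cis t - 1))\<^sup>2 \<le> 2 * \<bar>t\<bar>"
proof -
  have "(cmod (cis t - 1))\<^sup>2 = 4 * (sin (t / 2))\<^sup>2" by (rule cmod_cis_diff_one_sq)
  also have "\<dots> \<le> 4 * \<bar>sin (t / 2)\<bar>"
  proof -
    have "(sin (t / 2))\<^sup>2 = \<bar>sin (t / 2)\<bar> * \<bar>sin (t / 2)\<bar>" by (simp only: power2_eq_square abs_mult_self_eq)
    also have "\<dots> \<le> \<bar>sin (t / 2)\<bar> * 1" by (rule mult_left_mono[OF abs_sin_le_one abs_ge_zero])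
    finally show ?thesis by simp
  qed
  also have "\<dots> \<le> 4 * \<bar>t / 2\<bar>" by (intro mult_left_mono abs_sin_x_le_abs_x) simp
  finally show ?thesis by simp
qed

text \<open>On the Fourier side the difference multiplies by cis(h xi) - 1, whose squared modulus is
  at most 2 |h| |xi|; the weight |xi| is that of \<open>half_form\<close>.\<close>

lemma translation_half_form:
  assumes u: "in_X u"
  shows "nsq lborel (\<lambda>x. u (x + h) - u x) \<le> 2 * \<bar>h\<bar> * half_form u u"
proof -
  have u2: "sqint lborel u" by (rule in_X_sqint[OF u])
  have s2: "sqint lborel (\<lambda>x. u (x + h))" by (rule sqint_shift(1)[OF u2])
  have d2: "sqint lborel (\<lambda>x. u (x + h) - u x)" by (rule sqint_diff(1)[OF s2 u2])
  have int: "integrable lborel (\<lambda>\<xi>. 2 * \<bar>h\<bar> * (\<bar>\<xi>\<bar> * (cmod (fourier u \<xi>))\<^sup>2))"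
    using u by (auto simp: in_X_iff mfin_def)
  have "2 * pi * nsq lborel (\<lambda>x. u (x + h) - u x) = nsq lborel (fourier (\<lambda>x. u (x + h) - u x))"
    using plancherel[OF d2] by simp
  also have "\<dots> \<le> (\<integral>\<xi>. 2 * \<bar>h\<bar> * (\<bar>\<xi>\<bar> * (cmod (fourier u \<xi>))\<^sup>2) \<partial>lborel)"
    unfolding nsq_def
  proof (rule integral_mono_AE[OF sqint_integrable[OF fourier_L2(1)[OF d2]] int])
    show "AE \<xi> in lborel. (cmod (fourier (\<lambda>x. u (x + h) - u x) \<xi>))\<^sup>2 \<le> 2 * \<bar>h\<bar> * (\<bar>\<xi>\<bar> * (cmod (fourier u \<xi>))\<^sup>2)"
      using fourier_lincomb[OF s2 u2, of 1 "-1"] fourier_shift[OF u2, of h]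
    proof eventually_elim
      case (elim \<xi>)
      then have "fourier (\<lambda>x. u (x + h) - u x) \<xi> = (cis (h * \<xi>) - 1) * fourier u \<xi>"
        by (simp add: left_diff_distrib)
      then have "(cmod (fourier (\<lambda>x. u (x + h) - u x) \<xi>))\<^sup>2 = (cmod (cis (h * \<xi>) - 1))\<^sup>2 * (cmod (fourier u \<xi>))\<^sup>2"
        by (simp add: norm_mult power_mult_distrib)
      also have "\<dots> \<le> (2 * \<bar>h * \<xi>\<bar>) * (cmod (fourier u \<xi>))\<^sup>2"
        by (intro mult_right_mono cmod_cis_diff_one_sq_le) simp
      finally show ?case by (simp add: abs_mult mult.assoc)
    qed
  qed
  also have "\<dots> = 2 * \<bar>h\<bar> * (2 * pi * half_form u u)"
    by (simp add: half_form_mform mform_diag)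
  finally show ?thesis by (simp add: mult.left_commute)
qed

section \<open>Averages over intervals and the embedding into L^r\<close>

definition avg :: "real \<Rightarrow> (real \<Rightarrow> real) \<Rightarrow> real \<Rightarrow> real" where
  "avg h u x = (1 / h) * (\<integral>s. indicator {0..h} s * u (x + s) \<partial>lborel)"

lemma sqint_translate: 
  fixes u :: "real \<Rightarrow> 'b::{banach,second_countable_topology}"
  assumes "sqint lborel u"
  shows "sqint lborel (\<lambda>s. u (x + s))" "nsq lborel (\<lambda>s. u (x + s)) = nsq lborel u"
  using sqint_shift[OF assms, of x] by (simp_all add: add.commute)

lemma indicator_integral_le:
  assumes "sqint lborel (g :: real \<Rightarrow> real)" "h > 0"
  shows "integrable lborel (\<lambda>s. indicator {0..h} s * g s)"
    "\<bar>\<integral>s. indicator {0..h} s * g s \<partial>lborel\<bar> \<le> sqrt h * sqrt (nsq lborel g)"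
  using cauchy_schwarz_prod[OF indicator_Icc_sqint(1)[of 0 h] assms(1)]
    sqint_times_integrable[OF indicator_Icc_sqint(1)[of 0 h] assms(1)] indicator_Icc_sqint(2)[of 0 h] assms(2)
  by simp_all

text \<open>Two functions and two base points at once: w = 0 gives a bound for a single average, w =
  u at a shifted point gives the modulus of continuity.\<close>

lemma avg_diff_le:
  assumes u: "sqint lborel u" and w: "sqint lborel w" and h: "h > 0"
  shows "\<bar>avg h u x - avg h w y\<bar> \<le> (1 / sqrt h) * sqrt (nsq lborel (\<lambda>s. u (x + s) - w (y + s)))"
proof -
  have d: "sqint lborel (\<lambda>s. u (x + s) - w (y + s))" by (intro sqint_diff sqint_translate u w)
  have "avg h u x - avg h w y = (1 / h) * ((\<integral>s. indicator {0..h} s * u (x + s) \<partial>lborel) - (\<integral>s. indicator {0..h} s * w (y + s) \<partial>lborel))"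
    by (simp add: avg_def right_diff_distrib)
  also have "\<dots> = (1 / h) * (\<integral>s. indicator {0..h} s * (u (x + s) - w (y + s)) \<partial>lborel)"
    by (subst Bochner_Integration.integral_diff[symmetric])
      (auto intro!: indicator_integral_le sqint_translate u w h simp: right_diff_distrib)
  finally have "\<bar>avg h u x - avg h w y\<bar> = (1 / h) * \<bar>\<integral>s. indicator {0..h} s * (u (x + s) - w (y + s)) \<partial>lborel\<bar>"
    using h by (simp add: abs_mult)
  also have "\<dots> \<le> (1 / h) * (sqrt h * sqrt (nsq lborel (\<lambda>s. u (x + s) - w (y + s))))"
    using h by (intro mult_left_mono indicator_integral_le d) auto
  also have "\<dots> = (1 / sqrt h) * sqrt (nsq lborel (\<lambda>s. u (x + s) - w (y + s)))"
    using h real_div_sqrt[of h] by (simp add: field_simps)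
  finally show ?thesis .
qed

lemma avg_zero: "avg h (\<lambda>x. 0) y = 0"
  by (simp add: avg_def)

lemma avg_double:
  assumes u: "sqint lborel u" and h: "h > 0"
  shows "avg (2 * h) u x = (avg h u x + avg h u (x + h)) / 2"
proof -
  have i: "integrable lborel (\<lambda>s. indicator {0..h} s * u (x + s))"
    "integrable lborel (\<lambda>s. indicator {0..h} s * u (x + h + s))"
    by (auto intro!: indicator_integral_le sqint_translate u h)
  have i2: "integrable lborel (\<lambda>s. indicator {0..h} (- h + 1 * s) * u (x + h + (- h + 1 * s)))"
    using lborel_integrable_real_affine[OF i(2), of 1 "- h"] by simp
  have "(\<integral>s. indicator {0..2 * h} s * u (x + s) \<partial>lborel)
    = (\<integral>s. indicator {0..h} s * u (x + s) + indicator {0..h} (- h + 1 * s) * u (x + h + (- h + 1 * s)) \<partial>lborel)"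
  proof (rule integral_cong_AE)
    have [measurable]: "u \<in> borel_measurable borel" using sqint_measurable[OF u] by simp
    show "(\<lambda>s. indicator {0..2 * h} s * u (x + s)) \<in> borel_measurable lborel" by measurable
    show "(\<lambda>s. indicator {0..h} s * u (x + s) + indicator {0..h} (- h + 1 * s) * u (x + h + (- h + 1 * s))) \<in> borel_measurable lborel"
      by measurable
    \<comment> \<open>The two halves of [0, 2h] share the point h, where both terms on the right
      count.\<close>
    have "AE s in lborel. s \<noteq> h" by (rule AE_lborel_singleton)
    then show "AE s in lborel. indicator {0..2 * h} s * u (x + s)
      = indicator {0..h} s * u (x + s) + indicator {0..h} (- h + 1 * s) * u (x + h + (- h + 1 * s))"
      by eventually_elim (use h in \<open>auto simp: indicator_def algebra_simps\<close>)
  qed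
  also have "\<dots> = (\<integral>s. indicator {0..h} s * u (x + s) \<partial>lborel) + (\<integral>s. indicator {0..h} s * u (x + h + s) \<partial>lborel)"
    using lborel_integral_real_affine[of 1 "\<lambda>s. indicator {0..h} s * u (x + h + s)" "- h"]
    by (subst Bochner_Integration.integral_add[OF i(1) i2]) simp
  finally show ?thesis using h by (simp add: avg_def field_simps)
qed

lemma avg_measurable[measurable]:
  assumes [measurable]: "u \<in> borel_measurable borel"
  shows "avg h u \<in> borel_measurable borel"
  unfolding avg_def[abs_def] by measurable

text \<open>Halving the interval changes the average by half the difference of the averages over its
  two halves, and Cauchy-Schwarz bounds that difference by h^(-1/2) times the square root of h N^2,
  hence by N at every scale. A logarithmic growth thus replaces the missing bound on u.\<close>

lemma avg_dyadic_bound: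
  assumes u: "Hhalf N u" and N: "N > 0"
  shows "\<bar>avg ((1/2)^k) u x\<bar> \<le> N * (1 + real k / 2)"
proof (induction k)
  case 0
  have u2: "sqint lborel u" and n: "nsq lborel u \<le> N\<^sup>2" using u by (auto simp: Hhalf_def)
  have "\<bar>avg 1 u x\<bar> \<le> sqrt (nsq lborel u)"
    using avg_diff_le[OF u2 sqint_zero, of 1 x x] sqint_translate(2)[OF u2, of x] by (simp add: avg_zero)
  also have "\<dots> \<le> N" using real_sqrt_le_mono[OF n] N by simp
  finally show ?case by simp
next
  case (Suc k)
  have u2: "sqint lborel u" and d: "nsq lborel (\<lambda>x. u (x + h) - u x) \<le> \<bar>h\<bar> * N\<^sup>2" for h
    using u by (auto simp: Hhalf_def)
  define h where "h = (1/2::real)^Suc k"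
  have h: "h > 0" by (simp add: h_def)
  have "\<bar>avg h u x - avg h u (x + h)\<bar> \<le> (1 / sqrt h) * sqrt (nsq lborel (\<lambda>s. u (x + s) - u (x + h + s)))"
    by (rule avg_diff_le[OF u2 u2 h])
  also have "nsq lborel (\<lambda>s. u (x + s) - u (x + h + s)) = nsq lborel (\<lambda>s. u (s + h) - u s)"
    using sqint_translate(2)[OF sqint_diff(1)[OF sqint_shift(1)[OF u2, of h] u2], of x]
    by (subst nsq_swap) (simp add: ac_simps)
  also have "(1 / sqrt h) * sqrt (nsq lborel (\<lambda>s. u (s + h) - u s)) \<le> (1 / sqrt h) * sqrt (\<bar>h\<bar> * N\<^sup>2)"
    using h by (intro mult_left_mono real_sqrt_le_mono d) auto
  also have "\<dots> = N" using h N by (simp add: real_sqrt_mult)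
  finally have 1: "\<bar>avg h u x - avg h u (x + h)\<bar> \<le> N" .
  have "avg ((1/2)^k) u x = (avg h u x + avg h u (x + h)) / 2"
    using avg_double[OF u2 h, of x] by (simp add: h_def)
  then have "avg h u x = avg ((1/2)^k) u x + (avg h u x - avg h u (x + h)) / 2" by (simp add: field_simps)
  then have "\<bar>avg h u x\<bar> = \<bar>avg ((1/2)^k) u x + (avg h u x - avg h u (x + h)) / 2\<bar>" by (rule arg_cong)
  also have "\<dots> \<le> \<bar>avg ((1/2)^k) u x\<bar> + \<bar>(avg h u x - avg h u (x + h)) / 2\<bar>" by (rule abs_triangle_ineq)
  also have "\<bar>(avg h u x - avg h u (x + h)) / 2\<bar> = \<bar>avg h u x - avg h u (x + h)\<bar> / 2" by simp
  also have "\<bar>avg ((1/2)^k) u x\<bar> + \<bar>avg h u x - avg h u (x + h)\<bar> / 2 \<le> N * (1 + real k / 2) + N / 2"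
    using 1 by (intro add_mono Suc divide_right_mono) auto
  finally have "\<bar>avg h u x\<bar> \<le> N * (1 + real k / 2) + N / 2" .
  then show ?case by (simp add: h_def field_simps)
qed

text \<open>The error is a mean of u(x) - u(x + s) over s in [0, h]; Cauchy-Schwarz in s and Tonelli
  reduce its squared norm to the mean of the squared norms of translation differences, each at most
  h N^2.\<close>

lemma avg_approx:
  assumes u: "Hhalf N u" and h: "h > 0"
  shows "sqint lborel (\<lambda>x. u x - avg h u x)" "nsq lborel (\<lambda>x. u x - avg h u x) \<le> h * N\<^sup>2"
proof -
  have u2: "sqint lborel u" and d: "nsq lborel (\<lambda>x. u (x + s) - u x) \<le> \<bar>s\<bar> * N\<^sup>2" for s
    using u by (auto simp: Hhalf_def)
  have [measurable]: "u \<in> borel_measurable borel" using sqint_measurable[OF u2] by simp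
  let ?g = "\<lambda>x s. indicator {0..h} s * (u (x + s) - u x)"
  have pt: "ennreal ((norm (u x - avg h u x))\<^sup>2) \<le> ennreal (1 / h) * (\<integral>\<^sup>+s. ennreal ((?g x s)\<^sup>2) \<partial>lborel)" for x
  proof -
    have c: "sqint lborel (\<lambda>s. indicat_real {0..h} s * u x)"
      using sqint_mult_left(1)[OF indicator_Icc_sqint(1)[of 0 h], of "u x"] by (simp add: mult.commute)
    have g2: "sqint lborel (?g x)"
    proof -
      have "sqint lborel (\<lambda>s. indicator {0..h} s *\<^sub>R u (x + s))" by (intro sqint_indicator sqint_translate u2) simp
      from sqint_diff(1)[OF this c] show ?thesis by (simp add: right_diff_distrib)
    qed
    have "u x - avg h u x = - (1 / h) * (\<integral>s. indicator {0..h} s * ?g x s \<partial>lborel)"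
    proof -
      have "(\<integral>s. indicator {0..h} s * ?g x s \<partial>lborel) = (\<integral>s. indicator {0..h} s * u (x + s) - indicat_real {0..h} s * u x \<partial>lborel)"
        by (intro Bochner_Integration.integral_cong) (auto simp: indicator_def)
      also have "\<dots> = (\<integral>s. indicator {0..h} s * u (x + s) \<partial>lborel) - (\<integral>s. indicat_real {0..h} s * u x \<partial>lborel)"
        by (rule Bochner_Integration.integral_diff[OF indicator_integral_le(1)[OF sqint_translate(1)[OF u2] h]])
          (intro integrable_mult_left integrable_real_indicator, auto simp: emeasure_lborel_Icc_eq)
      also have "(\<integral>s. indicat_real {0..h} s * u x \<partial>lborel) = h * u x" using h by simp
      finally have eq: "(\<integral>s. indicator {0..h} s * ?g x s \<partial>lborel) = (\<integral>s. indicator {0..h} s * u (x + s) \<partial>lborel) - h * u x" .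
      show ?thesis unfolding avg_def eq using h by (simp add: right_diff_distrib)
    qed
    then have "\<bar>u x - avg h u x\<bar> \<le> (1 / h) * (sqrt h * sqrt (nsq lborel (?g x)))"
      using mult_left_mono[OF indicator_integral_le(2)[OF g2 h], of "1/h"] h by (simp add: abs_mult)
    then have "(norm (u x - avg h u x))\<^sup>2 \<le> ((1 / h) * (sqrt h * sqrt (nsq lborel (?g x))))\<^sup>2"
      by (intro power_mono) auto
    also have "\<dots> = (1 / h) * nsq lborel (?g x)"
      using h by (simp add: power_mult_distrib power_divide) (simp add: power2_eq_square)
    finally have "ennreal ((norm (u x - avg h u x))\<^sup>2) \<le> ennreal ((1 / h) * nsq lborel (?g x))" by (rule ennreal_leI)
    also have "\<dots> = ennreal (1 / h) * (\<integral>\<^sup>+s. ennreal ((?g x s)\<^sup>2) \<partial>lborel)"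
    proof -
      have s: "(\<integral>\<^sup>+s. ennreal ((?g x s)\<^sup>2) \<partial>lborel) = ennreal (nsq lborel (?g x))"
        using sqint_nn_integral[OF g2] by simp
      show ?thesis unfolding s by (rule ennreal_mult) (use h in auto)
    qed
    finally show ?thesis .
  qed
  have "(\<integral>\<^sup>+x. ennreal ((norm (u x - avg h u x))\<^sup>2) \<partial>lborel)
    \<le> (\<integral>\<^sup>+x. ennreal (1 / h) * (\<integral>\<^sup>+s. ennreal ((?g x s)\<^sup>2) \<partial>lborel) \<partial>lborel)"
    by (intro nn_integral_mono pt)
  also have "\<dots> = ennreal (1 / h) * (\<integral>\<^sup>+x. (\<integral>\<^sup>+s. ennreal ((?g x s)\<^sup>2) \<partial>lborel) \<partial>lborel)"
    by (rule nn_integral_cmult) measurable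
  also have "(\<integral>\<^sup>+x. (\<integral>\<^sup>+s. ennreal ((?g x s)\<^sup>2) \<partial>lborel) \<partial>lborel) = (\<integral>\<^sup>+s. (\<integral>\<^sup>+x. ennreal ((?g x s)\<^sup>2) \<partial>lborel) \<partial>lborel)"
    by (rule lborel_pair.Fubini'[symmetric]) measurable
  also have "\<dots> \<le> (\<integral>\<^sup>+s. ennreal (h * N\<^sup>2) * indicator {0..h} s \<partial>lborel)"
  proof (rule nn_integral_mono)
    fix s
    have ds: "sqint lborel (\<lambda>x. u (x + s) - u x)" by (rule sqint_diff(1)[OF sqint_shift(1)[OF u2] u2])
    have "(\<integral>\<^sup>+x. ennreal ((?g x s)\<^sup>2) \<partial>lborel) = (\<integral>\<^sup>+x. ennreal ((norm (u (x + s) - u x))\<^sup>2) * indicator {0..h} s \<partial>lborel)"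
      by (intro nn_integral_cong) (auto simp: indicator_def)
    also have "\<dots> = ennreal (nsq lborel (\<lambda>x. u (x + s) - u x)) * indicator {0..h} s"
      using sqint_nn_integral[OF ds] by (subst nn_integral_multc) auto
    also have "\<dots> \<le> ennreal (h * N\<^sup>2) * indicator {0..h} s"
    proof (cases "s \<in> {0..h}")
      case True
      then have "\<bar>s\<bar> * N\<^sup>2 \<le> h * N\<^sup>2" by (intro mult_right_mono) auto
      then have "nsq lborel (\<lambda>x. u (x + s) - u x) \<le> h * N\<^sup>2" using d[of s] by linarith
      then show ?thesis by (intro mult_right_mono ennreal_leI) auto
    qed simp
    finally show "(\<integral>\<^sup>+x. ennreal ((?g x s)\<^sup>2) \<partial>lborel) \<le> ennreal (h * N\<^sup>2) * indicator {0..h} s" .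
  qed
  also have "\<dots> = ennreal (h * N\<^sup>2) * ennreal h"
    using h by (subst nn_integral_cmult_indicator) (auto simp: emeasure_lborel_Icc_eq)
  also have "ennreal (1 / h) * (ennreal (h * N\<^sup>2) * ennreal h) = ennreal (h * N\<^sup>2)"
    using h by (simp flip: ennreal_mult)
  finally have le: "(\<integral>\<^sup>+x. ennreal ((norm (u x - avg h u x))\<^sup>2) \<partial>lborel) \<le> ennreal (h * N\<^sup>2)"
    by (simp add: mult_left_mono)
  show "sqint lborel (\<lambda>x. u x - avg h u x)" "nsq lborel (\<lambda>x. u x - avg h u x) \<le> h * N\<^sup>2"
    using h by (auto intro!: sqint_nnI[OF _ le])
qed

lemma summable_powr_geometric: "summable (\<lambda>k. (3 + real k) powr a * (1/2)^k)"
proof (rule summable_comparison_test_bigo)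
  show "summable (\<lambda>k. norm ((3/4::real)^k))" by simp
  show "(\<lambda>k. (3 + real k) powr a * (1/2)^k) \<in> O(\<lambda>k. (3/4)^k)" by real_asymp
qed

text \<open>The first term collects the region |u| < 2N, the k-th term of the series the layer N (2
  + k) <= |u| < N (3 + k); the factor 4 is the square of the loss in |u| <= 2 |u - average|.\<close>

definition sob :: "real \<Rightarrow> real" where
  "sob r = 2 powr (r - 2) + (\<Sum>k. 4 * ((3 + real k) powr (r - 2) * (1/2)^k))"

lemma sob_pos: "sob r > 0"
proof -
  have "(\<Sum>k. 4 * ((3 + real k) powr (r - 2) * (1/2)^k)) \<ge> 0"
    by (intro suminf_nonneg summable_mult summable_powr_geometric) simp
  then show ?thesis by (simp add: sob_def add_pos_nonneg)
qed

text \<open>In layer k the average at scale 2^(-k) is at most half of |u|, so |u| is controlled by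
  its distance to the average. The squared norm of that distance decays like 2^(-k), which beats the
  polynomial factor from the height of the layer.\<close>

theorem sobolev:
  assumes u: "Hhalf N u" and N: "N > 0" and r: "r \<ge> 2"
  shows "integrable lborel (\<lambda>x. \<bar>u x\<bar> powr r)" "(\<integral>x. \<bar>u x\<bar> powr r \<partial>lborel) \<le> sob r * N powr r"
proof -
  have u2: "sqint lborel u" and n: "nsq lborel u \<le> N\<^sup>2" using u by (auto simp: Hhalf_def)
  have [measurable]: "u \<in> borel_measurable borel" using sqint_measurable[OF u2] by simp
  define a where "a k = avg ((1/2)^k) u" for k
  have [measurable]: "a k \<in> borel_measurable borel" for k unfolding a_def by measurable
  have a: "\<bar>a k x\<bar> \<le> N * (1 + real k / 2)" for k x unfolding a_def by (rule avg_dyadic_bound[OF u N])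
  have ad: "sqint lborel (\<lambda>x. u x - a k x)" "nsq lborel (\<lambda>x. u x - a k x) \<le> (1/2)^k * N\<^sup>2" for k
    unfolding a_def by (intro avg_approx[OF u]; simp)+
  let ?t = "\<lambda>k x. ennreal ((N * (3 + real k)) powr (r - 2) * 4 * (u x - a k x)\<^sup>2)"
  let ?b = "\<lambda>x. ennreal ((2 * N) powr (r - 2) * (u x)\<^sup>2)"
  have split: "t powr r = t powr (r - 2) * t\<^sup>2" if "t \<ge> 0" for t :: real
    using that r by (cases "t = 0") (auto simp: powr_diff powr_numeral)
  have pt: "ennreal (\<bar>u x\<bar> powr r) \<le> ?b x + (\<Sum>k. ?t k x)" for x
  proof (cases "\<bar>u x\<bar> < 2 * N")
    case True
    have "\<bar>u x\<bar> powr r \<le> (2 * N) powr (r - 2) * (u x)\<^sup>2"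
      unfolding split[OF abs_ge_zero] power2_abs using True r by (intro mult_right_mono powr_mono2) auto
    then have "ennreal (\<bar>u x\<bar> powr r) \<le> ?b x" by (rule ennreal_leI)
    then show ?thesis by (rule order_trans) simp
  next
    case False
    \<comment> \<open>Index of the layer containing |u x|. Its lower end N (2 + k) is exactly twice
      the bound N (1 + k/2) on the average.\<close>
    define k where "k = nat \<lfloor>\<bar>u x\<bar> / N - 2\<rfloor>"
    have q: "\<bar>u x\<bar> / N - 2 \<ge> 0" using False N by (simp add: field_simps)
    then have "real k \<le> \<bar>u x\<bar> / N - 2" "\<bar>u x\<bar> / N - 2 < real k + 1" unfolding k_def by linarith+
    then have k: "N * (2 + real k) \<le> \<bar>u x\<bar>" "\<bar>u x\<bar> < N * (3 + real k)" using N by (auto simp: field_simps)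
    have "\<bar>u x - a k x\<bar> \<ge> \<bar>u x\<bar> / 2" 
    proof -
      have "2 * \<bar>a k x\<bar> \<le> \<bar>u x\<bar>" using a[of k x] k(1) by (simp add: algebra_simps)
      moreover have "\<bar>u x\<bar> \<le> \<bar>u x - a k x\<bar> + \<bar>a k x\<bar>" by arith
      ultimately show ?thesis by simp
    qed
    then have "(\<bar>u x\<bar> / 2)\<^sup>2 \<le> \<bar>u x - a k x\<bar>\<^sup>2" by (intro power_mono) auto
    then have s: "(u x)\<^sup>2 \<le> 4 * (u x - a k x)\<^sup>2" by (simp add: power_divide)
    have "\<bar>u x\<bar> powr r \<le> (N * (3 + real k)) powr (r - 2) * (4 * (u x - a k x)\<^sup>2)"
      unfolding split[OF abs_ge_zero] power2_abs using k(2) r s by (intro mult_mono powr_mono2) auto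
    then have "ennreal (\<bar>u x\<bar> powr r) \<le> ?t k x" by (intro ennreal_leI) (simp add: mult.assoc)
    also have "\<dots> \<le> (\<Sum>k. ?t k x)"
    proof -
      have "(\<Sum>i\<in>{k}. ?t i x) \<le> (\<Sum>k. ?t k x)" by (rule sum_le_suminf) (auto intro: summableI)
      then show ?thesis by simp
    qed
    finally show ?thesis by (rule order_trans) simp
  qed
  have tk: "(\<integral>\<^sup>+x. ?t k x \<partial>lborel) \<le> ennreal (N powr r * (4 * ((3 + real k) powr (r - 2) * (1/2)^k)))" for k
  proof -
    have "(\<integral>\<^sup>+x. ?t k x \<partial>lborel) = (\<integral>\<^sup>+x. ennreal ((N * (3 + real k)) powr (r - 2) * 4) * ennreal ((norm (u x - a k x))\<^sup>2) \<partial>lborel)"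
      by (intro nn_integral_cong) (simp flip: ennreal_mult)
    also have "\<dots> = ennreal ((N * (3 + real k)) powr (r - 2) * 4) * ennreal (nsq lborel (\<lambda>x. u x - a k x))"
      using sqint_nn_integral[OF ad(1)[of k]] by (subst nn_integral_cmult) auto
    also have "\<dots> \<le> ennreal ((N * (3 + real k)) powr (r - 2) * 4) * ennreal ((1/2)^k * N\<^sup>2)"
      by (intro mult_left_mono ennreal_leI ad) simp
    also have "\<dots> = ennreal ((N * (3 + real k)) powr (r - 2) * 4 * ((1/2)^k * N\<^sup>2))"
      by (rule ennreal_mult[symmetric]) auto
    also have "(N * (3 + real k)) powr (r - 2) * 4 * ((1/2)^k * N\<^sup>2) = N powr r * (4 * ((3 + real k) powr (r - 2) * (1/2)^k))"
      using N split[of N] by (simp add: powr_mult)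
    finally show ?thesis .
  qed
  have "(\<integral>\<^sup>+x. ennreal (\<bar>u x\<bar> powr r) \<partial>lborel) \<le> (\<integral>\<^sup>+x. ?b x + (\<Sum>k. ?t k x) \<partial>lborel)"
    by (intro nn_integral_mono pt)
  also have "\<dots> = (\<integral>\<^sup>+x. ?b x \<partial>lborel) + (\<integral>\<^sup>+x. (\<Sum>k. ?t k x) \<partial>lborel)"
    by (rule nn_integral_add) measurable
  also have "(\<integral>\<^sup>+x. (\<Sum>k. ?t k x) \<partial>lborel) = (\<Sum>k. \<integral>\<^sup>+x. ?t k x \<partial>lborel)"
    by (rule nn_integral_suminf) measurable
  also have "(\<integral>\<^sup>+x. ?b x \<partial>lborel) + (\<Sum>k. \<integral>\<^sup>+x. ?t k x \<partial>lborel)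
      \<le> ennreal (N powr r * 2 powr (r - 2)) + (\<Sum>k. ennreal (N powr r * (4 * ((3 + real k) powr (r - 2) * (1/2)^k))))"
  proof (rule add_mono)
    have "(\<integral>\<^sup>+x. ?b x \<partial>lborel) = (\<integral>\<^sup>+x. ennreal ((2 * N) powr (r - 2)) * ennreal ((norm (u x))\<^sup>2) \<partial>lborel)"
      by (intro nn_integral_cong) (simp flip: ennreal_mult)
    also have "\<dots> = ennreal ((2 * N) powr (r - 2)) * ennreal (nsq lborel u)"
      using sqint_nn_integral[OF u2] by (subst nn_integral_cmult) auto
    also have "\<dots> \<le> ennreal ((2 * N) powr (r - 2)) * ennreal (N\<^sup>2)"
      by (intro mult_left_mono ennreal_leI n) simp
    also have "\<dots> = ennreal ((2 * N) powr (r - 2) * N\<^sup>2)" by (rule ennreal_mult[symmetric]) auto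
    also have "(2 * N) powr (r - 2) * N\<^sup>2 = N powr r * 2 powr (r - 2)"
      using N split[of N] by (simp add: powr_mult)
    finally show "(\<integral>\<^sup>+x. ?b x \<partial>lborel) \<le> ennreal (N powr r * 2 powr (r - 2))" .
    show "(\<Sum>k. \<integral>\<^sup>+x. ?t k x \<partial>lborel) \<le> (\<Sum>k. ennreal (N powr r * (4 * ((3 + real k) powr (r - 2) * (1/2)^k))))"
      by (intro suminf_le tk allI summableI)
  qed
  also have "(\<Sum>k. ennreal (N powr r * (4 * ((3 + real k) powr (r - 2) * (1/2)^k))))
      = ennreal (\<Sum>k. N powr r * (4 * ((3 + real k) powr (r - 2) * (1/2)^k)))"
    by (intro suminf_ennreal2 summable_mult summable_powr_geometric) auto
  also have "ennreal (N powr r * 2 powr (r - 2)) + ennreal (\<Sum>k. N powr r * (4 * ((3 + real k) powr (r - 2) * (1/2)^k)))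
      = ennreal (sob r * N powr r)"
  proof -
    have sm: "summable (\<lambda>k. 4 * ((3 + real k) powr (r - 2) * (1/2)^k))"
      by (intro summable_mult summable_powr_geometric)
    have "(\<Sum>k. N powr r * (4 * ((3 + real k) powr (r - 2) * (1/2)^k))) \<ge> 0"
      by (intro suminf_nonneg summable_mult sm) auto
    then show ?thesis
      unfolding sob_def suminf_mult[OF sm] by (subst ennreal_plus[symmetric]) (auto simp: algebra_simps)
  qed
  finally have le: "(\<integral>\<^sup>+x. ennreal (\<bar>u x\<bar> powr r) \<partial>lborel) \<le> ennreal (sob r * N powr r)" .
  have "(\<integral>\<^sup>+x. ennreal (norm (\<bar>u x\<bar> powr r)) \<partial>lborel) < \<infinity>" using le by (simp add: order_le_less_trans)
  then show i: "integrable lborel (\<lambda>x. \<bar>u x\<bar> powr r)" by (intro integrableI_bounded) auto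
  show "(\<integral>x. \<bar>u x\<bar> powr r \<partial>lborel) \<le> sob r * N powr r"
    using le sob_pos[of r] nn_integral_eq_integral[OF i] by simp
qed

section \<open>Compactness\<close>

lemma Hhalf_sqint: "Hhalf N u \<Longrightarrow> sqint lborel u"
  by (simp add: Hhalf_def)

text \<open>All three terms of the form are nonnegative, so the mass is at most M / s and the
  H^(1/2) term at most M / beta; the 2 comes from \<open>translation_half_form\<close>. The constant
  does not contain gamma, which later gives bounds uniform as gamma tends to 0.\<close>

lemma Hhalf_Bform:
  assumes p: "\<beta> > 0" "s > 0" "\<gamma> > 0" and u: "in_X u" and M: "Bform \<beta> s \<gamma> u u \<le> M"
  shows "Hhalf (sqrt (M * (1 / s + 2 / \<beta>))) u" "0 \<le> M"
proof -
  have u2: "sqint lborel u" by (rule in_X_sqint[OF u])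
  define H where "H = half_form u u"
  define I where "I = inv_form u u"
  have H0: "H \<ge> 0" unfolding H_def half_form_mform by (intro mform_nonneg mult_ok_basic)
  have I0: "I \<ge> 0" unfolding I_def inv_form_mform by (intro mform_nonneg mult_ok_basic)
  have nq: "nsq lborel u = (\<integral>x. u x * u x \<partial>lborel)" by (simp add: nsq_def power2_eq_square)
  have "\<beta> * H + s * nsq lborel u + \<gamma> * I \<le> M"
    using Bform_eq[OF p u u] M by (simp add: H_def I_def nq)
  moreover have "\<beta> * H \<ge> 0" "s * nsq lborel u \<ge> 0" "\<gamma> * I \<ge> 0" using p H0 I0 by auto
  ultimately have b: "\<beta> * H \<le> M" "s * nsq lborel u \<le> M" and M0: "M \<ge> 0" by linarith+
  show "0 \<le> M" by (fact M0)
  have n1: "nsq lborel u \<le> M * (1 / s)" and n2: "2 * H \<le> M * (2 / \<beta>)"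
    using b p by (simp_all add: field_simps)
  have c: "M * (1 / s + 2 / \<beta>) = M * (1 / s) + M * (2 / \<beta>)" by (rule distrib_left)
  have c0: "M * (1 / s) \<ge> 0" "M * (2 / \<beta>) \<ge> 0" using M0 p by auto
  have sq: "(sqrt (M * (1 / s + 2 / \<beta>)))\<^sup>2 = M * (1 / s + 2 / \<beta>)" using c c0 by simp
  show "Hhalf (sqrt (M * (1 / s + 2 / \<beta>))) u"
    unfolding Hhalf_def sq
  proof (intro conjI allI u2)
    show "nsq lborel u \<le> M * (1 / s + 2 / \<beta>)" using n1 c c0 by linarith
    fix h
    have "nsq lborel (\<lambda>x. u (x + h) - u x) \<le> \<bar>h\<bar> * (2 * H)"
      using translation_half_form[OF u, of h] by (simp add: H_def mult_ac)
    also have "\<dots> \<le> \<bar>h\<bar> * (M * (1 / s + 2 / \<beta>))" using n2 c c0 by (intro mult_left_mono) linarith+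
    finally show "nsq lborel (\<lambda>x. u (x + h) - u x) \<le> \<bar>h\<bar> * (M * (1 / s + 2 / \<beta>))" .
  qed
qed

lemma Hhalf_mono:
  assumes "Hhalf N u" "0 \<le> N" "N \<le> N'"
  shows "Hhalf N' u"
proof -
  have sq: "N\<^sup>2 \<le> N'\<^sup>2" using assms(2,3) by (rule power_mono[rotated])
  have "\<bar>h\<bar> * N\<^sup>2 \<le> \<bar>h\<bar> * N'\<^sup>2" for h :: real by (rule mult_left_mono[OF sq]) simp
  with sq show ?thesis
    using assms(1) unfolding Hhalf_def
    by (intro conjI allI) (auto intro: order_trans[of "nsq lborel u"] order_trans[of "nsq lborel (\<lambda>x. u (x + h) - u x)" "\<bar>h\<bar> * N\<^sup>2" for h])
qed

lemma in_X_Hhalf: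
  assumes "in_X u"
  obtains N where "N > 0" "Hhalf N u"
proof -
  define N where "N = sqrt (Bform 1 1 1 u u * (1 / 1 + 2 / 1))"
  have one: "(1::real) > 0" by simp
  have N: "Hhalf N u" "0 \<le> Bform 1 1 1 u u"
    unfolding N_def by (rule Hhalf_Bform[OF one one one assms order_refl])+
  have N0: "N \<ge> 0" unfolding N_def using N(2) by (intro real_sqrt_ge_zero mult_nonneg_nonneg) auto
  \<comment> \<open>One is added for strict positivity, since N vanishes for u = 0.\<close>
  have "Hhalf (N + 1) u" by (rule Hhalf_mono[OF N(1) N0]) simp
  moreover have "N + 1 > 0" using N0 by simp
  ultimately show thesis using that by blast
qed

lemma powr_sqint:
  assumes u: "Hhalf N u" and N: "N > 0" and r: "r \<ge> 1"
  shows "sqint lborel (\<lambda>x. \<bar>u x\<bar> powr r)" "nsq lborel (\<lambda>x. \<bar>u x\<bar> powr r) \<le> sob (2 * r) * N powr (2 * r)"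
proof -
  have [measurable]: "u \<in> borel_measurable borel" using sqint_measurable[OF Hhalf_sqint[OF u]] by simp
  have eq: "(norm (\<bar>u x\<bar> powr r))\<^sup>2 = \<bar>u x\<bar> powr (2 * r)" for x
    by (simp add: power2_eq_square flip: powr_add)
  show "sqint lborel (\<lambda>x. \<bar>u x\<bar> powr r)" "nsq lborel (\<lambda>x. \<bar>u x\<bar> powr r) \<le> sob (2 * r) * N powr (2 * r)"
    unfolding sqint_def nsq_def eq using sobolev[OF u N, of "2 * r"] r by simp_all
qed

lemma in_X_powr_sqint: "in_X u \<Longrightarrow> r \<ge> 1 \<Longrightarrow> sqint lborel (\<lambda>x. \<bar>u x\<bar> powr r)"
  using in_X_Hhalf powr_sqint(1) by metis

lemma in_X_powr_integrable: "in_X u \<Longrightarrow> r \<ge> 2 \<Longrightarrow> integrable lborel (\<lambda>x. \<bar>u x\<bar> powr r)"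
  using in_X_Hhalf sobolev(1) by metis

text \<open>One factor |u| of |u|^r is split into the distance to the average and the average. The
  first part is O(sqrt h) by Cauchy-Schwarz, the second is O(delta). The assumption r >= 3 keeps r -
  1 in the range of the embedding.\<close>

lemma vanishing_bound:
  assumes u: "Hhalf N u" and N: "N > 0" and r: "r \<ge> 3" and h: "h > 0" and \<delta>: "\<And>x. \<bar>avg h u x\<bar> \<le> \<delta>"
  shows "(\<integral>x. \<bar>u x\<bar> powr r \<partial>lborel)
    \<le> sqrt (sob (2 * (r - 1)) * N powr (2 * (r - 1))) * sqrt (h * N\<^sup>2) + \<delta> * (sob (r - 1) * N powr (r - 1))"
proof -
  let ?p = "\<lambda>x. \<bar>u x\<bar> powr (r - 1)"
  have p: "sqint lborel ?p" "nsq lborel ?p \<le> sob (2 * (r - 1)) * N powr (2 * (r - 1))"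
    using powr_sqint[OF u N, of "r - 1"] r by auto
  have pi: "integrable lborel ?p" "(\<integral>x. ?p x \<partial>lborel) \<le> sob (r - 1) * N powr (r - 1)"
    using sobolev[OF u N, of "r - 1"] r by auto
  note a = avg_approx[OF u h]
  have \<delta>0: "\<delta> \<ge> 0" using \<delta>[of 0] by linarith
  have i1: "integrable lborel (\<lambda>x. norm (?p x) * norm (u x - avg h u x))"
    by (rule sqint_times_norm_integrable[OF p(1) a(1)])
  have "(\<integral>x. \<bar>u x\<bar> powr r \<partial>lborel) \<le> (\<integral>x. norm (?p x) * norm (u x - avg h u x) + \<delta> * ?p x \<partial>lborel)"
  proof (rule integral_mono)
    show "integrable lborel (\<lambda>x. \<bar>u x\<bar> powr r)" using sobolev(1)[OF u N, of r] r by simp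
    show "integrable lborel (\<lambda>x. norm (?p x) * norm (u x - avg h u x) + \<delta> * ?p x)" using i1 pi(1) by simp
    fix x
    have "\<bar>u x\<bar> powr r = ?p x * \<bar>u x\<bar>" using r by (cases "u x = 0") (auto simp: powr_diff)
    also have "\<dots> \<le> ?p x * (\<bar>u x - avg h u x\<bar> + \<delta>)" using \<delta>[of x] by (intro mult_left_mono) auto
    finally show "\<bar>u x\<bar> powr r \<le> norm (?p x) * norm (u x - avg h u x) + \<delta> * ?p x" by (simp add: algebra_simps)
  qed
  also have "\<dots> = (\<integral>x. norm (?p x) * norm (u x - avg h u x) \<partial>lborel) + \<delta> * (\<integral>x. ?p x \<partial>lborel)"
    using i1 pi(1) by simp
  also have "\<dots> \<le> sqrt (nsq lborel ?p) * sqrt (nsq lborel (\<lambda>x. u x - avg h u x)) + \<delta> * (sob (r - 1) * N powr (r - 1))"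
    by (intro add_mono cauchy_schwarz[OF p(1) a(1)] mult_left_mono pi \<delta>0)
  also have "\<dots> \<le> sqrt (sob (2 * (r - 1)) * N powr (2 * (r - 1))) * sqrt (h * N\<^sup>2) + \<delta> * (sob (r - 1) * N powr (r - 1))"
    using p(2) a(2) sob_pos[of "2 * (r - 1)"] by (intro add_mono mult_mono real_sqrt_le_mono order_refl) auto
  finally show ?thesis .
qed

text \<open>An integrable weight: convergence to zero of \<open>rho * v n\<close> in \<open>L\<^sup>2\<close> expresses local convergence of a
  bounded sequence \<open>v n\<close>.\<close>

definition rho :: "real \<Rightarrow> real" where "rho x = sqrt (gauss x)"

lemma rho_props: "rho x > 0" "rho x \<le> 1" "(rho x)\<^sup>2 = gauss x"
  by (simp_all add: rho_def gauss_def)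

lemma rho_measurable[measurable]: "rho \<in> borel_measurable borel"
  unfolding rho_def[abs_def] by measurable

lemma sqint_rho:
  assumes "sqint lborel (f :: real \<Rightarrow> real)"
  shows "sqint lborel (\<lambda>x. rho x * f x)" "nsq lborel (\<lambda>x. rho x * f x) \<le> nsq lborel f"
proof -
  have [measurable]: "f \<in> borel_measurable borel" using sqint_measurable[OF assms] by simp
  have "norm (rho x * f x) \<le> norm (f x)" for x
    using rho_props[of x] by (simp add: abs_mult mult_left_le_one_le)
  then show "sqint lborel (\<lambda>x. rho x * f x)" "nsq lborel (\<lambda>x. rho x * f x) \<le> nsq lborel f"
    by (intro sqint_bound[OF assms]; simp)+
qed

text \<open>Arzela-Ascoli at all dyadic scales simultaneously: a diagonal subsequence converges at
  rational points, and the common Hoelder-1/2 modulus of the averages at a fixed scale extends this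
  to all points.\<close>

lemma avg_subsequence:
  assumes u: "\<And>n. Hhalf N (u n)" and N: "N > 0"
  obtains r where "strict_mono (r :: nat \<Rightarrow> nat)" "\<And>k x. convergent (\<lambda>n. avg ((1/2)^k) (u (r n)) x)"
proof -
  \<comment> \<open>Division by 1 + k removes the growth of the averages, so that one bound N serves
    all scales in the diagonal extraction.\<close>
  define f where "f n q = avg ((1/2)^(fst q)) (u n) (snd q) / (1 + real (fst q))" for n and q :: "nat \<times> real"
  have "countable ((UNIV :: nat set) \<times> (\<rat> :: real set))" by (simp add: countable_rat)
  moreover have "norm (f n q) \<le> N" for n q
  proof -
    have "\<bar>avg ((1/2)^(fst q)) (u n) (snd q)\<bar> \<le> N * (1 + real (fst q) / 2)"
      by (rule avg_dyadic_bound[OF u N])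
    also have "\<dots> \<le> N * (1 + real (fst q))" using N by (intro mult_left_mono) auto
    finally show ?thesis by (simp add: f_def pos_divide_le_eq)
  qed
  ultimately obtain r where r: "strict_mono (r :: nat \<Rightarrow> nat)"
    and l: "\<And>q. q \<in> UNIV \<times> \<rat> \<Longrightarrow> \<exists>l. (\<lambda>n. f (r n) q) \<longlonglongrightarrow> l"
    using function_convergent_subsequence[of "UNIV \<times> \<rat>" f N] by blast
  have rat: "convergent (\<lambda>n. avg ((1/2)^k) (u (r n)) y)" if "y \<in> \<rat>" for k y
  proof -
    obtain l where "(\<lambda>n. f (r n) (k, y)) \<longlonglongrightarrow> l" using l[of "(k, y)"] \<open>y \<in> \<rat>\<close> by auto
    then have "(\<lambda>n. f (r n) (k, y) * (1 + real k)) \<longlonglongrightarrow> l * (1 + real k)" by (intro tendsto_intros)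
    then have "(\<lambda>n. avg ((1/2)^k) (u (r n)) y) \<longlonglongrightarrow> l * (1 + real k)" by (simp add: f_def add_nonneg_eq_0_iff)
    then show ?thesis by (rule convergentI)
  qed
  have "convergent (\<lambda>n. avg ((1/2)^k) (u (r n)) x)" for k x
  proof -
    define h where "h = (1/2::real)^k"
    have h: "h > 0" by (simp add: h_def)
    have equi: "\<bar>avg h (u n) x - avg h (u n) y\<bar> \<le> (1 / sqrt h) * (sqrt \<bar>x - y\<bar> * N)" for n y
    proof -
      have u2: "sqint lborel (u n)" and d: "nsq lborel (\<lambda>s. u n (s + t) - u n s) \<le> \<bar>t\<bar> * N\<^sup>2" for t
        using u[of n] by (auto simp: Hhalf_def)
      have "\<bar>avg h (u n) x - avg h (u n) y\<bar> \<le> (1 / sqrt h) * sqrt (nsq lborel (\<lambda>s. u n (x + s) - u n (y + s)))"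
        by (rule avg_diff_le[OF u2 u2 h])
      also have "nsq lborel (\<lambda>s. u n (x + s) - u n (y + s)) = nsq lborel (\<lambda>s. u n (s + (x - y)) - u n s)"
        using sqint_translate(2)[OF sqint_diff(1)[OF sqint_shift(1)[OF u2, of "x - y"] u2], of y]
        by (simp add: algebra_simps)
      also have "(1 / sqrt h) * sqrt \<dots> \<le> (1 / sqrt h) * sqrt (\<bar>x - y\<bar> * N\<^sup>2)"
        using h by (intro mult_left_mono real_sqrt_le_mono d) auto
      also have "\<dots> = (1 / sqrt h) * (sqrt \<bar>x - y\<bar> * N)" using N by (simp add: real_sqrt_mult)
      finally show ?thesis .
    qed
    have "Cauchy (\<lambda>n. avg h (u (r n)) x)"
    proof (rule metric_CauchyI)
      fix e :: real assume e: "e > 0"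
      define d where "d = (e * sqrt h / (4 * N))\<^sup>2"
      have d: "d > 0" using e h N by (simp add: d_def)
      obtain y where y: "y \<in> \<rat>" "x < y" "y < x + d" using Rats_dense_in_real[of x "x + d"] d by auto
      have "sqrt \<bar>x - y\<bar> \<le> sqrt d" using y by (intro real_sqrt_le_mono) auto
      also have "sqrt d = e * sqrt h / (4 * N)" using e h N by (simp add: d_def)
      finally have "(1 / sqrt h) * (sqrt \<bar>x - y\<bar> * N) \<le> (1 / sqrt h) * (e * sqrt h / (4 * N) * N)"
        using h N by (intro mult_left_mono mult_right_mono) auto
      also have "\<dots> = e / 4" using h N by simp
      finally have close: "\<bar>avg h (u n) x - avg h (u n) y\<bar> \<le> e / 4" for n using equi[of n y] by linarith
      have "Cauchy (\<lambda>n. avg h (u (r n)) y)" unfolding h_def by (intro convergent_Cauchy rat y)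
      then obtain M where M: "\<And>m n. m \<ge> M \<Longrightarrow> n \<ge> M \<Longrightarrow> dist (avg h (u (r m)) y) (avg h (u (r n)) y) < e / 4"
        using e by (meson metric_CauchyD zero_less_divide_iff zero_less_numeral)
      show "\<exists>M. \<forall>m\<ge>M. \<forall>n\<ge>M. dist (avg h (u (r m)) x) (avg h (u (r n)) x) < e"
      proof (intro exI[of _ M] allI impI)
        fix m n assume "M \<le> m" "M \<le> n"
        then show "dist (avg h (u (r m)) x) (avg h (u (r n)) x) < e"
          using M[of m n] close[of "r m"] close[of "r n"] e unfolding dist_real_def by linarith
      qed
    qed
    then show ?thesis unfolding h_def by (rule real_Cauchy_convergent)
  qed
  then show thesis using that r by blast
qed

text \<open>The averages at a fixed scale converge pointwise and boundedly, hence in the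
  Gaussian-weighted norm; they approximate the functions uniformly in n as the scale shrinks. So the
  weighted sequence is Cauchy.\<close>

theorem local_compactness:
  assumes u: "\<And>n. Hhalf N (u n)" and N: "N > 0"
  obtains r v where "strict_mono (r :: nat \<Rightarrow> nat)" "sqint lborel v" "nsq lborel v \<le> N\<^sup>2"
    "(\<lambda>n. nsq lborel (\<lambda>x. rho x * (u (r n) x - v x))) \<longlonglongrightarrow> 0"
proof -
  obtain r where r: "strict_mono (r :: nat \<Rightarrow> nat)" and conv: "\<And>k x. convergent (\<lambda>n. avg ((1/2)^k) (u (r n)) x)"
    using avg_subsequence[of N u, OF u N] by blast
  define w where "w n = u (r n)" for n
  have w: "Hhalf N (w n)" for n unfolding w_def by (rule u)
  have w2: "sqint lborel (w n)" for n by (rule Hhalf_sqint[OF w])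
  have [measurable]: "w n \<in> borel_measurable borel" for n using sqint_measurable[OF w2] by simp
  define b where "b k x = lim (\<lambda>n. avg ((1/2)^k) (w n) x)" for k x
  have [measurable]: "b k \<in> borel_measurable borel" for k unfolding b_def by measurable
  have b: "(\<lambda>n. avg ((1/2)^k) (w n) x) \<longlonglongrightarrow> b k x" for k x
    unfolding b_def w_def using conv by (simp add: convergent_LIMSEQ_iff)
  have ab: "\<bar>avg ((1/2)^k) (w n) x\<bar> \<le> N * (1 + real k / 2)" for k n x by (rule avg_dyadic_bound[OF w N])
  have bb: "\<bar>b k x\<bar> \<le> N * (1 + real k / 2)" for k x
    by (rule tendsto_upperbound[OF tendsto_rabs[OF b]]) (auto simp: ab)
  have dom: "(\<lambda>n. nsq lborel (\<lambda>x. rho x * (avg ((1/2)^k) (w n) x - b k x))) \<longlonglongrightarrow> 0" for k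
  proof (rule nsq_tendsto_dominated[where w="\<lambda>x. (2 * (N * (1 + real k / 2)))\<^sup>2 * gauss x"])
    show "integrable lborel (\<lambda>x. (2 * (N * (1 + real k / 2)))\<^sup>2 * gauss x)" using gauss_integrable(1) by simp
    show "AE x in lborel. (\<lambda>n. rho x * (avg ((1/2)^k) (w n) x - b k x)) \<longlonglongrightarrow> 0"
      using LIM_zero[OF b] by (intro AE_I2 tendsto_mult_right_zero)
    show "AE x in lborel. (norm (rho x * (avg ((1/2)^k) (w n) x - b k x)))\<^sup>2 \<le> (2 * (N * (1 + real k / 2)))\<^sup>2 * gauss x" for n
    proof (rule AE_I2)
      fix x
      have "\<bar>avg ((1/2)^k) (w n) x - b k x\<bar> \<le> 2 * (N * (1 + real k / 2))"
        using ab[of k n x] bb[of k x] by linarith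
      then have "\<bar>avg ((1/2)^k) (w n) x - b k x\<bar>\<^sup>2 \<le> (2 * (N * (1 + real k / 2)))\<^sup>2" by (rule power_mono) simp
      then have "gauss x * (avg ((1/2)^k) (w n) x - b k x)\<^sup>2 \<le> gauss x * (2 * (N * (1 + real k / 2)))\<^sup>2"
        by (intro mult_left_mono) (auto simp: gauss_def)
      then show "(norm (rho x * (avg ((1/2)^k) (w n) x - b k x)))\<^sup>2 \<le> (2 * (N * (1 + real k / 2)))\<^sup>2 * gauss x"
        by (simp only: real_norm_def power2_abs power_mult_distrib[of "rho x"] rho_props(3) mult.commute[of _ "gauss x"])
    qed
  qed measurable
  have bg: "sqint lborel (\<lambda>x. rho x * b k x)" for k
  proof -
    have "integrable lborel (\<lambda>x. (norm (rho x * b k x))\<^sup>2)"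
    proof (rule Bochner_Integration.integrable_bound)
      show "integrable lborel (\<lambda>x. (N * (1 + real k / 2))\<^sup>2 * gauss x)" using gauss_integrable(1) by simp
      have "\<bar>b k x\<bar>\<^sup>2 \<le> (N * (1 + real k / 2))\<^sup>2" for x by (intro power_mono bb) simp
      then have "gauss x * (b k x)\<^sup>2 \<le> gauss x * (N * (1 + real k / 2))\<^sup>2" for x
        by (intro mult_left_mono) (auto simp: gauss_def)
      note gb = this
      have "norm ((norm (rho x * b k x))\<^sup>2) \<le> norm ((N * (1 + real k / 2))\<^sup>2 * gauss x)" for x
      proof -
        have "norm ((norm (rho x * b k x))\<^sup>2) = gauss x * (b k x)\<^sup>2"
          by (simp add: abs_mult power_mult_distrib rho_props(3)) (simp add: gauss_def)
        also have "\<dots> \<le> (N * (1 + real k / 2))\<^sup>2 * gauss x"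
          using gb[of x] by (simp only: mult.commute)
        also have "\<dots> \<le> norm ((N * (1 + real k / 2))\<^sup>2 * gauss x)" unfolding real_norm_def by (rule abs_ge_self)
        finally show ?thesis .
      qed
      then show "AE x in lborel. norm ((norm (rho x * b k x))\<^sup>2) \<le> norm ((N * (1 + real k / 2))\<^sup>2 * gauss x)"
        by (rule AE_I2)
    qed measurable
    then show ?thesis by (simp add: sqint_def)
  qed
  define dn where "dn k n = nsq lborel (\<lambda>x. rho x * (avg ((1/2)^k) (w n) x - b k x))" for k n
  have step: "nsq lborel (\<lambda>x. rho x * w n x - rho x * b k x) \<le> 2 * ((1/2)^k * N\<^sup>2) + 2 * dn k n" for k n
  proof -
    have ap: "sqint lborel (\<lambda>x. w n x - avg ((1/2)^k) (w n) x)" "nsq lborel (\<lambda>x. w n x - avg ((1/2)^k) (w n) x) \<le> (1/2)^k * N\<^sup>2"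
      by (rule avg_approx[OF w], simp)+
    have s2: "sqint lborel (\<lambda>x. rho x * (avg ((1/2)^k) (w n) x - b k x))"
    proof -
      have "sqint lborel (\<lambda>x. (rho x * w n x - rho x * b k x) - rho x * (w n x - avg ((1/2)^k) (w n) x))"
        by (intro sqint_diff(1) sqint_rho(1) w2 bg ap)
      then show ?thesis by (simp add: algebra_simps)
    qed
    have "nsq lborel (\<lambda>x. rho x * (w n x - avg ((1/2)^k) (w n) x) + rho x * (avg ((1/2)^k) (w n) x - b k x))
      \<le> 2 * nsq lborel (\<lambda>x. rho x * (w n x - avg ((1/2)^k) (w n) x)) + 2 * dn k n"
      unfolding dn_def by (intro sqint_add(2) sqint_rho ap s2)
    also have "(\<lambda>x. rho x * (w n x - avg ((1/2)^k) (w n) x) + rho x * (avg ((1/2)^k) (w n) x - b k x))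
      = (\<lambda>x. rho x * w n x - rho x * b k x)" by (simp add: algebra_simps)
    finally show ?thesis using sqint_rho(2)[OF ap(1)] ap(2) by linarith
  qed
  obtain g q where g: "sqint lborel g" "(\<lambda>n. nsq lborel (\<lambda>x. rho x * w n x - g x)) \<longlonglongrightarrow> 0"
    and q: "strict_mono (q :: nat \<Rightarrow> nat)" "AE x in lborel. (\<lambda>k. rho x * w (q k) x) \<longlonglongrightarrow> g x"
  proof (rule L2_complete[of lborel "\<lambda>n x. rho x * w n x"])
    show "sqint lborel (\<lambda>x. rho x * w n x)" for n by (rule sqint_rho[OF w2])
    fix e :: real assume e: "e > 0"
    \<comment> \<open>Two terms below e / 16 give e / 4 in \<open>step\<close>, and two such
      distances give e in \<open>sqint_diff\<close>, each time with the factor 2.\<close>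
    then obtain k where k: "(1/2)^k < e / (16 * N\<^sup>2)" using N real_arch_pow_inv[of "e / (16 * N\<^sup>2)" "1/2"] by auto
    then have k': "(1/2)^k * N\<^sup>2 < e / 16" using N by (simp add: field_simps)
    have "\<forall>\<^sub>F n in sequentially. dn k n < e / 16"
      unfolding dn_def by (rule order_tendstoD(2)[OF dom]) (use e in simp)
    then obtain M where M: "\<And>n. n \<ge> M \<Longrightarrow> dn k n < e / 16" by (auto simp: eventually_sequentially)
    show "\<exists>M. \<forall>m\<ge>M. \<forall>n\<ge>M. nsq lborel (\<lambda>x. rho x * w m x - rho x * w n x) < e"
    proof (intro exI[of _ M] allI impI)
      fix m n assume "M \<le> m" "M \<le> n"
      then have "nsq lborel (\<lambda>x. rho x * w m x - rho x * b k x) < e / 4" "nsq lborel (\<lambda>x. rho x * w n x - rho x * b k x) < e / 4"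
        using step[of m k] step[of n k] M[of m] M[of n] k' by auto
      moreover have "nsq lborel (\<lambda>x. (rho x * w m x - rho x * b k x) - (rho x * w n x - rho x * b k x))
        \<le> 2 * nsq lborel (\<lambda>x. rho x * w m x - rho x * b k x) + 2 * nsq lborel (\<lambda>x. rho x * w n x - rho x * b k x)"
        by (intro sqint_diff(2) sqint_diff(1) sqint_rho w2 bg)
      ultimately show "nsq lborel (\<lambda>x. rho x * w m x - rho x * w n x) < e" by simp
    qed
  qed
  have [measurable]: "g \<in> borel_measurable borel" using sqint_measurable[OF g(1)] by simp
  \<comment> \<open>Dividing by the weight could lead out of L^2; the unweighted bound follows from
    Fatou along the almost everywhere convergent subsequence.\<close>
  define v where "v x = g x / rho x" for x
  have rv: "rho x * v x = g x" for x using rho_props(1)[of x] by (simp add: v_def)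
  have vm: "v \<in> borel_measurable lborel" unfolding v_def by measurable
  have "AE x in lborel. (\<lambda>k. w (q k) x) \<longlonglongrightarrow> v x"
    using q(2)
  proof eventually_elim
    case (elim x)
    then have "(\<lambda>k. rho x * w (q k) x / rho x) \<longlonglongrightarrow> g x / rho x" using rho_props(1)[of x] by (intro tendsto_intros) auto
    then show ?case using rho_props(1)[of x] by (simp add: v_def)
  qed
  then have v: "sqint lborel v" "nsq lborel v \<le> N\<^sup>2"
    using nsq_fatou[of lborel "\<lambda>k. w (q k)", OF w2 vm, of "N\<^sup>2"] w by (auto simp: Hhalf_def)
  have "(\<lambda>n. nsq lborel (\<lambda>x. rho x * (u (r n) x - v x))) \<longlonglongrightarrow> 0"
    using g(2) by (simp add: right_diff_distrib rv w_def)
  then show thesis using that r v by blast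
qed

section \<open>Local convergence, weak limits and multiplier forms\<close>

lemma weak_null:
  fixes v :: "nat \<Rightarrow> real \<Rightarrow> real" and h :: "real \<Rightarrow> 'b::{banach,second_countable_topology}"
  assumes v: "\<And>n. sqint lborel (v n)" "\<And>n. nsq lborel (v n) \<le> B"
    and l: "(\<lambda>n. nsq lborel (\<lambda>x. rho x * v n x)) \<longlonglongrightarrow> 0" and h: "sqint lborel h"
  shows "(\<lambda>n. \<integral>x. norm (v n x) * norm (h x) \<partial>lborel) \<longlonglongrightarrow> 0"
proof (rule LIMSEQ_I)
  fix e :: real assume e: "e > 0"
  have [measurable]: "h \<in> borel_measurable borel" using sqint_measurable[OF h] by simp
  define B' where "B' = B + 1"
  have B': "B' > 0" "\<And>n. nsq lborel (v n) \<le> B'"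
    using order_trans[OF nsq_nonneg v(2)[of 0]] v(2) by (auto simp: B'_def intro: add_increasing2)
  \<comment> \<open>The part of h where the weight is small has small norm and needs only the bound
    on v n; elsewhere 1 <= (j + 1) rho, and the weighted convergence applies.\<close>
  let ?t = "\<lambda>j x. (if rho x < 1 / real (Suc j) then h x else 0)"
  have t: "sqint lborel (?t j)" for j by (rule sqint_bound(1)[OF h]) auto
  have "(\<lambda>j. nsq lborel (?t j)) \<longlonglongrightarrow> 0"
  proof (rule nsq_tendsto_dominated[OF _ sqint_integrable[OF h]])
    show "AE x in lborel. (\<lambda>j. ?t j x) \<longlonglongrightarrow> 0"
    proof (intro AE_I2 tendsto_eventually)
      fix x
      have "\<forall>\<^sub>F j in sequentially. 1 / real (Suc j) < rho x"
        using order_tendstoD(2)[OF LIMSEQ_inverse_real_of_nat rho_props(1)[of x]] by (simp add: inverse_eq_divide)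
      then show "\<forall>\<^sub>F j in sequentially. ?t j x = 0" by eventually_elim auto
    qed
  qed auto
  then have "(\<lambda>j. sqrt B' * sqrt (nsq lborel (?t j))) \<longlonglongrightarrow> sqrt B' * sqrt 0" by (intro tendsto_intros)
  then have "\<forall>\<^sub>F j in sequentially. sqrt B' * sqrt (nsq lborel (?t j)) < e / 2"
    by (rule order_tendstoD) (use e in simp)
  then obtain j where j: "sqrt B' * sqrt (nsq lborel (?t j)) < e / 2" by (auto simp: eventually_sequentially)
  have "(\<lambda>n. real (Suc j) * (sqrt (nsq lborel (\<lambda>x. rho x * v n x)) * sqrt (nsq lborel h))) \<longlonglongrightarrow> real (Suc j) * (sqrt 0 * sqrt (nsq lborel h))"
    by (intro tendsto_mult_left tendsto_mult_right tendsto_real_sqrt l)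
  then have "\<forall>\<^sub>F n in sequentially. real (Suc j) * (sqrt (nsq lborel (\<lambda>x. rho x * v n x)) * sqrt (nsq lborel h)) < e / 2"
    by (rule order_tendstoD) (use e in simp)
  then obtain M where M: "\<And>n. n \<ge> M \<Longrightarrow> real (Suc j) * (sqrt (nsq lborel (\<lambda>x. rho x * v n x)) * sqrt (nsq lborel h)) < e / 2"
    by (auto simp: eventually_sequentially)
  have "(\<integral>x. norm (v n x) * norm (h x) \<partial>lborel) < e" if "n \<ge> M" for n
  proof -
    note rv = sqint_rho(1)[OF v(1)[of n]]
    have i: "integrable lborel (\<lambda>x. norm (rho x * v n x) * norm (h x))" "integrable lborel (\<lambda>x. norm (v n x) * norm (?t j x))"
      by (intro sqint_times_norm_integrable rv h v t)+
    have "(\<integral>x. norm (v n x) * norm (h x) \<partial>lborel)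
      \<le> (\<integral>x. real (Suc j) * (norm (rho x * v n x) * norm (h x)) + norm (v n x) * norm (?t j x) \<partial>lborel)"
    proof (rule integral_mono)
      show "integrable lborel (\<lambda>x. norm (v n x) * norm (h x))" by (intro sqint_times_norm_integrable v h)
      show "integrable lborel (\<lambda>x. real (Suc j) * (norm (rho x * v n x) * norm (h x)) + norm (v n x) * norm (?t j x))"
        by (intro Bochner_Integration.integrable_add integrable_mult_right i)
      fix x
      show "norm (v n x) * norm (h x) \<le> real (Suc j) * (norm (rho x * v n x) * norm (h x)) + norm (v n x) * norm (?t j x)"
      proof (cases "rho x < 1 / real (Suc j)")
        case True
        then show ?thesis by simp
      next
        case False
        then have "1 \<le> real (Suc j) * rho x" by (simp add: pos_divide_le_eq mult.commute not_less)
        then have "1 * (norm (v n x) * norm (h x)) \<le> (real (Suc j) * rho x) * (norm (v n x) * norm (h x))"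
          by (intro mult_right_mono) auto
        then show ?thesis using rho_props(1)[of x] by (simp add: abs_mult mult.assoc False)
      qed
    qed
    also have "\<dots> = real (Suc j) * (\<integral>x. norm (rho x * v n x) * norm (h x) \<partial>lborel) + (\<integral>x. norm (v n x) * norm (?t j x) \<partial>lborel)"
      by (simp only: Bochner_Integration.integral_add[OF integrable_mult_right[OF i(1)] i(2)] integral_mult_right_zero)
    also have "\<dots> \<le> real (Suc j) * (sqrt (nsq lborel (\<lambda>x. rho x * v n x)) * sqrt (nsq lborel h)) + sqrt (nsq lborel (v n)) * sqrt (nsq lborel (?t j))"
      by (intro add_mono mult_left_mono cauchy_schwarz rv h v t) simp
    also have "\<dots> \<le> real (Suc j) * (sqrt (nsq lborel (\<lambda>x. rho x * v n x)) * sqrt (nsq lborel h)) + sqrt B' * sqrt (nsq lborel (?t j))"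
      by (intro add_mono order_refl mult_right_mono real_sqrt_le_mono B') simp
    also have "\<dots> < e" using M[OF that] j by linarith
    finally show ?thesis .
  qed
  moreover have "0 \<le> (\<integral>x. norm (v n x) * norm (h x) \<partial>lborel)" for n by simp
  ultimately show "\<exists>no. \<forall>n\<ge>no. norm ((\<integral>x. norm (v n x) * norm (h x) \<partial>lborel) - 0) < e"
    by (intro exI[of _ M]) (simp only: real_norm_def diff_0_right abs_of_nonneg, blast)
qed

text \<open>By duality the pairing becomes one of u n - v with the fixed square integrable function
  \<open>ft g\<close>, and \<open>weak_null\<close> applies. Local convergence is thus turned into
  weak convergence of the transforms.\<close>

lemma fourier_weak_limit:
  assumes u: "\<And>n. sqint lborel (u n)" and v: "sqint lborel v" and B: "\<And>n. nsq lborel (\<lambda>x. u n x - v x) \<le> B"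
    and l: "(\<lambda>n. nsq lborel (\<lambda>x. rho x * (u n x - v x))) \<longlonglongrightarrow> 0"
    and g: "integrable lborel g" "sqint lborel g"
  shows "(\<lambda>n. \<integral>\<xi>. fourier (u n) \<xi> * g \<xi> \<partial>lborel) \<longlonglongrightarrow> (\<integral>\<xi>. fourier v \<xi> * g \<xi> \<partial>lborel)"
  unfolding fourier_dual[OF u g] fourier_dual[OF v g]
proof (rule LIM_zero_cancel, rule Lim_null_comparison)
  have g2: "sqint lborel (ft g)" by (rule plancherel_L1_L2[OF g])
  have d: "sqint lborel (\<lambda>x. u n x - v x)" for n by (intro sqint_diff u v)
  show "(\<lambda>n. \<integral>x. norm (u n x - v x) * norm (ft g x) \<partial>lborel) \<longlonglongrightarrow> 0"
    by (rule weak_null[OF d B l g2])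
  have "norm ((\<integral>x. complex_of_real (u n x) * ft g x \<partial>lborel) - (\<integral>x. complex_of_real (v x) * ft g x \<partial>lborel))
     = norm (\<integral>x. complex_of_real (u n x - v x) * ft g x \<partial>lborel)" for n
    by (subst Bochner_Integration.integral_diff[symmetric])
      (auto intro!: sqint_times_integrable sqint_of_real u v g2 simp: left_diff_distrib)
  also have "\<dots> n \<le> (\<integral>x. norm (complex_of_real (u n x - v x) * ft g x) \<partial>lborel)" for n
    by (rule integral_norm_bound)
  also have "(\<integral>x. norm (complex_of_real (u n x - v x) * ft g x) \<partial>lborel) = (\<integral>x. norm (u n x - v x) * norm (ft g x) \<partial>lborel)" for n
    by (intro Bochner_Integration.integral_cong refl) (simp only: norm_mult norm_of_real real_norm_def)
  finally show "\<forall>\<^sub>F n in sequentially. norm ((\<integral>x. complex_of_real (u n x) * ft g x \<partial>lborel) - (\<integral>x. complex_of_real (v x) * ft g x \<partial>lborel))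
     \<le> (\<integral>x. norm (u n x - v x) * norm (ft g x) \<partial>lborel)" by (intro always_eventually allI)
qed

lemma sqint_cnj:
  assumes "sqint M f"
  shows "sqint M (\<lambda>x. cnj (f x))" "nsq M (\<lambda>x. cnj (f x)) = nsq M f"
  using assms unfolding sqint_def nsq_def complex_mod_cnj by (auto intro: borel_measurable_cnj)

lemma mfin_sqint:
  assumes m: "mult_ok m" and u: "mfin m u"
  shows "sqint lborel (\<lambda>\<xi>. sqrt (m \<xi>) *\<^sub>R fourier u \<xi>)"
    "nsq lborel (\<lambda>\<xi>. sqrt (m \<xi>) *\<^sub>R fourier u \<xi>) = 2 * pi * mform m u u"
proof -
  have [measurable]: "m \<in> borel_measurable borel" "fourier u \<in> borel_measurable borel"
    using m u by (auto simp: mult_ok_def mfin_def intro: fourier_measurable)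
  have eq: "(norm (sqrt (m \<xi>) *\<^sub>R fourier u \<xi>))\<^sup>2 = m \<xi> * (cmod (fourier u \<xi>))\<^sup>2" for \<xi>
    using m by (simp add: power_mult_distrib mult_ok_def)
  have "(\<lambda>\<xi>. sqrt (m \<xi>) *\<^sub>R fourier u \<xi>) \<in> borel_measurable lborel" by measurable
  then show "sqint lborel (\<lambda>\<xi>. sqrt (m \<xi>) *\<^sub>R fourier u \<xi>)"
    "nsq lborel (\<lambda>\<xi>. sqrt (m \<xi>) *\<^sub>R fourier u \<xi>) = 2 * pi * mform m u u"
    unfolding sqint_def nsq_def eq mform_diag using u by (simp_all add: mfin_def)
qed

text \<open>Bounds the frequency and the symbol at once, since the symbols in use are unbounded at
  infinity or at the origin. With this cutoff the weighted transform of a fixed function becomes a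
  test function for weak convergence.\<close>

definition cut :: "(real \<Rightarrow> real) \<Rightarrow> nat \<Rightarrow> real \<Rightarrow> real" where
  "cut m j \<xi> = (if \<bar>\<xi>\<bar> \<le> real j \<and> m \<xi> \<le> real j then 1 else 0)"

lemma cut_measurable[measurable]: "m \<in> borel_measurable borel \<Longrightarrow> cut m j \<in> borel_measurable borel"
  unfolding cut_def[abs_def] by measurable

lemma cut_eventually: "\<forall>\<^sub>F j in sequentially. cut m j \<xi> = 1"
proof -
  obtain N where "real N \<ge> max \<bar>\<xi>\<bar> (m \<xi>)" using real_arch_simple by blast
  then have "cut m j \<xi> = 1" if "j \<ge> N" for j
  proof -
    have "real j \<ge> real N" using that by simp
    then show ?thesis using \<open>real N \<ge> max \<bar>\<xi>\<bar> (m \<xi>)\<close> by (simp add: cut_def)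
  qed
  then show ?thesis unfolding eventually_sequentially by blast
qed

lemma cut_weight:
  assumes m: "mult_ok m" and v: "sqint lborel v"
  defines "g \<equiv> \<lambda>j \<xi>. (cut m j \<xi> * m \<xi>) *\<^sub>R cnj (fourier v \<xi>)"
  shows "integrable lborel (g j)" "sqint lborel (g j)"
    "sqint lborel (\<lambda>\<xi>. (cut m j \<xi> * sqrt (m \<xi>)) *\<^sub>R fourier v \<xi>)"
proof -
  have [measurable]: "m \<in> borel_measurable borel" "fourier v \<in> borel_measurable borel"
    using m v by (auto simp: mult_ok_def intro: fourier_measurable)
  have m0: "m \<xi> \<ge> 0" for \<xi> using m by (simp add: mult_ok_def)
  have F: "sqint lborel (\<lambda>\<xi>. cnj (fourier v \<xi>))" using fourier_L2(1)[OF v] by (auto simp: sqint_def)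
  have jF: "sqint lborel (\<lambda>\<xi>. real j *\<^sub>R cnj (fourier v \<xi>))" "sqint lborel (\<lambda>\<xi>. sqrt (real j) *\<^sub>R fourier v \<xi>)"
    by (intro sqint_scaleR F fourier_L2 v)+
  show g2: "sqint lborel (g j)"
  proof (rule sqint_bound(1)[OF jF(1)])
    show "g j \<in> borel_measurable lborel" unfolding g_def by measurable
    have "cut m j \<xi> * m \<xi> \<le> real j" for \<xi> by (auto simp: cut_def)
    then show "AE \<xi> in lborel. norm (g j \<xi>) \<le> norm (real j *\<^sub>R cnj (fourier v \<xi>))"
      using m0 by (intro AE_I2) (auto simp: g_def abs_mult cut_def intro!: mult_right_mono)
  qed
  show "sqint lborel (\<lambda>\<xi>. (cut m j \<xi> * sqrt (m \<xi>)) *\<^sub>R fourier v \<xi>)"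
  proof (rule sqint_bound(1)[OF jF(2)])
    show "AE \<xi> in lborel. norm ((cut m j \<xi> * sqrt (m \<xi>)) *\<^sub>R fourier v \<xi>) \<le> norm (sqrt (real j) *\<^sub>R fourier v \<xi>)"
      using m0 by (intro AE_I2) (auto simp: abs_mult cut_def intro!: mult_right_mono)
  qed measurable
  have "integrable lborel (\<lambda>\<xi>. complex_of_real (indicat_real {- real j..real j} \<xi>) * g j \<xi>)"
    by (rule sqint_times_integrable[OF sqint_of_real(1)[OF indicator_Icc_sqint(1)] g2])
  also have "(\<lambda>\<xi>. complex_of_real (indicat_real {- real j..real j} \<xi>) * g j \<xi>) = g j"
    by (intro ext) (auto simp: g_def cut_def indicator_def)
  finally show "integrable lborel (g j)" .
qed

lemma integral_cut_product_le:
  assumes m: "mult_ok m" and u: "mfin m u" and v: "sqint lborel v"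
  shows "norm (\<integral>\<xi>. fourier u \<xi> * ((cut m j \<xi> * m \<xi>) *\<^sub>R cnj (fourier v \<xi>)) \<partial>lborel)
    \<le> sqrt (2 * pi * mform m u u) * sqrt (nsq lborel (\<lambda>\<xi>. (cut m j \<xi> * sqrt (m \<xi>)) *\<^sub>R fourier v \<xi>))"
proof -
  have m0: "m \<xi> \<ge> 0" for \<xi> using m by (simp add: mult_ok_def)
  note s = cut_weight(3)[OF m v, of j]
  note sc = sqint_cnj[OF s]
  have "(\<integral>\<xi>. fourier u \<xi> * ((cut m j \<xi> * m \<xi>) *\<^sub>R cnj (fourier v \<xi>)) \<partial>lborel)
    = (\<integral>\<xi>. (sqrt (m \<xi>) *\<^sub>R fourier u \<xi>) * cnj ((cut m j \<xi> * sqrt (m \<xi>)) *\<^sub>R fourier v \<xi>) \<partial>lborel)"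
  proof (rule Bochner_Integration.integral_cong[OF refl])
    fix \<xi>
    have "cut m j \<xi> * m \<xi> = sqrt (m \<xi>) * (cut m j \<xi> * sqrt (m \<xi>))" using m0[of \<xi>] by simp
    then show "fourier u \<xi> * ((cut m j \<xi> * m \<xi>) *\<^sub>R cnj (fourier v \<xi>))
      = (sqrt (m \<xi>) *\<^sub>R fourier u \<xi>) * cnj ((cut m j \<xi> * sqrt (m \<xi>)) *\<^sub>R fourier v \<xi>)"
      by (simp only: scaleR_conv_of_real complex_cnj_mult complex_cnj_complex_of_real of_real_mult mult_ac)
  qed
  then show ?thesis
    using cauchy_schwarz_prod[OF mfin_sqint(1)[OF m u] sc(1)] by (simp only: mfin_sqint(2)[OF m u] sc(2))
qed

text \<open>Testing with the cut-off form of v itself bounds its squared cut-off norm by sqrt(2 pi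
  M) times that norm. After division the bound no longer involves the cutoff, and Fatou removes
  it.\<close>

lemma mfin_weak_limit:
  assumes m: "mult_ok m" and u: "\<And>n. mfin m (u n)" "\<And>n. mform m (u n) (u n) \<le> M" and v: "sqint lborel v"
    and B: "\<And>n. nsq lborel (\<lambda>x. u n x - v x) \<le> B"
    and l: "(\<lambda>n. nsq lborel (\<lambda>x. rho x * (u n x - v x))) \<longlonglongrightarrow> 0"
  shows "mfin m v"
proof -
  have [measurable]: "m \<in> borel_measurable borel" "fourier v \<in> borel_measurable borel"
    using m v by (auto simp: mult_ok_def intro: fourier_measurable)
  have m0: "m \<xi> \<ge> 0" for \<xi> using m by (simp add: mult_ok_def)
  have u2: "sqint lborel (u n)" for n using u(1) by (simp add: mfin_def)
  have M0: "M \<ge> 0" using mform_nonneg[OF m, of "u 0"] u(2)[of 0] by linarith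
  let ?s = "\<lambda>j \<xi>. (cut m j \<xi> * sqrt (m \<xi>)) *\<^sub>R fourier v \<xi>"
  have s: "sqint lborel (?s j)" for j by (rule cut_weight(3)[OF m v])
  have "nsq lborel (?s j) \<le> 2 * pi * M" for j
  proof -
    let ?g = "\<lambda>\<xi>. (cut m j \<xi> * m \<xi>) *\<^sub>R cnj (fourier v \<xi>)"
    have "(\<lambda>n. norm (\<integral>\<xi>. fourier (u n) \<xi> * ?g \<xi> \<partial>lborel)) \<longlonglongrightarrow> norm (\<integral>\<xi>. fourier v \<xi> * ?g \<xi> \<partial>lborel)"
      by (intro tendsto_norm fourier_weak_limit[OF u2 v B l] cut_weight[OF m v])
    moreover have "fourier v \<xi> * ?g \<xi> = complex_of_real ((norm (?s j \<xi>))\<^sup>2)" for \<xi>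
    proof -
      have "complex_of_real ((norm (?s j \<xi>))\<^sup>2) = of_real (cut m j \<xi> * m \<xi>) * of_real ((cmod (fourier v \<xi>))\<^sup>2)"
        using m0[of \<xi>] by (auto simp: cut_def power_mult_distrib)
      then show ?thesis by (simp only: complex_norm_square scaleR_conv_of_real mult_ac)
    qed
    ultimately have "(\<lambda>n. norm (\<integral>\<xi>. fourier (u n) \<xi> * ?g \<xi> \<partial>lborel)) \<longlonglongrightarrow> norm (\<integral>\<xi>. complex_of_real ((norm (?s j \<xi>))\<^sup>2) \<partial>lborel)"
      by simp
    also have "(\<integral>\<xi>. complex_of_real ((norm (?s j \<xi>))\<^sup>2) \<partial>lborel) = complex_of_real (nsq lborel (?s j))"
      unfolding nsq_def by (rule integral_of_real[OF sqint_integrable[OF s]])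
    finally have "(\<lambda>n. norm (\<integral>\<xi>. fourier (u n) \<xi> * ?g \<xi> \<partial>lborel)) \<longlonglongrightarrow> nsq lborel (?s j)" by simp
    moreover have "norm (\<integral>\<xi>. fourier (u n) \<xi> * ?g \<xi> \<partial>lborel) \<le> sqrt (2 * pi * M) * sqrt (nsq lborel (?s j))" for n
    proof -
      have "norm (\<integral>\<xi>. fourier (u n) \<xi> * ?g \<xi> \<partial>lborel) \<le> sqrt (2 * pi * mform m (u n) (u n)) * sqrt (nsq lborel (?s j))"
        by (rule integral_cut_product_le[OF m u(1) v])
      also have "\<dots> \<le> sqrt (2 * pi * M) * sqrt (nsq lborel (?s j))"
        using u(2)[of n] by (intro mult_right_mono real_sqrt_le_mono mult_left_mono) auto
      finally show ?thesis .
    qed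
    ultimately have "nsq lborel (?s j) \<le> sqrt (2 * pi * M) * sqrt (nsq lborel (?s j))"
      by (intro tendsto_upperbound[where F=sequentially]) auto
    then have le: "sqrt (nsq lborel (?s j)) * sqrt (nsq lborel (?s j)) \<le> sqrt (2 * pi * M) * sqrt (nsq lborel (?s j))" by simp
    have "sqrt (nsq lborel (?s j)) \<le> sqrt (2 * pi * M)"
    proof (cases "nsq lborel (?s j) = 0")
      case False
      have "0 < nsq lborel (?s j)" by (rule le_neq_trans[OF nsq_nonneg False[symmetric]])
      then have "0 < sqrt (nsq lborel (?s j))" by (simp only: real_sqrt_gt_0_iff)
      with le show ?thesis by (rule mult_right_le_imp_le)
    qed (use M0 in simp)
    then show ?thesis by simp
  qed
  then have ev: "\<forall>\<^sub>F j in sequentially. nsq lborel (?s j) \<le> 2 * pi * M" by (intro always_eventually allI)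
  have "sqint lborel (\<lambda>\<xi>. sqrt (m \<xi>) *\<^sub>R fourier v \<xi>)"
  proof (rule nsq_fatou(1)[OF s _ _ ev])
    show "AE \<xi> in lborel. (\<lambda>j. ?s j \<xi>) \<longlonglongrightarrow> sqrt (m \<xi>) *\<^sub>R fourier v \<xi>"
    proof (intro AE_I2 tendsto_eventually)
      fix \<xi>
      show "\<forall>\<^sub>F j in sequentially. ?s j \<xi> = sqrt (m \<xi>) *\<^sub>R fourier v \<xi>"
        using cut_eventually[of m \<xi>] by eventually_elim simp
    qed
  qed measurable
  then show "mfin m v"
    using v m0 by (simp add: mfin_def sqint_def power_mult_distrib)
qed

text \<open>The cut-off part of v is a test function, so its pairing tends to 0; the rest of v is
  small in the weighted norm, and Cauchy-Schwarz makes its contribution small uniformly in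
  n.\<close>

lemma mform_weak_null:
  assumes m: "mult_ok m" and w: "\<And>n. mfin m (w n)" "\<And>n. mform m (w n) (w n) \<le> M" and v: "mfin m v"
    and weak: "\<And>g. integrable lborel g \<Longrightarrow> sqint lborel g \<Longrightarrow> (\<lambda>n. \<integral>\<xi>. fourier (w n) \<xi> * g \<xi> \<partial>lborel) \<longlonglongrightarrow> 0"
  shows "(\<lambda>n. mform m (w n) v) \<longlonglongrightarrow> 0"
proof -
  have v2: "sqint lborel v" and w2: "sqint lborel (w n)" for n using v w(1) by (auto simp: mfin_def)
  have [measurable]: "m \<in> borel_measurable borel" "fourier v \<in> borel_measurable borel" "fourier (w n) \<in> borel_measurable borel" for n
    using m v2 w2 by (auto simp: mult_ok_def intro: fourier_measurable)
  have m0: "m \<xi> \<ge> 0" for \<xi> using m by (simp add: mult_ok_def)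
  have M0: "M \<ge> 0" using mform_nonneg[OF m, of "w 0"] w(2)[of 0] by linarith
  let ?V = "\<lambda>\<xi>. sqrt (m \<xi>) *\<^sub>R fourier v \<xi>" and ?W = "\<lambda>n \<xi>. sqrt (m \<xi>) *\<^sub>R fourier (w n) \<xi>"
  let ?g = "\<lambda>j \<xi>. (cut m j \<xi> * m \<xi>) *\<^sub>R cnj (fourier v \<xi>)"
  let ?r = "\<lambda>j \<xi>. (1 - cut m j \<xi>) *\<^sub>R ?V \<xi>"
  note V = mfin_sqint(1)[OF m v] and W = mfin_sqint[OF m w(1)]
  have r: "sqint lborel (?r j)" for j by (rule sqint_bound(1)[OF V]) (auto simp: cut_def)
  have rlim: "(\<lambda>j. nsq lborel (?r j)) \<longlonglongrightarrow> 0"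
  proof (rule nsq_tendsto_dominated[OF _ sqint_integrable[OF V]])
    show "AE \<xi> in lborel. (\<lambda>j. ?r j \<xi>) \<longlonglongrightarrow> 0"
    proof (intro AE_I2 tendsto_eventually)
      fix \<xi> show "\<forall>\<^sub>F j in sequentially. ?r j \<xi> = 0"
        using cut_eventually[of m \<xi>] by eventually_elim simp
    qed
    show "AE \<xi> in lborel. (norm (?r j \<xi>))\<^sup>2 \<le> (norm (?V \<xi>))\<^sup>2" for j by (intro AE_I2) (auto simp: cut_def)
  qed measurable
  have split: "2 * pi * mform m (w n) v = Re (\<integral>\<xi>. fourier (w n) \<xi> * ?g j \<xi> \<partial>lborel) + Re (\<integral>\<xi>. ?W n \<xi> * cnj (?r j \<xi>) \<partial>lborel)" for n j
  proof -
    have i1: "integrable lborel (\<lambda>\<xi>. fourier (w n) \<xi> * ?g j \<xi>)"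
      by (intro sqint_times_integrable fourier_L2 w2 cut_weight[OF m v2])
    note rc = sqint_cnj[OF r[of j]]
    have i2: "integrable lborel (\<lambda>\<xi>. ?W n \<xi> * cnj (?r j \<xi>))"
      by (rule sqint_times_integrable[OF W(1) rc(1)])
    have "2 * pi * mform m (w n) v = (\<integral>\<xi>. Re (fourier (w n) \<xi> * ?g j \<xi> + ?W n \<xi> * cnj (?r j \<xi>)) \<partial>lborel)"
      unfolding mform_def
    proof -
      have "m \<xi> * Re (fourier (w n) \<xi> * cnj (fourier v \<xi>)) = Re (fourier (w n) \<xi> * ?g j \<xi> + ?W n \<xi> * cnj (?r j \<xi>))" for \<xi>
      proof -
        have "?W n \<xi> * cnj (?r j \<xi>) = ((sqrt (m \<xi>) * sqrt (m \<xi>)) * (1 - cut m j \<xi>)) *\<^sub>R (fourier (w n) \<xi> * cnj (fourier v \<xi>))"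
          by (simp only: scaleR_conv_of_real complex_cnj_mult complex_cnj_complex_of_real of_real_mult mult_ac)
        also have "\<dots> = (m \<xi> * (1 - cut m j \<xi>)) *\<^sub>R (fourier (w n) \<xi> * cnj (fourier v \<xi>))" using m0[of \<xi>] by simp
        finally have a: "?W n \<xi> * cnj (?r j \<xi>) = (m \<xi> * (1 - cut m j \<xi>)) *\<^sub>R (fourier (w n) \<xi> * cnj (fourier v \<xi>))" .
        have b: "fourier (w n) \<xi> * ?g j \<xi> = (cut m j \<xi> * m \<xi>) *\<^sub>R (fourier (w n) \<xi> * cnj (fourier v \<xi>))" by simp
        have "Re (c *\<^sub>R z + d *\<^sub>R z) = (c + d) * Re z" for c d z by (simp add: distrib_right)
        then show ?thesis unfolding a b by (simp only:) (simp add: algebra_simps)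
      qed
      then have "(\<integral>\<xi>. m \<xi> * Re (fourier (w n) \<xi> * cnj (fourier v \<xi>)) \<partial>lborel)
        = (\<integral>\<xi>. Re (fourier (w n) \<xi> * ?g j \<xi> + ?W n \<xi> * cnj (?r j \<xi>)) \<partial>lborel)" by (simp only:)
      then show "2 * pi * (1 / (2 * pi) * (\<integral>\<xi>. m \<xi> * Re (fourier (w n) \<xi> * cnj (fourier v \<xi>)) \<partial>lborel))
        = (\<integral>\<xi>. Re (fourier (w n) \<xi> * ?g j \<xi> + ?W n \<xi> * cnj (?r j \<xi>)) \<partial>lborel)" by simp
    qed
    also have "\<dots> = Re (\<integral>\<xi>. fourier (w n) \<xi> * ?g j \<xi> + ?W n \<xi> * cnj (?r j \<xi>) \<partial>lborel)"
      by (rule integral_Re[OF Bochner_Integration.integrable_add[OF i1 i2]])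
    also have "\<dots> = Re (\<integral>\<xi>. fourier (w n) \<xi> * ?g j \<xi> \<partial>lborel) + Re (\<integral>\<xi>. ?W n \<xi> * cnj (?r j \<xi>) \<partial>lborel)"
      unfolding Bochner_Integration.integral_add[OF i1 i2] by simp
    finally show ?thesis .
  qed
  have bnd: "\<bar>Re (\<integral>\<xi>. ?W n \<xi> * cnj (?r j \<xi>) \<partial>lborel)\<bar> \<le> sqrt (2 * pi * M) * sqrt (nsq lborel (?r j))" for n j
  proof -
    note rc = sqint_cnj[OF r[of j]]
    have "\<bar>Re (\<integral>\<xi>. ?W n \<xi> * cnj (?r j \<xi>) \<partial>lborel)\<bar> \<le> norm (\<integral>\<xi>. ?W n \<xi> * cnj (?r j \<xi>) \<partial>lborel)" by (rule abs_Re_le_cmod)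
    also have "\<dots> \<le> sqrt (nsq lborel (?W n)) * sqrt (nsq lborel (?r j))"
      using cauchy_schwarz_prod[OF W(1)[of n] rc(1)] by (simp only: rc(2))
    also have "\<dots> \<le> sqrt (2 * pi * M) * sqrt (nsq lborel (?r j))"
      unfolding W(2) using w(2)[of n] by (intro mult_right_mono real_sqrt_le_mono mult_left_mono) auto
    finally show ?thesis .
  qed
  have "(\<lambda>n. 2 * pi * mform m (w n) v) \<longlonglongrightarrow> 0"
  proof (rule LIMSEQ_I)
    fix e :: real assume e: "e > 0"
    have "(\<lambda>j. sqrt (2 * pi * M) * sqrt (nsq lborel (?r j))) \<longlonglongrightarrow> sqrt (2 * pi * M) * sqrt 0"
      by (intro tendsto_mult_left tendsto_real_sqrt rlim)
    then have "\<forall>\<^sub>F j in sequentially. sqrt (2 * pi * M) * sqrt (nsq lborel (?r j)) < e / 2"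
      by (rule order_tendstoD) (use e in simp)
    then obtain j where j: "sqrt (2 * pi * M) * sqrt (nsq lborel (?r j)) < e / 2" by (auto simp: eventually_sequentially)
    have "(\<lambda>n. \<integral>\<xi>. fourier (w n) \<xi> * ?g j \<xi> \<partial>lborel) \<longlonglongrightarrow> 0" by (intro weak cut_weight[OF m v2])
    from LIMSEQ_D[OF this, of "e / 2"] e obtain N
      where N: "\<And>n. n \<ge> N \<Longrightarrow> norm (\<integral>\<xi>. fourier (w n) \<xi> * ?g j \<xi> \<partial>lborel) < e / 2" by auto
    have "norm (2 * pi * mform m (w n) v - 0) < e" if "n \<ge> N" for n
      unfolding split[of n j] real_norm_def
      using N[OF that] bnd[of n j] j abs_Re_le_cmod[of "\<integral>\<xi>. fourier (w n) \<xi> * ?g j \<xi> \<partial>lborel"] by linarith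
    then show "\<exists>N. \<forall>n\<ge>N. norm (2 * pi * mform m (w n) v - 0) < e" by blast
  qed
  then have "(\<lambda>n. (2 * pi * mform m (w n) v) / (2 * pi)) \<longlonglongrightarrow> 0 / (2 * pi)" by (intro tendsto_divide tendsto_const) auto
  then show ?thesis by simp
qed

text \<open>The square of |v|^r is |v| times |v|^(2r - 1): the first factor carries the weighted
  smallness, the second is bounded in L^2 by the embedding. One factor of the weight is dropped, as
  the weight is at most 1.\<close>

lemma rho_powr_null:
  assumes v: "\<And>n. Hhalf N (v n)" and N: "N > 0" and r: "r \<ge> 1"
    and l: "(\<lambda>n. nsq lborel (\<lambda>x. rho x * v n x)) \<longlonglongrightarrow> 0"
  shows "(\<lambda>n. nsq lborel (\<lambda>x. rho x * (\<bar>v n x\<bar> powr r))) \<longlonglongrightarrow> 0"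
proof (rule Lim_null_comparison)
  define C where "C = sqrt (sob (2 * (2 * r - 1)) * N powr (2 * (2 * r - 1)))"
  have "nsq lborel (\<lambda>x. rho x * (\<bar>v n x\<bar> powr r)) \<le> sqrt (nsq lborel (\<lambda>x. rho x * v n x)) * C" for n
  proof -
    note v2 = Hhalf_sqint[OF v[of n]]
    note q = powr_sqint[OF v[of n] N, of "2 * r - 1"] and q1 = powr_sqint(1)[OF v[of n] N r]
    have r1: "2 * r - 1 \<ge> 1" using r by simp
    have "nsq lborel (\<lambda>x. rho x * (\<bar>v n x\<bar> powr r)) \<le> (\<integral>x. norm (rho x * v n x) * norm (\<bar>v n x\<bar> powr (2 * r - 1)) \<partial>lborel)"
      unfolding nsq_def
    proof (rule integral_mono)
      show "integrable lborel (\<lambda>x. (norm (rho x * (\<bar>v n x\<bar> powr r)))\<^sup>2)" by (intro sqint_integrable sqint_rho q1)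
      show "integrable lborel (\<lambda>x. norm (rho x * v n x) * norm (\<bar>v n x\<bar> powr (2 * r - 1)))"
        by (intro sqint_times_norm_integrable sqint_rho v2 q(1) r1)
      fix x
      have "(\<bar>v n x\<bar> powr r)\<^sup>2 = \<bar>v n x\<bar> * \<bar>v n x\<bar> powr (2 * r - 1)"
        using r by (cases "v n x = 0") (auto simp: power2_eq_square powr_diff simp flip: powr_add)
      then have "(norm (rho x * (\<bar>v n x\<bar> powr r)))\<^sup>2 = (rho x)\<^sup>2 * (\<bar>v n x\<bar> * \<bar>v n x\<bar> powr (2 * r - 1))"
        by (simp add: power_mult_distrib)
      also have "\<dots> \<le> rho x * (\<bar>v n x\<bar> * \<bar>v n x\<bar> powr (2 * r - 1))"
      proof (rule mult_right_mono)
        show "(rho x)\<^sup>2 \<le> rho x"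
          unfolding power2_eq_square using rho_props(1,2)[of x] by (simp add: mult_left_le)
      qed simp
      also have "\<dots> = norm (rho x * v n x) * norm (\<bar>v n x\<bar> powr (2 * r - 1))"
        using rho_props(1)[of x] by (simp add: abs_mult)
      finally show "(norm (rho x * (\<bar>v n x\<bar> powr r)))\<^sup>2 \<le> norm (rho x * v n x) * norm (\<bar>v n x\<bar> powr (2 * r - 1))" .
    qed
    also have "\<dots> \<le> sqrt (nsq lborel (\<lambda>x. rho x * v n x)) * sqrt (nsq lborel (\<lambda>x. \<bar>v n x\<bar> powr (2 * r - 1)))"
      by (intro cauchy_schwarz sqint_rho v2 q(1) r1)
    also have "\<dots> \<le> sqrt (nsq lborel (\<lambda>x. rho x * v n x)) * C"
      unfolding C_def by (intro mult_left_mono real_sqrt_le_mono q(2) r1) simp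
    finally show ?thesis .
  qed
  then show "\<forall>\<^sub>F n in sequentially. norm (nsq lborel (\<lambda>x. rho x * (\<bar>v n x\<bar> powr r))) \<le> sqrt (nsq lborel (\<lambda>x. rho x * v n x)) * C"
    by simp
  have "(\<lambda>n. sqrt (nsq lborel (\<lambda>x. rho x * v n x)) * C) \<longlonglongrightarrow> sqrt 0 * C"
    by (intro tendsto_mult_right tendsto_real_sqrt l)
  then show "(\<lambda>n. sqrt (nsq lborel (\<lambda>x. rho x * v n x)) * C) \<longlonglongrightarrow> 0" by simp
qed

section \<open>The homogeneous nonlinearity\<close>

locale homogeneous_nonlinearity =
  fixes f F :: "real \<Rightarrow> real" and p :: real
  assumes p_gt: "p > 1"
    and f_C2: "C2_fun f"
    and f_hom: "\<And>t s. t > 0 \<Longrightarrow> f (t * s) = t powr p * f s"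
    and F_deriv: "\<And>s. (F has_real_derivative f s) (at s)"
    and F_0: "F 0 = 0"
    and F_neg: "\<exists>s0. F s0 < 0"
begin

lemma f_zero: "f 0 = 0"
proof -
  have "f 0 = 2 powr p * f 0" using f_hom[of 2 0] by simp
  then show ?thesis using p_gt by auto
qed

lemma f_sgn: "f s = \<bar>s\<bar> powr p * f (sgn s)"
proof (cases "s = 0")
  case False
  have "f (\<bar>s\<bar> * sgn s) = \<bar>s\<bar> powr p * f (sgn s)" by (rule f_hom) (use False in simp)
  then show ?thesis by (simp add: abs_mult_sgn)
qed (simp add: f_zero)

definition Cf :: real where "Cf = max \<bar>f 1\<bar> \<bar>f (-1)\<bar>"

lemma Cf_nonneg: "Cf \<ge> 0"
  by (simp add: Cf_def)

lemma f_bound: "\<bar>f s\<bar> \<le> Cf * \<bar>s\<bar> powr p"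
proof (cases "s = 0")
  case False
  then have "\<bar>f (sgn s)\<bar> \<le> Cf" by (auto simp: Cf_def sgn_if)
  then have "\<bar>s\<bar> powr p * \<bar>f (sgn s)\<bar> \<le> \<bar>s\<bar> powr p * Cf" by (rule mult_left_mono) simp
  then show ?thesis by (subst f_sgn) (simp add: abs_mult mult.commute)
qed (simp add: f_zero)

text \<open>Differentiate f(t s) = t^p f(s) in t at t = 1.\<close>

lemma euler:
  assumes "\<And>s. (f has_real_derivative f1 s) (at s)"
  shows "s * f1 s = p * f s"
proof -
  have a: "((\<lambda>t. f (t * s)) has_real_derivative f1 (1 * s) * s) (at 1)"
    by (rule DERIV_chain2[OF assms]) (auto intro!: derivative_eq_intros)
  have b: "((\<lambda>t. t powr p * f s) has_real_derivative p * f s) (at 1)"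
    by (auto intro!: derivative_eq_intros)
  have "\<forall>\<^sub>F t in nhds (1::real). f (t * s) = t powr p * f s"
    using eventually_nhds_in_open[of "{0<..}" "1::real"] by (auto elim!: eventually_mono simp: f_hom)
  then have "((\<lambda>t. f (t * s)) has_real_derivative p * f s) (at 1)"
    using b by (simp add: DERIV_cong_ev)
  from DERIV_unique[OF a this] show ?thesis by (simp add: mult.commute)
qed

text \<open>By Euler's relation both sides have the same derivative, and both vanish at 0.\<close>

lemma F_eq: "F s = s * f s / (p + 1)"
proof -
  obtain f1 where f1: "\<And>s. (f has_real_derivative f1 s) (at s)" using f_C2 by (auto simp: C2_fun_def)
  have "((\<lambda>s. F s - s * f s / (p + 1)) has_real_derivative 0) (at x)" for x
  proof -
    have "((\<lambda>s. F s - s * f s / (p + 1)) has_real_derivative (f x - (1 * f x + f1 x * x) / (p + 1))) (at x)"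
      by (rule DERIV_diff[OF F_deriv DERIV_cdivide[OF DERIV_mult[OF DERIV_ident f1]]])
    moreover have "(1 * f x + f1 x * x) / (p + 1) = f x"
      using euler[OF f1, of x] p_gt by (simp add: field_simps)
    ultimately show ?thesis by simp
  qed
  then have "F s - s * f s / (p + 1) = F 0 - 0 * f 0 / (p + 1)" by (rule DERIV_isconst_all[rule_format]) 
  then show ?thesis by (simp add: F_0)
qed

lemma F_hom: "t > 0 \<Longrightarrow> F (t * s) = t powr (p + 1) * F s"
  by (simp add: F_eq f_hom powr_add)

lemma F_bound: "\<bar>F s\<bar> \<le> Cf * \<bar>s\<bar> powr (p + 1)"
proof -
  have "\<bar>F s\<bar> = \<bar>s\<bar> * \<bar>f s\<bar> / (p + 1)" using p_gt by (simp add: F_eq abs_mult)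
  also have "\<dots> \<le> \<bar>s\<bar> * \<bar>f s\<bar>" using p_gt by (simp add: pos_divide_le_eq mult_left_mono distrib_left add_increasing)
  also have "\<dots> \<le> \<bar>s\<bar> * (Cf * \<bar>s\<bar> powr p)" by (intro mult_left_mono f_bound) simp
  also have "\<dots> = Cf * \<bar>s\<bar> powr (p + 1)" by (simp add: powr_add)
  finally show ?thesis .
qed

lemma f1_bound:
  assumes f1: "\<And>s. (f has_real_derivative f1 s) (at s)"
  shows "\<bar>f1 s\<bar> \<le> p * Cf * \<bar>s\<bar> powr (p - 1)"
proof (cases "s = 0")
  case False
  have "\<bar>s\<bar> * \<bar>f1 s\<bar> = p * \<bar>f s\<bar>" using arg_cong[OF euler[OF f1, of s], of abs] p_gt by (simp add: abs_mult)
  also have "\<dots> \<le> p * (Cf * \<bar>s\<bar> powr p)" using p_gt by (intro mult_left_mono f_bound) simp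
  also have "\<dots> = \<bar>s\<bar> * (p * Cf * \<bar>s\<bar> powr (p - 1))" using False by (simp add: powr_diff)
  finally show ?thesis using False by simp
next
  case True
  \<comment> \<open>At 0 Euler's relation degenerates to 0 = 0; the difference quotient is instead
    bounded by Cf |h|^(p - 1), which tends to 0.\<close>
  have l: "((\<lambda>h. (f (0 + h) - f 0) / h) \<longlongrightarrow> f1 0) (at 0)" using f1[of 0] by (simp add: DERIV_def)
  have "((\<lambda>h. (f (0 + h) - f 0) / h) \<longlongrightarrow> 0) (at 0)"
  proof (rule Lim_null_comparison)
    have "norm ((f (0 + h) - f 0) / h) \<le> Cf * \<bar>h\<bar> powr (p - 1)" if "h \<noteq> 0" for h
      using f_bound[of h] that by (simp add: f_zero powr_diff pos_divide_le_eq)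
    then show "\<forall>\<^sub>F h in at 0. norm ((f (0 + h) - f 0) / h) \<le> Cf * \<bar>h\<bar> powr (p - 1)"
      by (auto simp: eventually_at_filter)
    have "((\<lambda>h::real. Cf * \<bar>h\<bar> powr (p - 1)) \<longlongrightarrow> Cf * \<bar>0\<bar> powr (p - 1)) (at 0)"
      using p_gt by (intro tendsto_intros tendsto_powr') (auto simp: eventually_at_filter)
    then show "((\<lambda>h::real. Cf * \<bar>h\<bar> powr (p - 1)) \<longlongrightarrow> 0) (at 0)" by simp
  qed
  with l have "f1 0 = 0" by (rule tendsto_unique[OF trivial_limit_at])
  then show ?thesis using True by simp
qed

lemma f_nontrivial: "f 1 \<noteq> 0 \<or> f (-1) \<noteq> 0"
proof (rule ccontr)
  assume "\<not> ?thesis"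
  then have "Cf = 0" by (simp add: Cf_def)
  then have "F s = 0" for s using F_bound[of s] by simp
  then show False using F_neg by auto
qed

text \<open>For \<open>p < 2\<close> a nonzero \<open>p\<close>-homogeneous function is not twice differentiable at the origin.\<close>

lemma p_ge_2: "p \<ge> 2"
proof (rule ccontr)
  assume "\<not> p \<ge> 2"
  then have p2: "p < 2" by simp
  obtain f1 f2 where f1: "\<And>s. (f has_real_derivative f1 s) (at s)" and f2: "\<And>s. (f1 has_real_derivative f2 s) (at s)"
    using f_C2 by (auto simp: C2_fun_def)
  have f10: "f1 0 = 0" using f1_bound[OF f1, of 0] by simp
  have "f e = 0" if e: "e = 1 \<or> e = -1" for e
  proof -
    have e2: "e * e = 1" "e \<noteq> 0" using e by auto
    have l: "((\<lambda>h. (f1 (0 + h) - f1 0) / h) \<longlongrightarrow> f2 0) (at 0)" using f2[of 0] by (simp add: DERIV_def)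
    have te: "filterlim (\<lambda>t. t * e) (at 0) (at_right 0)"
      unfolding filterlim_at using e2
      by (auto intro!: tendsto_eq_intros simp: eventually_at_filter)
    have "((\<lambda>t. f1 (t * e) / (t * e)) \<longlongrightarrow> f2 0) (at_right 0)"
      using filterlim_compose[OF l te] by (simp add: f10)
    \<comment> \<open>Along the ray through e, Euler's relation makes this product the constant p
      f(e), while the quotient converges and t^(2 - p) tends to 0. So f(e) = 0.\<close>
    then have "((\<lambda>t. f1 (t * e) / (t * e) * t powr (2 - p)) \<longlongrightarrow> f2 0 * 0 powr (2 - p)) (at_right 0)"
      using p2 by (intro tendsto_mult tendsto_powr') (auto intro!: tendsto_intros simp: eventually_at_filter)
    moreover have "\<forall>\<^sub>F t in at_right 0. f1 (t * e) / (t * e) * t powr (2 - p) = p * f e"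
    proof (rule eventually_at_right_less[of 0, THEN eventually_mono])
      fix t :: real assume t: "0 < t"
      have te0: "t * e \<noteq> 0" using t e2 by simp
      have "(t * e) * f1 (t * e) = p * (t powr p * f e)" using euler[OF f1, of "t * e"] f_hom[OF t, of e] by simp
      moreover have "(t * e) * (t * e) = t powr 2" using e2 t by (simp add: power2_eq_square algebra_simps)
      moreover have "f1 (t * e) / (t * e) = ((t * e) * f1 (t * e)) / ((t * e) * (t * e))" using te0 by simp
      ultimately have "f1 (t * e) / (t * e) = p * (t powr p * f e) / t powr 2" by (simp only:)
      then show "f1 (t * e) / (t * e) * t powr (2 - p) = p * f e" using t by (simp add: powr_diff)
    qed
    ultimately have "((\<lambda>t::real. p * f e) \<longlongrightarrow> f2 0 * 0 powr (2 - p)) (at_right 0)"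
      by (rule Lim_transform_eventually)
    then have "p * f e = f2 0 * 0 powr (2 - p)" by (simp add: tendsto_const_iff)
    then show ?thesis using p_gt by simp
  qed
  then show False using f_nontrivial by auto
qed

lemma f_lipschitz: "\<bar>f x - f y\<bar> \<le> p * Cf * (\<bar>x\<bar> + \<bar>y\<bar>) powr (p - 1) * \<bar>x - y\<bar>"
proof -
  obtain f1 where f1: "\<And>s. (f has_real_derivative f1 s) (at s)" using f_C2 by (auto simp: C2_fun_def)
  have le: "\<bar>f b - f a\<bar> \<le> p * Cf * (\<bar>a\<bar> + \<bar>b\<bar>) powr (p - 1) * \<bar>b - a\<bar>" if ab: "a < b" for a b
  proof -
    obtain z where z: "a < z" "z < b" "f b - f a = (b - a) * f1 z"
      using MVT2[OF ab, of f f1] f1 by blast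
    have "\<bar>z\<bar> \<le> \<bar>a\<bar> + \<bar>b\<bar>" using z(1,2) by linarith
    then have "\<bar>z\<bar> powr (p - 1) \<le> (\<bar>a\<bar> + \<bar>b\<bar>) powr (p - 1)" using p_gt by (intro powr_mono2) auto
    then have "p * Cf * \<bar>z\<bar> powr (p - 1) \<le> p * Cf * (\<bar>a\<bar> + \<bar>b\<bar>) powr (p - 1)"
      using p_gt Cf_nonneg by (intro mult_left_mono) auto
    then have "\<bar>f1 z\<bar> \<le> p * Cf * (\<bar>a\<bar> + \<bar>b\<bar>) powr (p - 1)"
      using f1_bound[OF f1, of z] by linarith
    then have "\<bar>f1 z\<bar> * \<bar>b - a\<bar> \<le> p * Cf * (\<bar>a\<bar> + \<bar>b\<bar>) powr (p - 1) * \<bar>b - a\<bar>" by (rule mult_right_mono) simp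
    then show ?thesis by (simp add: z(3) abs_mult mult.commute)
  qed
  show ?thesis
    using le[of x y] le[of y x] by (cases x y rule: linorder_cases) (simp_all add: abs_minus_commute add.commute)
qed

text \<open>The mean value theorem at a point of modulus at most 2 |a| handles F(a + b) - F a; the
  remaining F b is bounded directly using |b| <= |a|.\<close>

lemma F_split_small:
  assumes ab: "\<bar>b\<bar> \<le> \<bar>a\<bar>"
  shows "\<bar>F (a + b) - F a - F b\<bar> \<le> Cf * (2 powr p + 1) * (\<bar>a\<bar> powr p * \<bar>b\<bar>)"
proof -
  have 1: "\<bar>F (a + b) - F a\<bar> \<le> Cf * (2 * \<bar>a\<bar>) powr p * \<bar>b\<bar>"
  proof (cases "b = 0")
    case False
    have mvt: "\<exists>z. \<bar>z\<bar> \<le> 2 * \<bar>a\<bar> \<and> F (a + b) - F a = b * f z"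
    proof (cases "b > 0")
      case True
      then obtain z where "a < z" "z < a + b" "F (a + b) - F a = (a + b - a) * f z"
        using MVT2[of a "a + b" F f] F_deriv by auto
      then show ?thesis using ab by (intro exI[of _ z]) auto
    next
      case b: False
      then have "a + b < a" using False by simp
      then obtain z where "a + b < z" "z < a" "F a - F (a + b) = (a - (a + b)) * f z"
        using MVT2[of "a + b" a F f] F_deriv by auto
      then show ?thesis using ab by (intro exI[of _ z]) (auto simp: algebra_simps)
    qed
    then obtain z where z: "\<bar>z\<bar> \<le> 2 * \<bar>a\<bar>" "F (a + b) - F a = b * f z" by blast
    have "\<bar>f z\<bar> \<le> Cf * \<bar>z\<bar> powr p" by (rule f_bound)
    also have "\<dots> \<le> Cf * (2 * \<bar>a\<bar>) powr p" using z(1) p_gt by (intro mult_left_mono powr_mono2 Cf_nonneg) auto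
    finally have "\<bar>f z\<bar> * \<bar>b\<bar> \<le> Cf * (2 * \<bar>a\<bar>) powr p * \<bar>b\<bar>" by (rule mult_right_mono) simp
    then show ?thesis by (simp add: z(2) abs_mult mult.commute)
  qed simp
  have "\<bar>F b\<bar> \<le> Cf * \<bar>b\<bar> powr (p + 1)" by (rule F_bound)
  also have "\<dots> = Cf * (\<bar>b\<bar> powr p * \<bar>b\<bar>)" by (simp add: powr_add)
  also have "\<dots> \<le> Cf * (\<bar>a\<bar> powr p * \<bar>b\<bar>)"
    using ab p_gt by (intro mult_left_mono mult_right_mono powr_mono2 Cf_nonneg) auto
  finally have 2: "\<bar>F b\<bar> \<le> Cf * (\<bar>a\<bar> powr p * \<bar>b\<bar>)" .
  have "Cf * (2 * \<bar>a\<bar>) powr p * \<bar>b\<bar> = Cf * 2 powr p * (\<bar>a\<bar> powr p * \<bar>b\<bar>)" by (simp add: powr_mult)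
  then have "Cf * (2 * \<bar>a\<bar>) powr p * \<bar>b\<bar> + Cf * (\<bar>a\<bar> powr p * \<bar>b\<bar>) = Cf * (2 powr p + 1) * (\<bar>a\<bar> powr p * \<bar>b\<bar>)"
    by (simp add: algebra_simps)
  then show ?thesis using 1 2 by linarith
qed

text \<open>A Brezis-Lieb inequality: the error contains only mixed products, so its integral
  vanishes in the limit when one argument is fixed and the other converges locally to 0.\<close>

lemma F_split: "\<bar>F (a + b) - F a - F b\<bar> \<le> Cf * (2 powr p + 1) * (\<bar>a\<bar> powr p * \<bar>b\<bar> + \<bar>a\<bar> * \<bar>b\<bar> powr p)"
proof -
  have C: "Cf * (2 powr p + 1) \<ge> 0" using Cf_nonneg by simp
  show ?thesis
  proof (cases "\<bar>b\<bar> \<le> \<bar>a\<bar>")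
    case True
    have "Cf * (2 powr p + 1) * (\<bar>a\<bar> powr p * \<bar>b\<bar>) \<le> Cf * (2 powr p + 1) * (\<bar>a\<bar> powr p * \<bar>b\<bar> + \<bar>a\<bar> * \<bar>b\<bar> powr p)"
      by (rule mult_left_mono[OF _ C]) simp
    then show ?thesis using F_split_small[OF True] by linarith
  next
    case False
    then have "\<bar>a\<bar> \<le> \<bar>b\<bar>" by simp
    have "F (a + b) - F a - F b = F (b + a) - F b - F a" by (simp add: add.commute[of a b])
    then have "\<bar>F (a + b) - F a - F b\<bar> \<le> Cf * (2 powr p + 1) * (\<bar>a\<bar> * \<bar>b\<bar> powr p)"
      using F_split_small[OF \<open>\<bar>a\<bar> \<le> \<bar>b\<bar>\<close>] by (simp only: mult.commute[of "\<bar>a\<bar>"])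
    also have "\<dots> \<le> Cf * (2 powr p + 1) * (\<bar>a\<bar> powr p * \<bar>b\<bar> + \<bar>a\<bar> * \<bar>b\<bar> powr p)"
      by (rule mult_left_mono[OF _ C]) simp
    finally show ?thesis .
  qed
qed

lemma F_taylor: "\<bar>F (a + b) - F a - f a * b\<bar> \<le> p * Cf * (2 * \<bar>a\<bar> + \<bar>b\<bar>) powr (p - 1) * b\<^sup>2"
proof (cases "b = 0")
  case False
  have "\<exists>z. \<bar>z - a\<bar> \<le> \<bar>b\<bar> \<and> F (a + b) - F a = b * f z"
  proof (cases "b > 0")
    case True
    then obtain z where "a < z" "z < a + b" "F (a + b) - F a = (a + b - a) * f z"
      using MVT2[of a "a + b" F f] F_deriv by auto
    then show ?thesis by (intro exI[of _ z]) auto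
  next
    case b: False
    then have "a + b < a" using False by simp
    then obtain z where "a + b < z" "z < a" "F a - F (a + b) = (a - (a + b)) * f z"
      using MVT2[of "a + b" a F f] F_deriv by auto
    then show ?thesis by (intro exI[of _ z]) (auto simp: algebra_simps)
  qed
  then obtain z where z: "\<bar>z - a\<bar> \<le> \<bar>b\<bar>" "F (a + b) - F a = b * f z" by blast
  have "\<bar>f z - f a\<bar> \<le> p * Cf * (\<bar>z\<bar> + \<bar>a\<bar>) powr (p - 1) * \<bar>z - a\<bar>" by (rule f_lipschitz)
  also have "\<dots> \<le> p * Cf * (2 * \<bar>a\<bar> + \<bar>b\<bar>) powr (p - 1) * \<bar>b\<bar>"
    using z(1) p_gt Cf_nonneg by (intro mult_mono powr_mono2) auto
  finally have "\<bar>f z - f a\<bar> * \<bar>b\<bar> \<le> p * Cf * (2 * \<bar>a\<bar> + \<bar>b\<bar>) powr (p - 1) * \<bar>b\<bar> * \<bar>b\<bar>" by (rule mult_right_mono) simp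
  moreover have "F (a + b) - F a - f a * b = (f z - f a) * b" using z(2) by (simp add: algebra_simps)
  ultimately show ?thesis by (simp add: abs_mult power2_eq_square mult.assoc)
qed simp

lemma f_measurable[measurable]: "f \<in> borel_measurable borel"
proof -
  obtain f1 where "\<And>s. (f has_real_derivative f1 s) (at s)" using f_C2 by (auto simp: C2_fun_def)
  then show ?thesis
    by (intro borel_measurable_continuous_onI continuous_at_imp_continuous_on ballI DERIV_isCont)
qed

lemma F_measurable[measurable]: "F \<in> borel_measurable borel"
  by (intro borel_measurable_continuous_onI continuous_at_imp_continuous_on ballI DERIV_isCont[OF F_deriv])

end

section \<open>Existence of a minimizer\<close>

context homogeneous_nonlinearity
begin

text \<open>With this factor K u equals minus the integral of f(u) u, see \<open>K_eq\<close>, so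
  that every solitary wave satisfies I = K.\<close>

definition K :: "(real \<Rightarrow> real) \<Rightarrow> real" where
  "K u = - (p + 1) * (\<integral>x. F (u x) \<partial>lborel)"

lemma F_integrable:
  assumes "in_X u"
  shows "integrable lborel (\<lambda>x. F (u x))"
proof (rule Bochner_Integration.integrable_bound)
  have [measurable]: "u \<in> borel_measurable borel" using sqint_measurable[OF in_X_sqint[OF assms]] by simp
  show "integrable lborel (\<lambda>x. Cf * \<bar>u x\<bar> powr (p + 1))"
    using in_X_powr_integrable[OF assms, of "p + 1"] p_gt by simp
  show "AE x in lborel. norm (F (u x)) \<le> norm (Cf * \<bar>u x\<bar> powr (p + 1))"
    using F_bound Cf_nonneg by (intro AE_I2) (simp add: abs_mult)
  show "(\<lambda>x. F (u x)) \<in> borel_measurable lborel" by measurable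
qed

lemma K_scale: "t > 0 \<Longrightarrow> K (\<lambda>x. t * u x) = t powr (p + 1) * K u"
  by (simp add: K_def F_hom)

lemma K_shift: "K (\<lambda>x. u (x + h)) = K u"
  using lborel_integral_real_affine[of 1 "\<lambda>x. F (u x)" h] by (simp add: K_def add.commute)

lemma K_dilate: "c > 0 \<Longrightarrow> K (\<lambda>x. u (c * x)) = K u / c"
  using lborel_integral_real_affine[of c "\<lambda>x. F (u x)" 0] by (simp add: K_def field_simps)

lemma K_le:
  assumes "in_X u"
  shows "K u \<le> (p + 1) * Cf * (\<integral>x. \<bar>u x\<bar> powr (p + 1) \<partial>lborel)"
proof -
  have "- (\<integral>x. F (u x) \<partial>lborel) = (\<integral>x. - F (u x) \<partial>lborel)" by simp
  also have "\<dots> \<le> (\<integral>x. Cf * \<bar>u x\<bar> powr (p + 1) \<partial>lborel)"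
  proof (rule integral_mono)
    show "integrable lborel (\<lambda>x. - F (u x))" using F_integrable[OF assms] by simp
    show "integrable lborel (\<lambda>x. Cf * \<bar>u x\<bar> powr (p + 1))"
      using in_X_powr_integrable[OF assms, of "p + 1"] p_gt by simp
    show "- F (u x) \<le> Cf * \<bar>u x\<bar> powr (p + 1)" for x using F_bound[of "u x"] by linarith
  qed
  finally have "- (\<integral>x. F (u x) \<partial>lborel) \<le> Cf * (\<integral>x. \<bar>u x\<bar> powr (p + 1) \<partial>lborel)" by simp
  then have "(p + 1) * - (\<integral>x. F (u x) \<partial>lborel) \<le> (p + 1) * (Cf * (\<integral>x. \<bar>u x\<bar> powr (p + 1) \<partial>lborel))"
    by (rule mult_left_mono) (use p_gt in simp)
  moreover have "K u = (p + 1) * - (\<integral>x. F (u x) \<partial>lborel)" unfolding K_def by (rule minus_mult_commute)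
  ultimately show ?thesis by (simp only: mult.assoc)
qed

text \<open>Both mixed products of \<open>F_split\<close> pair a sequence that is bounded in L^2 and
  tends locally to 0 with a fixed L^2 function, so \<open>weak_null\<close> applies; for the power
  of v n this uses \<open>rho_powr_null\<close>.\<close>

theorem K_splitting:
  assumes v: "\<And>n. in_X (v n)" "\<And>n. Hhalf N (v n)" and N: "N > 0" and u: "in_X u"
    and l: "(\<lambda>n. nsq lborel (\<lambda>x. rho x * v n x)) \<longlonglongrightarrow> 0"
  shows "(\<lambda>n. K (\<lambda>x. v n x + u x) - K (v n)) \<longlonglongrightarrow> K u"
proof -
  have p1: "p \<ge> 1" using p_gt by simp
  define C where "C = Cf * (2 powr p + 1)"
  let ?A = "\<lambda>n. \<integral>x. norm (\<bar>v n x\<bar> powr p) * norm (u x) \<partial>lborel"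
  let ?B = "\<lambda>n. \<integral>x. norm (v n x) * norm (\<bar>u x\<bar> powr p) \<partial>lborel"
  have up: "sqint lborel (\<lambda>x. \<bar>u x\<bar> powr p)" by (rule in_X_powr_sqint[OF u p1])
  note vp = powr_sqint[OF v(2) N p1]
  have A: "?A \<longlonglongrightarrow> 0"
    by (rule weak_null[OF vp(1) vp(2) rho_powr_null[OF v(2) N p1 l] in_X_sqint[OF u]])
  have B: "?B \<longlonglongrightarrow> 0"
  proof (rule weak_null[OF in_X_sqint[OF v(1)] _ l up])
    show "nsq lborel (v n) \<le> N\<^sup>2" for n using v(2) by (simp add: Hhalf_def)
  qed
  have iA: "integrable lborel (\<lambda>x. norm (\<bar>v n x\<bar> powr p) * norm (u x))" for n
    by (rule sqint_times_norm_integrable[OF vp(1) in_X_sqint[OF u]])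
  have iB: "integrable lborel (\<lambda>x. norm (v n x) * norm (\<bar>u x\<bar> powr p))" for n
    by (rule sqint_times_norm_integrable[OF in_X_sqint[OF v(1)] up])
  have D: "\<bar>(\<integral>x. F (v n x + u x) \<partial>lborel) - (\<integral>x. F (v n x) \<partial>lborel) - (\<integral>x. F (u x) \<partial>lborel)\<bar> \<le> C * (?A n + ?B n)" for n
  proof -
    have i: "integrable lborel (\<lambda>x. F (v n x + u x))" "integrable lborel (\<lambda>x. F (v n x))" "integrable lborel (\<lambda>x. F (u x))"
      by (intro F_integrable in_X_add v u)+
    have "(\<integral>x. F (v n x + u x) \<partial>lborel) - (\<integral>x. F (v n x) \<partial>lborel) - (\<integral>x. F (u x) \<partial>lborel)
      = (\<integral>x. F (v n x + u x) - F (v n x) - F (u x) \<partial>lborel)" using i by simp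
    also have "\<bar>\<dots>\<bar> \<le> (\<integral>x. \<bar>F (v n x + u x) - F (v n x) - F (u x)\<bar> \<partial>lborel)" by (rule integral_abs_bound)
    also have "\<dots> \<le> (\<integral>x. C * (norm (\<bar>v n x\<bar> powr p) * norm (u x) + norm (v n x) * norm (\<bar>u x\<bar> powr p)) \<partial>lborel)"
    proof (rule integral_mono)
      show "integrable lborel (\<lambda>x. \<bar>F (v n x + u x) - F (v n x) - F (u x)\<bar>)" using i by simp
      show "integrable lborel (\<lambda>x. C * (norm (\<bar>v n x\<bar> powr p) * norm (u x) + norm (v n x) * norm (\<bar>u x\<bar> powr p)))"
        by (intro integrable_mult_right Bochner_Integration.integrable_add iA iB)
      show "\<bar>F (v n x + u x) - F (v n x) - F (u x)\<bar>
        \<le> C * (norm (\<bar>v n x\<bar> powr p) * norm (u x) + norm (v n x) * norm (\<bar>u x\<bar> powr p))" for x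
        using F_split[of "v n x" "u x"] by (simp add: C_def)
    qed
    also have "\<dots> = C * (?A n + ?B n)"
      unfolding integral_mult_right_zero Bochner_Integration.integral_add[OF iA iB] ..
    finally show ?thesis .
  qed
  have "(\<lambda>n. C * (?A n + ?B n)) \<longlonglongrightarrow> C * (0 + 0)" by (intro tendsto_mult_left tendsto_add A B)
  then have "(\<lambda>n. C * (?A n + ?B n)) \<longlonglongrightarrow> 0" by (simp only: add_0_left mult_zero_right)
  then have "(\<lambda>n. (\<integral>x. F (v n x + u x) \<partial>lborel) - (\<integral>x. F (v n x) \<partial>lborel) - (\<integral>x. F (u x) \<partial>lborel)) \<longlonglongrightarrow> 0"
    by (rule Lim_null_comparison[rotated]) (intro always_eventually allI order_trans[OF eq_refl[OF real_norm_def] D])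
  then have "(\<lambda>n. (\<integral>x. F (v n x + u x) \<partial>lborel) - (\<integral>x. F (v n x) \<partial>lborel)) \<longlonglongrightarrow> (\<integral>x. F (u x) \<partial>lborel)"
    by (rule LIM_zero_cancel)
  then have "(\<lambda>n. - (p + 1) * ((\<integral>x. F (v n x + u x) \<partial>lborel) - (\<integral>x. F (v n x) \<partial>lborel))) \<longlonglongrightarrow> - (p + 1) * (\<integral>x. F (u x) \<partial>lborel)"
    by (rule tendsto_mult_left)
  then show ?thesis unfolding K_def right_diff_distrib .
qed

definition admissible :: "(real \<Rightarrow> real) set" where
  "admissible = {u. in_X u \<and> K u = 1}"

definition minval :: "real \<Rightarrow> real \<Rightarrow> real \<Rightarrow> real" where
  "minval \<beta> s \<gamma> = (INF u\<in>admissible. Bform \<beta> s \<gamma> u u)"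

end

locale variational_problem = homogeneous_nonlinearity +
  fixes \<beta> s \<gamma> :: real
  assumes pos: "\<beta> > 0" "s > 0" "\<gamma> > 0"
begin

abbreviation I where "I u \<equiv> Bform \<beta> s \<gamma> u u"

lemma wt_ok: "mult_ok (wt \<beta> s \<gamma>)"
  by (rule mult_ok_wt[OF pos])

lemma mfin_wt: "in_X u \<Longrightarrow> mfin (wt \<beta> s \<gamma>) u"
  using in_X_wt[OF pos] by blast

lemma I_nonneg: "I u \<ge> 0"
  by (rule mform_nonneg[OF wt_ok])

lemma I_scale: "in_X u \<Longrightarrow> I (\<lambda>x. t * u x) = t\<^sup>2 * I u"
  using mform_lincomb_diag[OF wt_ok mfin_wt mfin_wt, of u u t 0] by simp

lemma I_add:
  assumes "in_X u" "in_X v"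
  shows "I (\<lambda>x. u x + v x) = I u + 2 * Bform \<beta> s \<gamma> u v + I v"
  using mform_lincomb_diag[OF wt_ok mfin_wt[OF assms(1)] mfin_wt[OF assms(2)], of 1 1] by simp

lemma I_shift: "in_X u \<Longrightarrow> I (\<lambda>x. u (x + h)) = I u"
  by (rule mfin_shift(2)[OF wt_ok mfin_wt])

lemma I_pos:
  assumes u: "in_X u" and nz: "\<not> (AE x in lborel. u x = 0)"
  shows "I u > 0"
proof (rule ccontr)
  assume "\<not> I u > 0"
  then have "I u = 0" using I_nonneg[of u] by linarith
  then have "Hhalf (sqrt (0 * (1 / s + 2 / \<beta>))) u" using Hhalf_Bform(1)[OF pos u, of 0] by simp
  then have "sqint lborel u" "nsq lborel u = 0"
    using nsq_nonneg[of lborel u] by (auto simp: Hhalf_def simp del: nsq_nonneg)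
  then show False using nz nsq_AE_zero by blast
qed

definition kap :: real where "kap = 1 / s + 2 / \<beta>"

lemma kap_pos: "kap > 0"
  using pos by (simp add: kap_def add_pos_pos)

lemma Hhalf_I:
  assumes "in_X u" "I u \<le> M" "M > 0"
  shows "Hhalf (sqrt (M * kap)) u" "sqrt (M * kap) > 0"
  using Hhalf_Bform(1)[OF pos assms(1,2)] assms(3) kap_pos by (simp_all add: kap_def)

lemma K_le_I:
  assumes u: "in_X u" and M: "I u \<le> M" "M > 0"
  shows "K u \<le> (p + 1) * Cf * (sob (p + 1) * (sqrt (M * kap)) powr (p + 1))"
proof -
  have "(\<integral>x. \<bar>u x\<bar> powr (p + 1) \<partial>lborel) \<le> sob (p + 1) * (sqrt (M * kap)) powr (p + 1)"
    using sobolev(2)[OF Hhalf_I[OF u M], of "p + 1"] p_gt by simp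
  then have "(p + 1) * Cf * (\<integral>x. \<bar>u x\<bar> powr (p + 1) \<partial>lborel) \<le> (p + 1) * Cf * (sob (p + 1) * (sqrt (M * kap)) powr (p + 1))"
    using p_gt Cf_nonneg by (intro mult_left_mono) auto
  then show ?thesis using K_le[OF u] by linarith
qed

abbreviation mval :: real where "mval \<equiv> minval \<beta> s \<gamma>"

lemma mval_le: "u \<in> admissible \<Longrightarrow> mval \<le> I u"
  unfolding minval_def by (intro cINF_lower bdd_belowI2[where m=0]) (auto simp: I_nonneg)

text \<open>I is homogeneous of degree 2 and K of degree p + 1, so scaling to K = 1 extends the
  defining inequality of the infimum to all u with K u > 0.\<close>

lemma I_ge_mval:
  assumes u: "in_X u" and K: "K u > 0"
  shows "mval * (K u) powr (2 / (p + 1)) \<le> I u"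
proof -
  define t where "t = (K u) powr (- 1 / (p + 1))"
  have t: "t > 0" using K by (simp add: t_def)
  have "t powr (p + 1) = (K u) powr (-1)" unfolding t_def powr_powr using p_gt by simp
  then have "K (\<lambda>x. t * u x) = 1" using K_scale[OF t, of u] K by (simp add: powr_minus_divide)
  then have "(\<lambda>x. t * u x) \<in> admissible" by (simp add: admissible_def in_X_scale u)
  then have "mval \<le> t\<^sup>2 * I u" using mval_le I_scale[OF u] by metis
  also have "t\<^sup>2 = (K u) powr (- (2 / (p + 1)))" using t by (simp add: t_def power2_eq_square flip: powr_add)
  finally have "mval * (K u) powr (2 / (p + 1)) \<le> (K u) powr (- (2 / (p + 1))) * I u * (K u) powr (2 / (p + 1))"
    by (rule mult_right_mono) simp
  also have "\<dots> = ((K u) powr (- (2 / (p + 1))) * (K u) powr (2 / (p + 1))) * I u" by (simp only: mult_ac)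
  also have "\<dots> = I u" using K by (simp flip: powr_add)
  finally show ?thesis .
qed

text \<open>For K u <= 0 the left side is 0, as \<open>0 powr a = 0\<close>. Without a sign
  condition the inequality can be passed to the limit along the remainders in
  \<open>minimizer_exists\<close>.\<close>

lemma I_ge_mval': "in_X u \<Longrightarrow> mval * (max 0 (K u)) powr (2 / (p + 1)) \<le> I u"
  using I_ge_mval[of u] I_nonneg[of u] by (cases "K u > 0") (auto simp: max_def)

text \<open>K = 1 and the embedding give 1 <= A I^((p + 1)/2). The bound is explicit because A does
  not contain gamma: \<open>dfun_growth\<close> uses it for all gamma at once.\<close>

lemma mval_lower:
  assumes "admissible \<noteq> {}"
  defines "A \<equiv> (p + 1) * Cf * sob (p + 1) * (1 / s + 2 / \<beta>) powr ((p + 1) / 2)"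
  shows "(1 / A) powr (2 / (p + 1)) \<le> mval" "(1 / A) powr (2 / (p + 1)) > 0"
proof -
  have A_def: "A = (p + 1) * Cf * sob (p + 1) * kap powr ((p + 1) / 2)" by (simp add: A_def kap_def)
  have Cf: "Cf > 0" using f_nontrivial by (auto simp: Cf_def max_def)
  have A: "A > 0" using p_gt Cf sob_pos kap_pos by (simp add: A_def)
  have low: "(1 / A) powr (2 / (p + 1)) \<le> I u" if u: "u \<in> admissible" for u
  proof -
    have uX: "in_X u" and K: "K u = 1" using u by (auto simp: admissible_def)
    have "\<not> (AE x in lborel. u x = 0)"
    proof
      assume u0: "AE x in lborel. u x = 0"
      have "(\<integral>x. F (u x) \<partial>lborel) = 0"
      proof (rule integral_eq_zero_AE)
        show "AE x in lborel. F (u x) = 0" using u0 by eventually_elim (simp add: F_0)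
      qed
      then show False using K by (simp add: K_def)
    qed
    then have I: "I u > 0" by (rule I_pos[OF uX])
    have "1 \<le> (p + 1) * Cf * (sob (p + 1) * (sqrt (I u * kap)) powr (p + 1))"
      using K_le_I[OF uX order_refl I] K by simp
    also have "(sqrt (I u * kap)) powr (p + 1) = (I u) powr ((p + 1) / 2) * kap powr ((p + 1) / 2)"
      using I kap_pos by (simp add: powr_half_sqrt[symmetric] powr_powr powr_mult)
    finally have "1 \<le> A * (I u) powr ((p + 1) / 2)" by (simp add: A_def mult_ac)
    then have "1 / A \<le> (I u) powr ((p + 1) / 2)" using A by (simp add: pos_divide_le_eq mult.commute)
    then have "(1 / A) powr (2 / (p + 1)) \<le> ((I u) powr ((p + 1) / 2)) powr (2 / (p + 1))"
      using A p_gt by (intro powr_mono2) auto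
    also have "\<dots> = I u powr ((p + 1) / 2 * (2 / (p + 1)))" by (rule powr_powr)
    also have "(p + 1) / 2 * (2 / (p + 1)) = 1" using p_gt by simp
    also have "I u powr 1 = I u" using I by simp
    finally show ?thesis .
  qed
  show "(1 / A) powr (2 / (p + 1)) \<le> mval"
    unfolding minval_def by (rule cINF_greatest[OF assms(1) low])
  show "(1 / A) powr (2 / (p + 1)) > 0" using A by simp
qed

lemma mval_pos: "admissible \<noteq> {} \<Longrightarrow> mval > 0"
  using mval_lower by (rule order_less_le_trans[rotated])

lemma minimizing_sequence:
  assumes "admissible \<noteq> {}"
  obtains u where "\<And>n. u n \<in> admissible" "\<And>n. I (u n) \<le> mval + 1" "(\<lambda>n. I (u n)) \<longlonglongrightarrow> mval"
proof -
  have "\<exists>u\<in>admissible. I u < mval + inverse (real (Suc n))" for n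
    unfolding minval_def
    by (subst cINF_less_iff[symmetric]) (use assms I_nonneg in \<open>auto intro!: bdd_belowI2[where m=0]\<close>)
  then obtain u where u: "\<And>n. u n \<in> admissible" "\<And>n. I (u n) < mval + inverse (real (Suc n))" by metis
  have "(\<lambda>n. I (u n)) \<longlonglongrightarrow> mval"
  proof (rule tendsto_sandwich[where f="\<lambda>n. mval" and h="\<lambda>n. mval + inverse (real (Suc n))"])
    show "(\<lambda>n. mval + inverse (real (Suc n))) \<longlonglongrightarrow> mval"
      using tendsto_add[OF tendsto_const LIMSEQ_inverse_real_of_nat, of mval] by simp
    show "(\<lambda>n. mval) \<longlonglongrightarrow> mval" by simp
  qed (use u mval_le in \<open>auto intro!: always_eventually less_imp_le\<close>)
  moreover have "I (u n) \<le> mval + 1" for n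
  proof -
    have "inverse (real (Suc n)) \<le> 1" by (simp add: field_simps)
    then show ?thesis using u(2)[of n] by linarith
  qed
  ultimately show thesis using that u(1) by blast
qed

text \<open>Small averages would make the integral of |u|^(p + 1) small by
  \<open>vanishing_bound\<close>, against K u = 1. The scale and the threshold serve all admissible
  u with I u <= M.\<close>

lemma nonvanishing:
  assumes M: "M > 0"
  obtains k \<delta> where "\<delta> > 0" "\<And>u. u \<in> admissible \<Longrightarrow> I u \<le> M \<Longrightarrow> \<exists>x. \<bar>avg ((1/2)^k) u x\<bar> > \<delta>"
proof -
  define N where "N = sqrt (M * kap)"
  have N: "N > 0" using M kap_pos by (simp add: N_def)
  \<comment> \<open>By \<open>K_le\<close>, an integral of |u|^(p + 1) below this value would give K
    u < 1.\<close>
  define \<eta> where "\<eta> = 1 / ((p + 1) * Cf)"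
  have Cf: "Cf > 0" using f_nontrivial by (auto simp: Cf_def max_def)
  have \<eta>: "\<eta> > 0" using Cf p_gt by (simp add: \<eta>_def)
  define S where "S = sqrt (sob (2 * (p + 1 - 1)) * N powr (2 * (p + 1 - 1)))"
  define T where "T = sob (p + 1 - 1) * N powr (p + 1 - 1)"
  have T: "T > 0" using sob_pos N by (simp add: T_def)
  have "(\<lambda>k. S * sqrt ((1/2)^k * N\<^sup>2)) \<longlonglongrightarrow> S * sqrt (0 * N\<^sup>2)"
    by (intro tendsto_mult_left tendsto_real_sqrt tendsto_mult_right LIMSEQ_power_zero) simp
  then have "\<forall>\<^sub>F k in sequentially. S * sqrt ((1/2)^k * N\<^sup>2) < \<eta> / 2"
    by (rule order_tendstoD) (use \<eta> in simp)
  then obtain k where k: "S * sqrt ((1/2)^k * N\<^sup>2) < \<eta> / 2" by (auto simp: eventually_sequentially)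
  define \<delta> where "\<delta> = \<eta> / (4 * T)"
  have \<delta>: "\<delta> > 0" "\<delta> * T = \<eta> / 4" using \<eta> T by (simp_all add: \<delta>_def)
  have "\<exists>x. \<bar>avg ((1/2)^k) u x\<bar> > \<delta>" if u: "u \<in> admissible" "I u \<le> M" for u
  proof (rule ccontr)
    assume "\<not> ?thesis"
    then have le: "\<bar>avg ((1/2)^k) u x\<bar> \<le> \<delta>" for x by (simp add: not_less)
    have uX: "in_X u" and K: "K u = 1" using u by (auto simp: admissible_def)
    have r3: "p + 1 \<ge> 3" using p_ge_2 by simp
    have "(\<integral>x. \<bar>u x\<bar> powr (p + 1) \<partial>lborel) \<le> S * sqrt ((1/2)^k * N\<^sup>2) + \<delta> * T"
      unfolding S_def T_def
      by (rule vanishing_bound[OF _ N r3 _ le]) (use Hhalf_I(1)[OF uX u(2) M] in \<open>simp_all add: N_def\<close>)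
    also have "\<dots> < \<eta>" using k \<delta>(2) \<eta> by linarith
    finally have "(\<integral>x. \<bar>u x\<bar> powr (p + 1) \<partial>lborel) < \<eta>" .
    then have "(p + 1) * Cf * (\<integral>x. \<bar>u x\<bar> powr (p + 1) \<partial>lborel) < (p + 1) * Cf * \<eta>"
      using Cf p_gt by (intro mult_strict_left_mono) auto
    also have "\<dots> = 1" using Cf p_gt by (simp add: \<eta>_def)
    finally show False using K_le[OF uX] K by linarith
  qed
  then show thesis using that \<delta>(1) by blast
qed

text \<open>Translations change neither I nor K; they bring the large average to the origin, where
  local convergence can see it.\<close>

lemma translated_minimizing_sequence:
  assumes ne: "admissible \<noteq> {}"
  obtains w h \<delta> where "\<And>n. w n \<in> admissible" "\<And>n. I (w n) \<le> mval + 1" "(\<lambda>n. I (w n)) \<longlonglongrightarrow> mval"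
    "h > 0" "\<delta> > 0" "\<And>n. \<bar>avg h (w n) 0\<bar> > \<delta>"
proof -
  obtain u where u: "\<And>n. u n \<in> admissible" "\<And>n. I (u n) \<le> mval + 1" "(\<lambda>n. I (u n)) \<longlonglongrightarrow> mval"
    using minimizing_sequence[OF ne] by blast
  have M: "mval + 1 > 0" using mval_pos[OF ne] by simp
  obtain k \<delta> where \<delta>: "\<delta> > 0" "\<And>u. u \<in> admissible \<Longrightarrow> I u \<le> mval + 1 \<Longrightarrow> \<exists>x. \<bar>avg ((1/2)^k) u x\<bar> > \<delta>"
    using nonvanishing[OF M] by blast
  obtain y where y: "\<And>n. \<bar>avg ((1/2)^k) (u n) (y n)\<bar> > \<delta>" using \<delta>(2)[OF u(1,2)] by metis
  define w where "w n x = u n (x + y n)" for n x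
  have uX: "in_X (u n)" for n using u(1) by (simp add: admissible_def)
  have wI: "I (w n) = I (u n)" for n unfolding w_def by (rule I_shift[OF uX])
  have "K (w n) = 1" for n using u(1) K_shift unfolding w_def by (simp add: admissible_def)
  then have 1: "w n \<in> admissible" for n by (simp add: admissible_def w_def[abs_def] in_X_shift uX)
  have "avg ((1/2)^k) (w n) 0 = avg ((1/2)^k) (u n) (y n)" for n by (simp add: avg_def w_def add.commute)
  then have "\<bar>avg ((1/2)^k) (w n) 0\<bar> > \<delta>" for n using y by simp
  then show thesis using that[of w "(1/2)^k" \<delta>] 1 u(2,3) \<delta>(1) by (simp add: wI)
qed

text \<open>For q < 1 and 0 < x < 1 one has x < x^q; adding this for k and 1 - k gives the strict
  inequality that excludes splitting of the constraint.\<close>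

lemma powr_sum_gt:
  assumes k: "0 < k" "k < 1" and q: "q < (1::real)"
  shows "k powr q + (1 - k) powr q > 1"
proof -
  have "x < x powr q" if "0 < x" "x < 1" for x :: real
    using powr_less_mono'[of x q 1] that q by simp
  from this[of k] this[of "1 - k"] k show ?thesis by simp
qed

theorem minimizer_exists:
  assumes ne: "admissible \<noteq> {}"
  obtains u where "u \<in> admissible" "I u = mval"
proof -
  define \<theta> where "\<theta> = 2 / (p + 1)"
  have \<theta>: "0 < \<theta>" "\<theta> < 1" using p_gt by (auto simp: \<theta>_def)
  have m: "mval > 0" by (rule mval_pos[OF ne])
  have M: "mval + 1 > 0" using m by simp
  obtain w0 h \<delta> where w0: "\<And>n. w0 n \<in> admissible" "\<And>n. I (w0 n) \<le> mval + 1" "(\<lambda>n. I (w0 n)) \<longlonglongrightarrow> mval"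
    and h: "h > 0" and \<delta>: "\<delta> > 0" "\<And>n. \<bar>avg h (w0 n) 0\<bar> > \<delta>"
    using translated_minimizing_sequence[OF ne] by blast
  have w0X: "in_X (w0 n)" for n using w0(1) by (simp add: admissible_def)
  define N where "N = sqrt ((mval + 1) * kap)"
  have H: "Hhalf N (w0 n)" and N: "N > 0" for n
    unfolding N_def using Hhalf_I[OF w0X w0(2) M] by auto
  obtain r v where r: "strict_mono (r :: nat \<Rightarrow> nat)" and v: "sqint lborel v" "nsq lborel v \<le> N\<^sup>2"
    and l0: "(\<lambda>n. nsq lborel (\<lambda>x. rho x * (w0 (r n) x - v x))) \<longlonglongrightarrow> 0"
    using local_compactness[of N w0, OF H N] by blast
  define w where "w n = w0 (r n)" for n
  have w: "\<And>n. w n \<in> admissible" "\<And>n. I (w n) \<le> mval + 1" "(\<lambda>n. I (w n)) \<longlonglongrightarrow> mval"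
    "\<And>n. \<bar>avg h (w n) 0\<bar> > \<delta>"
    using w0 \<delta>(2) LIMSEQ_subseq_LIMSEQ[OF w0(3) r] by (auto simp: w_def comp_def)
  have wX: "in_X (w n)" and wK: "K (w n) = 1" for n using w(1) by (auto simp: admissible_def)
  have w2: "sqint lborel (w n)" for n by (rule in_X_sqint[OF wX])
  have l: "(\<lambda>n. nsq lborel (\<lambda>x. rho x * (w n x - v x))) \<longlonglongrightarrow> 0" using l0 by (simp add: w_def)
  have z2: "sqint lborel (\<lambda>x. w n x - v x)" for n by (intro sqint_diff w2 v)
  have zB: "nsq lborel (\<lambda>x. w n x - v x) \<le> 4 * N\<^sup>2" for n
    using sqint_diff(2)[OF w2[of n] v(1)] H[of "r n"] v(2) by (simp add: Hhalf_def w_def)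
  have "mfin (wt \<beta> s \<gamma>) v" by (rule mfin_weak_limit[OF wt_ok mfin_wt[OF wX] w(2) v(1) zB l])
  then have vX: "in_X v" using in_X_wt[OF pos] by blast
  define z where "z n x = w n x - v x" for n x
  have zX: "in_X (z n)" for n unfolding z_def by (intro in_X_diff wX vX)
  have wz: "w n = (\<lambda>x. z n x + v x)" for n by (simp add: z_def)
  have zl: "(\<lambda>n. nsq lborel (\<lambda>x. rho x * z n x)) \<longlonglongrightarrow> 0" using l by (simp add: z_def)

  \<comment> \<open>The averages at the origin stay above delta in modulus, but would tend to 0 if w
    n converged locally to 0.\<close>
  have nz: "\<not> (AE x in lborel. v x = 0)"
  proof
    assume v0: "AE x in lborel. v x = 0"
    have ind: "sqint lborel (indicat_real {0..h})" by (rule indicator_Icc_sqint(1))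
    have "(\<lambda>n. \<integral>x. norm (w n x - v x) * norm (indicat_real {0..h} x) \<partial>lborel) \<longlonglongrightarrow> 0"
      by (rule weak_null[OF z2 zB l ind])
    then have "(\<lambda>n. (1 / h) * (\<integral>x. norm (w n x - v x) * norm (indicat_real {0..h} x) \<partial>lborel)) \<longlonglongrightarrow> (1 / h) * 0"
      by (rule tendsto_mult_left)
    then have "\<forall>\<^sub>F n in sequentially. (1 / h) * (\<integral>x. norm (w n x - v x) * norm (indicat_real {0..h} x) \<partial>lborel) < \<delta>"
      by (rule order_tendstoD) (use \<delta>(1) in simp)
    then obtain n where n: "(1 / h) * (\<integral>x. norm (w n x - v x) * norm (indicat_real {0..h} x) \<partial>lborel) < \<delta>"
      by (auto simp: eventually_sequentially)
    have [measurable]: "w n \<in> borel_measurable borel" "v \<in> borel_measurable borel"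
      using sqint_measurable[OF w2[of n]] sqint_measurable[OF v(1)] by auto
    have "\<bar>avg h (w n) 0\<bar> = (1 / h) * \<bar>\<integral>s. indicat_real {0..h} s * w n s \<partial>lborel\<bar>"
      using h by (simp add: avg_def abs_mult)
    also have "\<dots> \<le> (1 / h) * (\<integral>s. \<bar>indicat_real {0..h} s * w n s\<bar> \<partial>lborel)"
      using h by (intro mult_left_mono integral_abs_bound) simp
    also have "(\<integral>s. \<bar>indicat_real {0..h} s * w n s\<bar> \<partial>lborel) = (\<integral>x. norm (w n x - v x) * norm (indicat_real {0..h} x) \<partial>lborel)"
    proof (rule integral_cong_AE)
      show "AE x in lborel. \<bar>indicat_real {0..h} x * w n x\<bar> = norm (w n x - v x) * norm (indicat_real {0..h} x)"
        using v0 by eventually_elim (simp add: abs_mult)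
    qed measurable
    finally show False using n w(4)[of n] by linarith
  qed
  have Iv: "I v > 0" by (rule I_pos[OF vX nz])

  have Isum: "I (w n) = I (z n) + 2 * Bform \<beta> s \<gamma> (z n) v + I v" for n
    unfolding wz by (rule I_add[OF zX vX])
  have zI: "I (z n) \<le> 2 * (mval + 1) + 2 * I v" for n
  proof -
    \<comment> \<open>Parallelogram law: I(w - v) + I(w + v) = 2 I(w) + 2 I(v), with the nonnegative
      term I(w + v) dropped.\<close>
    have "I (\<lambda>x. 1 * w n x + 1 * v x) \<ge> 0" by (rule I_nonneg)
    then show ?thesis
      using mform_lincomb_diag[OF wt_ok mfin_wt[OF wX] mfin_wt[OF vX], of 1 n 1] mform_lincomb_diag[OF wt_ok mfin_wt[OF wX] mfin_wt[OF vX], of 1 n "-1"] w(2)[of n]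
      by (simp add: z_def[abs_def])
  qed
  have cross: "(\<lambda>n. Bform \<beta> s \<gamma> (z n) v) \<longlonglongrightarrow> 0"
  proof (rule mform_weak_null[OF wt_ok mfin_wt[OF zX] zI mfin_wt[OF vX]])
    fix g :: "real \<Rightarrow> complex" assume g: "integrable lborel g" "sqint lborel g"
    have zero: "sqint lborel (\<lambda>x. 0 :: real)" by simp
    \<comment> \<open>The transform of the zero function is a chosen representative; that it
      vanishes almost everywhere is read off from linearity with zero coefficients.\<close>
    have "AE \<xi> in lborel. fourier (\<lambda>x. 0 * v x + 0 * v x) \<xi> = of_real 0 * fourier v \<xi> + of_real 0 * fourier v \<xi>"
      by (rule fourier_lincomb[OF v(1) v(1)])
    then have f0: "AE \<xi> in lborel. fourier (\<lambda>x. 0) \<xi> = 0" by simp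
    have "(\<lambda>n. \<integral>\<xi>. fourier (z n) \<xi> * g \<xi> \<partial>lborel) \<longlonglongrightarrow> (\<integral>\<xi>. fourier (\<lambda>x. 0) \<xi> * g \<xi> \<partial>lborel)"
      using z2 zB zl unfolding z_def[symmetric]
      by (intro fourier_weak_limit[OF _ zero _ _ g, where B="4 * N\<^sup>2"]) (auto simp: z_def[symmetric])
    also have "(\<integral>\<xi>. fourier (\<lambda>x. 0) \<xi> * g \<xi> \<partial>lborel) = 0"
    proof (rule integral_eq_zero_AE)
      show "AE \<xi> in lborel. fourier (\<lambda>x. 0) \<xi> * g \<xi> = 0" using f0 by eventually_elim simp
    qed
    finally show "(\<lambda>n. \<integral>\<xi>. fourier (z n) \<xi> * g \<xi> \<partial>lborel) \<longlonglongrightarrow> 0" .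
  qed
  have Iz: "(\<lambda>n. I (z n)) \<longlonglongrightarrow> mval - I v"
  proof -
    have "(\<lambda>n. I (w n) - 2 * Bform \<beta> s \<gamma> (z n) v - I v) \<longlonglongrightarrow> mval - 2 * 0 - I v"
      by (intro tendsto_diff tendsto_mult_left cross w(3) tendsto_const)
    then show ?thesis by (simp add: Isum)
  qed
  define N' where "N' = sqrt ((2 * (mval + 1) + 2 * I v) * kap)"
  have M': "2 * (mval + 1) + 2 * I v > 0" using m Iv by simp
  have zH: "Hhalf N' (z n)" "N' > 0" for n unfolding N'_def using Hhalf_I[OF zX zI M'] by auto
  have "(\<lambda>n. K (\<lambda>x. z n x + v x) - K (z n)) \<longlonglongrightarrow> K v"
    by (rule K_splitting[OF zX zH vX zl])
  then have "(\<lambda>n. 1 - K (z n)) \<longlonglongrightarrow> K v" using wK unfolding wz[symmetric] by simp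
  then have "(\<lambda>n. 1 - (1 - K (z n))) \<longlonglongrightarrow> 1 - K v" by (intro tendsto_diff tendsto_const)
  then have Kz: "(\<lambda>n. K (z n)) \<longlonglongrightarrow> 1 - K v" by simp
  have "(\<lambda>n. mval * (max 0 (K (z n))) powr \<theta>) \<longlonglongrightarrow> mval * (max 0 (1 - K v)) powr \<theta>"
    using \<theta>(1) by (intro tendsto_mult_left tendsto_powr' tendsto_max tendsto_const Kz) (auto intro!: always_eventually)
  \<comment> \<open>The remainder has constraint value tending to 1 - K v and costs at least the
    corresponding share of the minimum; \<open>vlow\<close> does the same for v, and the two costs
    add up to the minimum.\<close>
  then have zlow: "mval * (max 0 (1 - K v)) powr \<theta> \<le> mval - I v"
    by (rule tendsto_le[OF sequentially_bot Iz]) (use I_ge_mval'[OF zX] in \<open>simp add: \<theta>_def\<close>)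
  have vlow: "mval * (max 0 (K v)) powr \<theta> \<le> I v" using I_ge_mval'[OF vX] by (simp add: \<theta>_def)
  have "K v \<ge> 1"
  proof (rule ccontr)
    assume "\<not> K v \<ge> 1"
    then have k1: "K v < 1" by simp
    show False
    proof (cases "K v \<le> 0")
      case True
      \<comment> \<open>If K v <= 0, the remainder alone costs the full minimum, although v costs a
        positive amount.\<close>
      have "1 \<le> (1 - K v) powr \<theta>" using True \<theta> by (intro ge_one_powr_ge_zero) auto
      then have "mval * 1 \<le> mval * (1 - K v) powr \<theta>" using m by (intro mult_left_mono) auto
      then show False using zlow Iv k1 by simp
    next
      case False
      then have "(K v) powr \<theta> + (1 - K v) powr \<theta> > 1" using powr_sum_gt[of "K v" \<theta>] k1 \<theta> by simp
      then have "mval * ((K v) powr \<theta> + (1 - K v) powr \<theta>) > mval * 1" using m by (rule mult_strict_left_mono)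
      then show False using zlow vlow False k1 by (simp add: distrib_left)
    qed
  qed
  have "mval - I v \<ge> 0" by (rule LIMSEQ_le_const[OF Iz]) (use I_nonneg in auto)
  then have Ivm: "I v \<le> mval" by simp
  \<comment> \<open>Only K v >= 1 is known; this factor, at most 1, restores the constraint without
    increasing I.\<close>
  define t where "t = (K v) powr (- 1 / (p + 1))"
  have t: "t > 0" using \<open>K v \<ge> 1\<close> by (simp add: t_def)
  have t1: "t \<le> 1"
  proof -
    have "t = inverse ((K v) powr (1 / (p + 1)))" by (simp add: t_def flip: powr_minus)
    moreover have "(K v) powr (1 / (p + 1)) \<ge> 1" using \<open>K v \<ge> 1\<close> p_gt by (intro ge_one_powr_ge_zero) auto
    ultimately show ?thesis by (simp add: inverse_le_1_iff)
  qed
  have "t powr (p + 1) = (K v) powr (-1)" unfolding t_def powr_powr using p_gt by simp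
  then have "K (\<lambda>x. t * v x) = 1" using K_scale[OF t, of v] \<open>K v \<ge> 1\<close> by (simp add: powr_minus_divide)
  then have ad: "(\<lambda>x. t * v x) \<in> admissible" by (simp add: admissible_def in_X_scale vX)
  have "I (\<lambda>x. t * v x) = t\<^sup>2 * I v" by (rule I_scale[OF vX])
  also have "\<dots> \<le> 1 * I v" using t t1 Iv by (intro mult_right_mono) (auto simp: power_le_one)
  finally have "I (\<lambda>x. t * v x) = mval" using Ivm mval_le[OF ad] by simp
  then show thesis using that ad by blast
qed

end

section \<open>Ground states are the rescaled minimizers\<close>

text \<open>Lets a parameter integral be differentiated from one quadratic error bound, in place of
  differentiation under the integral sign.\<close>

lemma quadratic_error_derivative:
  fixes g :: "real \<Rightarrow> real"
  assumes "\<And>t. \<bar>t\<bar> \<le> 1 \<Longrightarrow> \<bar>g t - g 0 - t * k\<bar> \<le> C * t\<^sup>2"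
  shows "(g has_real_derivative k) (at 0)"
  unfolding DERIV_def
proof (rule LIM_zero_cancel, rule Lim_null_comparison)
  have "norm ((g (0 + h) - g 0) / h - k) \<le> C * \<bar>h\<bar>" if h: "h \<noteq> 0" "\<bar>h\<bar> < 1" for h
  proof -
    have "(g (0 + h) - g 0) / h - k = (g h - g 0 - h * k) / h" using h by (simp add: field_simps)
    then have "norm ((g (0 + h) - g 0) / h - k) = \<bar>g h - g 0 - h * k\<bar> / \<bar>h\<bar>" by (simp add: abs_divide)
    also have "\<dots> \<le> (C * h\<^sup>2) / \<bar>h\<bar>" using assms[of h] h by (intro divide_right_mono) auto
    also have "h\<^sup>2 = \<bar>h\<bar> * \<bar>h\<bar>" by (simp only: power2_eq_square abs_mult_self_eq)
    also have "C * (\<bar>h\<bar> * \<bar>h\<bar>) / \<bar>h\<bar> = C * \<bar>h\<bar>"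
      unfolding mult.assoc[symmetric] by (rule nonzero_mult_div_cancel_right) (use h in simp)
    finally show ?thesis .
  qed
  then show "\<forall>\<^sub>F h in at 0. norm ((g (0 + h) - g 0) / h - k) \<le> C * \<bar>h\<bar>"
    unfolding eventually_at by (intro exI[of _ 1]) (auto simp: dist_real_def)
  have "((\<lambda>h::real. C * \<bar>h\<bar>) \<longlongrightarrow> C * \<bar>0\<bar>) (at 0)" by (intro tendsto_intros)
  then show "((\<lambda>h::real. C * \<bar>h\<bar>) \<longlongrightarrow> 0) (at 0)" by simp
qed

context homogeneous_nonlinearity
begin

lemma f_times_integrable:
  assumes u: "in_X u" and w: "in_X w"
  shows "integrable lborel (\<lambda>x. f (u x) * w x)"
proof (rule Bochner_Integration.integrable_bound)
  have [measurable]: "u \<in> borel_measurable borel" "w \<in> borel_measurable borel"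
    using sqint_measurable[OF in_X_sqint[OF u]] sqint_measurable[OF in_X_sqint[OF w]] by auto
  show "integrable lborel (\<lambda>x. Cf * (norm (\<bar>u x\<bar> powr p) * norm (w x)))"
    using p_gt by (intro integrable_mult_right sqint_times_norm_integrable in_X_powr_sqint u in_X_sqint w) simp
  show "AE x in lborel. norm (f (u x) * w x) \<le> norm (Cf * (norm (\<bar>u x\<bar> powr p) * norm (w x)))"
  proof (rule AE_I2)
    fix x
    have "\<bar>f (u x)\<bar> * \<bar>w x\<bar> \<le> Cf * \<bar>u x\<bar> powr p * \<bar>w x\<bar>" by (intro mult_right_mono f_bound) simp
    then show "norm (f (u x) * w x) \<le> norm (Cf * (norm (\<bar>u x\<bar> powr p) * norm (w x)))"
      using Cf_nonneg by (simp add: abs_mult mult.assoc)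
  qed
  show "(\<lambda>x. f (u x) * w x) \<in> borel_measurable lborel" by measurable
qed

lemma K_eq: "K u = - (\<integral>x. f (u x) * u x \<partial>lborel)"
proof -
  have "(\<integral>x. F (u x) \<partial>lborel) = (\<integral>x. f (u x) * u x / (p + 1) \<partial>lborel)"
    by (simp add: F_eq mult.commute)
  also have "\<dots> = (\<integral>x. f (u x) * u x \<partial>lborel) / (p + 1)" by simp
  finally show ?thesis using p_gt by (simp add: K_def field_simps)
qed

lemma K_derivative:
  assumes u: "in_X u" and w: "in_X w"
  shows "((\<lambda>t. K (\<lambda>x. u x + t * w x)) has_real_derivative - (p + 1) * (\<integral>x. f (u x) * w x \<partial>lborel)) (at 0)"
proof (rule quadratic_error_derivative)
  fix t :: real assume t: "\<bar>t\<bar> \<le> 1"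
  \<comment> \<open>Majorant of (2 |u| + |w|)^(p + 1): the base is at most the larger of 4 |u| and 2
    |w|.\<close>
  let ?W = "\<lambda>x. 4 powr (p + 1) * \<bar>u x\<bar> powr (p + 1) + 2 powr (p + 1) * \<bar>w x\<bar> powr (p + 1)"
  define C where "C = (p + 1) * (p * Cf * (\<integral>x. ?W x \<partial>lborel))"
  have W: "integrable lborel ?W"
    using in_X_powr_integrable[OF u, of "p + 1"] in_X_powr_integrable[OF w, of "p + 1"] p_gt by simp
  have tw: "in_X (\<lambda>x. t * w x)" by (rule in_X_scale[OF w])
  have i: "integrable lborel (\<lambda>x. F (u x + t * w x))" "integrable lborel (\<lambda>x. F (u x))" "integrable lborel (\<lambda>x. f (u x) * (t * w x))"
    by (intro F_integrable in_X_add u tw f_times_integrable)+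
  have pt: "\<bar>F (u x + t * w x) - F (u x) - f (u x) * (t * w x)\<bar> \<le> p * Cf * t\<^sup>2 * ?W x" for x
  proof -
    let ?y = "2 * \<bar>u x\<bar> + \<bar>w x\<bar>"
    have tw: "\<bar>t * w x\<bar> \<le> \<bar>w x\<bar>" using t by (simp add: abs_mult mult_left_le_one_le)
    have "\<bar>F (u x + t * w x) - F (u x) - f (u x) * (t * w x)\<bar> \<le> p * Cf * (2 * \<bar>u x\<bar> + \<bar>t * w x\<bar>) powr (p - 1) * (t * w x)\<^sup>2"
      by (rule F_taylor)
    also have "\<dots> \<le> p * Cf * ?y powr (p - 1) * (t\<^sup>2 * ?y\<^sup>2)"
    proof (rule mult_mono)
      show "p * Cf * (2 * \<bar>u x\<bar> + \<bar>t * w x\<bar>) powr (p - 1) \<le> p * Cf * ?y powr (p - 1)"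
        using tw p_gt Cf_nonneg by (intro mult_left_mono powr_mono2) auto
      have "\<bar>w x\<bar>\<^sup>2 \<le> ?y\<^sup>2" by (intro power_mono) auto
      then show "(t * w x)\<^sup>2 \<le> t\<^sup>2 * ?y\<^sup>2" by (simp add: power_mult_distrib mult_left_mono)
    qed (use p_gt Cf_nonneg in auto)
    also have "\<dots> = p * Cf * t\<^sup>2 * (?y powr (p - 1) * ?y\<^sup>2)" by (simp only: mult_ac)
    also have "?y powr (p - 1) * ?y\<^sup>2 = ?y powr (p + 1)"
    proof (cases "?y = 0")
      case False
      then have "?y > 0" by simp
      then have "?y powr (p - 1) * ?y powr 2 = ?y powr (p - 1 + 2)" by (simp only: powr_add)
      then show ?thesis using \<open>?y > 0\<close> by (simp add: powr_numeral add.commute)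
    next
      case True
      show ?thesis unfolding True by simp
    qed
    also have "p * Cf * t\<^sup>2 * ?y powr (p + 1) \<le> p * Cf * t\<^sup>2 * ?W x"
    proof (rule mult_left_mono)
      have "?y powr (p + 1) \<le> (4 * \<bar>u x\<bar>) powr (p + 1) \<or> ?y powr (p + 1) \<le> (2 * \<bar>w x\<bar>) powr (p + 1)"
      proof (cases "2 * \<bar>u x\<bar> \<ge> \<bar>w x\<bar>")
        case True then show ?thesis using p_gt by (intro disjI1 powr_mono2) auto
      next
        case False then show ?thesis using p_gt by (intro disjI2 powr_mono2) auto
      qed
      then show "?y powr (p + 1) \<le> ?W x"
        by (auto simp: powr_mult intro: add_increasing add_increasing2)
    qed (use p_gt Cf_nonneg in auto)
    finally show ?thesis .
  qed
  have "\<bar>(\<integral>x. F (u x + t * w x) \<partial>lborel) - (\<integral>x. F (u x) \<partial>lborel) - t * (\<integral>x. f (u x) * w x \<partial>lborel)\<bar> \<le> p * Cf * t\<^sup>2 * (\<integral>x. ?W x \<partial>lborel)"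
  proof -
    have "t * (\<integral>x. f (u x) * w x \<partial>lborel) = (\<integral>x. f (u x) * (t * w x) \<partial>lborel)"
      by (simp only: mult.left_commute[of _ t] integral_mult_right_zero)
    then have eq: "(\<integral>x. F (u x + t * w x) \<partial>lborel) - (\<integral>x. F (u x) \<partial>lborel) - t * (\<integral>x. f (u x) * w x \<partial>lborel)
      = (\<integral>x. F (u x + t * w x) - F (u x) - f (u x) * (t * w x) \<partial>lborel)"
      by (simp only: Bochner_Integration.integral_diff[OF Bochner_Integration.integrable_diff[OF i(1,2)] i(3)]
          Bochner_Integration.integral_diff[OF i(1,2)])
    have "\<bar>\<integral>x. F (u x + t * w x) - F (u x) - f (u x) * (t * w x) \<partial>lborel\<bar>
      \<le> (\<integral>x. \<bar>F (u x + t * w x) - F (u x) - f (u x) * (t * w x)\<bar> \<partial>lborel)" by (rule integral_abs_bound)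
    also have "\<dots> \<le> (\<integral>x. p * Cf * t\<^sup>2 * ?W x \<partial>lborel)"
    proof (rule integral_mono)
      show "integrable lborel (\<lambda>x. \<bar>F (u x + t * w x) - F (u x) - f (u x) * (t * w x)\<bar>)"
        by (rule integrable_abs[OF Bochner_Integration.integrable_diff[OF Bochner_Integration.integrable_diff[OF i(1,2)] i(3)]])
      show "integrable lborel (\<lambda>x. p * Cf * t\<^sup>2 * ?W x)" by (rule integrable_mult_right[OF W])
    qed (rule pt)
    also have "\<dots> = p * Cf * t\<^sup>2 * (\<integral>x. ?W x \<partial>lborel)" by (rule integral_mult_right_zero)
    finally show ?thesis unfolding eq .
  qed
  then have le: "(p + 1) * \<bar>(\<integral>x. F (u x + t * w x) \<partial>lborel) - (\<integral>x. F (u x) \<partial>lborel) - t * (\<integral>x. f (u x) * w x \<partial>lborel)\<bar>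
    \<le> (p + 1) * (p * Cf * t\<^sup>2 * (\<integral>x. ?W x \<partial>lborel))" by (rule mult_left_mono) (use p_gt in simp)
  have "K (\<lambda>x. u x + t * w x) - K (\<lambda>x. u x + 0 * w x) - t * (- (p + 1) * (\<integral>x. f (u x) * w x \<partial>lborel))
    = - (p + 1) * ((\<integral>x. F (u x + t * w x) \<partial>lborel) - (\<integral>x. F (u x) \<partial>lborel) - t * (\<integral>x. f (u x) * w x \<partial>lborel))"
    unfolding K_def right_diff_distrib by (simp only: mult_zero_left add_0_right mult.left_commute)
  then have "\<bar>K (\<lambda>x. u x + t * w x) - K (\<lambda>x. u x + 0 * w x) - t * (- (p + 1) * (\<integral>x. f (u x) * w x \<partial>lborel))\<bar>
    = (p + 1) * \<bar>(\<integral>x. F (u x + t * w x) \<partial>lborel) - (\<integral>x. F (u x) \<partial>lborel) - t * (\<integral>x. f (u x) * w x \<partial>lborel)\<bar>"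
    unfolding abs_mult[symmetric] using p_gt by (simp only: abs_mult)
  with le show "\<bar>K (\<lambda>x. u x + t * w x) - K (\<lambda>x. u x + 0 * w x) - t * (- (p + 1) * (\<integral>x. f (u x) * w x \<partial>lborel))\<bar> \<le> C * t\<^sup>2"
    unfolding C_def by (simp only: mult_ac)
qed

end

context variational_problem
begin

text \<open>In place of a Lagrange multiplier: \<open>I_ge_mval\<close> is an equality at u, so
  along u + t w the difference of its two sides has a minimum at t = 0, and its derivative vanishes
  there.\<close>

lemma euler_lagrange:
  assumes u: "u \<in> admissible" "I u = mval" and w: "in_X w"
  shows "Bform \<beta> s \<gamma> u w = - mval * (\<integral>x. f (u x) * w x \<partial>lborel)"
proof -
  have uX: "in_X u" and K1: "K u = 1" using u(1) by (auto simp: admissible_def)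
  define k where "k = - (p + 1) * (\<integral>x. f (u x) * w x \<partial>lborel)"
  define \<theta> where "\<theta> = 2 / (p + 1)"
  define \<kappa> where "\<kappa> t = K (\<lambda>x. u x + t * w x)" for t
  define g where "g t = mval + 2 * t * Bform \<beta> s \<gamma> u w + t\<^sup>2 * I w - mval * (\<kappa> t) powr \<theta>" for t
  have \<kappa>d: "(\<kappa> has_real_derivative k) (at 0)" unfolding \<kappa>_def k_def by (rule K_derivative[OF uX w])
  have \<kappa>0: "\<kappa> 0 = 1" using K1 by (simp add: \<kappa>_def)
  have "((\<lambda>t. \<kappa> t powr \<theta>) has_real_derivative \<theta> * \<kappa> 0 powr (\<theta> - 1) * k) (at 0)"
    using has_real_derivative_powr[of "\<kappa> 0" \<theta>] \<kappa>0 by (intro DERIV_chain2[OF _ \<kappa>d]) simp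
  then have "((\<lambda>t. mval * \<kappa> t powr \<theta>) has_real_derivative mval * (\<theta> * k)) (at 0)"
    using \<kappa>0 by (intro DERIV_cmult) simp
  moreover have "((\<lambda>t. mval + 2 * t * Bform \<beta> s \<gamma> u w + t\<^sup>2 * I w) has_real_derivative 2 * Bform \<beta> s \<gamma> u w) (at 0)"
    by (auto intro!: derivative_eq_intros)
  ultimately have gd: "(g has_real_derivative 2 * Bform \<beta> s \<gamma> u w - mval * (\<theta> * k)) (at 0)"
    unfolding g_def by (intro DERIV_diff)
  \<comment> \<open>The inequality is available only where K is positive, which continuity provides
    near t = 0.\<close>
  have "\<forall>\<^sub>F t in nhds 0. 0 < \<kappa> t"
    using order_tendstoD(1)[OF DERIV_isCont[OF \<kappa>d, unfolded isCont_def], of 0] \<kappa>0 by (simp add: eventually_nhds_conv_at)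
  then obtain d where d: "d > 0" "\<And>t. \<bar>t\<bar> < d \<Longrightarrow> 0 < \<kappa> t"
    unfolding eventually_nhds_metric by (auto simp: dist_real_def)
  have "g 0 \<le> g t" if "\<bar>0 - t\<bar> < d" for t
  proof -
    have tX: "in_X (\<lambda>x. u x + t * w x)" by (intro in_X_add uX in_X_scale w)
    have "mval * (\<kappa> t) powr \<theta> \<le> I (\<lambda>x. u x + t * w x)"
      unfolding \<kappa>_def \<theta>_def by (rule I_ge_mval[OF tX]) (use d(2)[of t] that in \<open>simp add: \<kappa>_def\<close>)
    also have "\<dots> = mval + 2 * t * Bform \<beta> s \<gamma> u w + t\<^sup>2 * I w"
      using mform_lincomb_diag[OF wt_ok mfin_wt[OF uX] mfin_wt[OF w], of 1 t] u(2) by simp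
    finally have "0 \<le> g t" by (simp add: g_def)
    moreover have "g 0 = 0" by (simp add: g_def \<kappa>0)
    ultimately show ?thesis by simp
  qed
  then have "2 * Bform \<beta> s \<gamma> u w - mval * (\<theta> * k) = 0" by (intro DERIV_local_min[OF gd d(1)]) auto
  moreover have "\<theta> * k = - 2 * (\<integral>x. f (u x) * w x \<partial>lborel)"
  proof -
    have "\<theta> * k = (2 / (p + 1) * (p + 1)) * - (\<integral>x. f (u x) * w x \<partial>lborel)"
      by (simp only: \<theta>_def k_def mult.assoc minus_mult_commute)
    also have "2 / (p + 1) * (p + 1) = 2" using p_gt by (simp add: field_simps)
    finally show ?thesis by simp
  qed
  ultimately show ?thesis by simp
qed

lemma solitary_wave_iff:
  "solitary_wave f \<beta> (- s) \<gamma> \<phi> \<longleftrightarrow> in_X \<phi> \<and> (\<forall>\<psi>. in_X \<psi> \<longrightarrow> Bform \<beta> s \<gamma> \<phi> \<psi> + (\<integral>x. f (\<phi> x) * \<psi> x \<partial>lborel) = 0)"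
proof -
  have e: "\<beta> * half_form \<phi> \<psi> - (- s) * (\<integral>x. \<phi> x * \<psi> x \<partial>lborel) + (\<integral>x. f (\<phi> x) * \<psi> x \<partial>lborel) + \<gamma> * inv_form \<phi> \<psi>
    = Bform \<beta> s \<gamma> \<phi> \<psi> + (\<integral>x. f (\<phi> x) * \<psi> x \<partial>lborel)" if "in_X \<phi>" "in_X \<psi>" for \<psi>
    using Bform_eq[OF pos that] by simp
  show ?thesis
    unfolding solitary_wave_def
    by (intro conj_cong refl all_cong1 imp_cong) (simp only: e f_times_integrable simp_thms)
qed

lemma actionS_eq:
  assumes "in_X u"
  shows "actionS F \<beta> (- s) \<gamma> u = I u / 2 - K u / (p + 1)"
proof -
  have "K u / (p + 1) = - (\<integral>x. F (u x) \<partial>lborel)" using p_gt by (simp add: K_def field_simps)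
  then show ?thesis
    using Bform_eq[OF pos assms assms]
    by (simp add: actionS_def energyE_def massQ_def power2_eq_square field_simps)
qed

text \<open>The value of I on ground states: rescaling a minimizer by t = mval^(1/(p - 1)) gives t^2
  mval.\<close>

definition level :: real where "level = mval powr ((p + 1) / (p - 1))"

text \<open>Testing the equation with the wave itself gives I = K, which leaves the action as a
  fixed positive multiple of I. Comparing actions is then comparing values of I.\<close>

lemma solitary_wave_action:
  assumes \<phi>: "solitary_wave f \<beta> (- s) \<gamma> \<phi>"
  shows "actionS F \<beta> (- s) \<gamma> \<phi> = (1 / 2 - 1 / (p + 1)) * I \<phi>" "I \<phi> = K \<phi>"
proof -
  have X: "in_X \<phi>" using \<phi> by (simp add: solitary_wave_iff)
  then have "I \<phi> + (\<integral>x. f (\<phi> x) * \<phi> x \<partial>lborel) = 0" using \<phi> by (simp add: solitary_wave_iff)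
  then show "I \<phi> = K \<phi>" by (simp add: K_eq)
  then show "actionS F \<beta> (- s) \<gamma> \<phi> = (1 / 2 - 1 / (p + 1)) * I \<phi>"
    by (simp add: actionS_eq[OF X] left_diff_distrib)
qed

text \<open>Inserting K = I into \<open>I_ge_mval\<close> gives mval <= I^(1 - 2/(p + 1)), and the
  exponent of \<open>level\<close> is the reciprocal of this one.\<close>

lemma solitary_wave_level:
  assumes ne: "admissible \<noteq> {}" and \<phi>: "solitary_wave f \<beta> (- s) \<gamma> \<phi>" "nonzero_fun \<phi>"
  shows "level \<le> I \<phi>"
proof -
  have X: "in_X \<phi>" using \<phi> by (simp add: solitary_wave_iff)
  have I0: "I \<phi> > 0" using I_pos[OF X] \<phi>(2) by (simp add: nonzero_fun_def)
  define \<theta> where "\<theta> = 2 / (p + 1)"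
  have "mval * (I \<phi>) powr \<theta> \<le> I \<phi>"
    using I_ge_mval[OF X] I0 solitary_wave_action(2)[OF \<phi>(1)] by (simp add: \<theta>_def)
  then have "mval \<le> I \<phi> / (I \<phi>) powr \<theta>" using I0 by (simp add: pos_le_divide_eq)
  also have "\<dots> = (I \<phi>) powr (1 - \<theta>)" using I0 by (simp add: powr_diff)
  finally have "mval powr ((p + 1) / (p - 1)) \<le> ((I \<phi>) powr (1 - \<theta>)) powr ((p + 1) / (p - 1))"
    using mval_pos[OF ne] p_gt by (intro powr_mono2) auto
  also have "\<dots> = (I \<phi>) powr ((1 - \<theta>) * ((p + 1) / (p - 1)))" by (rule powr_powr)
  also have "1 - \<theta> = (p - 1) / (p + 1)" using p_gt by (simp add: \<theta>_def field_simps)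
  also have "(p - 1) / (p + 1) * ((p + 1) / (p - 1)) = 1" using p_gt by simp
  finally show ?thesis using I0 by (simp add: level_def)
qed

lemma solitary_wave_at_level:
  assumes ne: "admissible \<noteq> {}"
  obtains \<phi> where "solitary_wave f \<beta> (- s) \<gamma> \<phi>" "nonzero_fun \<phi>" "I \<phi> = level"
proof -
  obtain u where u: "u \<in> admissible" "I u = mval" using minimizer_exists[OF ne] by blast
  have uX: "in_X u" using u(1) by (simp add: admissible_def)
  have m: "mval > 0" by (rule mval_pos[OF ne])
  \<comment> \<open>Chosen so that t^p = t mval: homogeneity absorbs the multiplier of the
    Euler-Lagrange equation.\<close>
  define t where "t = mval powr (1 / (p - 1))"
  have t: "t > 0" using m by (simp add: t_def)
  have tp: "t powr p = t * mval"
  proof -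
    have "t powr (p - 1) = mval powr (1 / (p - 1) * (p - 1))" unfolding t_def by (rule powr_powr)
    also have "\<dots> = mval" using p_gt m by simp
    finally show ?thesis using t by (simp add: powr_diff field_simps)
  qed
  define \<phi> where "\<phi> x = t * u x" for x
  have \<phi>X: "in_X \<phi>" unfolding \<phi>_def by (rule in_X_scale[OF uX])
  have "solitary_wave f \<beta> (- s) \<gamma> \<phi>"
    unfolding solitary_wave_iff
  proof (intro conjI allI impI \<phi>X)
    fix \<psi> assume \<psi>: "in_X \<psi>"
    have "Bform \<beta> s \<gamma> \<phi> \<psi> = t * Bform \<beta> s \<gamma> u \<psi>"
      using mform_lincomb_left[OF wt_ok mfin_wt[OF uX] mfin_wt[OF uX] mfin_wt[OF \<psi>], of t 0] by (simp add: \<phi>_def[abs_def])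
    moreover have "(\<integral>x. f (\<phi> x) * \<psi> x \<partial>lborel) = t powr p * (\<integral>x. f (u x) * \<psi> x \<partial>lborel)"
      by (simp add: \<phi>_def f_hom[OF t] mult.assoc)
    ultimately show "Bform \<beta> s \<gamma> \<phi> \<psi> + (\<integral>x. f (\<phi> x) * \<psi> x \<partial>lborel) = 0"
      by (simp add: euler_lagrange[OF u \<psi>] tp)
  qed
  moreover have "I \<phi> = level"
  proof -
    have "I \<phi> = t\<^sup>2 * mval" unfolding \<phi>_def I_scale[OF uX] u(2) ..
    also have "\<dots> = mval powr (1 / (p - 1) + 1 / (p - 1) + 1)"
      unfolding powr_add t_def power2_eq_square using m by simp
    also have "1 / (p - 1) + 1 / (p - 1) + 1 = (p + 1) / (p - 1)" using p_gt by (simp add: field_simps)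
    finally show ?thesis by (simp add: level_def)
  qed
  moreover have "nonzero_fun \<phi>"
  proof (rule ccontr)
    assume "\<not> nonzero_fun \<phi>"
    then have "AE x in lborel. u x = 0" using t by (simp add: nonzero_fun_def \<phi>_def)
    then have "(\<integral>x. F (u x) \<partial>lborel) = 0"
      by (intro integral_eq_zero_AE) (auto elim!: eventually_mono simp: F_0)
    then show False using u(1) by (simp add: admissible_def K_def)
  qed
  ultimately show thesis using that by blast
qed

text \<open>All ground states have I equal to \<open>level\<close>, so the choice made by
  \<open>dfun\<close> does not matter once a ground state exists.\<close>

theorem dfun_eq:
  assumes ne: "admissible \<noteq> {}"
  shows "dfun f F \<beta> (- s) \<gamma> = (1 / 2 - 1 / (p + 1)) * mval powr ((p + 1) / (p - 1))"
proof -
  obtain \<phi>0 where \<phi>0: "solitary_wave f \<beta> (- s) \<gamma> \<phi>0" "nonzero_fun \<phi>0" "I \<phi>0 = level"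
    using solitary_wave_at_level[OF ne] by blast
  have k: "1 / 2 - 1 / (p + 1) \<ge> 0" using p_gt by (simp add: field_simps)
  have "\<phi>0 \<in> ground_states f F \<beta> (- s) \<gamma>"
    using \<phi>0 solitary_wave_action(1) solitary_wave_level[OF ne] k
    by (auto simp: ground_states_def intro!: mult_left_mono)
  then have "(SOME \<phi>. \<phi> \<in> ground_states f F \<beta> (- s) \<gamma>) \<in> ground_states f F \<beta> (- s) \<gamma>"
    by (rule someI[of "\<lambda>\<phi>. \<phi> \<in> ground_states f F \<beta> (- s) \<gamma>"])
  moreover have "actionS F \<beta> (- s) \<gamma> \<phi> = (1 / 2 - 1 / (p + 1)) * level" if "\<phi> \<in> ground_states f F \<beta> (- s) \<gamma>" for \<phi>
  proof (rule antisym)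
    show "actionS F \<beta> (- s) \<gamma> \<phi> \<le> (1 / 2 - 1 / (p + 1)) * level"
    proof -
      have "actionS F \<beta> (- s) \<gamma> \<phi> \<le> actionS F \<beta> (- s) \<gamma> \<phi>0"
        using that \<phi>0(1,2) unfolding ground_states_def by blast
      then show ?thesis using solitary_wave_action(1)[OF \<phi>0(1)] \<phi>0(3) by simp
    qed
    show "(1 / 2 - 1 / (p + 1)) * level \<le> actionS F \<beta> (- s) \<gamma> \<phi>"
      using that solitary_wave_level[OF ne, of \<phi>] solitary_wave_action(1)[of \<phi>] k
      by (auto simp: ground_states_def intro!: mult_left_mono)
  qed
  ultimately show ?thesis unfolding dfun_def level_def by blast
qed

end

section \<open>An admissible function\<close>

lemma cmod_cis_diff_one_le: "cmod (cis t - 1) \<le> \<bar>t\<bar>"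
proof (rule power2_le_imp_le)
  have "(cmod (cis t - 1))\<^sup>2 = 4 * (sin (t / 2))\<^sup>2" by (rule cmod_cis_diff_one_sq)
  also have "\<dots> \<le> 4 * \<bar>t / 2\<bar>\<^sup>2"
    using power_mono[OF abs_sin_x_le_abs_x[of "t / 2"], of 2] by simp
  finally show "(cmod (cis t - 1))\<^sup>2 \<le> \<bar>t\<bar>\<^sup>2" by (simp add: power_divide)
qed simp

text \<open>For integrable functions the chosen transform agrees almost everywhere with a concrete
  integral, which makes its behaviour near frequency 0 accessible.\<close>

lemma fourier_eq_ft:
  assumes u: "sqint lborel u" and i: "integrable lborel u"
  shows "AE \<xi> in lborel. fourier u \<xi> = ft (\<lambda>x. complex_of_real (u x)) \<xi>"
proof (rule fourier_unique[OF u])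
  have ci: "integrable lborel (\<lambda>x. complex_of_real (u x))" using i by (rule integrable_of_real)
  show "sqint lborel (ft (\<lambda>x. complex_of_real (u x)))"
    by (rule plancherel_L1_L2(1)[OF ci sqint_of_real(1)[OF u]])
  fix g :: "real \<Rightarrow> complex" assume "integrable lborel g" "sqint lborel g"
  then show "(\<integral>\<xi>. ft (\<lambda>x. complex_of_real (u x)) \<xi> * g \<xi> \<partial>lborel) = (\<integral>x. complex_of_real (u x) * ft g x \<partial>lborel)"
    by (intro ft_multiplication_formula ci)
qed

lemma compact_support_integrable:
  fixes u :: "real \<Rightarrow> real"
  assumes c: "continuous_on UNIV u" and supp: "\<And>x. \<bar>x\<bar> > R \<Longrightarrow> u x = 0"
  shows "sqint lborel u" "integrable lborel u" "integrable lborel (\<lambda>x. \<bar>x\<bar> * \<bar>u x\<bar>)"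
proof -
  show u2: "sqint lborel u" using continuous_compact_support_sqint[OF c supp] by metis
  have 1: "integrable lborel (\<lambda>x. indicat_real {-R..R} x * u x)"
    by (rule sqint_times_integrable[OF indicator_Icc_sqint(1) u2])
  have eq: "indicat_real {-R..R} x * u x = u x" for x
  proof (cases "\<bar>x\<bar> > R")
    case False
    then have "x \<in> {-R..R}" by auto
    then show ?thesis by simp
  qed (simp add: supp)
  show i: "integrable lborel u" using 1 by (simp only: eq)
  show "integrable lborel (\<lambda>x. \<bar>x\<bar> * \<bar>u x\<bar>)"
  proof (rule Bochner_Integration.integrable_bound)
    show "integrable lborel (\<lambda>x. R * u x)" using i by simp
    have "norm (\<bar>x\<bar> * \<bar>u x\<bar>) \<le> norm (R * u x)" for x
    proof (cases "\<bar>x\<bar> > R")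
      case False
      then show ?thesis by (auto simp: abs_mult intro!: mult_right_mono)
    qed (simp add: supp)
    then show "AE x in lborel. norm (\<bar>x\<bar> * \<bar>u x\<bar>) \<le> norm (R * u x)" by (rule AE_I2)
    have [measurable]: "u \<in> borel_measurable borel" using sqint_measurable[OF u2] by simp
    show "(\<lambda>x. \<bar>x\<bar> * \<bar>u x\<bar>) \<in> borel_measurable lborel" by measurable
  qed
qed

text \<open>Difference quotients of u have bounded norm by the Lipschitz condition and the compact
  support. Their transforms converge to i xi times the transform of u, so Fatou's lemma gives square
  integrability without any derivative of u.\<close>

lemma lipschitz_H1:
  fixes u :: "real \<Rightarrow> real"
  assumes lip: "\<And>x y. \<bar>u x - u y\<bar> \<le> L * \<bar>x - y\<bar>" and supp: "\<And>x. \<bar>x\<bar> > R \<Longrightarrow> u x = 0" and R: "R > 0"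
    and u2: "sqint lborel u"
  shows "sqint lborel (\<lambda>\<xi>. (\<i> * of_real \<xi>) * fourier u \<xi>)"
proof -
  have [measurable]: "u \<in> borel_measurable borel" "fourier u \<in> borel_measurable borel"
    using sqint_measurable[OF u2] fourier_measurable[OF u2] by auto
  define h where "h n = inverse (real (Suc n))" for n
  have h: "0 < h n" "h n \<le> 1" for n by (simp_all add: h_def field_simps)
  have hl: "h \<longlonglongrightarrow> 0" unfolding h_def by (rule LIMSEQ_inverse_real_of_nat)
  have tr: "nsq lborel (\<lambda>x. u (x + h n) - u x) \<le> (L * h n)\<^sup>2 * (2 * (R + 1))" for n
  proof -
    have "nsq lborel (\<lambda>x. u (x + h n) - u x) \<le> (\<integral>x. (L * h n)\<^sup>2 * indicat_real {-(R+1)..R+1} x \<partial>lborel)"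
      unfolding nsq_def
    proof (rule integral_mono)
      show "integrable lborel (\<lambda>x. (norm (u (x + h n) - u x))\<^sup>2)"
        by (rule sqint_integrable[OF sqint_diff(1)[OF sqint_shift(1)[OF u2] u2]])
      show "integrable lborel (\<lambda>x. (L * h n)\<^sup>2 * indicat_real {-(R+1)..R+1} x)"
        by (intro integrable_mult_right integrable_real_indicator) (auto simp: emeasure_lborel_Icc_eq)
      fix x
      have "\<bar>u (x + h n) - u x\<bar> \<le> L * h n" using lip[of "x + h n" x] h[of n] by simp
      from power_mono[OF this abs_ge_zero, of 2]
      have "(norm (u (x + h n) - u x))\<^sup>2 \<le> (L * h n)\<^sup>2" by simp
      moreover have "u (x + h n) - u x = 0" if "\<bar>x\<bar> > R + 1"
        using that h[of n] by (subst (1 2) supp) auto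
      ultimately show "(norm (u (x + h n) - u x))\<^sup>2 \<le> (L * h n)\<^sup>2 * indicat_real {-(R+1)..R+1} x"
        by (cases "\<bar>x\<bar> > R + 1") (auto simp: indicator_def)
    qed
    also have "\<dots> = (L * h n)\<^sup>2 * (2 * (R + 1))" using R by simp
    finally show ?thesis .
  qed
  define g where "g n \<xi> = of_real (1 / h n) * ((cis (h n * \<xi>) - 1) * fourier u \<xi>)" for n \<xi>
  have gm: "g n \<in> borel_measurable lborel" for n unfolding g_def by measurable
  have g: "sqint lborel (g n)" "nsq lborel (g n) \<le> 2 * pi * (L\<^sup>2 * (2 * (R + 1)))" for n
  proof -
    have s2: "sqint lborel (\<lambda>x. u (x + h n))" by (rule sqint_shift(1)[OF u2])
    have d2: "sqint lborel (\<lambda>x. u (x + h n) - u x)" by (rule sqint_diff(1)[OF s2 u2])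
    have e2: "sqint lborel (\<lambda>\<xi>. of_real (1 / h n) * fourier (\<lambda>x. u (x + h n) - u x) \<xi>)"
      by (intro sqint_mult_left fourier_L2 d2)
    have ae: "AE \<xi> in lborel. of_real (1 / h n) * fourier (\<lambda>x. u (x + h n) - u x) \<xi> = g n \<xi>"
      using fourier_lincomb[OF s2 u2, of 1 "-1"] fourier_shift[OF u2, of "h n"]
      by eventually_elim (simp add: g_def left_diff_distrib)
    show "sqint lborel (g n)" by (rule sqint_cong_AE(1)[OF e2 gm ae])
    have "nsq lborel (g n) = (norm (complex_of_real (1 / h n)))\<^sup>2 * nsq lborel (fourier (\<lambda>x. u (x + h n) - u x))"
      using sqint_cong_AE(2)[OF e2 gm ae] sqint_mult_left(2)[OF fourier_L2(1)[OF d2], of "of_real (1 / h n)"] by simp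
    also have "\<dots> = (1 / h n)\<^sup>2 * (2 * pi * nsq lborel (\<lambda>x. u (x + h n) - u x))"
      using plancherel[OF d2] h[of n] by (simp add: norm_divide)
    also have "\<dots> \<le> (1 / h n)\<^sup>2 * (2 * pi * ((L * h n)\<^sup>2 * (2 * (R + 1))))"
      by (intro mult_left_mono tr) auto
    also have "\<dots> = 2 * pi * (L\<^sup>2 * (2 * (R + 1)))" using h[of n] by (simp add: power_mult_distrib power_divide)
    finally show "nsq lborel (g n) \<le> 2 * pi * (L\<^sup>2 * (2 * (R + 1)))" .
  qed
  have lim: "AE \<xi> in lborel. (\<lambda>n. g n \<xi>) \<longlonglongrightarrow> (\<i> * of_real \<xi>) * fourier u \<xi>"
  proof (rule AE_I2)
    fix \<xi>
    show "(\<lambda>n. g n \<xi>) \<longlonglongrightarrow> (\<i> * of_real \<xi>) * fourier u \<xi>"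
    proof (cases "\<xi> = 0")
      case True
      then show ?thesis by (simp add: g_def)
    next
      case False
      let ?z = "\<lambda>n. \<i> * complex_of_real (h n * \<xi>)"
      have "(\<lambda>n. h n * \<xi>) \<longlonglongrightarrow> 0 * \<xi>" by (intro tendsto_mult_right hl)
      then have "(\<lambda>n. complex_of_real (h n * \<xi>)) \<longlonglongrightarrow> complex_of_real (0 * \<xi>)" by (rule tendsto_of_real)
      then have "?z \<longlonglongrightarrow> \<i> * complex_of_real (0 * \<xi>)" by (rule tendsto_mult_left)
      then have z: "?z \<longlonglongrightarrow> 0" by simp
      have z0: "?z n \<noteq> 0" for n using False h(1)[of n] by simp
      have "filterlim ?z (at 0) sequentially"
        unfolding filterlim_at using z z0 by (intro conjI always_eventually allI) auto
      then have "(\<lambda>n. (exp (?z n) - 1) / ?z n) \<longlonglongrightarrow> 1" by (rule filterlim_compose[OF lim_exp_minus_1])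
      then have "(\<lambda>n. (exp (?z n) - 1) / ?z n * ((\<i> * of_real \<xi>) * fourier u \<xi>)) \<longlonglongrightarrow> 1 * ((\<i> * of_real \<xi>) * fourier u \<xi>)"
        by (rule tendsto_mult_right)
      moreover have "(exp (?z n) - 1) / ?z n * ((\<i> * of_real \<xi>) * fourier u \<xi>) = g n \<xi>" for n
        using False h(1)[of n] by (simp add: g_def cis_conv_exp)
      ultimately show ?thesis by simp
    qed
  qed
  show ?thesis
    by (rule nsq_fatou(1)[OF g(1) _ lim always_eventually[OF allI[OF g(2)]]]) measurable
qed

text \<open>The weight |xi| is at most 1 + xi^2, which \<open>lipschitz_H1\<close> covers. The
  weight 1 / xi^2 matters on [-1, 1], where mean zero makes the transform O(|xi|).\<close>

lemma mean_zero_in_X: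
  fixes u :: "real \<Rightarrow> real"
  assumes lip: "\<And>x y. \<bar>u x - u y\<bar> \<le> L * \<bar>x - y\<bar>" and supp: "\<And>x. \<bar>x\<bar> > R \<Longrightarrow> u x = 0" and R: "R > 0"
    and mean: "(\<integral>x. u x \<partial>lborel) = 0"
  shows "in_X u"
proof -
  have c: "continuous_on UNIV u"
  proof (rule lipschitz_on_continuous_on)
    show "\<bar>L\<bar>-lipschitz_on UNIV u"
      unfolding lipschitz_on_def dist_real_def
      by (intro conjI ballI abs_ge_zero order_trans[OF lip mult_right_mono[OF abs_ge_self abs_ge_zero]])
  qed
  note csi = compact_support_integrable[OF c supp]
  have u2: "sqint lborel u" using csi(1) by blast
  have ui: "integrable lborel u" using csi(2) by blast
  have xu: "integrable lborel (\<lambda>x. \<bar>x\<bar> * \<bar>u x\<bar>)" using csi(3) by blast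
  have [measurable]: "fourier u \<in> borel_measurable borel" by (rule fourier_measurable[OF u2])
  have F2: "integrable lborel (\<lambda>\<xi>. (cmod (fourier u \<xi>))\<^sup>2)" by (rule sqint_integrable[OF fourier_L2(1)[OF u2]])
  have H1: "sqint lborel (\<lambda>\<xi>. (\<i> * of_real \<xi>) * fourier u \<xi>)" by (rule lipschitz_H1[OF lip supp R u2])
  have G2: "integrable lborel (\<lambda>\<xi>. \<xi>\<^sup>2 * (cmod (fourier u \<xi>))\<^sup>2)"
    using sqint_integrable[OF H1] by (simp add: norm_mult power_mult_distrib)
  have half: "mfin (\<lambda>\<xi>. \<bar>\<xi>\<bar>) u"
    unfolding mfin_def
  proof (rule conjI, rule u2, rule Bochner_Integration.integrable_bound)
    show "integrable lborel (\<lambda>\<xi>. (cmod (fourier u \<xi>))\<^sup>2 + \<xi>\<^sup>2 * (cmod (fourier u \<xi>))\<^sup>2)" using F2 G2 by simp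
    have "\<bar>\<xi>\<bar> * (cmod (fourier u \<xi>))\<^sup>2 \<le> (1 + \<xi>\<^sup>2) * (cmod (fourier u \<xi>))\<^sup>2" for \<xi>
    proof (rule mult_right_mono)
      show "\<bar>\<xi>\<bar> \<le> 1 + \<xi>\<^sup>2" using sum_squares_bound[of "\<bar>\<xi>\<bar>" 1] by simp
    qed simp
    then show "AE \<xi> in lborel. norm (\<bar>\<xi>\<bar> * (cmod (fourier u \<xi>))\<^sup>2) \<le> norm ((cmod (fourier u \<xi>))\<^sup>2 + \<xi>\<^sup>2 * (cmod (fourier u \<xi>))\<^sup>2)"
      by (intro AE_I2) (simp add: distrib_right)
  qed measurable
  define C where "C = (\<integral>x. \<bar>x\<bar> * \<bar>u x\<bar> \<partial>lborel)"
  have low: "AE \<xi> in lborel. cmod (fourier u \<xi>) \<le> C * \<bar>\<xi>\<bar>"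
    using fourier_eq_ft[OF u2 ui]
  proof eventually_elim
    case (elim \<xi>)
    have ci: "integrable lborel (\<lambda>x. complex_of_real (u x))" using ui by (rule integrable_of_real)
    have cc: "integrable lborel (\<lambda>x. complex_of_real (u x) * cis (- (x * \<xi>)))"
      by (rule integrable_times_cis[OF ci]) simp
    \<comment> \<open>Subtracting the vanishing mean replaces the exponential by its difference from
      1, of modulus at most |x xi|.\<close>
    have "ft (\<lambda>x. complex_of_real (u x)) \<xi> = (\<integral>x. complex_of_real (u x) * cis (- (x * \<xi>)) \<partial>lborel) - (\<integral>x. complex_of_real (u x) \<partial>lborel)"
      unfolding ft_def using mean integral_of_real[OF ui, where 'a=complex] by simp
    also have "\<dots> = (\<integral>x. complex_of_real (u x) * cis (- (x * \<xi>)) - complex_of_real (u x) \<partial>lborel)"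
      by (rule Bochner_Integration.integral_diff[OF cc ci, symmetric])
    finally have "cmod (fourier u \<xi>) = cmod (\<integral>x. complex_of_real (u x) * cis (- (x * \<xi>)) - complex_of_real (u x) \<partial>lborel)"
      using elim by simp
    also have "\<dots> \<le> (\<integral>x. cmod (complex_of_real (u x) * cis (- (x * \<xi>)) - complex_of_real (u x)) \<partial>lborel)"
      by (rule integral_norm_bound)
    also have "\<dots> \<le> (\<integral>x. \<bar>\<xi>\<bar> * (\<bar>x\<bar> * \<bar>u x\<bar>) \<partial>lborel)"
    proof (rule integral_mono)
      show "integrable lborel (\<lambda>x. cmod (complex_of_real (u x) * cis (- (x * \<xi>)) - complex_of_real (u x)))"
        by (intro integrable_norm Bochner_Integration.integrable_diff cc ci)
      show "integrable lborel (\<lambda>x. \<bar>\<xi>\<bar> * (\<bar>x\<bar> * \<bar>u x\<bar>))" using xu by simp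
      fix x
      have "complex_of_real (u x) * cis (- (x * \<xi>)) - complex_of_real (u x) = complex_of_real (u x) * (cis (- (x * \<xi>)) - 1)"
        by (simp add: right_diff_distrib)
      then have "cmod (complex_of_real (u x) * cis (- (x * \<xi>)) - complex_of_real (u x)) = \<bar>u x\<bar> * cmod (cis (- (x * \<xi>)) - 1)"
        by (simp only: norm_mult norm_of_real real_norm_def)
      also have "\<dots> \<le> \<bar>u x\<bar> * \<bar>- (x * \<xi>)\<bar>" by (intro mult_left_mono cmod_cis_diff_one_le) simp
      finally show "cmod (complex_of_real (u x) * cis (- (x * \<xi>)) - complex_of_real (u x)) \<le> \<bar>\<xi>\<bar> * (\<bar>x\<bar> * \<bar>u x\<bar>)"
        by (simp add: abs_mult mult_ac)
    qed
    also have "\<dots> = C * \<bar>\<xi>\<bar>" by (simp add: C_def mult.commute)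
    finally show ?case .
  qed
  have inv: "mfin (\<lambda>\<xi>. 1 / \<xi>\<^sup>2) u"
    unfolding mfin_def
  proof (rule conjI, rule u2, rule Bochner_Integration.integrable_bound)
    show "integrable lborel (\<lambda>\<xi>. C\<^sup>2 * indicat_real {-1..1} \<xi> + (cmod (fourier u \<xi>))\<^sup>2)"
      using F2 by (intro Bochner_Integration.integrable_add integrable_mult_right integrable_real_indicator) (auto simp: emeasure_lborel_Icc_eq)
    show "AE \<xi> in lborel. norm (1 / \<xi>\<^sup>2 * (cmod (fourier u \<xi>))\<^sup>2) \<le> norm (C\<^sup>2 * indicat_real {-1..1} \<xi> + (cmod (fourier u \<xi>))\<^sup>2)"
      using low
    proof eventually_elim
      case (elim \<xi>)
      have "1 / \<xi>\<^sup>2 * (cmod (fourier u \<xi>))\<^sup>2 \<le> C\<^sup>2 * indicat_real {-1..1} \<xi> + (cmod (fourier u \<xi>))\<^sup>2"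
      proof (cases "\<bar>\<xi>\<bar> \<le> 1")
        case True
        have "(cmod (fourier u \<xi>))\<^sup>2 \<le> (C * \<bar>\<xi>\<bar>)\<^sup>2" by (rule power_mono[OF elim]) simp
        then have "1 / \<xi>\<^sup>2 * (cmod (fourier u \<xi>))\<^sup>2 \<le> C\<^sup>2"
          by (cases "\<xi> = 0") (simp_all add: power_mult_distrib pos_divide_le_eq)
        then show ?thesis using True by (auto simp: indicator_def abs_le_iff intro: add_increasing2)
      next
        case False
        then have "1 \<le> \<xi>\<^sup>2" using abs_square_le_1[of \<xi>] by linarith
        then have "1 / \<xi>\<^sup>2 * (cmod (fourier u \<xi>))\<^sup>2 \<le> 1 * (cmod (fourier u \<xi>))\<^sup>2"
          by (intro mult_right_mono) (auto simp: divide_le_eq)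
        then show ?thesis by (simp add: add_increasing)
      qed
      then show ?case by (simp add: abs_mult)
    qed
  qed measurable
  show ?thesis unfolding in_X_iff using half inv by blast
qed

definition tent :: "real \<Rightarrow> real" where "tent x = max 0 (1 - \<bar>x\<bar>)"

lemma tent_props: "tent x \<ge> 0" "\<bar>x\<bar> \<ge> 1 \<Longrightarrow> tent x = 0" "\<bar>tent x - tent y\<bar> \<le> \<bar>x - y\<bar>"
  by (auto simp: tent_def)

lemma continuous_tent: "continuous_on UNIV tent"
  unfolding tent_def[abs_def] by (intro continuous_intros)

text \<open>A tent of height 1 and a disjoint wide shallow tent of opposite sign: mean zero makes the antiderivative
  square integrable, and the wide tent contributes little to \<open>K\<close>.\<close>

definition bump :: "real \<Rightarrow> real \<Rightarrow> real" where
  "bump L x = tent x - (1 / L) * tent ((x - (L + 1)) / L)"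

lemma integral_wide_tent:
  assumes L: "L > 0"
  shows "(\<integral>x. g (tent ((x - a) / L)) \<partial>lborel) = L * (\<integral>x. g (tent x) \<partial>lborel :: real)"
  using lborel_integral_real_affine[of L "\<lambda>x. g (tent ((x - a) / L))" a] L by simp

lemma bump_in_X:
  assumes L: "L \<ge> 1"
  shows "in_X (\<lambda>x. t * bump L x)"
proof (rule in_X_scale, rule mean_zero_in_X)
  fix x y
  have "\<bar>tent ((x - (L + 1)) / L) - tent ((y - (L + 1)) / L)\<bar> \<le> \<bar>(x - (L + 1)) / L - (y - (L + 1)) / L\<bar>" by (rule tent_props)
  also have "\<dots> = \<bar>x - y\<bar> / L" using L by (simp add: diff_divide_distrib[symmetric] abs_divide)
  also have "\<dots> \<le> \<bar>x - y\<bar>" using mult_right_mono[OF L abs_ge_zero[of "x - y"]] L by (simp add: pos_divide_le_eq mult.commute)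
  finally have 1: "\<bar>tent ((x - (L + 1)) / L) - tent ((y - (L + 1)) / L)\<bar> \<le> \<bar>x - y\<bar>" .
  have "(1 / L) * \<bar>tent ((x - (L + 1)) / L) - tent ((y - (L + 1)) / L)\<bar> \<le> 1 * \<bar>x - y\<bar>"
    using L by (intro mult_mono 1) auto
  then have 2: "\<bar>(1 / L) * (tent ((x - (L + 1)) / L) - tent ((y - (L + 1)) / L))\<bar> \<le> \<bar>x - y\<bar>"
    using L by (simp add: abs_mult)
  have "bump L x - bump L y = (tent x - tent y) - (1 / L) * (tent ((x - (L + 1)) / L) - tent ((y - (L + 1)) / L))"
    by (simp add: bump_def right_diff_distrib)
  also have "\<bar>\<dots>\<bar> \<le> \<bar>tent x - tent y\<bar> + \<bar>(1 / L) * (tent ((x - (L + 1)) / L) - tent ((y - (L + 1)) / L))\<bar>"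
    by (rule abs_triangle_ineq4)
  also have "\<dots> \<le> \<bar>x - y\<bar> + \<bar>x - y\<bar>" by (intro add_mono tent_props 2)
  finally show "\<bar>bump L x - bump L y\<bar> \<le> 2 * \<bar>x - y\<bar>" by simp
next
  fix x :: real assume x: "2 * L + 1 < \<bar>x\<bar>"
  have "\<bar>x - (L + 1)\<bar> \<ge> L" using x L by linarith
  then have "\<bar>(x - (L + 1)) / L\<bar> \<ge> 1" using L by (simp add: abs_divide pos_le_divide_eq)
  then show "bump L x = 0" using x L by (simp add: bump_def tent_props(2))
next
  show "2 * L + 1 > 0" using L by simp
  have i: "integrable lborel tent" by (rule compact_support_integrable(2)[OF continuous_tent, of 1]) (simp add: tent_props)
  have i2: "integrable lborel (\<lambda>x. tent ((x - (L + 1)) / L))"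
  proof -
    have "- (L + 1) / L + 1 / L * x = (x - (L + 1)) / L" for x using L by (simp add: field_simps)
    then show ?thesis
      using lborel_integrable_real_affine[OF i, of "1 / L" "- (L + 1) / L"] L by (simp only:) simp
  qed
  have "(\<integral>x. bump L x \<partial>lborel) = (\<integral>x. tent x \<partial>lborel) - (1 / L) * (\<integral>x. tent ((x - (L + 1)) / L) \<partial>lborel)"
    unfolding bump_def using i i2 by simp
  also have "\<dots> = 0" using integral_wide_tent[of L "\<lambda>x. x" "L + 1"] L by simp
  finally show "(\<integral>x. bump L x \<partial>lborel) = 0" .
qed

context homogeneous_nonlinearity
begin

lemma tent_powr_integrable: "integrable lborel (\<lambda>x. tent x powr (p + 1))"
proof (rule compact_support_integrable(2)[of _ 1])
  show "continuous_on UNIV (\<lambda>x. tent x powr (p + 1))"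
    using p_gt by (intro continuous_on_powr' continuous_tent continuous_on_const) (auto simp: tent_props)
  show "1 < \<bar>x\<bar> \<Longrightarrow> tent x powr (p + 1) = 0" for x by (simp add: tent_props)
qed

text \<open>At each point at most one tent is nonzero, so F splits pointwise. The height 1 / L of
  the wide tent contributes L^(-p - 1) and its width L, hence L^(-p).\<close>

lemma integral_F_bump:
  assumes L: "L \<ge> 1" and \<tau>: "\<tau> = (\<integral>x. tent x powr (p + 1) \<partial>lborel)"
  shows "(\<integral>x. F (e * bump L x) \<partial>lborel) = \<tau> * (F e + L powr (- p) * F (- e))"
proof -
  note T = tent_powr_integrable
  define W where "W x = tent ((x - (L + 1)) / L)" for x
  have W: "integrable lborel (\<lambda>x. W x powr (p + 1))"
  proof -
    have "- (L + 1) / L + 1 / L * x = (x - (L + 1)) / L" for x using L by (simp add: field_simps)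
    then show ?thesis
      using lborel_integrable_real_affine[OF T, of "1 / L" "- (L + 1) / L"] L by (simp only: W_def) simp
  qed
  have Ft: "F (t * y) = t powr (p + 1) * F y" if "t \<ge> 0" for t y
    using that F_hom[of t y] by (cases "t = 0") (auto simp: F_0)
  have pt: "F (e * bump L x) = tent x powr (p + 1) * F e + (W x powr (p + 1)) * ((1 / L) powr (p + 1) * F (- e))" for x
  proof (cases "\<bar>x\<bar> \<ge> 1")
    case True
    then have t0: "tent x = 0" by (rule tent_props)
    have "e * bump L x = ((1 / L) * W x) * (- e)" by (simp add: bump_def t0 W_def)
    then have "F (e * bump L x) = ((1 / L) * W x) powr (p + 1) * F (- e)"
      using Ft[of "(1 / L) * W x" "- e"] L tent_props(1) by (simp only:) (simp add: W_def)
    moreover have "((1 / L) * W x) powr (p + 1) = (1 / L) powr (p + 1) * W x powr (p + 1)"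
      by (rule powr_mult)
    ultimately have "F (e * bump L x) = W x powr (p + 1) * ((1 / L) powr (p + 1) * F (- e))"
      by (simp only: mult_ac)
    then show ?thesis unfolding t0 by simp
  next
    case False
    then have "\<bar>x - (L + 1)\<bar> \<ge> L" by linarith
    then have "\<bar>(x - (L + 1)) / L\<bar> \<ge> 1" using L by (simp add: abs_divide pos_le_divide_eq)
    then have w0: "W x = 0" unfolding W_def by (rule tent_props)
    have "F (e * bump L x) = F (tent x * e)" using w0 by (simp add: bump_def W_def mult.commute)
    then show ?thesis using Ft[OF tent_props(1)] w0 by simp
  qed
  have "(\<integral>x. F (e * bump L x) \<partial>lborel) = \<tau> * F e + (\<integral>x. W x powr (p + 1) \<partial>lborel) * ((1 / L) powr (p + 1) * F (- e))"
    unfolding pt using T W by (simp add: \<tau>)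
  also have "(\<integral>x. W x powr (p + 1) \<partial>lborel) = L * \<tau>"
    using integral_wide_tent[of L "\<lambda>x. x powr (p + 1)" "L + 1"] L by (simp add: W_def \<tau>)
  also have "L * \<tau> * ((1 / L) powr (p + 1) * F (- e)) = \<tau> * (L powr (- p) * F (- e))"
  proof -
    have "L * (1 / L) powr (p + 1) = L powr (- p)" using L by (simp add: powr_add powr_divide powr_minus_divide)
    then show ?thesis by (metis mult.assoc mult.commute)
  qed
  finally show ?thesis by (simp add: distrib_left)
qed

theorem admissible_nonempty: "admissible \<noteq> {}"
proof -
  obtain s0 where s0: "F s0 < 0" using F_neg by blast
  \<comment> \<open>Homogeneity moves the sign condition from s0 to one of the two points 1 and
    -1.\<close>
  define e where "e = sgn s0"
  have "s0 \<noteq> 0" using s0 F_0 by auto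
  then have "F s0 = \<bar>s0\<bar> powr (p + 1) * F e" using F_hom[of "\<bar>s0\<bar>" e] by (simp add: e_def abs_mult_sgn)
  then have Fe: "F e < 0" using s0 \<open>s0 \<noteq> 0\<close> by (simp add: mult_less_0_iff)
  define \<tau> where "\<tau> = (\<integral>x. tent x powr (p + 1) \<partial>lborel)"
  have \<tau>: "\<tau> > 0"
  proof -
    note T = tent_powr_integrable
    have "(1/2) powr (p + 1) * 1 = (\<integral>x. (1/2) powr (p + 1) * indicat_real {-1/2..1/2::real} x \<partial>lborel)" by simp
    also have "\<dots> \<le> \<tau>" unfolding \<tau>_def
    proof (rule integral_mono[OF _ T])
      show "integrable lborel (\<lambda>x. (1/2) powr (p + 1) * indicat_real {-1/2..1/2::real} x)"
        by (intro integrable_mult_right integrable_real_indicator) (auto simp: emeasure_lborel_Icc_eq)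
      fix x :: real
      show "(1/2) powr (p + 1) * indicat_real {-1/2..1/2::real} x \<le> tent x powr (p + 1)"
      proof (cases "x \<in> {-1/2..1/2::real}")
        case True
        then have "1/2 \<le> tent x" by (auto simp: tent_def)
        then have "(1/2) powr (p + 1) \<le> tent x powr (p + 1)" using p_gt by (intro powr_mono2) auto
        then show ?thesis using True by simp
      next
        case False
        then have "indicat_real {-1/2..1/2} x = 0" by (rule indicator_simps(2))
        then show ?thesis by (simp only: mult_zero_right powr_ge_zero)
      qed
    qed
    finally show ?thesis using powr_gt_zero[of "1/2" "p + 1"] by linarith
  qed
  \<comment> \<open>Large enough that |F(-e)| / L < - F e: the wide tent, entering with weight
    L^(-p) <= 1 / L, cannot cancel the narrow one.\<close>
  define L where "L = 1 + \<bar>F (- e)\<bar> / (- F e)"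
  have L: "L \<ge> 1" using Fe by (simp add: L_def field_simps)
  have "L powr (- p) * F (- e) \<le> (1 / L) * \<bar>F (- e)\<bar>"
  proof -
    have "L powr (- p) \<le> L powr (- 1)" using L p_gt by (intro powr_mono) auto
    then have "L powr (- p) \<le> 1 / L" using L by (simp add: powr_minus_divide)
    then have "L powr (- p) * \<bar>F (- e)\<bar> \<le> (1 / L) * \<bar>F (- e)\<bar>" by (rule mult_right_mono) simp
    moreover have "L powr (- p) * F (- e) \<le> L powr (- p) * \<bar>F (- e)\<bar>" by (intro mult_left_mono) auto
    ultimately show ?thesis by linarith
  qed
  also have "\<dots> < - F e"
  proof -
    have "\<bar>F (- e)\<bar> = (L - 1) * (- F e)" using Fe by (simp add: L_def)
    also have "\<dots> < L * (- F e)" using Fe by (intro mult_strict_right_mono) auto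
    finally show ?thesis using L by (simp add: pos_divide_less_eq mult.commute)
  qed
  finally have "F e + L powr (- p) * F (- e) < 0" by simp
  then have "(\<integral>x. F (e * bump L x) \<partial>lborel) < 0"
    unfolding integral_F_bump[OF L \<tau>_def] using \<tau> by (simp add: mult_pos_neg)
  then have Kp: "K (\<lambda>x. e * bump L x) > 0" unfolding K_def using p_gt by (intro mult_neg_neg) auto
  define k where "k = K (\<lambda>x. e * bump L x)"
  define t where "t = k powr (- 1 / (p + 1))"
  have k: "k > 0" using Kp by (simp add: k_def)
  have t: "t > 0" using k by (simp add: t_def)
  have "t powr (p + 1) = k powr (-1)" unfolding t_def powr_powr using p_gt by simp
  then have "K (\<lambda>x. t * (e * bump L x)) = 1"
    using K_scale[OF t, of "\<lambda>x. e * bump L x"] k by (simp add: k_def powr_minus_divide)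
  then have "(\<lambda>x. t * (e * bump L x)) \<in> admissible"
    by (simp add: admissible_def in_X_scale bump_in_X[OF L])
  then show ?thesis by blast
qed

end

section \<open>Scaling and the sign of the second derivative\<close>

context homogeneous_nonlinearity
begin

lemma variational_problemI: "\<beta> > 0 \<Longrightarrow> s > 0 \<Longrightarrow> \<gamma> > 0 \<Longrightarrow> variational_problem f F p \<beta> s \<gamma>"
  by (intro variational_problem.intro homogeneous_nonlinearity_axioms variational_problem_axioms.intro)

text \<open>Under u(c x) the symbol at c xi is c times the symbol with s / c and gamma / c^3, and
  the Jacobian cancels the factor c. The constraint value becomes 1 / c, which the homogeneous
  inequality converts into the power of c.\<close>

lemma minval_dilate_le:
  assumes pos: "\<beta> > 0" "s > 0" "\<gamma> > 0" and c: "c > 0"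
  shows "minval \<beta> s \<gamma> \<le> c powr (2 / (p + 1)) * minval \<beta> (s / c) (\<gamma> / c^3)"
proof -
  interpret A: variational_problem f F p \<beta> s \<gamma> by (rule variational_problemI[OF pos])
  have pos': "\<beta> > 0" "s / c > 0" "\<gamma> / c^3 > 0" using pos c by auto
  have key: "minval \<beta> s \<gamma> \<le> c powr (2 / (p + 1)) * Bform \<beta> (s / c) (\<gamma> / c^3) u u" if u: "u \<in> admissible" for u
  proof -
    have uX: "in_X u" and K: "K u = 1" using u by (auto simp: admissible_def)
    have u2: "sqint lborel u" by (rule in_X_sqint[OF uX])
    have wt: "wt \<beta> s \<gamma> (c * \<xi>) = c * wt \<beta> (s / c) (\<gamma> / c^3) \<xi>" for \<xi>
      using c by (simp add: wt_def abs_mult distrib_left power_mult_distrib power3_eq_cube power2_eq_square)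
    have mf: "mfin (wt \<beta> (s / c) (\<gamma> / c^3)) u" using in_X_wt[OF pos'] uX by blast
    have "mfin (\<lambda>\<xi>. wt \<beta> s \<gamma> (c * \<xi>)) u"
      unfolding wt using mf by (simp add: mfin_def mult.assoc)
    then have dX: "in_X (\<lambda>x. u (c * x))"
      using in_X_wt[OF pos] mfin_dilate(1)[OF A.wt_ok c u2] by blast
    have "Bform \<beta> s \<gamma> (\<lambda>x. u (c * x)) (\<lambda>x. u (c * x)) = mform (\<lambda>\<xi>. wt \<beta> s \<gamma> (c * \<xi>)) u u / c"
      by (rule mfin_dilate(2)[OF A.wt_ok c u2])
    also have "\<dots> = Bform \<beta> (s / c) (\<gamma> / c^3) u u"
      unfolding wt mform_diag using c by (simp add: mult.assoc)
    finally have B: "Bform \<beta> s \<gamma> (\<lambda>x. u (c * x)) (\<lambda>x. u (c * x)) = Bform \<beta> (s / c) (\<gamma> / c^3) u u" .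
    have "minval \<beta> s \<gamma> * (K (\<lambda>x. u (c * x))) powr (2 / (p + 1)) \<le> Bform \<beta> s \<gamma> (\<lambda>x. u (c * x)) (\<lambda>x. u (c * x))"
      by (rule A.I_ge_mval[OF dX]) (use K_dilate[OF c, of u] K c in simp)
    then have "minval \<beta> s \<gamma> * (1 / c) powr (2 / (p + 1)) \<le> Bform \<beta> (s / c) (\<gamma> / c^3) u u"
      unfolding B K_dilate[OF c] K .
    then have "c powr (2 / (p + 1)) * (minval \<beta> s \<gamma> * (1 / c) powr (2 / (p + 1))) \<le> c powr (2 / (p + 1)) * Bform \<beta> (s / c) (\<gamma> / c^3) u u"
      by (rule mult_left_mono) simp
    moreover have "c powr (2 / (p + 1)) * (1 / c) powr (2 / (p + 1)) = 1" using c by (simp flip: powr_mult)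
    ultimately show ?thesis by (simp add: mult.left_commute)
  qed
  have cp: "c powr (2 / (p + 1)) > 0" using c by simp
  have "minval \<beta> s \<gamma> / c powr (2 / (p + 1)) \<le> minval \<beta> (s / c) (\<gamma> / c^3)"
    unfolding minval_def[of \<beta> "s / c"]
    by (rule cINF_greatest[OF admissible_nonempty]) (use key cp in \<open>simp add: pos_divide_le_eq mult.commute\<close>)
  then show ?thesis using cp by (simp add: pos_divide_le_eq mult.commute)
qed

text \<open>Dilation by s gives one inequality; dilation by 1 / s, applied to the normalized
  problem, gives the other.\<close>

lemma minval_scaling:
  assumes pos: "\<beta> > 0" "s > 0" "\<gamma> > 0"
  shows "minval \<beta> s \<gamma> = s powr (2 / (p + 1)) * minval \<beta> 1 (\<gamma> / s^3)"
proof (rule antisym)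
  show "minval \<beta> s \<gamma> \<le> s powr (2 / (p + 1)) * minval \<beta> 1 (\<gamma> / s^3)"
    using minval_dilate_le[OF pos pos(2)] pos by simp
  have "minval \<beta> 1 (\<gamma> / s^3) \<le> (1 / s) powr (2 / (p + 1)) * minval \<beta> (1 / (1 / s)) (\<gamma> / s^3 / (1 / s)^3)"
    by (rule minval_dilate_le) (use pos in auto)
  also have "minval \<beta> (1 / (1 / s)) (\<gamma> / s^3 / (1 / s)^3) = minval \<beta> s \<gamma>"
    using pos by (simp add: power_divide)
  finally have "s powr (2 / (p + 1)) * minval \<beta> 1 (\<gamma> / s^3) \<le> s powr (2 / (p + 1)) * ((1 / s) powr (2 / (p + 1)) * minval \<beta> s \<gamma>)"
    by (rule mult_left_mono) simp
  also have "\<dots> = (s powr (2 / (p + 1)) * (1 / s) powr (2 / (p + 1))) * minval \<beta> s \<gamma>" by (simp only: mult.assoc)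
  also have "s powr (2 / (p + 1)) * (1 / s) powr (2 / (p + 1)) = 1" using pos by (simp flip: powr_mult)
  finally show "s powr (2 / (p + 1)) * minval \<beta> 1 (\<gamma> / s^3) \<le> minval \<beta> s \<gamma>" by simp
qed

lemma minval_mono:
  assumes pos: "\<beta> > 0" "s > 0" "\<gamma> > 0" and le: "\<gamma> \<le> \<gamma>'"
  shows "minval \<beta> s \<gamma> \<le> minval \<beta> s \<gamma>'"
  unfolding minval_def[of \<beta> s \<gamma>']
proof (rule cINF_greatest[OF admissible_nonempty])
  interpret A: variational_problem f F p \<beta> s \<gamma> by (rule variational_problemI[OF pos])
  fix u assume u: "u \<in> admissible"
  have uX: "in_X u" using u by (simp add: admissible_def)
  have "inv_form u u \<ge> 0" unfolding inv_form_mform by (intro mform_nonneg mult_ok_basic)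
  then have "\<gamma> * inv_form u u \<le> \<gamma>' * inv_form u u" using le by (rule mult_right_mono[rotated])
  then have "Bform \<beta> s \<gamma> u u \<le> Bform \<beta> s \<gamma>' u u"
    using Bform_eq[OF pos uX uX] Bform_eq[OF pos(1,2) less_le_trans[OF pos(3) le] uX uX] by simp
  then show "minval \<beta> s \<gamma> \<le> Bform \<beta> s \<gamma>' u u" using A.mval_le[OF u] by linarith
qed

definition expo :: real where "expo = 2 / (p - 1)"

lemma expo_eq: "2 / (p + 1) * ((p + 1) / (p - 1)) = expo"
proof -
  have "p + 1 \<noteq> 0" using p_gt by simp
  then show ?thesis
    unfolding expo_def times_divide_times_eq mult.commute[of "p + 1" "p - 1"]
    by (rule nonzero_mult_divide_mult_cancel_right)
qed

text \<open>Apart from a power of s = -c, the value depends on s and gamma only through gamma / s^3.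
  The factor mu keeps this ratio while moving gamma to 1, so small gamma at fixed c means large s at
  gamma = 1.\<close>

lemma dfun_scaling:
  assumes \<beta>: "\<beta> > 0" and \<gamma>: "\<gamma> > 0" and c: "c < 0" and \<mu>: "\<mu> = \<gamma> powr (- 1 / 3)"
  shows "dfun f F \<beta> c \<gamma> = \<mu> powr (- expo) * dfun f F \<beta> (\<mu> * c) 1"
proof -
  have \<mu>0: "\<mu> > 0" using \<gamma> by (simp add: \<mu>)
  have \<mu>3: "\<mu> ^ 3 = 1 / \<gamma>"
  proof -
    have "\<mu> ^ 3 = \<mu> powr 3" using \<mu>0 by (simp add: powr_numeral)
    also have "\<dots> = \<gamma> powr (- 1)" unfolding \<mu> powr_powr by simp
    finally show ?thesis using \<gamma> by (simp add: powr_minus_divide)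
  qed
  have eq: "dfun f F \<beta> (- s) \<gamma>' = (1 / 2 - 1 / (p + 1)) * (s powr expo * minval \<beta> 1 (\<gamma>' / s^3) powr ((p + 1) / (p - 1)))"
    if "s > 0" "\<gamma>' > 0" for s \<gamma>'
  proof -
    interpret variational_problem f F p \<beta> s \<gamma>' by (rule variational_problemI[OF \<beta> that])
    show ?thesis
      unfolding dfun_eq[OF admissible_nonempty] minval_scaling[OF pos] powr_mult powr_powr expo_eq ..
  qed
  have s: "- c > 0" "\<mu> * (- c) > 0" using c \<mu>0 by (auto simp: mult_pos_neg)
  have "1 / (\<mu> * (- c))^3 = \<gamma> / (- c)^3" unfolding power_mult_distrib \<mu>3 using \<gamma> by simp
  then have "dfun f F \<beta> (\<mu> * c) 1 = (1 / 2 - 1 / (p + 1)) * ((\<mu> * (- c)) powr expo * minval \<beta> 1 (\<gamma> / (- c)^3) powr ((p + 1) / (p - 1)))"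
    using eq[OF s(2), of 1] by simp
  also have "(\<mu> * (- c)) powr expo = \<mu> powr expo * (- c) powr expo" by (rule powr_mult)
  finally have "\<mu> powr (- expo) * dfun f F \<beta> (\<mu> * c) 1
    = (\<mu> powr (- expo) * \<mu> powr expo) * ((1 / 2 - 1 / (p + 1)) * ((- c) powr expo * minval \<beta> 1 (\<gamma> / (- c)^3) powr ((p + 1) / (p - 1))))"
    by (simp only: mult_ac)
  also have "\<mu> powr (- expo) * \<mu> powr expo = 1" using \<mu>0 by (simp flip: powr_add)
  finally show ?thesis using eq[OF s(1) \<gamma>] by simp
qed

text \<open>For x >= 1 the ratio 1 / x^3 lies in (0, 1]. The lower constant is the bound of
  \<open>mval_lower\<close>, common to all gamma; the upper one uses the minimal value at gamma = 1,
  by monotonicity.\<close>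

lemma dfun_growth:
  assumes \<beta>: "\<beta> > 0"
  obtains k1 k2 where "k1 > 0" "k2 > 0" "\<And>x. x \<ge> 1 \<Longrightarrow> k1 * x powr expo \<le> dfun f F \<beta> (- x) 1"
    "\<And>x. x \<ge> 1 \<Longrightarrow> dfun f F \<beta> (- x) 1 \<le> k2 * x powr expo"
proof -
  define q where "q = (p + 1) / (p - 1)"
  have q: "q > 0" using p_gt by (simp add: q_def)
  define \<kappa> where "\<kappa> = 1 / 2 - 1 / (p + 1)"
  have \<kappa>: "\<kappa> > 0" using p_gt by (simp add: \<kappa>_def field_simps)
  define m0 where "m0 = (1 / ((p + 1) * Cf * sob (p + 1) * (1 / 1 + 2 / \<beta>) powr ((p + 1) / 2))) powr (2 / (p + 1))"
  have m0: "m0 \<le> minval \<beta> 1 \<gamma>" "m0 > 0" if "\<gamma> > 0" for \<gamma>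
  proof -
    interpret variational_problem f F p \<beta> 1 \<gamma> by (rule variational_problemI) (use \<beta> that in auto)
    show "m0 \<le> minval \<beta> 1 \<gamma>" "m0 > 0" unfolding m0_def by (rule mval_lower[OF admissible_nonempty])+
  qed
  define M where "M = minval \<beta> 1 1"
  have M: "M \<ge> m0" "m0 > 0" "M > 0" using m0[of 1] by (auto simp: M_def)
  have eq: "dfun f F \<beta> (- x) 1 = \<kappa> * (x powr expo * minval \<beta> 1 (1 / x^3) powr q)" if "x \<ge> 1" for x
  proof -
    have x: "x > 0" using that by simp
    interpret variational_problem f F p \<beta> x 1 by (rule variational_problemI) (use \<beta> x in auto)
    have e: "2 / (p + 1) * q = expo" unfolding q_def by (rule expo_eq)
    show ?thesis
      unfolding dfun_eq[OF admissible_nonempty] minval_scaling[OF pos] powr_mult powr_powr q_def[symmetric] e \<kappa>_def ..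
  qed
  have b: "m0 \<le> minval \<beta> 1 (1 / x^3)" "minval \<beta> 1 (1 / x^3) \<le> M" if "x \<ge> 1" for x
  proof -
    have x3: "1 / x^3 > 0" "1 / x^3 \<le> 1" using that by (auto simp: divide_le_eq_1 one_le_power)
    show "m0 \<le> minval \<beta> 1 (1 / x^3)" by (rule m0[OF x3(1)])
    show "minval \<beta> 1 (1 / x^3) \<le> M" unfolding M_def by (rule minval_mono[OF \<beta> _ x3]) simp
  qed
  show thesis
  proof (rule that)
    show "\<kappa> * m0 powr q > 0" "\<kappa> * M powr q > 0" using \<kappa> M by auto
    fix x :: real assume x: "x \<ge> 1"
    have "m0 powr q \<le> minval \<beta> 1 (1 / x^3) powr q" using b[OF x] M q by (intro powr_mono2) auto
    then have "\<kappa> * (x powr expo * m0 powr q) \<le> \<kappa> * (x powr expo * minval \<beta> 1 (1 / x^3) powr q)"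
      using \<kappa> by (intro mult_left_mono) auto
    then show "\<kappa> * m0 powr q * x powr expo \<le> dfun f F \<beta> (- x) 1" unfolding eq[OF x] by (simp only: mult_ac)
    have "minval \<beta> 1 (1 / x^3) powr q \<le> M powr q" using b[OF x] M q by (intro powr_mono2) auto
    then have "\<kappa> * (x powr expo * minval \<beta> 1 (1 / x^3) powr q) \<le> \<kappa> * (x powr expo * M powr q)"
      using \<kappa> by (intro mult_left_mono) auto
    then show "dfun f F \<beta> (- x) 1 \<le> \<kappa> * M powr q * x powr expo" unfolding eq[OF x] by (simp only: mult_ac)
  qed
qed

end

section \<open>Growth rates against concavity and convexity on a half-line\<close>

lemma powr_inverse_cancel: "(0::real) < z \<Longrightarrow> a \<noteq> 0 \<Longrightarrow> z = (z powr (1 / a)) powr a"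
  by (simp add: powr_powr)

lemma powr_superlinear:
  fixes k A B X :: real
  assumes "a > 1" "k > 0"
  obtains x where "x \<ge> X" "x \<ge> 1" "A + B * x < k * x powr a"
proof -
  \<comment> \<open>The last entry makes k x^(a - 1) at least |A| + |B| + 1; the extra 1 gives
    strictness.\<close>
  define x0 where "x0 = max X (max 1 (((\<bar>A\<bar> + \<bar>B\<bar> + 1) / k) powr (1 / (a - 1))))"
  have x: "x0 \<ge> X" "x0 \<ge> 1" "x0 \<ge> ((\<bar>A\<bar> + \<bar>B\<bar> + 1) / k) powr (1 / (a - 1))" by (auto simp: x0_def)
  have pos: "(\<bar>A\<bar> + \<bar>B\<bar> + 1) / k > 0" using assms by (intro divide_pos_pos) auto
  have "(\<bar>A\<bar> + \<bar>B\<bar> + 1) / k = (((\<bar>A\<bar> + \<bar>B\<bar> + 1) / k) powr (1 / (a - 1))) powr (a - 1)"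
    by (rule powr_inverse_cancel[OF pos]) (use assms in simp)
  also have "\<dots> \<le> x0 powr (a - 1)" using x(3) assms by (intro powr_mono2) auto
  finally have "(\<bar>A\<bar> + \<bar>B\<bar> + 1) \<le> k * x0 powr (a - 1)" using assms by (simp add: pos_divide_le_eq mult.commute)
  then have "(\<bar>A\<bar> + \<bar>B\<bar> + 1) * x0 \<le> k * x0 powr (a - 1) * x0" by (rule mult_right_mono) (use x in simp)
  also have "\<dots> = k * x0 powr a" using x by (simp add: powr_diff)
  finally have 1: "(\<bar>A\<bar> + \<bar>B\<bar> + 1) * x0 \<le> k * x0 powr a" .
  have "A \<le> \<bar>A\<bar> * x0" using mult_left_mono[OF x(2), of "\<bar>A\<bar>"] by simp
  moreover have "B * x0 \<le> \<bar>B\<bar> * x0" using x by (intro mult_right_mono) auto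
  ultimately have "A + B * x0 < \<bar>A\<bar> * x0 + \<bar>B\<bar> * x0 + 1 * x0" using x(2) by linarith
  then have "A + B * x0 < k * x0 powr a" using 1 by (simp only: distrib_right)
  then show thesis using that x by blast
qed

text \<open>The substitution y = x^a turns the claim into \<open>powr_superlinear\<close> with
  exponent 1 / a > 1.\<close>

lemma linear_superpower:
  fixes k A B X :: real
  assumes a: "0 < a" "a < 1" and k: "k > 0" and B: "B > 0"
  obtains x where "x \<ge> X" "x \<ge> 1" "A + k * x powr a < B * x"
proof -
  obtain y where y: "y \<ge> (max X 1) powr a" "y \<ge> 1" "A + k * y < B * y powr (1 / a)"
    using powr_superlinear[of "1 / a" B "(max X 1) powr a" A k] a B by auto
  define x where "x = y powr (1 / a)"
  have xy: "x powr a = y" unfolding x_def powr_powr using a y by simp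
  have "max X 1 = ((max X 1) powr a) powr (1 / a)" unfolding powr_powr using a by simp
  also have "\<dots> \<le> x" unfolding x_def using y a by (intro powr_mono2) auto
  finally have "x \<ge> X" "x \<ge> 1" by auto
  then show thesis using that y(3) xy by (simp add: x_def)
qed

lemma derivative_mono_left:
  fixes E1 E2 :: "real \<Rightarrow> real"
  assumes E2: "\<And>y. y < Y \<Longrightarrow> (E1 has_real_derivative E2 y) (at y)" and le: "\<And>y. y < Y \<Longrightarrow> E2 y \<le> 0" and xy: "x \<le> y" "y < Y"
  shows "E1 y \<le> E1 x"
proof (rule DERIV_nonpos_imp_nonincreasing[OF xy(1)])
  fix z assume "x \<le> z" "z \<le> y"
  then have "z < Y" using xy(2) by simp
  then show "\<exists>d. (E1 has_real_derivative d) (at z) \<and> d \<le> 0" using E2 le by blast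
qed

text \<open>The slope decreases, so z -> e z - E1 y * z is nondecreasing to the left of y. Only
  points left of y occur, as growth is studied towards minus infinity.\<close>

lemma concave_below_tangent:
  fixes e E1 E2 :: "real \<Rightarrow> real"
  assumes e: "\<And>y. y < Y \<Longrightarrow> (e has_real_derivative E1 y) (at y)"
    and E2: "\<And>y. y < Y \<Longrightarrow> (E1 has_real_derivative E2 y) (at y)" and le: "\<And>y. y < Y \<Longrightarrow> E2 y \<le> 0"
    and xy: "x \<le> y" "y < Y"
  shows "e x \<le> e y + E1 y * (x - y)"
proof -
  have "e x - E1 y * x \<le> e y - E1 y * y"
  proof (rule DERIV_nonneg_imp_nondecreasing[OF xy(1)])
    fix z assume z: "x \<le> z" "z \<le> y"
    then have zY: "z < Y" using xy(2) by simp
    have "((\<lambda>z. e z - E1 y * z) has_real_derivative E1 z - E1 y) (at z)"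
      by (auto intro!: derivative_eq_intros e[OF zY])
    moreover have "E1 y \<le> E1 z" by (rule derivative_mono_left[OF E2 le z(2) xy(2)])
    ultimately show "\<exists>d. ((\<lambda>z. e z - E1 y * z) has_real_derivative d) (at z) \<and> d \<ge> 0"
      by (intro exI[of _ "E1 z - E1 y"]) simp
  qed
  then show ?thesis by (simp add: algebra_simps)
qed

text \<open>A negative slope anywhere would force linear growth towards minus infinity, too fast for
  a < 1. So e is nondecreasing, hence bounded above towards minus infinity, against the lower bound
  k1 x^a.\<close>

lemma convex_sublinear_nonneg_slope:
  fixes e E1 E2 :: "real \<Rightarrow> real"
  assumes a: "0 < a" "a < 1" and k: "k1 > 0" "k2 > 0"
    and up: "\<And>x. x \<ge> 1 \<Longrightarrow> e (- x) \<le> k2 * x powr a" and low: "\<And>x. x \<ge> 1 \<Longrightarrow> k1 * x powr a \<le> e (- x)"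
    and e: "\<And>y. y < Y \<Longrightarrow> (e has_real_derivative E1 y) (at y)"
    and E2: "\<And>y. y < Y \<Longrightarrow> (E1 has_real_derivative E2 y) (at y)" and ge: "\<And>y. y < Y \<Longrightarrow> E2 y \<ge> 0"
  shows False
proof -
  have tang: "e x \<ge> e y + E1 y * (x - y)" if "x \<le> y" "y < Y" for x y
  proof -
    have "- e x \<le> - e y + (- E1 y) * (x - y)"
      by (rule concave_below_tangent[where e="\<lambda>x. - e x" and ?E1.0="\<lambda>x. - E1 x" and ?E2.0="\<lambda>x. - E2 x", OF _ _ _ that])
        (auto intro!: derivative_intros e E2 simp: ge)
    then show ?thesis by simp
  qed
  have slope: "E1 y \<ge> 0" if y: "y < Y" for y
  proof (rule ccontr)
    assume "\<not> E1 y \<ge> 0"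
    then have B: "- E1 y > 0" by simp
    \<comment> \<open>The constant equals \<open>- e y + E1 y * y\<close>: the tangent inequality at
      - x, with everything but its linear term moved to the other side.\<close>
    obtain x where x: "x \<ge> - y" "x \<ge> 1" "(- e y - E1 y * y * 1 + 2 * (E1 y * y)) + k2 * x powr a < (- E1 y) * x"
      using linear_superpower[OF a k(2) B] by blast
    have "e (- x) \<ge> e y + E1 y * (- x - y)" by (rule tang) (use x y in auto)
    moreover have "e (- x) \<le> k2 * x powr a" by (rule up[OF x(2)])
    ultimately show False using x(3) by (simp add: algebra_simps)
  qed
  define y0 where "y0 = Y - 1"
  have mono: "e x \<le> e y0" if "x \<le> y0" for x
  proof (rule DERIV_nonneg_imp_nondecreasing[OF that])
    fix z assume "x \<le> z" "z \<le> y0"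
    then have "z < Y" by (simp add: y0_def)
    then show "\<exists>d. (e has_real_derivative d) (at z) \<and> d \<ge> 0" using e slope by blast
  qed
  define t where "t = max (max 1 (- y0)) (((\<bar>e y0\<bar> + 1) / k1) powr (1 / a))"
  have t: "t \<ge> 1" "t \<ge> - y0" "t \<ge> ((\<bar>e y0\<bar> + 1) / k1) powr (1 / a)" by (auto simp: t_def)
  have pos: "(\<bar>e y0\<bar> + 1) / k1 > 0" using k by (intro divide_pos_pos) auto
  have "(\<bar>e y0\<bar> + 1) / k1 = (((\<bar>e y0\<bar> + 1) / k1) powr (1 / a)) powr a"
    by (rule powr_inverse_cancel[OF pos]) (use a in simp)
  also have "\<dots> \<le> t powr a" using t(3) a by (intro powr_mono2) auto
  finally have "\<bar>e y0\<bar> + 1 \<le> k1 * t powr a" using k by (simp add: pos_divide_le_eq mult.commute)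
  moreover have "k1 * t powr a \<le> e (- t)" by (rule low[OF t(1)])
  moreover have "e (- t) \<le> e y0" by (rule mono) (use t in simp)
  ultimately show False by linarith
qed

text \<open>A concave function lies below its tangent, so e grows at most linearly towards minus
  infinity; for a > 1 the lower bound grows faster.\<close>

lemma concave_superlinear:
  fixes e E1 E2 :: "real \<Rightarrow> real"
  assumes a: "a > 1" and k: "k > 0" and low: "\<And>x. x \<ge> 1 \<Longrightarrow> k * x powr a \<le> e (- x)"
    and e: "\<And>y. y < Y \<Longrightarrow> (e has_real_derivative E1 y) (at y)"
    and E2: "\<And>y. y < Y \<Longrightarrow> (E1 has_real_derivative E2 y) (at y)" and le: "\<And>y. y < Y \<Longrightarrow> E2 y \<le> 0"
  shows False
proof -
  define y where "y = Y - 1"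
  have y: "y < Y" by (simp add: y_def)
  obtain x where x: "x \<ge> - y" "x \<ge> 1" "(e y - E1 y * y) + (- E1 y) * x < k * x powr a"
    using powr_superlinear[OF a k] by blast
  have "e (- x) \<le> e y + E1 y * (- x - y)"
    by (rule concave_below_tangent[OF e E2 le _ y]) (use x in auto)
  moreover have "k * x powr a \<le> e (- x)" by (rule low[OF x(2)])
  ultimately show False using x(3) by (simp add: algebra_simps)
qed

text \<open>Chain rule along the line c -> (beta, c, gamma), which stays in the domain for c < 0
  because the upper limit for c is nonnegative. The derivative of the operator-valued map is
  evaluated at the direction (0, 1, 0).\<close>

lemma partial_second_derivative:
  assumes tw: "twice_differentiable_on g dom3" and \<beta>: "\<beta> > 0" and \<gamma>: "\<gamma> > 0"
  obtains E1 E2 where "\<And>c. c < 0 \<Longrightarrow> ((\<lambda>c. g (\<beta>, c, \<gamma>)) has_real_derivative E1 c) (at c)"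
    "\<And>c. c < 0 \<Longrightarrow> (E1 has_real_derivative E2 c) (at c)"
proof -
  obtain D where D: "\<And>x. x \<in> dom3 \<Longrightarrow> (g has_derivative blinfun_apply (D x)) (at x)" "\<And>x. x \<in> dom3 \<Longrightarrow> D differentiable (at x)"
    using tw unfolding twice_differentiable_on_def by blast
  have dom: "(\<beta>, c, \<gamma>) \<in> dom3" if "c < 0" for c
  proof -
    have "c < 3 * (\<beta>\<^sup>2 * \<gamma> / 4) powr (1 / 3)" by (rule less_le_trans[OF that]) simp
    then show ?thesis unfolding dom3_def using that \<beta> \<gamma> by auto
  qed
  define \<iota> where "\<iota> c = (\<beta>, c, \<gamma>)" for c :: real
  have \<iota>: "(\<iota> has_derivative (\<lambda>h. (0, h, 0))) (at c)" for c
    unfolding \<iota>_def by (intro has_derivative_Pair has_derivative_const has_derivative_ident)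
  define E1 where "E1 c = blinfun_apply (D (\<iota> c)) (0, 1, 0)" for c
  have 1: "((\<lambda>c. g (\<beta>, c, \<gamma>)) has_real_derivative E1 c) (at c)" if "c < 0" for c
  proof -
    have "((\<lambda>c. g (\<iota> c)) has_derivative (\<lambda>h. blinfun_apply (D (\<iota> c)) (0, h, 0))) (at c)"
      by (rule has_derivative_compose[OF \<iota> D(1)]) (use dom[OF that] in \<open>simp add: \<iota>_def\<close>)
    moreover have "blinfun_apply (D (\<iota> c)) (0, h, 0) = E1 c * h" for h
    proof -
      have "(0, h, 0) = h *\<^sub>R (0::real, 1::real, 0::real)" by simp
      then have "blinfun_apply (D (\<iota> c)) (0, h, 0) = blinfun_apply (D (\<iota> c)) (h *\<^sub>R (0, 1, 0))" by (rule arg_cong)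
      also have "\<dots> = E1 c * h" by (simp only: blinfun.scaleR_right E1_def real_scaleR_def mult.commute)
      finally show ?thesis .
    qed
    ultimately show ?thesis unfolding has_field_derivative_def \<iota>_def by simp
  qed
  have "\<exists>d. (E1 has_real_derivative d) (at c)" if "c < 0" for c
  proof -
    have "D differentiable (at (\<iota> c))" using D(2)[OF dom[OF that]] by (simp add: \<iota>_def)
    then obtain D' where "(D has_derivative D') (at (\<iota> c))" by (auto simp: differentiable_def)
    then have "((\<lambda>c. D (\<iota> c)) has_derivative (\<lambda>h. D' (0, h, 0))) (at c)" by (rule has_derivative_compose[OF \<iota>])
    then have "((\<lambda>c. blinfun_apply (D (\<iota> c)) (0, 1, 0)) has_derivative (\<lambda>h. blinfun_apply (D' (0, h, 0)) (0, 1, 0))) (at c)"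
      by (rule bounded_linear.has_derivative[OF blinfun.bounded_linear_left])
    then have "E1 differentiable (at c)" unfolding E1_def differentiable_def by blast
    then show ?thesis by (simp add: real_differentiable_def)
  qed
  then obtain E2 where "\<And>c. c < 0 \<Longrightarrow> (E1 has_real_derivative E2 c) (at c)" by metis
  with 1 show thesis using that by blast
qed

context homogeneous_nonlinearity
begin

text \<open>The scaling identity holds on the whole half-line c < 0, hence near each of its points,
  so both derivatives in \<open>d_cc\<close> pass through it; each contributes a positive factor
  mu.\<close>

lemma d_cc_scaling:
  assumes \<beta>: "\<beta> > 0" and \<gamma>: "\<gamma> > 0" and c: "c < 0" and \<mu>: "\<mu> = \<gamma> powr (- 1 / 3)"
    and E1: "\<And>c. c < 0 \<Longrightarrow> ((\<lambda>c. dfun f F \<beta> c 1) has_real_derivative E1 c) (at c)"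
    and E2: "\<And>c. c < 0 \<Longrightarrow> (E1 has_real_derivative E2 c) (at c)"
  shows "d_cc f F \<beta> c \<gamma> = \<mu> powr (- expo) * (\<mu>\<^sup>2 * E2 (\<mu> * c))"
proof -
  have \<mu>0: "\<mu> > 0" using \<gamma> by (simp add: \<mu>)
  have neg: "\<mu> * x < 0" if "x < 0" for x using \<mu>0 that by (rule mult_pos_neg)
  have nb: "\<forall>\<^sub>F y in nhds x. y < 0" if "x < 0" for x :: real
    using eventually_nhds_in_open[of "{..<0}" x] that by simp
  have d1: "((\<lambda>c. dfun f F \<beta> c \<gamma>) has_real_derivative \<mu> powr (- expo) * (E1 (\<mu> * x) * \<mu>)) (at x)" if x: "x < 0" for x
  proof -
    have "((\<lambda>c. \<mu> powr (- expo) * dfun f F \<beta> (\<mu> * c) 1) has_real_derivative \<mu> powr (- expo) * (E1 (\<mu> * x) * \<mu>)) (at x)"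
      by (rule DERIV_cmult[OF DERIV_chain2[where f="\<lambda>c. dfun f F \<beta> c 1" and g="\<lambda>c. \<mu> * c", OF E1[OF neg[OF x]]]])
        (auto intro!: derivative_eq_intros)
    moreover have "\<forall>\<^sub>F c in nhds x. dfun f F \<beta> c \<gamma> = \<mu> powr (- expo) * dfun f F \<beta> (\<mu> * c) 1"
      using nb[OF x] by eventually_elim (rule dfun_scaling[OF \<beta> \<gamma> _ \<mu>])
    ultimately show ?thesis by (simp add: DERIV_cong_ev)
  qed
  have "((\<lambda>c. \<mu> powr (- expo) * (E1 (\<mu> * c) * \<mu>)) has_real_derivative \<mu> powr (- expo) * (E2 (\<mu> * c) * \<mu> * \<mu>)) (at c)"
    by (rule DERIV_cmult[OF DERIV_cmult_right[OF DERIV_chain2[where f=E1 and g="\<lambda>c. \<mu> * c", OF E2[OF neg[OF c]]]]])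
      (auto intro!: derivative_eq_intros)
  moreover have "\<forall>\<^sub>F x in nhds c. deriv (\<lambda>c. dfun f F \<beta> c \<gamma>) x = \<mu> powr (- expo) * (E1 (\<mu> * x) * \<mu>)"
    using nb[OF c] by eventually_elim (rule DERIV_imp_deriv[OF d1])
  ultimately have "((\<lambda>x. deriv (\<lambda>c. dfun f F \<beta> c \<gamma>) x) has_real_derivative \<mu> powr (- expo) * (E2 (\<mu> * c) * \<mu> * \<mu>)) (at c)"
    by (simp add: DERIV_cong_ev)
  then have "d_cc f F \<beta> c \<gamma> = \<mu> powr (- expo) * (E2 (\<mu> * c) * \<mu> * \<mu>)"
    unfolding d_cc_def by (rule DERIV_imp_deriv)
  then show ?thesis by (simp add: power2_eq_square mult_ac)
qed

text \<open>\<open>\<epsilon> = 1\<close> gives part (i) and \<open>\<epsilon> = -1\<close> part (ii).\<close>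

lemma sign_sequence:
  assumes \<beta>: "\<beta> > 0" and c: "c < 0"
    and E1: "\<And>c. c < 0 \<Longrightarrow> ((\<lambda>c. dfun f F \<beta> c 1) has_real_derivative E1 c) (at c)"
    and E2: "\<And>c. c < 0 \<Longrightarrow> (E1 has_real_derivative E2 c) (at c)"
    and unb: "\<And>Y. Y \<le> 0 \<Longrightarrow> \<exists>y<Y. \<epsilon> * E2 y > (0::real)"
  shows "\<exists>\<gamma>s :: nat \<Rightarrow> real. (\<forall>k. \<gamma>s k > 0) \<and> \<gamma>s \<longlonglongrightarrow> 0 \<and> (\<forall>k. \<epsilon> * d_cc f F \<beta> c (\<gamma>s k) > 0)"
proof -
  have "\<exists>\<gamma>. 0 < \<gamma> \<and> \<gamma> \<le> inverse (real (Suc k)) \<and> \<epsilon> * d_cc f F \<beta> c \<gamma> > 0" for k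
  proof -
    \<comment> \<open>Beyond c (k + 1) the quotient y / c exceeds k + 1, so the resulting gamma =
      mu^(-3) is at most 1 / (k + 1).\<close>
    obtain y where y: "y < c * real (Suc k)" "\<epsilon> * E2 y > 0"
      using unb[of "c * real (Suc k)"] c by (auto simp: mult_nonpos_nonneg)
    define \<mu> where "\<mu> = y / c"
    have "c * real (Suc k) < 0" using c by (intro mult_neg_pos) auto
    then have y0: "y < 0" using y(1) by linarith
    have \<mu>: "\<mu> > real (Suc k)" using y(1) c by (simp add: \<mu>_def neg_less_divide_eq mult.commute)
    then have \<mu>1: "\<mu> \<ge> 1" "\<mu> > 0" by auto
    define \<gamma> where "\<gamma> = \<mu> powr (- 3)"
    have \<gamma>: "\<gamma> > 0" using \<mu>1 by (simp add: \<gamma>_def)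
    have g\<mu>: "\<mu> = \<gamma> powr (- 1 / 3)" unfolding \<gamma>_def powr_powr using \<mu>1 by simp
    have "\<gamma> \<le> \<mu> powr (- 1)" unfolding \<gamma>_def using \<mu>1 by (intro powr_mono) auto
    also have "\<dots> = inverse \<mu>" using \<mu>1 by (simp add: powr_minus)
    also have "\<dots> \<le> inverse (real (Suc k))" using \<mu> by (intro le_imp_inverse_le) auto
    finally have \<gamma>k: "\<gamma> \<le> inverse (real (Suc k))" .
    have "\<mu> * c = y" using c by (simp add: \<mu>_def)
    then have "\<epsilon> * d_cc f F \<beta> c \<gamma> = \<mu> powr (- expo) * \<mu>\<^sup>2 * (\<epsilon> * E2 y)"
      using d_cc_scaling[OF \<beta> \<gamma> c g\<mu> E1 E2] by (simp only: mult_ac)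
    also have "\<dots> > 0"
    proof (rule mult_pos_pos[OF _ y(2)])
      show "\<mu> powr (- expo) * \<mu>\<^sup>2 > 0" using \<mu>1 by simp
    qed
    finally show ?thesis using \<gamma> \<gamma>k by blast
  qed
  then obtain \<gamma>s where gs: "\<And>k. 0 < \<gamma>s k" "\<And>k. \<gamma>s k \<le> inverse (real (Suc k))" "\<And>k. \<epsilon> * d_cc f F \<beta> c (\<gamma>s k) > 0" by metis
  have "\<gamma>s \<longlonglongrightarrow> 0"
  proof (rule Lim_null_comparison[OF _ LIMSEQ_inverse_real_of_nat])
    show "\<forall>\<^sub>F k in sequentially. norm (\<gamma>s k) \<le> inverse (real (Suc k))"
      using gs(1,2) by (intro always_eventually allI) (simp add: abs_of_pos)
  qed
  then show ?thesis using gs by blast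
qed

end

theorem theorem8p2:
  fixes f F :: "real \<Rightarrow> real" and p :: real
  assumes p_gt: "p > 1"
    and f_C2: "C2_fun f"
    and f_hom: "\<And>t s. t > 0 \<Longrightarrow> f (t * s) = t powr p * f s"
    and F_deriv: "\<And>s. (F has_real_derivative f s) (at s)"
    and F_0: "F 0 = 0"
    and F_neg: "\<exists>s0. F s0 < 0"
    and d_twice: "twice_differentiable_on (\<lambda>(\<beta>, c, \<gamma>). dfun f F \<beta> c \<gamma>) dom3"
  shows "(p < 3 \<longrightarrow> (\<forall>\<beta> > 0. \<forall>c < 0. \<exists>\<gamma>s :: nat \<Rightarrow> real.
            (\<forall>k. \<gamma>s k > 0) \<and> \<gamma>s \<longlonglongrightarrow> 0 \<and> (\<forall>k. d_cc f F \<beta> c (\<gamma>s k) > 0)))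
       \<and> (p > 3 \<longrightarrow> (\<forall>\<beta> > 0. \<forall>c < 0. \<exists>\<gamma>s :: nat \<Rightarrow> real.
            (\<forall>k. \<gamma>s k > 0) \<and> \<gamma>s \<longlonglongrightarrow> 0 \<and> (\<forall>k. d_cc f F \<beta> c (\<gamma>s k) < 0)))"
proof -
  interpret homogeneous_nonlinearity f F p by standard (fact assms)+
  have ex: "\<exists>E1 E2. (\<forall>c<0. ((\<lambda>c. dfun f F \<beta> c 1) has_real_derivative E1 c) (at c)) \<and>
      (\<forall>c<0. (E1 has_real_derivative E2 c) (at c))" if \<beta>: "\<beta> > 0" for \<beta>
  proof -
    obtain E1 E2 where "\<And>c. c < 0 \<Longrightarrow> ((\<lambda>c. case (\<beta>, c, 1) of (\<beta>, c, \<gamma>) \<Rightarrow> dfun f F \<beta> c \<gamma>) has_real_derivative E1 c) (at c)"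
      "\<And>c. c < 0 \<Longrightarrow> (E1 has_real_derivative E2 c) (at c)"
      using partial_second_derivative[OF d_twice \<beta> zero_less_one] by blast
    then show ?thesis by (intro exI[of _ E1] exI[of _ E2]) simp
  qed
  have main: "\<exists>\<gamma>s :: nat \<Rightarrow> real. (\<forall>k. \<gamma>s k > 0) \<and> \<gamma>s \<longlonglongrightarrow> 0 \<and> (\<forall>k. \<epsilon> * d_cc f F \<beta> c (\<gamma>s k) > 0)"
    if \<beta>: "\<beta> > 0" and c: "c < 0" and \<epsilon>: "(\<epsilon> = 1 \<and> p < 3) \<or> (\<epsilon> = (-1::real) \<and> p > 3)" for \<beta> c \<epsilon>
  proof -
    obtain E1 E2 where E1: "\<And>c. c < 0 \<Longrightarrow> ((\<lambda>c. dfun f F \<beta> c 1) has_real_derivative E1 c) (at c)"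
      and E2: "\<And>c. c < 0 \<Longrightarrow> (E1 has_real_derivative E2 c) (at c)"
      using ex[OF \<beta>] by blast
    obtain k1 k2 where k: "k1 > 0" "k2 > 0" and low: "\<And>x. x \<ge> 1 \<Longrightarrow> k1 * x powr expo \<le> dfun f F \<beta> (- x) 1"
      and up: "\<And>x. x \<ge> 1 \<Longrightarrow> dfun f F \<beta> (- x) 1 \<le> k2 * x powr expo"
      using dfun_growth[OF \<beta>] by blast
    show ?thesis
    proof (rule sign_sequence[OF \<beta> c E1 E2])
      fix Y :: real assume Y: "Y \<le> 0"
      have E1': "((\<lambda>c. dfun f F \<beta> c 1) has_real_derivative E1 y) (at y)" and E2': "(E1 has_real_derivative E2 y) (at y)"
        if "y < Y" for y using that Y by (auto intro: E1 E2)
      show "\<exists>y<Y. \<epsilon> * E2 y > 0"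
      proof (rule ccontr)
        assume "\<not> ?thesis"
        \<comment> \<open>Failure beyond Y gives the second derivative one sign on the whole
          half-line below Y, which the growth bounds exclude.\<close>
        then have no: "\<epsilon> * E2 y \<le> 0" if "y < Y" for y using that by (meson not_less)
        from \<epsilon> show False
        proof
          assume *: "\<epsilon> = 1 \<and> p < 3"
          then have "expo > 1" using p_gt by (simp add: expo_def)
          then show False
            by (rule concave_superlinear[OF _ k(1) low E1' E2']) (use no * in auto)
        next
          assume *: "\<epsilon> = -1 \<and> p > 3"
          then have "0 < expo" "expo < 1" by (simp_all add: expo_def)
          then show False
            by (rule convex_sublinear_nonneg_slope[OF _ _ k up low E1' E2']) (use no * in auto)
        qed
      qed
    qed
  qed
  show ?thesis
    using main[of _ _ 1] main[of _ _ "-1"] by simp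
qed

end
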